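(* Let $A=\{a_1,a_2,\dots,a_n\}$ with $n\geq 2$, let $u,v\in A^*$ with $|v|\leq|u|\leq 3$, and let $S=sgp\langle A\mid u=v\rangle$. Then: (1) If there do not exist distinct letters $a,b\in A$ such that the relation $u=v$ is (letter for letter) one of $aba=ba$, $aab=ba$, $abb=bb$, then $S$ is prefix-automatic. If there exist distinct letters $a,b\in A$ such that $u=v$ is one of $aba=ba$, $aab=ba$, $abb=bb$, then $S$ is not automatic. (2) $S$ is biautomatic if one of the following holds: (i) $|u|=3$ and $|v|=0$; (ii) $|u|=|v|=3$; (iii) $|u|=2$ and there do not exist distinct letters $a,b\in A$ such that $u=v$ is one of $ab=a$, $ab=b$. If $|u|=2$ and there exist distinct $a,b\in A$ such that $u=v$ is one of $ab=a$, $ab=b$, then $S$ is not biautomatic.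
   Context: For a finite alphabet $A$, $A^*$ is the free monoid on $A$ (empty word $\varepsilon$), $A^+=A^*\setminus\{\varepsilon\}$, and $|w|$ is the length of $w$. $sgp\langle A\mid R\rangle$ denotes the monoid $A^*$ modulo the congruence generated by the relations $R$; $sgp^+\langle A\mid R\rangle$ denotes the semigroup $A^+$ modulo the congruence generated by $R$. A language is regular if it is accepted by a finite state automaton. Let $\$\notin A$ and $A(2,\$)=(A\cup\{\$\})^2\setminus\{(\$,\$)\}$. For $\alpha,\beta\in A^*$, $(\alpha,\beta)\delta_A^R$ is the word over $A(2,\$)$ obtained by padding the shorter of $\alpha,\beta$ on the right with $\$$'s to equal length and reading off the pairs of letters position by position; $(\alpha,\beta)\delta_A^L$ is defined the same way but padding on the left. Let $S$ be a semigroup generated by a finite set $A$, $\phi:A^+\to S$ the canonical epimorphism, and $L\subseteq A^+$ a regular language with $\phi(L)=S$; write $\alpha=\beta$ if $\phi(\alpha)=\phi(\beta)$ (with $\alpha\varepsilon\equiv\alpha$). For $a\in A\cup\{\varepsilon\}$ put $L_a^\$=\{(\alpha,\beta)\delta^R_A:\alpha,\beta\in L,\ \alpha a=\beta\}$, ${}^\$L_a=\{(\alpha,\beta)\delta^L_A:\alpha,\beta\in L,\ \alpha a=\beta\}$, ${}_aL^\$=\{(\alpha,\beta)\delta^R_A:\alpha,\beta\in L,\ a\alpha=\beta\}$, ${}^\$_aL=\{(\alpha,\beta)\delta^L_A:\alpha,\beta\in L,\ a\alpha=\beta\}$. $(A,L)$ is an automatic structure if $L_a^\$$ is regular for every $a\in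 A\cup\{\varepsilon\}$, and a biautomatic structure if all four of $L_a^\$,{}^\$L_a,{}_aL^\$,{}^\$_aL$ are regular for every $a\in A\cup\{\varepsilon\}$. $(A,L)$ is a prefix-automatic structure if it is an automatic structure and $\{(\alpha,\beta)\delta_A^R:\alpha\in L,\ \beta\in\mathrm{Pref}(L),\ \alpha=\beta\}$ is regular, where $\mathrm{Pref}(L)$ is the set of prefixes of words of $L$. A semigroup is automatic (biautomatic, prefix-automatic) if it admits such a structure for some finite generating set; a monoid is called automatic (biautomatic, prefix-automatic) if it is so as a semigroup. *)

theory Defs
  imports Main
begin

definition regular :: "'c set \<Rightarrow> 'c list set \<Rightarrow> bool" where
  "regular \<Sigma> L \<longleftrightarrow> finite \<Sigma> \<and> L \<subseteq> lists \<Sigma> \<and>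
     (\<exists>(Q::nat set) q0 \<delta> F. finite Q \<and> q0 \<in> Q \<and> (\<forall>q\<in>Q. \<forall>c\<in>\<Sigma>. \<delta> q c \<in> Q) \<and> F \<subseteq> Q \<and>
        L = {w \<in> lists \<Sigma>. foldl \<delta> q0 w \<in> F})"

text \<open>The alphabet A(2,\$): \$ is represented by None.\<close>
definition pad_alph :: "'b set \<Rightarrow> ('b option \<times> 'b option) set" where
  "pad_alph B = {(x, y). x \<in> insert None (Some ` B) \<and> y \<in> insert None (Some ` B) \<and> (x, y) \<noteq> (None, None)}"

definition padR :: "'b list \<Rightarrow> 'b list \<Rightarrow> ('b option \<times> 'b option) list" where
  "padR \<alpha> \<beta> = (let m = max (length \<alpha>) (length \<beta>) in
     zip (map Some \<alpha> @ replicate (m - length \<alpha>) None) (map Some \<beta> @ replicate (m - length \<beta>) None))"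

definition padL :: "'b list \<Rightarrow> 'b list \<Rightarrow> ('b option \<times> 'b option) list" where
  "padL \<alpha> \<beta> = (let m = max (length \<alpha>) (length \<beta>) in
     zip (replicate (m - length \<alpha>) None @ map Some \<alpha>) (replicate (m - length \<beta>) None @ map Some \<beta>))"

fun evalw :: "('b \<Rightarrow> 's) \<Rightarrow> ('s \<Rightarrow> 's \<Rightarrow> 's) \<Rightarrow> 'b list \<Rightarrow> 's" where
  "evalw gen mult [] = undefined"
| "evalw gen mult [b] = gen b"
| "evalw gen mult (b # c # cs) = mult (gen b) (evalw gen mult (c # cs))"

text \<open>a \<in> A \<union> {\<epsilon>} is represented by an option (None = \<epsilon>).\<close>
definition optw :: "'b option \<Rightarrow> 'b list" where
  "optw a = (case a of None \<Rightarrow> [] | Some b \<Rightarrow> [b])"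

definition structure_base :: "'s set \<Rightarrow> ('s \<Rightarrow> 's \<Rightarrow> 's) \<Rightarrow> 'b set \<Rightarrow> ('b \<Rightarrow> 's) \<Rightarrow> 'b list set \<Rightarrow> bool" where
  "structure_base S mult B gen L \<longleftrightarrow> finite B \<and> gen ` B \<subseteq> S \<and> L \<subseteq> lists B - {[]} \<and>
     evalw gen mult ` L = S"

definition L_right :: "('s \<Rightarrow> 's \<Rightarrow> 's) \<Rightarrow> ('b \<Rightarrow> 's) \<Rightarrow> 'b list set \<Rightarrow> 'b option \<Rightarrow> ('b option \<times> 'b option) list set" where
  "L_right mult gen L a = {padR \<alpha> \<beta> | \<alpha> \<beta>. \<alpha> \<in> L \<and> \<beta> \<in> L \<and> evalw gen mult (\<alpha> @ optw a) = evalw gen mult \<beta>}"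

definition L_right_pL :: "('s \<Rightarrow> 's \<Rightarrow> 's) \<Rightarrow> ('b \<Rightarrow> 's) \<Rightarrow> 'b list set \<Rightarrow> 'b option \<Rightarrow> ('b option \<times> 'b option) list set" where
  "L_right_pL mult gen L a = {padL \<alpha> \<beta> | \<alpha> \<beta>. \<alpha> \<in> L \<and> \<beta> \<in> L \<and> evalw gen mult (\<alpha> @ optw a) = evalw gen mult \<beta>}"

definition L_left :: "('s \<Rightarrow> 's \<Rightarrow> 's) \<Rightarrow> ('b \<Rightarrow> 's) \<Rightarrow> 'b list set \<Rightarrow> 'b option \<Rightarrow> ('b option \<times> 'b option) list set" where
  "L_left mult gen L a = {padR \<alpha> \<beta> | \<alpha> \<beta>. \<alpha> \<in> L \<and> \<beta> \<in> L \<and> evalw gen mult (optw a @ \<alpha>) = evalw gen mult \<beta>}"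

definition L_left_pL :: "('s \<Rightarrow> 's \<Rightarrow> 's) \<Rightarrow> ('b \<Rightarrow> 's) \<Rightarrow> 'b list set \<Rightarrow> 'b option \<Rightarrow> ('b option \<times> 'b option) list set" where
  "L_left_pL mult gen L a = {padL \<alpha> \<beta> | \<alpha> \<beta>. \<alpha> \<in> L \<and> \<beta> \<in> L \<and> evalw gen mult (optw a @ \<alpha>) = evalw gen mult \<beta>}"

definition automatic_structure :: "'s set \<Rightarrow> ('s \<Rightarrow> 's \<Rightarrow> 's) \<Rightarrow> 'b set \<Rightarrow> ('b \<Rightarrow> 's) \<Rightarrow> 'b list set \<Rightarrow> bool" where
  "automatic_structure S mult B gen L \<longleftrightarrow> structure_base S mult B gen L \<and>
     (\<forall>a \<in> insert None (Some ` B). regular (pad_alph B) (L_right mult gen L a))"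

definition biautomatic_structure :: "'s set \<Rightarrow> ('s \<Rightarrow> 's \<Rightarrow> 's) \<Rightarrow> 'b set \<Rightarrow> ('b \<Rightarrow> 's) \<Rightarrow> 'b list set \<Rightarrow> bool" where
  "biautomatic_structure S mult B gen L \<longleftrightarrow> structure_base S mult B gen L \<and>
     (\<forall>a \<in> insert None (Some ` B).
        regular (pad_alph B) (L_right mult gen L a) \<and> regular (pad_alph B) (L_right_pL mult gen L a) \<and>
        regular (pad_alph B) (L_left mult gen L a) \<and> regular (pad_alph B) (L_left_pL mult gen L a))"

definition Pref :: "'b list set \<Rightarrow> 'b list set" where
  "Pref L = {\<beta>. \<exists>\<gamma>. \<beta> @ \<gamma> \<in> L}"

definition prefix_automatic_structure :: "'s set \<Rightarrow> ('s \<Rightarrow> 's \<Rightarrow> 's) \<Rightarrow> 'b set \<Rightarrow> ('b \<Rightarrow> 's) \<Rightarrow> 'b list set \<Rightarrow> bool" where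
  "prefix_automatic_structure S mult B gen L \<longleftrightarrow> automatic_structure S mult B gen L \<and>
     regular (pad_alph B) {padR \<alpha> \<beta> | \<alpha> \<beta>. \<alpha> \<in> L \<and> \<beta> \<in> Pref L \<and> \<beta> \<noteq> [] \<and> evalw gen mult \<alpha> = evalw gen mult \<beta>}"

text \<open>Generating symbols are natural numbers (any finite set of symbols can be renamed into nat).\<close>
definition automatic :: "'s set \<Rightarrow> ('s \<Rightarrow> 's \<Rightarrow> 's) \<Rightarrow> bool" where
  "automatic S mult \<longleftrightarrow> (\<exists>(B::nat set) gen L. automatic_structure S mult B gen L)"

definition biautomatic :: "'s set \<Rightarrow> ('s \<Rightarrow> 's \<Rightarrow> 's) \<Rightarrow> bool" where
  "biautomatic S mult \<longleftrightarrow> (\<exists>(B::nat set) gen L. biautomatic_structure S mult B gen L)"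

definition prefix_automatic :: "'s set \<Rightarrow> ('s \<Rightarrow> 's \<Rightarrow> 's) \<Rightarrow> bool" where
  "prefix_automatic S mult \<longleftrightarrow> (\<exists>(B::nat set) gen L. prefix_automatic_structure S mult B gen L)"

definition rel_step :: "'a list \<Rightarrow> 'a list \<Rightarrow> 'a list \<Rightarrow> 'a list \<Rightarrow> bool" where
  "rel_step u v x y \<longleftrightarrow> (\<exists>p q. (x = p @ u @ q \<and> y = p @ v @ q) \<or> (x = p @ v @ q \<and> y = p @ u @ q))"

definition rel_cong :: "'a list \<Rightarrow> 'a list \<Rightarrow> 'a list \<Rightarrow> 'a list \<Rightarrow> bool" where
  "rel_cong u v = (rel_step u v)\<^sup>*\<^sup>*"

definition pres_class :: "'a set \<Rightarrow> 'a list \<Rightarrow> 'a list \<Rightarrow> 'a list \<Rightarrow> 'a list set" where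
  "pres_class A u v x = {y \<in> lists A. rel_cong u v x y}"

definition pres_carrier :: "'a set \<Rightarrow> 'a list \<Rightarrow> 'a list \<Rightarrow> 'a list set set" where
  "pres_carrier A u v = pres_class A u v ` lists A"

definition pres_mult :: "'a set \<Rightarrow> 'a list \<Rightarrow> 'a list \<Rightarrow> 'a list set \<Rightarrow> 'a list set \<Rightarrow> 'a list set" where
  "pres_mult A u v X Y = {w \<in> lists A. \<exists>x\<in>X. \<exists>y\<in>Y. rel_cong u v (x @ y) w}"

end

theory Submission
  imports Defs "HOL-Library.Sublist" "HOL-Library.Confluence"
begin

text \<open>In all positive cases there is a cross-section of the monoid, namely the words avoiding certain factors, on
  which multiplication by a generator at the head of a word has a simple form: a bounded word travels through a
  product of finitely many kinds of blocks, replacing each by one of equal length, and is finally absorbed. Such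
  relations are recognised by two-tape automata with left and with right padding. In several cases the words avoiding
  factors become a cross-section only after adding one generator that stands for a suitable word, for instance for the
  common value of the two sides of a relation between palindromes. Where a product of unboundedly many blocks has
  to be erased instead, only one padding works, which yields prefix automaticity but not biautomaticity.

  For \<open>aba = ba\<close> and \<open>abb = bb\<close>, as for the left multiplication with \<open>ab = a\<close>, there are words starting with an
  arbitrarily long power that is erased by multiplication with one letter. When the automaton has read the product
  completely, it has not yet seen the rest of the longer word, although the product determines how many letters \<open>b\<close>
  this rest contains; so it would have to remember an unbounded number. For \<open>aab = ba\<close> we have
  \<open>b\<^sup>n a = a\<^bsup>2^n\<^esup> b\<^sup>n\<close>, where cancelling \<open>b\<^sup>n\<close> would lead to a representative of \<open>a\<^bsup>2^n\<^esup>\<close> of length linear in \<open>n\<close>.\<close>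

section \<open>Regular languages through finitely many derivatives\<close>

text \<open>All languages of the positive part are reduced to one kind of statement: left
  multiplication by one generator on a cross-section. Right multiplication is left multiplication in
  the mirrored presentation, and for relations with bounded length difference and finitely many
  residuals (\<open>tame\<close>) both paddings are equivalent. This is why a block must be replaced
  by one of equal length: otherwise the two tapes drift apart without bound. Additional generators
  restore equal lengths or resolve overlaps of the relation with itself. A cross-section closed
  under suffixes has a mirror image closed under prefixes, which reduces the prefix condition to
  equality of words.

  The negative results concern arbitrary generators. These are tied to the letters through words
  that no side of the relation can change, whose classes are singletons, or through invariants of
  the congruence. In the collapsing cases the invariant is the number of occurrences of a letter
  that both sides contain equally often.\<close>

definition deriv :: "'c list set \<Rightarrow> 'c list \<Rightarrow> 'c list set" where
  "deriv L w = {v. w @ v \<in> L}"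

definition conc :: "'c list set \<Rightarrow> 'c list set \<Rightarrow> 'c list set" where
  "conc K L = {x @ y | x y. x \<in> K \<and> y \<in> L}"

lemma deriv_append: "deriv L (v @ w) = deriv (deriv L v) w"
  by (simp add: deriv_def)

lemma mem_iff_Nil_deriv: "w \<in> L \<longleftrightarrow> [] \<in> deriv L w"
  by (simp add: deriv_def)

lemma regular_finite_derivs:
  assumes "regular \<Sigma> L"
  shows "finite (range (deriv L))"
proof -
  obtain Q q0 \<delta> F where M: "finite (Q::nat set)" "q0 \<in> Q" "\<forall>q\<in>Q. \<forall>c\<in>\<Sigma>. \<delta> q c \<in> Q"
    "L = {w \<in> lists \<Sigma>. foldl \<delta> q0 w \<in> F}"
    using assms by (auto simp: regular_def)
  have run: "foldl \<delta> q w \<in> Q" if "q \<in> Q" "w \<in> lists \<Sigma>" for q w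
    using that M(3) by (induction w arbitrary: q) auto
  \<comment> \<open>The transition function is unconstrained outside \<open>\<Sigma>\<close>, but
    \<open>L\<close> lies in \<open>lists \<Sigma>\<close>, so that words with foreign letters all
    have the empty derivative.\<close>
  have "range (deriv L) \<subseteq> insert {} ((\<lambda>q. {v \<in> lists \<Sigma>. foldl \<delta> q v \<in> F}) ` Q)"
  proof
    fix X assume "X \<in> range (deriv L)"
    then obtain w where X: "X = deriv L w" by auto
    show "X \<in> insert {} ((\<lambda>q. {v \<in> lists \<Sigma>. foldl \<delta> q v \<in> F}) ` Q)"
    proof (cases "w \<in> lists \<Sigma>")
      case True
      then have "X = {v \<in> lists \<Sigma>. foldl \<delta> (foldl \<delta> q0 w) v \<in> F}"
        using X M(4) by (auto simp: deriv_def)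
      then show ?thesis using run[OF M(2) True] by blast
    next
      case False
      then have "X = {}" using X M(4) by (auto simp: deriv_def)
      then show ?thesis by simp
    qed
  qed
  then show ?thesis by (rule finite_subset) (simp add: M(1))
qed

text \<open>The states of the minimal automaton are the derivatives themselves. They are coded by
  natural numbers because \<open>regular\<close> asks for states of that type.\<close>

lemma finite_derivs_regular:
  assumes fin: "finite \<Sigma>" and sub: "L \<subseteq> lists \<Sigma>" and D: "finite (range (deriv L))"
  shows "regular \<Sigma> L"
proof -
  obtain enc :: "'a list set \<Rightarrow> nat" where enc: "inj_on enc (range (deriv L))"
    using finite_imp_inj_to_nat_seg[OF D] by blast
  define dec where "dec = inv_into (range (deriv L)) enc"
  have dec: "dec (enc (deriv L w)) = deriv L w" for w
    unfolding dec_def using enc by simp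
  define \<delta> where "\<delta> q c = enc (deriv (dec q) [c])" for q c
  have step: "\<delta> (enc (deriv L w)) c = enc (deriv L (w @ [c]))" for w c
    by (simp add: \<delta>_def dec deriv_append)
  have run: "foldl \<delta> (enc (deriv L w)) v = enc (deriv L (w @ v))" for w v
    by (induction v arbitrary: w) (simp_all add: step)
  show ?thesis unfolding regular_def
  proof (intro conjI exI)
    show "finite \<Sigma>" "L \<subseteq> lists \<Sigma>" using fin sub .
    show "finite (enc ` range (deriv L))" using D by simp
    show "enc (deriv L []) \<in> enc ` range (deriv L)" by simp
    show "\<forall>q\<in>enc ` range (deriv L). \<forall>c\<in>\<Sigma>. \<delta> q c \<in> enc ` range (deriv L)"
      by (auto simp: step)
    show "enc ` {X \<in> range (deriv L). [] \<in> X} \<subseteq> enc ` range (deriv L)" by auto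
    have "foldl \<delta> (enc (deriv L [])) w \<in> enc ` {X \<in> range (deriv L). [] \<in> X} \<longleftrightarrow> w \<in> L" for w
      unfolding run using enc by (auto simp: mem_iff_Nil_deriv[of w] inj_on_def)
    then show "L = {w \<in> lists \<Sigma>. foldl \<delta> (enc (deriv L [])) w \<in> enc ` {X \<in> range (deriv L). [] \<in> X}}"
      using sub by auto
  qed
qed

lemma regular_iff:
  "regular \<Sigma> L \<longleftrightarrow> finite \<Sigma> \<and> L \<subseteq> lists \<Sigma> \<and> finite (range (deriv L))"
proof
  assume "regular \<Sigma> L"
  then show "finite \<Sigma> \<and> L \<subseteq> lists \<Sigma> \<and> finite (range (deriv L))"
    by (meson regular_def regular_finite_derivs)
qed (use finite_derivs_regular in blast)

lemma regularI:
  assumes "finite \<Sigma>" "L \<subseteq> lists \<Sigma>" "finite \<D>" "\<And>w. deriv L w \<in> \<D>"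
  shows "regular \<Sigma> L"
  using assms finite_subset[of "range (deriv L)" \<D>] by (auto simp: regular_iff)

lemma regularD:
  assumes "regular \<Sigma> L"
  shows "finite \<Sigma>" "L \<subseteq> lists \<Sigma>" "finite (range (deriv L))"
  using assms by (auto simp: regular_iff)

section \<open>Closure properties of regular languages\<close>

lemma regular_lists: "finite \<Sigma> \<Longrightarrow> regular \<Sigma> (lists \<Sigma>)"
  by (rule regularI[where \<D>="{{}, lists \<Sigma>}"]) (auto simp: deriv_def)

lemma regular_Un:
  assumes "regular \<Sigma> K" "regular \<Sigma> L"
  shows "regular \<Sigma> (K \<union> L)"
proof (rule regularI[where \<D>="(\<lambda>(X, Y). X \<union> Y) ` (range (deriv K) \<times> range (deriv L))"])
  fix w
  have "deriv (K \<union> L) w = deriv K w \<union> deriv L w" by (auto simp: deriv_def)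
  then show "deriv (K \<union> L) w \<in> (\<lambda>(X, Y). X \<union> Y) ` (range (deriv K) \<times> range (deriv L))"
    by force
qed (use assms in \<open>auto dest: regularD\<close>)

lemma regular_Int:
  assumes "regular \<Sigma> K" "regular \<Sigma> L"
  shows "regular \<Sigma> (K \<inter> L)"
proof (rule regularI[where \<D>="(\<lambda>(X, Y). X \<inter> Y) ` (range (deriv K) \<times> range (deriv L))"])
  fix w
  have "deriv (K \<inter> L) w = deriv K w \<inter> deriv L w" by (auto simp: deriv_def)
  then show "deriv (K \<inter> L) w \<in> (\<lambda>(X, Y). X \<inter> Y) ` (range (deriv K) \<times> range (deriv L))"
    by force
qed (use assms in \<open>auto dest: regularD\<close>)

lemma regular_Diff:
  assumes "regular \<Sigma> K" "regular \<Sigma> L"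
  shows "regular \<Sigma> (K - L)"
proof (rule regularI[where \<D>="(\<lambda>(X, Y). X - Y) ` (range (deriv K) \<times> range (deriv L))"])
  fix w
  have "deriv (K - L) w = deriv K w - deriv L w" by (auto simp: deriv_def)
  then show "deriv (K - L) w \<in> (\<lambda>(X, Y). X - Y) ` (range (deriv K) \<times> range (deriv L))"
    by force
qed (use assms in \<open>auto dest: regularD\<close>)

text \<open>A word either is still inside the factor from \<open>K\<close> or has left it at one of
  its prefixes in \<open>K\<close>. The second alternative contributes only a union of derivatives
  of \<open>L\<close>, which bounds the number of derivatives of a product.\<close>

lemma deriv_conc:
  "deriv (conc K L) w = conc (deriv K w) L \<union> \<Union>{deriv L w2 | w1 w2. w = w1 @ w2 \<and> w1 \<in> K}"
  (is "?L = ?R")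
proof (intro set_eqI iffI)
  fix v assume "v \<in> ?L"
  then obtain x y where "w @ v = x @ y" and xy: "x \<in> K" "y \<in> L" by (auto simp: deriv_def conc_def)
  then consider us where "w = x @ us" "us @ v = y" | us where "w @ us = x" "v = us @ y"
    by (auto simp: append_eq_append_conv2)
  then show "v \<in> ?R"
  proof cases
    case 1
    then have "v \<in> deriv L us" using xy by (simp add: deriv_def)
    then show ?thesis using 1 xy by blast
  next
    case 2
    then show ?thesis using xy by (auto simp: deriv_def conc_def)
  qed
next
  fix v assume "v \<in> ?R"
  then consider x y where "v = x @ y" "w @ x \<in> K" "y \<in> L" | w1 w2 where "w = w1 @ w2" "w1 \<in> K" "w2 @ v \<in> L"
    by (auto simp: deriv_def conc_def)
  then show "v \<in> ?L"
  proof cases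
    case 1
    then show ?thesis unfolding deriv_def conc_def by (intro CollectI exI[of _ "w @ x"] exI[of _ y]) simp
  next
    case 2
    then show ?thesis unfolding deriv_def conc_def by (intro CollectI exI[of _ w1] exI[of _ "w2 @ v"]) simp
  qed
qed

lemma regular_conc:
  assumes K: "regular \<Sigma> K" and L: "regular \<Sigma> L"
  shows "regular \<Sigma> (conc K L)"
proof (rule regularI[where \<D>="(\<lambda>(X, Y). conc X L \<union> \<Union>Y) ` (range (deriv K) \<times> Pow (range (deriv L)))"])
  show "finite \<Sigma>" using K by (rule regularD)
  show "conc K L \<subseteq> lists \<Sigma>" using K[THEN regularD(2)] L[THEN regularD(2)]
    by (auto simp: conc_def dest!: subsetD)
  show "finite ((\<lambda>(X, Y). conc X L \<union> \<Union>Y) ` (range (deriv K) \<times> Pow (range (deriv L))))"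
    using K[THEN regularD(3)] L[THEN regularD(3)] by simp
  fix w
  define Y where "Y = {deriv L w2 | w1 w2. w = w1 @ w2 \<and> w1 \<in> K}"
  have "Y \<in> Pow (range (deriv L))" by (auto simp: Y_def)
  moreover have "deriv (conc K L) w = (\<lambda>(X, Y). conc X L \<union> \<Union>Y) (deriv K w, Y)"
    by (simp add: deriv_conc Y_def)
  ultimately show "deriv (conc K L) w \<in> (\<lambda>(X, Y). conc X L \<union> \<Union>Y) ` (range (deriv K) \<times> Pow (range (deriv L)))"
    by (intro image_eqI[where x="(deriv K w, Y)"]) simp_all
qed

text \<open>Whether \<open>rev v @ rev w\<close> lies in \<open>L\<close> depends on
  \<open>w\<close> only through the set of those derivatives of \<open>L\<close> that contain
  \<open>rev w\<close>, and there are finitely many such sets.\<close>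

lemma regular_rev:
  assumes L: "regular \<Sigma> L"
  shows "regular \<Sigma> (rev ` L)"
proof (rule regularI[where \<D>="(\<lambda>\<X>. {v. deriv L (rev v) \<in> \<X>}) ` Pow (range (deriv L))"])
  show "finite \<Sigma>" "rev ` L \<subseteq> lists \<Sigma>" using regularD[OF L] by auto
  show "finite ((\<lambda>\<X>. {v. deriv L (rev v) \<in> \<X>}) ` Pow (range (deriv L)))"
    using regularD(3)[OF L] by simp
  fix w
  have "deriv (rev ` L) w = {v. deriv L (rev v) \<in> {X \<in> range (deriv L). rev w \<in> X}}"
  proof (intro set_eqI)
    fix v
    have "w @ v \<in> rev ` L \<longleftrightarrow> rev (w @ v) \<in> L"
      by (metis image_eqI imageE rev_rev_ident)
    then show "v \<in> deriv (rev ` L) w \<longleftrightarrow> v \<in> {v. deriv L (rev v) \<in> {X \<in> range (deriv L). rev w \<in> X}}"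
      by (simp add: deriv_def)
  qed
  moreover have "{X \<in> range (deriv L). rev w \<in> X} \<in> Pow (range (deriv L))" by auto
  ultimately show "deriv (rev ` L) w \<in> (\<lambda>\<X>. {v. deriv L (rev v) \<in> \<X>}) ` Pow (range (deriv L))"
    by (rule image_eqI)
qed

text \<open>Subset construction: \<open>f\<close> need not be injective, so the derivative at
  \<open>w\<close> unites the images of the derivatives at all preimages of
  \<open>w\<close>.\<close>

lemma regular_map:
  assumes L: "regular \<Sigma> L" and "finite \<Gamma>" "f ` \<Sigma> \<subseteq> \<Gamma>"
  shows "regular \<Gamma> (map f ` L)"
proof (rule regularI[where \<D>="(\<lambda>\<X>. \<Union>X\<in>\<X>. map f ` X) ` Pow (range (deriv L))"])
  show "finite \<Gamma>" by fact
  show "map f ` L \<subseteq> lists \<Gamma>" using regularD(2)[OF L] assms(3) by (auto dest!: subsetD)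
  show "finite ((\<lambda>\<X>. \<Union>X\<in>\<X>. map f ` X) ` Pow (range (deriv L)))"
    using regularD(3)[OF L] by simp
  fix w
  have "deriv (map f ` L) w = (\<Union>X\<in>{deriv L w' | w'. map f w' = w}. map f ` X)"
  proof (intro set_eqI iffI)
    fix v assume "v \<in> deriv (map f ` L) w"
    then obtain z where "z \<in> L" "w @ v = map f z" by (auto simp: deriv_def)
    then obtain w' v' where "w = map f w'" "v = map f v'" "w' @ v' \<in> L" by (auto simp: append_eq_map_conv)
    then show "v \<in> (\<Union>X\<in>{deriv L w' | w'. map f w' = w}. map f ` X)" unfolding deriv_def by blast
  next
    fix v assume "v \<in> (\<Union>X\<in>{deriv L w' | w'. map f w' = w}. map f ` X)"
    then obtain w' v' where "w = map f w'" "v = map f v'" "w' @ v' \<in> L" by (auto simp: deriv_def)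
    then have "w @ v = map f (w' @ v')" "w' @ v' \<in> L" by simp_all
    then show "v \<in> deriv (map f ` L) w" unfolding deriv_def by blast
  qed
  moreover have "{deriv L w' | w'. map f w' = w} \<in> Pow (range (deriv L))" by auto
  ultimately show "deriv (map f ` L) w \<in> (\<lambda>\<X>. \<Union>X\<in>\<X>. map f ` X) ` Pow (range (deriv L))"
    by (rule image_eqI)
qed

lemma regular_vimage_map:
  assumes L: "regular \<Gamma> L" and "finite \<Sigma>"
  shows "regular \<Sigma> {w \<in> lists \<Sigma>. map f w \<in> L}"
proof (rule regularI[where \<D>="insert {} ((\<lambda>X. {v \<in> lists \<Sigma>. map f v \<in> X}) ` range (deriv L))"])
  show "finite (insert {} ((\<lambda>X. {v \<in> lists \<Sigma>. map f v \<in> X}) ` range (deriv L)))"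
    using regularD(3)[OF L] by simp
  fix w
  show "deriv {w \<in> lists \<Sigma>. map f w \<in> L} w \<in> insert {} ((\<lambda>X. {v \<in> lists \<Sigma>. map f v \<in> X}) ` range (deriv L))"
  proof (cases "w \<in> lists \<Sigma>")
    case True
    then have "deriv {w \<in> lists \<Sigma>. map f w \<in> L} w = {v \<in> lists \<Sigma>. map f v \<in> deriv L (map f w)}"
      by (auto simp: deriv_def)
    then show ?thesis by blast
  next
    case False
    then have "deriv {w \<in> lists \<Sigma>. map f w \<in> L} w = {}" by (auto simp: deriv_def)
    then show ?thesis by blast
  qed
qed (use assms in auto)

lemma regular_finite:
  assumes "finite \<Sigma>" "finite F" "F \<subseteq> lists \<Sigma>"
  shows "regular \<Sigma> F"
proof (rule regularI[where \<D>="Pow (\<Union>f\<in>F. set (suffixes f))"])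
  fix w show "deriv F w \<in> Pow (\<Union>f\<in>F. set (suffixes f))"
    by (force simp: deriv_def suffix_def)
qed (use assms in auto)

text \<open>A nonempty derivative is determined by the rest \<open>s\<close> of the copy of
  \<open>w\<close> that is being read: it consists of \<open>s\<close> followed by powers of
  \<open>w\<close>, and \<open>w\<close> has finitely many suffixes.\<close>

lemma regular_power_star:
  assumes "finite \<Sigma>" "w \<in> lists \<Sigma>"
  shows "regular \<Sigma> {concat (replicate n w) | n. True}"
proof (cases "w = []")
  case True
  then have "{concat (replicate n w) | n. True} = {[]}" by auto
  then show ?thesis using assms(1) by (simp add: regular_finite)
next
  case False
  let ?P = "{concat (replicate n w) | n. True}"
  have mult: "concat (replicate n w) = x @ y \<Longrightarrow> \<exists>s. suffix s w \<and> deriv ?P x = conc {s} ?P" for n x y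
  proof (induction n arbitrary: x)
    case 0
    then have "deriv ?P x = conc {[]} ?P" by (auto simp: deriv_def conc_def)
    then show ?case by (intro exI[of _ "[]"]) auto
  next
    case (Suc n)
    show ?case
    proof (cases "x = [] \<or> length w \<le> length x")
      case True
      show ?thesis
      proof (cases "x = []")
        case True
        then have "deriv ?P x = conc {[]} ?P" by (auto simp: deriv_def conc_def)
        then show ?thesis by (intro exI[of _ "[]"]) auto
      next
        case False
        with True have "length w \<le> length x" by simp
        then obtain x' where x: "x = w @ x'" "concat (replicate n w) = x' @ y"
          using Suc.prems by (auto simp: append_eq_append_conv2)
        have P: "w @ v \<in> ?P \<longleftrightarrow> v \<in> ?P" for v
        proof
          assume "w @ v \<in> ?P"
          then obtain m where m: "w @ v = concat (replicate m w)" by auto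
          then show "v \<in> ?P" using \<open>w \<noteq> []\<close> by (cases m) auto
        next
          assume "v \<in> ?P"
          then obtain m where "v = concat (replicate m w)" by auto
          then have "w @ v = concat (replicate (Suc m) w)" by simp
          then show "w @ v \<in> ?P" by blast
        qed
        have "deriv ?P x = deriv ?P x'" using P by (simp add: x deriv_def)
        then show ?thesis using Suc.IH[OF x(2)] by simp
      qed
    next
      case False
      then obtain s where s: "w = x @ s" "s \<noteq> []" using Suc.prems
        by (auto simp: append_eq_append_conv2)
      have "deriv ?P x = conc {s} ?P"
      proof (intro set_eqI iffI)
        fix v assume "v \<in> deriv ?P x"
        then obtain m where m: "x @ v = concat (replicate m w)" by (auto simp: deriv_def)
        then show "v \<in> conc {s} ?P" using s False by (cases m) (auto simp: conc_def)
      next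
        fix v assume "v \<in> conc {s} ?P"
        then obtain m where "v = s @ concat (replicate m w)" by (auto simp: conc_def)
        then have "x @ v = concat (replicate (Suc m) w)" by (simp add: s)
        then show "v \<in> deriv ?P x" unfolding deriv_def by blast
      qed
      moreover have "suffix s w" by (simp add: s suffix_def)
      ultimately show ?thesis by blast
    qed
  qed
  show ?thesis
  proof (rule regularI[where \<D>="insert {} ((\<lambda>s. conc {s} ?P) ` set (suffixes w))"])
    show "?P \<subseteq> lists \<Sigma>" using assms(2) by (auto dest: in_listsD)
    fix x
    show "deriv ?P x \<in> insert {} ((\<lambda>s. conc {s} ?P) ` set (suffixes w))"
    proof (cases "deriv ?P x = {}")
      case False
      then obtain y n where "concat (replicate n w) = x @ y" by (auto simp: deriv_def) metis
      from mult[OF this] show ?thesis by auto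
    qed simp
  qed (use assms in auto)
qed

section \<open>Two-tape languages\<close>

lemma padR_simps [simp]:
  "padR [] [] = []"
  "padR (a # \<alpha>) (b # \<beta>) = (Some a, Some b) # padR \<alpha> \<beta>"
  "padR (a # \<alpha>) [] = (Some a, None) # padR \<alpha> []"
  "padR [] (b # \<beta>) = (None, Some b) # padR [] \<beta>"
  by (simp_all add: padR_def Let_def)

lemma padL_eq_rev: "padL \<alpha> \<beta> = rev (padR (rev \<alpha>) (rev \<beta>))"
  by (simp add: padL_def padR_def Let_def zip_rev[symmetric] rev_map)

lemma padR_tapes:
  "map fst (padR \<alpha> \<beta>) = map Some \<alpha> @ replicate (length \<beta> - length \<alpha>) None"
  "map snd (padR \<alpha> \<beta>) = map Some \<beta> @ replicate (length \<alpha> - length \<beta>) None"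
  by (simp_all add: padR_def Let_def max_def)

lemma map_Some_None_inject:
  "map Some \<alpha> @ replicate i None = map Some \<alpha>' @ replicate j None \<longleftrightarrow> \<alpha> = \<alpha>' \<and> i = j"
proof (induction \<alpha> arbitrary: \<alpha>')
  case Nil
  then show ?case
  proof (cases \<alpha>')
    case Nil
    then show ?thesis by (metis append_Nil length_replicate list.map(1))
  next
    case (Cons b \<alpha>'')
    then show ?thesis by (cases i) auto
  qed
next
  case (Cons a \<alpha>)
  then show ?case by (cases \<alpha>'; cases j) auto
qed

lemma padR_inject [simp]: "padR \<alpha> \<beta> = padR \<alpha>' \<beta>' \<longleftrightarrow> \<alpha> = \<alpha>' \<and> \<beta> = \<beta>'"
  by (metis padR_tapes map_Some_None_inject)

lemma padL_inject [simp]: "padL \<alpha> \<beta> = padL \<alpha>' \<beta>' \<longleftrightarrow> \<alpha> = \<alpha>' \<and> \<beta> = \<beta>'"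
  by (auto simp: padL_eq_rev)

lemma pad_alph_simps [simp]:
  "(Some a, Some b) \<in> pad_alph B \<longleftrightarrow> a \<in> B \<and> b \<in> B"
  "(Some a, None) \<in> pad_alph B \<longleftrightarrow> a \<in> B"
  "(None, Some b) \<in> pad_alph B \<longleftrightarrow> b \<in> B"
  by (auto simp: pad_alph_def)

lemma padR_alph: "\<alpha> \<in> lists B \<Longrightarrow> \<beta> \<in> lists B \<Longrightarrow> padR \<alpha> \<beta> \<in> lists (pad_alph B)"
proof (induction \<alpha> \<beta> rule: list_induct2')
  case (2 a \<alpha>)
  then show ?case by (induction \<alpha> arbitrary: a) auto
next
  case (3 b \<beta>)
  then show ?case by (induction \<beta> arbitrary: b) auto
qed auto

lemma padR_append_same_length:
  "length \<alpha> = length \<beta> \<Longrightarrow> padR (\<alpha> @ \<alpha>') (\<beta> @ \<beta>') = padR \<alpha> \<beta> @ padR \<alpha>' \<beta>'"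
  by (induction \<alpha> \<beta> rule: list_induct2) auto

lemma finite_pad_alph: "finite B \<Longrightarrow> finite (pad_alph B)"
  by (rule finite_subset[where B="insert None (Some ` B) \<times> insert None (Some ` B)"])
    (auto simp: pad_alph_def)

text \<open>Each tape alone carries a word of its language followed by some blanks, which is a
  regular condition on a projection. No further condition couples the tapes: \<open>pad_alph\<close>
  excludes the pair of two blanks, so at most one tape is padded, and by the right amount.\<close>

lemma regular_padR_Times:
  assumes K: "regular B K" and L: "regular B L"
  shows "regular (pad_alph B) {padR \<alpha> \<beta> | \<alpha> \<beta>. \<alpha> \<in> K \<and> \<beta> \<in> L}"
proof -
  let ?O = "insert None (Some ` B)"
  have fin: "finite B" using K by (rule regularD)
  have nones: "regular ?O {concat (replicate n [None]) | n. True}"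
    using fin by (intro regular_power_star) auto
  have pads: "regular ?O (conc (map Some ` M) {concat (replicate n [None]) | n. True})" if "regular B M" for M
    using that fin nones by (intro regular_conc regular_map[OF that]) auto
  have mem: "w \<in> conc (map Some ` M) {concat (replicate n [None]) | n. True} \<longleftrightarrow>
      (\<exists>\<alpha>\<in>M. \<exists>n. w = map Some \<alpha> @ replicate n None)" for w M
  proof -
    have "concat (replicate n [None]) = replicate n None" for n by (induction n) auto
    then show ?thesis by (auto simp: conc_def)
  qed
  have valid: "w = padR \<alpha> \<beta>"
    if "w \<in> lists (pad_alph B)" "map fst w = map Some \<alpha> @ replicate i None"
      "map snd w = map Some \<beta> @ replicate j None" for w \<alpha> \<beta> i j
  proof -
    have "i = 0 \<or> j = 0"
    proof (rule ccontr)
      assume "\<not> ?thesis"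
      then have "last (map fst w) = None" "last (map snd w) = None" "w \<noteq> []"
        using that by (auto simp: last_replicate)
      then have "last w = (None, None)" by (simp add: last_map prod_eq_iff)
      then show False using that(1) last_in_set[OF \<open>w \<noteq> []\<close>] by (auto simp: pad_alph_def)
    qed
    moreover have "length w = length \<alpha> + i" "length w = length \<beta> + j"
      using that(2,3)[THEN arg_cong[where f=length]] by simp_all
    ultimately have "i = max (length \<alpha>) (length \<beta>) - length \<alpha>" "j = max (length \<alpha>) (length \<beta>) - length \<beta>"
      by auto
    then have "padR \<alpha> \<beta> = zip (map fst w) (map snd w)" by (simp add: padR_def Let_def that)
    then show ?thesis by (simp add: zip_map_fst_snd)
  qed
  have "{padR \<alpha> \<beta> | \<alpha> \<beta>. \<alpha> \<in> K \<and> \<beta> \<in> L} =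
    {w \<in> lists (pad_alph B). map fst w \<in> conc (map Some ` K) {concat (replicate n [None]) | n. True}} \<inter>
    {w \<in> lists (pad_alph B). map snd w \<in> conc (map Some ` L) {concat (replicate n [None]) | n. True}}"
    (is "?P = ?R")
  proof
    show "?P \<subseteq> ?R"
    proof
      fix w assume "w \<in> ?P"
      then obtain \<alpha> \<beta> where w: "w = padR \<alpha> \<beta>" "\<alpha> \<in> K" "\<beta> \<in> L" by blast
      have "\<alpha> \<in> lists B" using K[THEN regularD(2)] w(2) ..
      moreover have "\<beta> \<in> lists B" using L[THEN regularD(2)] w(3) ..
      ultimately have "w \<in> lists (pad_alph B)" unfolding w(1) by (rule padR_alph)
      then show "w \<in> ?R" unfolding Int_iff mem_Collect_eq mem using w(2,3) unfolding w(1) padR_tapes by blast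
    qed
    show "?R \<subseteq> ?P"
    proof
      fix w assume "w \<in> ?R"
      then obtain \<alpha> \<beta> i j where "\<alpha> \<in> K" "\<beta> \<in> L" "w \<in> lists (pad_alph B)"
        "map fst w = map Some \<alpha> @ replicate i None" "map snd w = map Some \<beta> @ replicate j None"
        unfolding Int_iff mem_Collect_eq mem by blast
      with valid[of w \<alpha> i \<beta> j] show "w \<in> ?P" by blast
    qed
  qed
  then show ?thesis
    using pads[OF K] pads[OF L] finite_pad_alph[OF fin]
    by (auto intro!: regular_Int regular_vimage_map)
qed

lemma regular_padR_Id:
  assumes "regular B K"
  shows "regular (pad_alph B) {padR \<alpha> \<alpha> | \<alpha>. \<alpha> \<in> K}"
proof -
  have "padR \<alpha> \<alpha> = map (\<lambda>x. (Some x, Some x)) \<alpha>" for \<alpha> :: "'a list"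
    by (induction \<alpha>) auto
  then have "{padR \<alpha> \<alpha> | \<alpha>. \<alpha> \<in> K} = map (\<lambda>x. (Some x, Some x)) ` K" by auto
  moreover have "finite B" using assms by (rule regularD)
  ultimately show ?thesis
    using regular_map[OF assms, of "pad_alph B" "\<lambda>x. (Some x, Some x)"] finite_pad_alph[of B]
    by (force simp: pad_alph_def)
qed

subsection \<open>Tame relations\<close>

definition quot :: "('b list \<times> 'b list) set \<Rightarrow> 'b list \<Rightarrow> 'b list \<Rightarrow> ('b list \<times> 'b list) set" where
  "quot R x y = {(\<alpha>, \<beta>). (x @ \<alpha>, y @ \<beta>) \<in> R}"

text \<open>The residuals \<open>quot\<close> are the two-tape analogue of \<open>deriv\<close>.
  Only pairs of equally long words are considered, which together with the bounded length difference
  makes the notion independent of the end at which the shorter word is padded.\<close>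

definition tame :: "'b set \<Rightarrow> ('b list \<times> 'b list) set \<Rightarrow> bool" where
  "tame B R \<longleftrightarrow> finite B \<and> R \<subseteq> lists B \<times> lists B \<and>
     (\<exists>N. \<forall>(\<alpha>, \<beta>)\<in>R. length \<alpha> \<le> length \<beta> + N \<and> length \<beta> \<le> length \<alpha> + N) \<and>
     finite {quot R x y | x y. length x = length y}"

lemma tame_lists: "tame B R \<Longrightarrow> (\<alpha>, \<beta>) \<in> R \<Longrightarrow> \<alpha> \<in> lists B \<and> \<beta> \<in> lists B"
  unfolding tame_def by blast

lemma quot_append: "quot R (x @ x') (y @ y') = quot (quot R x y) x' y'"
  by (auto simp: quot_def)

text \<open>The longer word is cut at the length of the shorter one. The overhang has at most
  \<open>N\<close> letters from a finite alphabet, and one of the finitely many residuals is divided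
  by it once more.\<close>

lemma tame_quot_lag:
  assumes "tame B R"
  shows "finite {quot R x y | x y. length x \<le> length y + N \<and> length y \<le> length x + N}"
proof -
  let ?W = "{w \<in> lists B. length w \<le> N}"
  let ?E = "{quot R x y | x y. length x = length y}"
  have fin: "finite B" "finite ?E" and sub: "R \<subseteq> lists B \<times> lists B"
    using assms by (auto simp: tame_def)
  have "finite ?W" using finite_lists_length_le[OF fin(1), of N] by (simp add: lists_eq_set)
  have "{quot R x y | x y. length x \<le> length y + N \<and> length y \<le> length x + N}
    \<subseteq> insert {} ((\<lambda>(X, w). quot X w []) ` (?E \<times> ?W) \<union> (\<lambda>(X, w). quot X [] w) ` (?E \<times> ?W))"
  proof
    fix X assume "X \<in> {quot R x y | x y. length x \<le> length y + N \<and> length y \<le> length x + N}"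
    then obtain x y where X: "X = quot R x y" and xy: "length x \<le> length y + N" "length y \<le> length x + N"
      by auto
    show "X \<in> insert {} ((\<lambda>(X, w). quot X w []) ` (?E \<times> ?W) \<union> (\<lambda>(X, w). quot X [] w) ` (?E \<times> ?W))"
    proof (cases "x \<in> lists B \<and> y \<in> lists B")
      case False
      then have "X = {}" using sub by (auto simp: X quot_def)
      then show ?thesis by simp
    next
      case True
      show ?thesis
      proof (cases "length x \<le> length y")
        case True
        let ?y = "take (length x) y" and ?w = "drop (length x) y"
        have "X = quot (quot R x ?y) [] ?w" by (simp add: X flip: quot_append)
        moreover have "quot R x ?y \<in> ?E"
          by (intro CollectI exI[of _ x] exI[of _ ?y]) (use True in simp)
        moreover have "?w \<in> ?W" using \<open>x \<in> lists B \<and> y \<in> lists B\<close> xy by (auto dest: in_set_dropD)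
        ultimately show ?thesis by blast
      next
        case False
        let ?x = "take (length y) x" and ?w = "drop (length y) x"
        have "X = quot (quot R ?x y) ?w []" by (simp add: X flip: quot_append)
        moreover have "quot R ?x y \<in> ?E"
          by (intro CollectI exI[of _ ?x] exI[of _ y]) (use False in simp)
        moreover have "?w \<in> ?W" using \<open>x \<in> lists B \<and> y \<in> lists B\<close> xy by (auto dest: in_set_dropD)
        ultimately show ?thesis by blast
      qed
    qed
  qed
  then show ?thesis by (rule finite_subset) (use fin \<open>finite ?W\<close> in simp)
qed

lemma tame_bound:
  assumes "tame B R"
  obtains N where "\<And>\<alpha> \<beta>. (\<alpha>, \<beta>) \<in> R \<Longrightarrow> length \<alpha> \<le> length \<beta> + N \<and> length \<beta> \<le> length \<alpha> + N"
  using assms unfolding tame_def by blast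

text \<open>The residual of the reversed relation at a pair of words is determined by the finitely many
  residuals of bounded lag that contain the reversed pair; hence left and right padding are
  interchangeable for tame relations.\<close>

lemma tame_rev:
  assumes R: "tame B R"
  shows "tame B ((\<lambda>(\<alpha>, \<beta>). (rev \<alpha>, rev \<beta>)) ` R)" (is "tame B ?R")
proof -
  obtain N where N: "\<And>\<alpha> \<beta>. (\<alpha>, \<beta>) \<in> R \<Longrightarrow> length \<alpha> \<le> length \<beta> + N \<and> length \<beta> \<le> length \<alpha> + N"
    using tame_bound[OF R] by blast
  let ?Q = "{quot R x y | x y. length x \<le> length y + N \<and> length y \<le> length x + N}"
  have "{quot ?R x y | x y. length x = length y} \<subseteq>
     (\<lambda>\<X>. {(\<alpha>, \<beta>). quot R (rev \<alpha>) (rev \<beta>) \<in> \<X>}) ` Pow ?Q"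
  proof
    fix X assume "X \<in> {quot ?R x y | x y. length x = length y}"
    then obtain x y where X: "X = quot ?R x y" "length x = length y" by auto
    have mem: "(\<alpha>, \<beta>) \<in> X \<longleftrightarrow> (rev \<alpha> @ rev x, rev \<beta> @ rev y) \<in> R" for \<alpha> \<beta>
    proof -
      have "(x @ \<alpha>, y @ \<beta>) \<in> ?R \<longleftrightarrow> (rev (x @ \<alpha>), rev (y @ \<beta>)) \<in> R"
      proof
        assume "(rev (x @ \<alpha>), rev (y @ \<beta>)) \<in> R"
        from imageI[OF this, of "\<lambda>(\<alpha>, \<beta>). (rev \<alpha>, rev \<beta>)"] show "(x @ \<alpha>, y @ \<beta>) \<in> ?R" by simp
      qed (auto simp del: rev_append)
      then show ?thesis by (simp add: X quot_def)
    qed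
    have "X = {(\<alpha>, \<beta>). quot R (rev \<alpha>) (rev \<beta>) \<in> {Y \<in> ?Q. (rev x, rev y) \<in> Y}}"
    proof (intro set_eqI, clarify)
      fix \<alpha> \<beta>
      show "(\<alpha>, \<beta>) \<in> X \<longleftrightarrow> (\<alpha>, \<beta>) \<in> {(\<alpha>, \<beta>). quot R (rev \<alpha>) (rev \<beta>) \<in> {Y \<in> ?Q. (rev x, rev y) \<in> Y}}"
      proof -
        have "quot R (rev \<alpha>) (rev \<beta>) \<in> ?Q" if "(rev \<alpha> @ rev x, rev \<beta> @ rev y) \<in> R"
        proof -
          have "length (rev \<alpha>) \<le> length (rev \<beta>) + N \<and> length (rev \<beta>) \<le> length (rev \<alpha>) + N"
            using N[OF that] X(2) by simp
          then show ?thesis by blast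
        qed
        moreover have "(rev x, rev y) \<in> quot R (rev \<alpha>) (rev \<beta>) \<longleftrightarrow> (rev \<alpha> @ rev x, rev \<beta> @ rev y) \<in> R"
          by (simp add: quot_def)
        ultimately show ?thesis unfolding mem mem_Collect_eq prod.case by blast
      qed
    qed
    then show "X \<in> (\<lambda>\<X>. {(\<alpha>, \<beta>). quot R (rev \<alpha>) (rev \<beta>) \<in> \<X>}) ` Pow ?Q"
      by (rule image_eqI) blast
  qed
  then have "finite {quot ?R x y | x y. length x = length y}"
    by (rule finite_subset) (use tame_quot_lag[OF R] in simp)
  moreover have "\<forall>(\<alpha>, \<beta>)\<in>?R. length \<alpha> \<le> length \<beta> + N \<and> length \<beta> \<le> length \<alpha> + N"
    using N by auto
  moreover have "?R \<subseteq> lists B \<times> lists B" "finite B" using R by (auto simp: tame_def)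
  ultimately show ?thesis unfolding tame_def by blast
qed

text \<open>The derivative at \<open>padR x y\<close> consists of the padded pairs of the residual
  at \<open>(x, y)\<close>. If one of the two words is shorter, its tape has already ended and must
  not continue, which is recorded by \<open>Z\<close>. The bounded length difference leaves only
  residuals of bounded lag.\<close>

lemma tame_regular_padR:
  assumes R: "tame B R"
  shows "regular (pad_alph B) {padR \<alpha> \<beta> | \<alpha> \<beta>. (\<alpha>, \<beta>) \<in> R}" (is "regular _ ?P")
proof -
  obtain N where N: "\<And>\<alpha> \<beta>. (\<alpha>, \<beta>) \<in> R \<Longrightarrow> length \<alpha> \<le> length \<beta> + N \<and> length \<beta> \<le> length \<alpha> + N"
    using tame_bound[OF R] by blast
  let ?Q = "{quot R x y | x y. length x \<le> length y + N \<and> length y \<le> length x + N}"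
  let ?f = "\<lambda>Z X. {padR \<alpha> \<beta> | \<alpha> \<beta>. (\<alpha>, \<beta>) \<in> X \<inter> Z}"
  let ?Z = "{UNIV, {(\<alpha>, \<beta>). \<beta> = []}, {(\<alpha>, \<beta>). \<alpha> = []}}"
  \<comment> \<open>A prefix of a padded word is itself a padded pair; a tape that is behind at the
    cut has no continuation.\<close>
  have cut: "\<exists>x y \<alpha>' \<beta>'. w = padR x y \<and> v = padR \<alpha>' \<beta>' \<and> \<alpha> = x @ \<alpha>' \<and> \<beta> = y @ \<beta>' \<and>
      (length x > length y \<longrightarrow> \<beta>' = []) \<and> (length x < length y \<longrightarrow> \<alpha>' = [])"
    if "w @ v = padR \<alpha> \<beta>" for w v and \<alpha> \<beta> :: "'a list"
    using that
  proof (induction \<alpha> \<beta> arbitrary: w rule: list_induct2')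
    case 1
    then show ?case by (intro exI[of _ "[]"]) auto
  next
    case (2 a \<alpha>)
    show ?case
    proof (cases w)
      case Nil
      with 2 show ?thesis by (intro exI[of _ "[]"] exI[of _ "a # \<alpha>"]) auto
    next
      case (Cons c w')
      have "v = drop (length w') (padR \<alpha> [])" "w' = take (length w') (padR \<alpha> [])"
        using 2 Cons by (auto simp: append_eq_conv_conj)
      moreover have "take k (padR \<alpha> []) = padR (take k \<alpha>) ([] :: 'a list)" for k
        by (simp add: padR_def Let_def take_zip min_def take_map)
      moreover have "drop k (padR \<alpha> []) = padR (drop k \<alpha>) ([] :: 'a list)" for k
        by (simp add: padR_def Let_def drop_zip drop_map)
      ultimately show ?thesis using 2 Cons
        by (intro exI[of _ "a # take (length w') \<alpha>"] exI[of _ "[]"] exI[of _ "drop (length w') \<alpha>"]) auto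
    qed
  next
    case (3 b \<beta>)
    show ?case
    proof (cases w)
      case Nil
      with 3 show ?thesis by (intro exI[of _ "[]"] exI[of _ "b # \<beta>"]) auto
    next
      case (Cons c w')
      have "v = drop (length w') (padR [] \<beta>)" "w' = take (length w') (padR [] \<beta>)"
        using 3 Cons by (auto simp: append_eq_conv_conj)
      moreover have "take k (padR [] \<beta>) = padR ([] :: 'a list) (take k \<beta>)" for k
        by (simp add: padR_def Let_def take_zip min_def take_map)
      moreover have "drop k (padR [] \<beta>) = padR ([] :: 'a list) (drop k \<beta>)" for k
        by (simp add: padR_def Let_def drop_zip drop_map)
      ultimately show ?thesis using 3 Cons
        by (intro exI[of _ "[]"] exI[of _ "b # take (length w') \<beta>"] exI[of _ "[]"] exI[of _ "drop (length w') \<beta>"]) auto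
    qed
  next
    case (4 a \<alpha> b \<beta>)
    show ?case
    proof (cases w)
      case Nil
      with 4 show ?thesis
        by (intro exI[of _ "[]"] exI[of _ "a # \<alpha>"] exI[of _ "b # \<beta>"]) auto
    next
      case (Cons c w')
      then have "w' @ v = padR \<alpha> \<beta>" using 4 by simp
      from "4.IH"[OF this] obtain x y \<alpha>' \<beta>' where "w' = padR x y" "v = padR \<alpha>' \<beta>'" "\<alpha> = x @ \<alpha>'" "\<beta> = y @ \<beta>'"
        "length x > length y \<longrightarrow> \<beta>' = []" "length x < length y \<longrightarrow> \<alpha>' = []" by blast
      then show ?thesis using Cons 4(2)
        by (intro exI[of _ "a # x"] exI[of _ "b # y"] exI[of _ \<alpha>'] exI[of _ \<beta>']) auto
    qed
  qed
  have glue: "padR (x @ \<alpha>) (y @ \<beta>) = padR x y @ padR \<alpha> \<beta>"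
    if "length x > length y \<longrightarrow> \<beta> = []" "length x < length y \<longrightarrow> \<alpha> = []" for x y \<alpha> \<beta> :: "'a list"
    using that
  proof (induction x y rule: list_induct2')
    case (2 a x)
    then have "\<beta> = []" by simp
    moreover have "padR (z @ \<alpha>) [] = padR z [] @ padR \<alpha> ([] :: 'a list)" for z by (induction z) auto
    ultimately show ?case by simp
  next
    case (3 b y)
    then have "\<alpha> = []" by simp
    moreover have "padR [] (z @ \<beta>) = padR [] z @ padR ([] :: 'a list) \<beta>" for z by (induction z) auto
    ultimately show ?case by simp
  qed auto
  show ?thesis
  proof (rule regularI[where \<D>="insert {} ((\<lambda>(Z, X). ?f Z X) ` (?Z \<times> ?Q))"])
    show "finite (pad_alph B)" using R unfolding tame_def by (blast intro: finite_pad_alph)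
    show "?P \<subseteq> lists (pad_alph B)"
    proof
      fix w assume "w \<in> ?P"
      then obtain \<alpha> \<beta> where "w = padR \<alpha> \<beta>" "(\<alpha>, \<beta>) \<in> R" by blast
      then show "w \<in> lists (pad_alph B)" using tame_lists[OF R] padR_alph[of \<alpha> B \<beta>] by simp
    qed
    show "finite (insert {} ((\<lambda>(Z, X). ?f Z X) ` (?Z \<times> ?Q)))" using tame_quot_lag[OF R] by simp
    fix w
    show "deriv ?P w \<in> insert {} ((\<lambda>(Z, X). ?f Z X) ` (?Z \<times> ?Q))"
    proof (cases "deriv ?P w = {}")
      case False
      then obtain v \<alpha> \<beta> where "w @ v = padR \<alpha> \<beta>" "(\<alpha>, \<beta>) \<in> R" by (auto simp: deriv_def)
      from cut[OF this(1)] this(2) obtain x y \<alpha>' \<beta>' where w: "w = padR x y" and "(x @ \<alpha>', y @ \<beta>') \<in> R"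
         and e: "length x > length y \<longrightarrow> \<beta>' = []" "length x < length y \<longrightarrow> \<alpha>' = []" by blast
      define Z :: "('a list \<times> 'a list) set" where "Z = (if length x > length y then {(\<alpha>, \<beta>). \<beta> = []}
        else if length x < length y then {(\<alpha>, \<beta>). \<alpha> = []} else UNIV)"
      have "deriv ?P w = ?f Z (quot R x y)"
      proof (intro set_eqI iffI)
        fix v assume "v \<in> deriv ?P w"
        then obtain \<alpha> \<beta> where ab: "w @ v = padR \<alpha> \<beta>" "(\<alpha>, \<beta>) \<in> R" by (auto simp: deriv_def)
        from cut[OF ab(1)] obtain x2 y2 \<alpha>2 \<beta>2 where "w = padR x2 y2" "v = padR \<alpha>2 \<beta>2" "\<alpha> = x2 @ \<alpha>2" "\<beta> = y2 @ \<beta>2"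
          "length x2 > length y2 \<longrightarrow> \<beta>2 = []" "length x2 < length y2 \<longrightarrow> \<alpha>2 = []" by blast
        then show "v \<in> ?f Z (quot R x y)" using w ab(2) by (auto simp: Z_def quot_def)
      next
        fix v assume "v \<in> ?f Z (quot R x y)"
        then obtain \<alpha> \<beta> where "v = padR \<alpha> \<beta>" "(x @ \<alpha>, y @ \<beta>) \<in> R" "(\<alpha>, \<beta>) \<in> Z" by (auto simp: quot_def)
        moreover from this(3) have "padR (x @ \<alpha>) (y @ \<beta>) = w @ padR \<alpha> \<beta>"
          unfolding w by (intro glue) (auto simp: Z_def split: if_splits)
        ultimately have "w @ v = padR (x @ \<alpha>) (y @ \<beta>)" "(x @ \<alpha>, y @ \<beta>) \<in> R" by simp_all
        then show "v \<in> deriv ?P w" unfolding deriv_def by blast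
      qed
      moreover have "quot R x y \<in> ?Q"
      proof -
        have "length x \<le> length y + N \<and> length y \<le> length x + N"
          using N[OF \<open>(x @ \<alpha>', y @ \<beta>') \<in> R\<close>] e by (cases "length x" "length y" rule: linorder_cases) auto
        then show ?thesis by blast
      qed
      moreover have "Z \<in> ?Z" by (simp add: Z_def)
      ultimately show ?thesis by blast
    qed simp
  qed
qed

lemma tame_regular_padL:
  assumes R: "tame B R"
  shows "regular (pad_alph B) {padL \<alpha> \<beta> | \<alpha> \<beta>. (\<alpha>, \<beta>) \<in> R}"
proof -
  have "{padL \<alpha> \<beta> | \<alpha> \<beta>. (\<alpha>, \<beta>) \<in> R} =
     rev ` {padR \<alpha> \<beta> | \<alpha> \<beta>. (\<alpha>, \<beta>) \<in> (\<lambda>(\<alpha>, \<beta>). (rev \<alpha>, rev \<beta>)) ` R}"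
    by (force simp: padL_eq_rev image_iff)
  then show ?thesis using regular_rev[OF tame_regular_padR[OF tame_rev[OF R]]] by simp
qed

section \<open>Closure properties of tame relations\<close>

lemma tame_Un:
  assumes R: "tame B R" and S: "tame B S"
  shows "tame B (R \<union> S)"
proof -
  have "{quot (R \<union> S) x y | x y. length x = length y} \<subseteq> (\<lambda>(X, Y). X \<union> Y) `
     ({quot R x y | x y. length x = length y} \<times> {quot S x y | x y. length x = length y})"
  proof
    fix X assume "X \<in> {quot (R \<union> S) x y | x y. length x = length y}"
    then obtain x y where "X = quot (R \<union> S) x y" and l: "length x = length y" by auto
    then have "X = quot R x y \<union> quot S x y" by (auto simp: quot_def)
    then show "X \<in> (\<lambda>(X, Y). X \<union> Y) `
     ({quot R x y | x y. length x = length y} \<times> {quot S x y | x y. length x = length y})"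
      using l by blast
  qed
  then have "finite {quot (R \<union> S) x y | x y. length x = length y}"
    by (rule finite_subset) (use R S in \<open>simp add: tame_def\<close>)
  moreover obtain M where "\<And>\<alpha> \<beta>. (\<alpha>, \<beta>) \<in> R \<Longrightarrow> length \<alpha> \<le> length \<beta> + M \<and> length \<beta> \<le> length \<alpha> + M"
    using tame_bound[OF R] by blast
  moreover obtain N where "\<And>\<alpha> \<beta>. (\<alpha>, \<beta>) \<in> S \<Longrightarrow> length \<alpha> \<le> length \<beta> + N \<and> length \<beta> \<le> length \<alpha> + N"
    using tame_bound[OF S] by blast
  ultimately have "\<forall>(\<alpha>, \<beta>)\<in>R \<union> S. length \<alpha> \<le> length \<beta> + (M + N) \<and> length \<beta> \<le> length \<alpha> + (M + N)"
    by fastforce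
  then show ?thesis using R S \<open>finite {quot (R \<union> S) x y | x y. length x = length y}\<close>
    unfolding tame_def by blast
qed

lemma tame_Int_Times:
  assumes R: "tame B R" and K: "regular B K" and L: "regular B L"
  shows "tame B (R \<inter> K \<times> L)"
proof -
  have "{quot (R \<inter> K \<times> L) x y | x y. length x = length y} \<subseteq> (\<lambda>(X, Y, Z). X \<inter> Y \<times> Z) `
     ({quot R x y | x y. length x = length y} \<times> range (deriv K) \<times> range (deriv L))"
  proof
    fix X assume "X \<in> {quot (R \<inter> K \<times> L) x y | x y. length x = length y}"
    then obtain x y where "X = quot (R \<inter> K \<times> L) x y" and l: "length x = length y" by auto
    then have "X = quot R x y \<inter> deriv K x \<times> deriv L y" by (auto simp: quot_def deriv_def)
    then have "X = (\<lambda>(X, Y, Z). X \<inter> Y \<times> Z) (quot R x y, deriv K x, deriv L y)" by simp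
    then show "X \<in> (\<lambda>(X, Y, Z). X \<inter> Y \<times> Z) `
     ({quot R x y | x y. length x = length y} \<times> range (deriv K) \<times> range (deriv L))"
      using l by blast
  qed
  then have "finite {quot (R \<inter> K \<times> L) x y | x y. length x = length y}"
    by (rule finite_subset) (use R K L in \<open>auto simp: tame_def dest: regularD\<close>)
  then show ?thesis using R unfolding tame_def by blast
qed

lemma tame_Id:
  assumes "finite B"
  shows "tame B {(\<gamma>, \<gamma>) | \<gamma>. \<gamma> \<in> lists B}" (is "tame B ?R")
proof -
  have "{quot ?R x y | x y. length x = length y} \<subseteq> {{}, ?R}"
    by (auto simp: quot_def)
  then have "finite {quot ?R x y | x y. length x = length y}"
    by (rule finite_subset) simp
  then show ?thesis using assms by (auto simp: tame_def)
qed

text \<open>As long as the words read are no longer than \<open>length s + length t\<close>, they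
  form a finite set of pairs. Afterwards \<open>s\<close> and \<open>t\<close> have both been
  passed, and the residual is one of \<open>R\<close> with lag bounded by that number.\<close>

lemma tame_prepend:
  assumes R: "tame B R" and s: "s \<in> lists B" "t \<in> lists B"
  shows "tame B {(s @ \<alpha>, t @ \<beta>) | \<alpha> \<beta>. (\<alpha>, \<beta>) \<in> R}" (is "tame B ?R")
proof -
  let ?M = "length s + length t"
  let ?W = "{w \<in> lists B. length w \<le> ?M}"
  let ?Q = "{quot R x y | x y. length x \<le> length y + ?M \<and> length y \<le> length x + ?M}"
  have sub: "?R \<subseteq> lists B \<times> lists B" using tame_lists[OF R] s by fastforce
  have "finite ?W" using finite_lists_length_le[of B ?M] R by (simp add: lists_eq_set tame_def)
  have "{quot ?R x y | x y. length x = length y} \<subseteq> insert {} ((\<lambda>(x, y). quot ?R x y) ` (?W \<times> ?W) \<union> ?Q)"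
  proof
    fix X assume "X \<in> {quot ?R x y | x y. length x = length y}"
    then obtain x y where X: "X = quot ?R x y" "length x = length y" by auto
    show "X \<in> insert {} ((\<lambda>(x, y). quot ?R x y) ` (?W \<times> ?W) \<union> ?Q)"
    proof (cases "X = {}")
      case False
      then obtain \<alpha>0 \<beta>0 where ne: "(x @ \<alpha>0, y @ \<beta>0) \<in> ?R" by (auto simp: X quot_def)
      then have xy: "x \<in> lists B" "y \<in> lists B" using subsetD[OF sub ne] by auto
      show ?thesis
      proof (cases "length x \<le> ?M")
        case True
        then have "X \<in> (\<lambda>(x, y). quot ?R x y) ` (?W \<times> ?W)" using xy X by auto
        then show ?thesis by blast
      next
        case False
        then obtain x' y' where x': "x = s @ x'" and y': "y = t @ y'"
          using ne X(2) by (auto simp: append_eq_append_conv2)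
        have "X = quot R x' y'" by (auto simp: X x' y' quot_def)
        moreover have "length x' \<le> length y' + ?M" "length y' \<le> length x' + ?M" using X(2) x' y' by auto
        ultimately show ?thesis by blast
      qed
    qed simp
  qed
  then have "finite {quot ?R x y | x y. length x = length y}"
    by (rule finite_subset) (use tame_quot_lag[OF R] \<open>finite ?W\<close> in simp)
  moreover obtain N where "\<And>\<alpha> \<beta>. (\<alpha>, \<beta>) \<in> R \<Longrightarrow> length \<alpha> \<le> length \<beta> + N \<and> length \<beta> \<le> length \<alpha> + N"
    using tame_bound[OF R] by blast
  then have "\<forall>(\<alpha>, \<beta>)\<in>?R. length \<alpha> \<le> length \<beta> + (N + ?M) \<and> length \<beta> \<le> length \<alpha> + (N + ?M)"
    by fastforce
  ultimately show ?thesis using R sub unfolding tame_def by blast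
qed

text \<open>The submonoid generated by \<open>Bl\<close> in the monoid of pairs of words.\<close>

definition blocks :: "('b list \<times> 'b list) set \<Rightarrow> ('b list \<times> 'b list) set" where
  "blocks Bl = {(concat (map fst zs), concat (map snd zs)) | zs. zs \<in> lists Bl}"

lemma blocks_Nil [simp]: "([], []) \<in> blocks Bl"
  unfolding blocks_def by (auto intro: exI[of _ "[]"])

lemma blocks_Cons: "(x, y) \<in> Bl \<Longrightarrow> (X, Y) \<in> blocks Bl \<Longrightarrow> (x @ X, y @ Y) \<in> blocks Bl"
proof -
  assume xy: "(x, y) \<in> Bl" and "(X, Y) \<in> blocks Bl"
  then obtain zs where "zs \<in> lists Bl" "X = concat (map fst zs)" "Y = concat (map snd zs)"
    by (auto simp: blocks_def)
  then have "(x, y) # zs \<in> lists Bl" "x @ X = concat (map fst ((x, y) # zs))" "y @ Y = concat (map snd ((x, y) # zs))"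
    using xy by simp_all
  then show ?thesis unfolding blocks_def by blast
qed

lemma blocks_induct [consumes 1, case_names Nil Cons]:
  assumes "(X, Y) \<in> blocks Bl" "P [] []"
    "\<And>x y X Y. (x, y) \<in> Bl \<Longrightarrow> (X, Y) \<in> blocks Bl \<Longrightarrow> P X Y \<Longrightarrow> P (x @ X) (y @ Y)"
  shows "P X Y"
proof -
  obtain zs where "zs \<in> lists Bl" "X = concat (map fst zs)" "Y = concat (map snd zs)"
    using assms(1) by (auto simp: blocks_def)
  then show ?thesis
  proof (induction zs arbitrary: X Y)
    case (Cons z zs)
    then have "(concat (map fst zs), concat (map snd zs)) \<in> blocks Bl" by (auto simp: blocks_def)
    moreover have "P (concat (map fst zs)) (concat (map snd zs))" using Cons by auto
    ultimately show ?case using assms(3)[of "fst z" "snd z"] Cons by auto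
  qed (use assms(2) in simp)
qed

lemma append_cut_le:
  "x @ \<alpha> = x1 @ z \<Longrightarrow> length x1 \<le> length x \<Longrightarrow> \<exists>x2. x = x1 @ x2 \<and> x2 @ \<alpha> = z"
  by (auto simp: append_eq_append_conv2)

text \<open>Both tapes of a block have equal length, so equally long prefixes end at the same place
  of the same block. The factorisation into blocks need not be unique; hence a residual is a union
  of pieces, each of them a residual of \<open>R\<close> or the rest of a half-read block followed
  by the whole relation. There are finitely many pieces and so finitely many unions.\<close>

lemma tame_blocks:
  assumes R: "tame B R" and Bl: "finite Bl" "Bl \<subseteq> lists B \<times> lists B"
    and len: "\<And>x y. (x, y) \<in> Bl \<Longrightarrow> length x = length y"
  shows "tame B {(X @ \<alpha>, Y @ \<beta>) | X Y \<alpha> \<beta>. (X, Y) \<in> blocks Bl \<and> (\<alpha>, \<beta>) \<in> R}" (is "tame B ?R")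
proof -
  have blk: "length X = length Y \<and> X \<in> lists B \<and> Y \<in> lists B" if "(X, Y) \<in> blocks Bl" for X Y
    using that by (induction rule: blocks_induct) (use Bl(2) len in auto)
  let ?E = "{quot R x y | x y. length x = length y}"
  let ?S = "\<Union>(x, y)\<in>Bl. set (suffixes x) \<times> set (suffixes y)"
  let ?g = "\<lambda>(x, y). {(x @ \<alpha>, y @ \<beta>) | \<alpha> \<beta>. (\<alpha>, \<beta>) \<in> ?R}"
  have unit: "\<exists>\<X> \<subseteq> ?E \<union> ?g ` ?S. quot ?R x y = \<Union>\<X>" if "length x = length y" for x y
  proof -
    let ?X = "{Z \<in> ?E \<union> ?g ` ?S. Z \<subseteq> quot ?R x y}"
    have "quot ?R x y \<subseteq> \<Union>?X"
    proof clarify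
      fix \<alpha> \<beta> assume "(\<alpha>, \<beta>) \<in> quot ?R x y"
      then obtain X Y \<alpha>' \<beta>' where XY: "x @ \<alpha> = X @ \<alpha>'" "y @ \<beta> = Y @ \<beta>'" "(X, Y) \<in> blocks Bl" "(\<alpha>', \<beta>') \<in> R"
        by (auto simp: quot_def)
      from XY(3,1,2) that have "\<exists>Z\<in>?X. (\<alpha>, \<beta>) \<in> Z"
      proof (induction arbitrary: x y rule: blocks_induct)
        case Nil
        let ?Z = "quot R x y"
        have "(\<alpha>, \<beta>) \<in> ?Z" using Nil XY(4) by (simp add: quot_def)
        moreover have "?Z \<subseteq> quot ?R x y" 
          unfolding quot_def using blocks_Nil[of Bl] append_Nil by blast
        moreover have "?Z \<in> ?E" using Nil by blast
        ultimately show ?case by blast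
      next
        case (Cons x1 y1 X Y)
        have l1: "length x1 = length y1" using len Cons by blast
        show ?case
        proof (cases "length x1 \<le> length x")
          case True
          then obtain x2 where x2: "x = x1 @ x2" "x2 @ \<alpha> = X @ \<alpha>'"
            using append_cut_le[of x \<alpha> x1 "X @ \<alpha>'"] Cons.prems(1) by auto
          obtain y2 where y2: "y = y1 @ y2" "y2 @ \<beta> = Y @ \<beta>'"
            using append_cut_le[of y \<beta> y1 "Y @ \<beta>'"] Cons.prems(2,3) True l1 by auto
          have "length x2 = length y2" using x2 y2 l1 Cons.prems(3) by simp
          note xy2 = x2(1) y2(1) x2(2) y2(2) this
          from Cons.IH[OF xy2(3-5)] obtain Z
            where Z0: "Z \<in> {Z \<in> ?E \<union> ?g ` ?S. Z \<subseteq> quot ?R x2 y2}" and Z1: "(\<alpha>, \<beta>) \<in> Z" by (rule bexE)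
          have "quot ?R x2 y2 \<subseteq> quot ?R x y"
          proof (clarsimp simp: quot_def)
            fix \<alpha> \<beta> X Y \<alpha>' \<beta>' assume *: "x2 @ \<alpha> = X @ \<alpha>'" "y2 @ \<beta> = Y @ \<beta>'" "(X, Y) \<in> blocks Bl" "(\<alpha>', \<beta>') \<in> R"
            show "\<exists>X Y \<alpha>'. x @ \<alpha> = X @ \<alpha>' \<and> (\<exists>\<beta>'. y @ \<beta> = Y @ \<beta>' \<and> (X, Y) \<in> blocks Bl \<and> (\<alpha>', \<beta>') \<in> R)"
              using blocks_Cons[OF Cons.hyps(1) *(3)] * xy2(1,2)
              by (intro exI[of _ "x1 @ X"] exI[of _ "y1 @ Y"] exI[of _ \<alpha>'] conjI exI[of _ \<beta>']) auto
          qed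
          then have "Z \<subseteq> quot ?R x y" using CollectD[OF Z0] by (elim conjE) (rule subset_trans)
          then have "Z \<in> {Z \<in> ?E \<union> ?g ` ?S. Z \<subseteq> quot ?R x y}" using CollectD[OF Z0] by (elim conjE) (intro CollectI conjI)
          then show ?thesis using Z1 by (rule bexI[rotated])
        next
          case False
          obtain x2 where x2: "x1 = x @ x2" "\<alpha> = x2 @ X @ \<alpha>'"
            using append_cut_le[of x1 "X @ \<alpha>'" x \<alpha>] Cons.prems(1) False by auto
          obtain y2 where y2: "y1 = y @ y2" "\<beta> = y2 @ Y @ \<beta>'"
            using append_cut_le[of y1 "Y @ \<beta>'" y \<beta>] Cons.prems(2,3) False l1 by auto
          note xy2 = x2(1) y2(1) x2(2) y2(2)
          let ?Z = "?g (x2, y2)"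
          have "(x2, y2) \<in> (case (x1, y1) of (x, y) \<Rightarrow> set (suffixes x) \<times> set (suffixes y))"
            by (simp add: xy2(1,2) suffix_def)
          with Cons.hyps(1) have "(x2, y2) \<in> ?S" by (rule UN_I)
          then have "?Z \<in> ?g ` ?S" by (rule imageI)
          moreover have "(\<alpha>, \<beta>) \<in> ?Z" using xy2 Cons.hyps(2) XY(4) by auto
          moreover have "?Z \<subseteq> quot ?R x y"
          proof -
            have "(x @ x2 @ X @ \<alpha>, y @ y2 @ Y @ \<beta>) \<in> ?R" if "(X, Y) \<in> blocks Bl" "(\<alpha>, \<beta>) \<in> R" for X Y \<alpha> \<beta>
              using blocks_Cons[OF Cons.hyps(1) that(1)] that(2) unfolding xy2(1,2) mem_Collect_eq prod.inject
              by (intro exI[of _ "(x @ x2) @ X"] exI[of _ "(y @ y2) @ Y"] exI[of _ \<alpha>] exI[of _ \<beta>]) simp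
            then show ?thesis by (auto simp: quot_def)
          qed
          ultimately show ?thesis by (intro bexI[of _ ?Z] CollectI conjI UnI2)
        qed
      qed
      then show "(\<alpha>, \<beta>) \<in> \<Union>?X" by (rule bexE) (rule UnionI)
    qed
    moreover have "\<Union>?X \<subseteq> quot ?R x y" by (rule Union_least) simp
    ultimately have "quot ?R x y = \<Union>?X" by (rule subset_antisym)
    moreover have "?X \<subseteq> ?E \<union> ?g ` ?S" by (rule Collect_restrict)
    ultimately show ?thesis by (intro exI[of _ ?X] conjI)
  qed
  have "{quot ?R x y | x y. length x = length y} \<subseteq> Union ` Pow (?E \<union> ?g ` ?S)"
  proof
    fix Z assume "Z \<in> {quot ?R x y | x y. length x = length y}"
    then obtain x y where Z: "Z = quot ?R x y" and l: "length x = length y" by (elim CollectE exE conjE)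
    from unit[OF l] obtain \<X> where "\<X> \<subseteq> ?E \<union> ?g ` ?S" "Z = \<Union>\<X>" unfolding Z by (elim exE conjE)
    then show "Z \<in> Union ` Pow (?E \<union> ?g ` ?S)" by (intro image_eqI[of _ _ \<X>]) (simp_all only: Pow_iff)
  qed
  moreover have "finite (Union ` Pow (?E \<union> ?g ` ?S))"
  proof -
    have "finite ?E" using R unfolding tame_def by blast
    moreover have "finite ?S" using Bl(1) by (rule finite_UN_I) auto
    ultimately show ?thesis by (intro finite_imageI iffD2[OF finite_Pow_iff] finite_UnI)
  qed
  ultimately have fin: "finite {quot ?R x y | x y. length x = length y}" by (rule finite_subset)
  obtain N where "\<And>\<alpha> \<beta>. (\<alpha>, \<beta>) \<in> R \<Longrightarrow> length \<alpha> \<le> length \<beta> + N \<and> length \<beta> \<le> length \<alpha> + N"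
    using tame_bound[OF R] by blast
  then have "\<forall>(\<alpha>, \<beta>)\<in>?R. length \<alpha> \<le> length \<beta> + N \<and> length \<beta> \<le> length \<alpha> + N"
    using blk by fastforce
  moreover have "?R \<subseteq> lists B \<times> lists B" using tame_lists[OF R] blk by fastforce
  ultimately show ?thesis using R fin unfolding tame_def by blast
qed

section \<open>The congruence of a one-relator presentation\<close>

lemma rel_cong_refl [simp, intro]: "rel_cong u v x x"
  by (simp add: rel_cong_def)

lemma rel_cong_trans [trans]: "rel_cong u v x y \<Longrightarrow> rel_cong u v y z \<Longrightarrow> rel_cong u v x z"
  unfolding rel_cong_def by (rule rtranclp_trans)

lemma rel_step_sym: "rel_step u v x y \<Longrightarrow> rel_step u v y x"
  unfolding rel_step_def by blast

lemma rel_cong_sym: "rel_cong u v x y \<Longrightarrow> rel_cong u v y x"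
  unfolding rel_cong_def
  by (induction rule: rtranclp_induct) (auto intro: converse_rtranclp_into_rtranclp rel_step_sym)

lemma rel_cong_swap: "rel_cong u v = rel_cong v u"
proof -
  have "rel_step u v = rel_step v u" by (intro ext) (auto simp: rel_step_def)
  then show ?thesis by (simp add: rel_cong_def)
qed

lemma rel_step_append: "rel_step u v x y \<Longrightarrow> rel_step u v (p @ x @ q) (p @ y @ q)"
  unfolding rel_step_def by (metis append.assoc)

lemma rel_cong_append: "rel_cong u v x y \<Longrightarrow> rel_cong u v (p @ x @ q) (p @ y @ q)"
  unfolding rel_cong_def
  by (induction rule: rtranclp_induct) (auto intro: rtranclp.rtrancl_into_rtrancl rel_step_append)

lemma rel_cong_append_left: "rel_cong u v x y \<Longrightarrow> rel_cong u v (p @ x) (p @ y)"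
  using rel_cong_append[of u v x y p "[]"] by simp

lemma rel_cong_append_right: "rel_cong u v x y \<Longrightarrow> rel_cong u v (x @ q) (y @ q)"
  using rel_cong_append[of u v x y "[]" q] by simp

lemma rel_cong_append2: "rel_cong u v x y \<Longrightarrow> rel_cong u v x' y' \<Longrightarrow> rel_cong u v (x @ x') (y @ y')"
  using rel_cong_append_right rel_cong_append_left rel_cong_trans by blast

lemma rel_cong_rule: "rel_cong u v (p @ u @ q) (p @ v @ q)"
  unfolding rel_cong_def rel_step_def by blast

lemma rel_cong_rule': "rel_cong u v (p @ v @ q) (p @ u @ q)"
  by (rule rel_cong_sym[OF rel_cong_rule])

lemma rel_cong_base: "rel_cong u v u v"
  using rel_cong_rule[of u v "[]" "[]"] by simp

text \<open>The target type of \<open>F\<close> is left open because numbers, truth values and words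
  all serve as invariants.\<close>

lemma rel_cong_invariant:
  assumes "rel_cong u v x y" "\<And>p q. F (p @ u @ q) = F (p @ v @ q)"
  shows "F x = F y"
  using assms(1) unfolding rel_cong_def
  by (induction rule: rtranclp_induct) (auto simp: rel_step_def assms(2))

lemma rel_cong_lists:
  assumes "rel_cong u v x y" "u \<in> lists A" "v \<in> lists A"
  shows "x \<in> lists A \<longleftrightarrow> y \<in> lists A"
  using assms(2,3) by (intro rel_cong_invariant[OF assms(1), of "\<lambda>x. x \<in> lists A"]) auto

lemma rel_cong_rev: "rel_cong u v x y \<Longrightarrow> rel_cong (rev u) (rev v) (rev x) (rev y)"
proof -
  have step: "rel_step u v x y \<Longrightarrow> rel_step (rev u) (rev v) (rev x) (rev y)" for x y
    unfolding rel_step_def by (metis append.assoc rev_append)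
  show "rel_cong u v x y \<Longrightarrow> rel_cong (rev u) (rev v) (rev x) (rev y)"
    unfolding rel_cong_def
    by (induction rule: rtranclp_induct) (auto intro: rtranclp.rtrancl_into_rtrancl step)
qed

lemma rel_cong_rev_iff: "rel_cong (rev u) (rev v) (rev x) (rev y) \<longleftrightarrow> rel_cong u v x y"
  using rel_cong_rev[of u v x y] rel_cong_rev[of "rev u" "rev v" "rev x" "rev y"] by auto

lemma pres_class_eq_iff:
  assumes "x \<in> lists A" "y \<in> lists A"
  shows "pres_class A u v x = pres_class A u v y \<longleftrightarrow> rel_cong u v x y"
proof
  assume "pres_class A u v x = pres_class A u v y"
  moreover have "y \<in> pres_class A u v y" using assms by (simp add: pres_class_def)
  ultimately show "rel_cong u v x y" by (auto simp: pres_class_def)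
next
  assume "rel_cong u v x y"
  then show "pres_class A u v x = pres_class A u v y"
    unfolding pres_class_def by (blast intro: rel_cong_trans rel_cong_sym)
qed

lemma pres_mult_class:
  assumes "x \<in> lists A" "y \<in> lists A"
  shows "pres_mult A u v (pres_class A u v x) (pres_class A u v y) = pres_class A u v (x @ y)"
proof (intro set_eqI iffI)
  fix w assume "w \<in> pres_mult A u v (pres_class A u v x) (pres_class A u v y)"
  then obtain x' y' where "w \<in> lists A" "rel_cong u v x x'" "rel_cong u v y y'" "rel_cong u v (x' @ y') w"
    by (auto simp: pres_mult_def pres_class_def)
  then show "w \<in> pres_class A u v (x @ y)"
    using rel_cong_trans[OF rel_cong_append2[of u v x x' y y']] by (simp add: pres_class_def)
next
  fix w assume "w \<in> pres_class A u v (x @ y)"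
  moreover have "x \<in> pres_class A u v x" "y \<in> pres_class A u v y"
    using assms by (auto simp: pres_class_def)
  ultimately show "w \<in> pres_mult A u v (pres_class A u v x) (pres_class A u v y)"
    unfolding pres_mult_def pres_class_def by blast
qed

section \<open>Values of words over arbitrary generators\<close>

definition vals :: "('b \<Rightarrow> 'a list) \<Rightarrow> 'b list \<Rightarrow> 'a list" where
  "vals val \<alpha> = concat (map val \<alpha>)"

lemma vals_simps [simp]:
  "vals val [] = []" "vals val (b # \<alpha>) = val b @ vals val \<alpha>"
  "vals val (\<alpha> @ \<beta>) = vals val \<alpha> @ vals val \<beta>"
  by (simp_all add: vals_def)

lemma vals_lists: "val ` B \<subseteq> lists A \<Longrightarrow> \<alpha> \<in> lists B \<Longrightarrow> vals val \<alpha> \<in> lists A"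
  by (induction \<alpha>) (auto simp del: in_lists_conv_set)

lemma vals_rev: "vals (\<lambda>b. rev (val b)) (rev \<alpha>) = rev (vals val \<alpha>)"
  by (induction \<alpha>) auto

lemma evalw_pres_class:
  assumes "\<And>b. b \<in> B \<Longrightarrow> val b \<in> lists A" "\<alpha> \<in> lists B" "\<alpha> \<noteq> []"
  shows "evalw (\<lambda>b. pres_class A u v (val b)) (pres_mult A u v) \<alpha> = pres_class A u v (vals val \<alpha>)"
  using assms(2,3)
proof (induction \<alpha> rule: induct_list012)
  case (3 b c \<alpha>)
  then have "val b \<in> lists A" "vals val (c # \<alpha>) \<in> lists A"
    using assms(1) vals_lists[of val B A "c # \<alpha>"] by auto
  with 3 show ?case by (simp add: pres_mult_class del: in_lists_conv_set)
qed simp_all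

section \<open>Renaming of generators\<close>

lemma padR_map: "padR (map j \<alpha>) (map j \<beta>) = map (map_prod (map_option j) (map_option j)) (padR \<alpha> \<beta>)"
proof (induction \<alpha> \<beta> rule: list_induct2')
  case (2 x xs)
  have "padR (map j xs) [] = map (map_prod (map_option j) (map_option j)) (padR xs [])" for xs
    by (induction xs) auto
  then show ?case by simp
next
  case (3 y ys)
  have "padR [] (map j ys) = map (map_prod (map_option j) (map_option j)) (padR [] ys)" for ys
    by (induction ys) auto
  then show ?case by simp
qed auto

lemma padL_map: "padL (map j \<alpha>) (map j \<beta>) = map (map_prod (map_option j) (map_option j)) (padL \<alpha> \<beta>)"
  by (simp add: padL_eq_rev padR_map rev_map)

lemma regular_pad_map:
  assumes "regular (pad_alph B) P" "finite C" "j ` B \<subseteq> C"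
  shows "regular (pad_alph C) (map (map_prod (map_option j) (map_option j)) ` P)"
  by (rule regular_map[OF assms(1) finite_pad_alph[OF assms(2)]])
    (use assms(3) in \<open>auto simp: pad_alph_def\<close>)

lemma evalw_map:
  "(\<And>b. b \<in> set \<alpha> \<Longrightarrow> gen' (j b) = gen b) \<Longrightarrow> evalw gen' mult (map j \<alpha>) = evalw gen mult \<alpha>"
  by (induction \<alpha> rule: induct_list012) auto

text \<open>The structures constructed for the positive results use the letters of the presentation
  or options over them, whereas \<open>automatic\<close> and its variants ask for natural numbers as
  generating symbols. An injection on the finite set \<open>B\<close> transports every relation
  letter by letter.\<close>

locale renaming =
  fixes B :: "'b set" and j :: "'b \<Rightarrow> nat" and gen :: "'b \<Rightarrow> 's" and mult :: "'s \<Rightarrow> 's \<Rightarrow> 's"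
    and L :: "'b list set" and S :: "'s set"
  assumes base: "structure_base S mult B gen L" and inj: "inj_on j B"
begin

definition gen' where "gen' n = gen (inv_into B j n)"

lemma gen'_j [simp]: "b \<in> B \<Longrightarrow> gen' (j b) = gen b"
  using inj by (simp add: gen'_def)

lemma L_lists: "\<alpha> \<in> L \<Longrightarrow> \<alpha> \<in> lists B"
  using base by (auto simp: structure_base_def)

lemma evalw_j: "\<alpha> \<in> lists B \<Longrightarrow> evalw gen' mult (map j \<alpha>) = evalw gen mult \<alpha>"
  by (rule evalw_map) auto

lemma optw_j: "map j (optw a) = optw (map_option j a)"
  by (cases a) (auto simp: optw_def)

lemma base': "structure_base S mult (j ` B) gen' (map j ` L)"
proof -
  have "evalw gen' mult ` map j ` L = evalw gen mult ` L"
    unfolding image_image by (rule image_cong) (use L_lists evalw_j in auto)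
  moreover have "map j ` L \<subseteq> lists (j ` B) - {[]}"
    using base L_lists by (force simp: structure_base_def)
  ultimately show ?thesis using base by (auto simp: structure_base_def)
qed

lemma relation_j:
  assumes a: "a \<in> insert None (Some ` B)"
  shows "L_right mult gen' (map j ` L) (map_option j a) =
      map (map_prod (map_option j) (map_option j)) ` L_right mult gen L a"
    "L_right_pL mult gen' (map j ` L) (map_option j a) =
      map (map_prod (map_option j) (map_option j)) ` L_right_pL mult gen L a"
    "L_left mult gen' (map j ` L) (map_option j a) =
      map (map_prod (map_option j) (map_option j)) ` L_left mult gen L a"
    "L_left_pL mult gen' (map j ` L) (map_option j a) =
      map (map_prod (map_option j) (map_option j)) ` L_left_pL mult gen L a"
proof -
  have a': "optw a \<in> lists B" using a by (auto simp: optw_def)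
  have l: "evalw gen' mult (optw (map_option j a) @ map j \<alpha>) = evalw gen mult (optw a @ \<alpha>)" if "\<alpha> \<in> L" for \<alpha>
    using evalw_j[of "optw a @ \<alpha>"] a' L_lists[OF that] by (simp add: optw_j)
  have r: "evalw gen' mult (map j \<alpha> @ optw (map_option j a)) = evalw gen mult (\<alpha> @ optw a)" if "\<alpha> \<in> L" for \<alpha>
    using evalw_j[of "\<alpha> @ optw a"] a' L_lists[OF that] by (simp add: optw_j)
  have e: "evalw gen' mult (map j \<alpha>) = evalw gen mult \<alpha>" if "\<alpha> \<in> L" for \<alpha>
    using evalw_j L_lists that by blast
  have gen: "{pad (map j \<alpha>) (map j \<beta>) | \<alpha> \<beta>. \<alpha> \<in> L \<and> \<beta> \<in> L \<and> P \<alpha> \<beta>} =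
      map (map_prod (map_option j) (map_option j)) ` {pad' \<alpha> \<beta> | \<alpha> \<beta>. \<alpha> \<in> L \<and> \<beta> \<in> L \<and> P \<alpha> \<beta>}"
    if "\<And>\<alpha> \<beta>. pad (map j \<alpha>) (map j \<beta>) = map (map_prod (map_option j) (map_option j)) (pad' \<alpha> \<beta>)"
    for pad :: "nat list \<Rightarrow> nat list \<Rightarrow> _" and pad' P
    using that by (auto simp: image_iff)
  have push: "{pad \<alpha> \<beta> | \<alpha> \<beta>. \<alpha> \<in> map j ` L \<and> \<beta> \<in> map j ` L \<and> Q \<alpha> \<beta>} =
      {pad (map j \<alpha>) (map j \<beta>) | \<alpha> \<beta>. \<alpha> \<in> L \<and> \<beta> \<in> L \<and> P \<alpha> \<beta>}"
    if "\<And>\<alpha> \<beta>. \<alpha> \<in> L \<Longrightarrow> \<beta> \<in> L \<Longrightarrow> Q (map j \<alpha>) (map j \<beta>) \<longleftrightarrow> P \<alpha> \<beta>"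
    for pad :: "nat list \<Rightarrow> nat list \<Rightarrow> ('c \<times> 'd) list" and Q P
    using that by blast
  show "L_right mult gen' (map j ` L) (map_option j a) =
      map (map_prod (map_option j) (map_option j)) ` L_right mult gen L a"
    unfolding L_right_def gen[where pad=padR and pad'=padR, OF padR_map, symmetric] by (rule push) (simp add: r e)
  show "L_right_pL mult gen' (map j ` L) (map_option j a) =
      map (map_prod (map_option j) (map_option j)) ` L_right_pL mult gen L a"
    unfolding L_right_pL_def gen[where pad=padL and pad'=padL, OF padL_map, symmetric] by (rule push) (simp add: r e)
  show "L_left mult gen' (map j ` L) (map_option j a) =
      map (map_prod (map_option j) (map_option j)) ` L_left mult gen L a"
    unfolding L_left_def gen[where pad=padR and pad'=padR, OF padR_map, symmetric] by (rule push) (simp add: l e)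
  show "L_left_pL mult gen' (map j ` L) (map_option j a) =
      map (map_prod (map_option j) (map_option j)) ` L_left_pL mult gen L a"
    unfolding L_left_pL_def gen[where pad=padL and pad'=padL, OF padL_map, symmetric] by (rule push) (simp add: l e)
qed

lemma pref_j:
  "{padR \<alpha> \<beta> | \<alpha> \<beta>. \<alpha> \<in> map j ` L \<and> \<beta> \<in> Pref (map j ` L) \<and> \<beta> \<noteq> [] \<and> evalw gen' mult \<alpha> = evalw gen' mult \<beta>} =
   map (map_prod (map_option j) (map_option j)) `
     {padR \<alpha> \<beta> | \<alpha> \<beta>. \<alpha> \<in> L \<and> \<beta> \<in> Pref L \<and> \<beta> \<noteq> [] \<and> evalw gen mult \<alpha> = evalw gen mult \<beta>}"
proof -
  have P: "Pref (map j ` L) = map j ` Pref L"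
  proof (intro set_eqI iffI)
    fix \<beta> assume "\<beta> \<in> Pref (map j ` L)"
    then obtain \<gamma> z where "z \<in> L" "\<beta> @ \<gamma> = map j z" by (auto simp: Pref_def)
    then obtain \<beta>' \<gamma>' where "\<beta> = map j \<beta>'" "z = \<beta>' @ \<gamma>'" by (auto simp: append_eq_map_conv)
    then show "\<beta> \<in> map j ` Pref L" using \<open>z \<in> L\<close> unfolding Pref_def by blast
  next
    fix \<beta> assume "\<beta> \<in> map j ` Pref L"
    then obtain \<beta>' \<gamma> where "\<beta> = map j \<beta>'" "\<beta>' @ \<gamma> \<in> L" by (auto simp: Pref_def)
    then have "\<beta> @ map j \<gamma> = map j (\<beta>' @ \<gamma>)" "\<beta>' @ \<gamma> \<in> L" by simp_all
    then show "\<beta> \<in> Pref (map j ` L)" unfolding Pref_def by blast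
  qed
  have "\<beta> \<in> lists B" if "\<beta> \<in> Pref L" for \<beta>
    using that L_lists by (force simp: Pref_def)
  then have e: "evalw gen' mult (map j \<beta>) = evalw gen mult \<beta>" if "\<beta> \<in> Pref L" for \<beta>
    using evalw_j that by blast
  have e': "evalw gen' mult (map j \<beta>) = evalw gen mult \<beta>" if "\<beta> \<in> L" for \<beta>
    using evalw_j L_lists that by blast
  show ?thesis (is "?X = ?F ` ?Y")
  proof (intro set_eqI iffI)
    fix w assume "w \<in> ?X"
    then obtain \<alpha> \<beta> where *: "w = padR (map j \<alpha>) (map j \<beta>)" "\<alpha> \<in> L" "\<beta> \<in> Pref L" "map j \<beta> \<noteq> []"
      "evalw gen' mult (map j \<alpha>) = evalw gen' mult (map j \<beta>)"
      unfolding P by blast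
    then have "\<beta> \<noteq> []" "evalw gen mult \<alpha> = evalw gen mult \<beta>" using e e' by simp_all
    with * show "w \<in> ?F ` ?Y" unfolding padR_map by blast
  next
    fix w assume "w \<in> ?F ` ?Y"
    then obtain \<alpha> \<beta> where *: "w = padR (map j \<alpha>) (map j \<beta>)" "\<alpha> \<in> L" "\<beta> \<in> Pref L" "\<beta> \<noteq> []"
      "evalw gen mult \<alpha> = evalw gen mult \<beta>"
      unfolding padR_map by auto
    then show "w \<in> ?X" unfolding P mem_Collect_eq
      by (intro exI[of _ "map j \<alpha>"] exI[of _ "map j \<beta>"]) (simp add: e e')
  qed
qed

end

lemma renaming_exists:
  assumes "structure_base S mult B gen L"
  obtains j where "renaming B j gen mult L S"
proof -
  obtain j :: "_ \<Rightarrow> nat" where "inj_on j B"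
    using assms finite_imp_inj_to_nat_seg[of B] by (auto simp: structure_base_def)
  then show thesis using that assms by (auto simp: renaming_def)
qed

lemma prefix_automatic_structure_imp:
  assumes "prefix_automatic_structure S mult B gen L"
  shows "prefix_automatic S mult"
proof -
  have base: "structure_base S mult B gen L"
    using assms by (simp add: prefix_automatic_structure_def automatic_structure_def)
  then obtain j where "renaming B j gen mult L S" by (rule renaming_exists)
  then interpret renaming B j gen mult L S .
  have fin: "finite (j ` B)" using base by (simp add: structure_base_def)
  have "prefix_automatic_structure S mult (j ` B) gen' (map j ` L)"
    unfolding prefix_automatic_structure_def automatic_structure_def pref_j
  proof (intro conjI ballI base')
    fix a' assume "a' \<in> insert None (Some ` j ` B)"
    moreover have "insert None (Some ` j ` B) = map_option j ` insert None (Some ` B)"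
      by (simp add: image_image)
    ultimately have "a' \<in> map_option j ` insert None (Some ` B)" by simp
    then obtain a where "a' = map_option j a" "a \<in> insert None (Some ` B)" by (rule imageE)
    then show "regular (pad_alph (j ` B)) (L_right mult gen' (map j ` L) a')"
      using assms regular_pad_map[OF _ fin order_refl]
      by (simp only: relation_j prefix_automatic_structure_def automatic_structure_def)
  next
    show "regular (pad_alph (j ` B)) (map (map_prod (map_option j) (map_option j)) `
     {padR \<alpha> \<beta> | \<alpha> \<beta>. \<alpha> \<in> L \<and> \<beta> \<in> Pref L \<and> \<beta> \<noteq> [] \<and> evalw gen mult \<alpha> = evalw gen mult \<beta>})"
      using assms regular_pad_map[OF _ fin order_refl] by (simp only: prefix_automatic_structure_def)
  qed
  then show ?thesis unfolding prefix_automatic_def by blast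
qed

lemma biautomatic_structure_imp:
  assumes "biautomatic_structure S mult B gen L"
  shows "biautomatic S mult"
proof -
  have base: "structure_base S mult B gen L"
    using assms by (simp add: biautomatic_structure_def)
  then obtain j where "renaming B j gen mult L S" by (rule renaming_exists)
  then interpret renaming B j gen mult L S .
  have fin: "finite (j ` B)" using base by (simp add: structure_base_def)
  have "biautomatic_structure S mult (j ` B) gen' (map j ` L)"
    unfolding biautomatic_structure_def
  proof (intro conjI[OF base'] ballI)
    fix a' assume "a' \<in> insert None (Some ` j ` B)"
    moreover have "insert None (Some ` j ` B) = map_option j ` insert None (Some ` B)"
      by (simp add: image_image)
    ultimately have "a' \<in> map_option j ` insert None (Some ` B)" by simp
    then obtain a where "a' = map_option j a" "a \<in> insert None (Some ` B)" by (rule imageE)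
    then show "regular (pad_alph (j ` B)) (L_right mult gen' (map j ` L) a') \<and>
      regular (pad_alph (j ` B)) (L_right_pL mult gen' (map j ` L) a') \<and>
      regular (pad_alph (j ` B)) (L_left mult gen' (map j ` L) a') \<and>
      regular (pad_alph (j ` B)) (L_left_pL mult gen' (map j ` L) a')"
      using assms regular_pad_map[OF _ fin order_refl]
      by (simp only: relation_j biautomatic_structure_def)
  qed
  then show ?thesis unfolding biautomatic_def by blast
qed

section \<open>Head structures\<close>

text \<open>A head structure is a regular cross-section \<open>K\<close> of the monoid over generators \<open>B\<close>, closed under
  suffixes, on which multiplication by a generator at the head of a word is a regular relation.
  It handles left multiplication; right multiplication is left multiplication in the mirror
  image of the presentation. \<open>val\<close> assigns to each generator the word it stands for.\<close>

definition cross_section :: "'a list \<Rightarrow> 'a list \<Rightarrow> ('b \<Rightarrow> 'a list) \<Rightarrow> 'b list set \<Rightarrow> bool" where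
  "cross_section u v val K \<longleftrightarrow> (\<forall>\<alpha>\<in>K. \<forall>\<beta>\<in>K. rel_cong u v (vals val \<alpha>) (vals val \<beta>) \<longrightarrow> \<alpha> = \<beta>)"

definition head_rel :: "'a list \<Rightarrow> 'a list \<Rightarrow> ('b \<Rightarrow> 'a list) \<Rightarrow> 'b list set \<Rightarrow> 'b \<Rightarrow> ('b list \<times> 'b list) set" where
  "head_rel u v val K b = {(\<alpha>, \<beta>). \<alpha> \<in> K \<and> \<beta> \<in> K \<and> rel_cong u v (val b @ vals val \<alpha>) (vals val \<beta>)}"

definition head_base :: "'a set \<Rightarrow> 'a list \<Rightarrow> 'a list \<Rightarrow> 'b set \<Rightarrow> ('b \<Rightarrow> 'a list) \<Rightarrow> 'b list set \<Rightarrow> bool" where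
  "head_base A u v B val K \<longleftrightarrow> u \<in> lists A \<and> v \<in> lists A \<and> finite B \<and> (\<forall>b\<in>B. val b \<in> lists A) \<and>
     (\<forall>a\<in>A. \<exists>b\<in>B. val b = [a]) \<and> regular B K \<and> [] \<in> K \<and> (\<forall>b \<alpha>. b # \<alpha> \<in> K \<longrightarrow> \<alpha> \<in> K) \<and>
     cross_section u v val K \<and>
     (\<forall>b\<in>B. \<forall>\<alpha>\<in>K. \<exists>\<beta>\<in>K. rel_cong u v (val b @ vals val \<alpha>) (vals val \<beta>))"

definition head_regular :: "'a set \<Rightarrow> 'a list \<Rightarrow> 'a list \<Rightarrow> 'b set \<Rightarrow> ('b \<Rightarrow> 'a list) \<Rightarrow> 'b list set \<Rightarrow> bool" where
  "head_regular A u v B val K \<longleftrightarrow> head_base A u v B val K \<and>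
     (\<forall>b\<in>B. regular (pad_alph B) {padL \<alpha> \<beta> | \<alpha> \<beta>. (\<alpha>, \<beta>) \<in> head_rel u v val K b})"

definition head_tame :: "'a set \<Rightarrow> 'a list \<Rightarrow> 'a list \<Rightarrow> 'b set \<Rightarrow> ('b \<Rightarrow> 'a list) \<Rightarrow> 'b list set \<Rightarrow> bool" where
  "head_tame A u v B val K \<longleftrightarrow> head_base A u v B val K \<and> (\<forall>b\<in>B. tame B (head_rel u v val K b))"

lemma head_tame_regular: "head_tame A u v B val K \<Longrightarrow> head_regular A u v B val K"
  unfolding head_tame_def head_regular_def using tame_regular_padL by blast

text \<open>A word is built up from its last letter; each letter is the value of a generator, and
  multiplication by a generator at the head does not leave \<open>K\<close>.\<close>

lemma head_base_covers:
  assumes "head_base A u v B val K" "w \<in> lists A"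
  shows "\<exists>\<alpha>\<in>K. rel_cong u v w (vals val \<alpha>)"
  using assms(2)
proof (induction w)
  case Nil
  then show ?case using assms(1) by (intro bexI[of _ "[]"]) (auto simp: head_base_def)
next
  case (Cons a w)
  then obtain \<alpha> where \<alpha>: "\<alpha> \<in> K" "rel_cong u v w (vals val \<alpha>)" by auto
  obtain b where b: "b \<in> B" "val b = [a]" using Cons assms(1) unfolding head_base_def by auto
  then obtain \<beta> where \<beta>: "\<beta> \<in> K" "rel_cong u v (val b @ vals val \<alpha>) (vals val \<beta>)"
    using \<alpha> assms(1) unfolding head_base_def by blast
  have "rel_cong u v (a # w) (val b @ vals val \<alpha>)"
    using rel_cong_append_left[OF \<alpha>(2), of "[a]"] b by simp
  then show ?case using \<beta> rel_cong_trans by blast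
qed

text \<open>The identity of the monoid needs a nonempty representative: a letter for the identity
  (\<open>None\<close>) is put in front of every word.\<close>

locale marked_words =
  fixes A :: "'a set" and u v :: "'a list" and B :: "'b set" and val :: "'b \<Rightarrow> 'a list" and K :: "'b list set"
  assumes uv: "u \<in> lists A" "v \<in> lists A" and val: "\<And>b. b \<in> B \<Longrightarrow> val b \<in> lists A" and K: "regular B K"
    and covers: "\<And>w. w \<in> lists A \<Longrightarrow> \<exists>\<alpha>\<in>K. rel_cong u v w (vals val \<alpha>)"
    and cross: "cross_section u v val K"
begin

abbreviation "B' \<equiv> insert None (Some ` B)"

definition gen :: "'b option \<Rightarrow> 'a list set" where
  "gen b = pres_class A u v (case b of None \<Rightarrow> [] | Some b \<Rightarrow> val b)"

abbreviation mark :: "'b list \<Rightarrow> 'b option list" where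
  "mark \<alpha> \<equiv> None # map Some \<alpha>"

definition L :: "'b option list set" where "L = mark ` K"

abbreviation "mult \<equiv> pres_mult A u v"

abbreviation "rel_right b \<equiv> {(\<alpha>, \<beta>). \<alpha> \<in> K \<and> \<beta> \<in> K \<and> rel_cong u v (vals val \<alpha> @ val b) (vals val \<beta>)}"

lemma finB: "finite B" using K by (rule regularD)

lemma K_lists: "\<alpha> \<in> K \<Longrightarrow> \<alpha> \<in> lists B" using K regularD(2) by blast

lemma evalw_gen:
  assumes "\<alpha> \<in> lists B'" "\<alpha> \<noteq> []"
  shows "evalw gen mult \<alpha> = pres_class A u v (vals (case_option [] val) \<alpha>)"
  unfolding gen_def
  by (rule evalw_pres_class[where B="B'"]) (use assms val in \<open>auto split: option.splits\<close>)

lemma vals_map_Some: "vals (case_option [] val) (map Some \<alpha>) = vals val \<alpha>"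
  by (induction \<alpha>) auto

lemma vals_in: "\<alpha> \<in> lists B \<Longrightarrow> vals val \<alpha> \<in> lists A"
  using vals_lists[of val B A] val by blast

lemma mark_lists: "\<alpha> \<in> lists B \<Longrightarrow> mark \<alpha> \<in> lists B'" by auto

lemma evalw_mark: "\<alpha> \<in> lists B \<Longrightarrow> evalw gen mult (mark \<alpha>) = pres_class A u v (vals val \<alpha>)"
  by (subst evalw_gen) (use mark_lists in \<open>auto simp: vals_map_Some\<close>)

lemma evalw_mark_right:
  assumes "\<alpha> \<in> lists B" "a \<in> insert None (Some ` B')"
  shows "evalw gen mult (mark \<alpha> @ optw a) =
    pres_class A u v (vals val \<alpha> @ (case a of Some (Some b) \<Rightarrow> val b | _ \<Rightarrow> []))"
  by (subst evalw_gen) (use assms in \<open>auto simp: vals_map_Some optw_def\<close>)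

lemma evalw_mark_left:
  assumes "\<alpha> \<in> lists B" "a \<in> insert None (Some ` B')"
  shows "evalw gen mult (optw a @ mark \<alpha>) =
    pres_class A u v ((case a of Some (Some b) \<Rightarrow> val b | _ \<Rightarrow> []) @ vals val \<alpha>)"
  by (subst evalw_gen) (use assms in \<open>auto simp: vals_map_Some optw_def\<close>)

lemma same_iff: "\<alpha> \<in> K \<Longrightarrow> \<beta> \<in> K \<Longrightarrow> rel_cong u v (vals val \<alpha>) (vals val \<beta>) \<longleftrightarrow> \<alpha> = \<beta>"
  using cross by (auto simp: cross_section_def)

lemma base: "structure_base (pres_carrier A u v) mult B' gen L"
  unfolding structure_base_def
proof (intro conjI)
  show "finite B'" using finB by simp
  show "gen ` B' \<subseteq> pres_carrier A u v"
    using val by (auto simp: gen_def pres_carrier_def simp del: in_lists_conv_set)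
  show "L \<subseteq> lists B' - {[]}" using K_lists by (fastforce simp: L_def)
  show "evalw gen mult ` L = pres_carrier A u v"
  proof (intro set_eqI iffI)
    fix X assume "X \<in> evalw gen mult ` L"
    then obtain \<alpha> where "\<alpha> \<in> K" "X = pres_class A u v (vals val \<alpha>)"
      unfolding L_def using evalw_mark K_lists by auto
    then show "X \<in> pres_carrier A u v" unfolding pres_carrier_def using vals_in K_lists by blast
  next
    fix X assume "X \<in> pres_carrier A u v"
    then obtain w where w: "w \<in> lists A" "X = pres_class A u v w" by (auto simp: pres_carrier_def)
    then obtain \<alpha> where \<alpha>: "\<alpha> \<in> K" "rel_cong u v w (vals val \<alpha>)" using covers by blast
    then have "X = evalw gen mult (mark \<alpha>)"
      using w evalw_mark K_lists pres_class_eq_iff[of w A "vals val \<alpha>"] vals_in by auto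
    then show "X \<in> evalw gen mult ` L" using \<alpha> by (auto simp: L_def)
  qed
qed

lemma right_iff:
  assumes "\<alpha> \<in> K" "\<beta> \<in> K" "a \<in> insert None (Some ` B')"
  shows "evalw gen mult (mark \<alpha> @ optw a) = evalw gen mult (mark \<beta>) \<longleftrightarrow>
    (case a of Some (Some b) \<Rightarrow> (\<alpha>, \<beta>) \<in> rel_right b | _ \<Rightarrow> \<alpha> = \<beta>)"
proof -
  have "vals val \<alpha> @ (case a of Some (Some b) \<Rightarrow> val b | _ \<Rightarrow> []) \<in> lists A" "vals val \<beta> \<in> lists A"
    using assms val vals_in K_lists by (auto split: option.splits simp del: in_lists_conv_set)
  then show ?thesis
    unfolding evalw_mark_right[OF K_lists[OF assms(1)] assms(3)] evalw_mark[OF K_lists[OF assms(2)]]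
    using assms same_iff[OF assms(1,2)]
    by (simp add: pres_class_eq_iff split: option.splits del: in_lists_conv_set)
qed

lemma left_iff:
  assumes "\<alpha> \<in> K" "\<beta> \<in> K" "a \<in> insert None (Some ` B')"
  shows "evalw gen mult (optw a @ mark \<alpha>) = evalw gen mult (mark \<beta>) \<longleftrightarrow>
    (case a of Some (Some b) \<Rightarrow> (\<alpha>, \<beta>) \<in> head_rel u v val K b | _ \<Rightarrow> \<alpha> = \<beta>)"
proof -
  have "(case a of Some (Some b) \<Rightarrow> val b | _ \<Rightarrow> []) @ vals val \<alpha> \<in> lists A" "vals val \<beta> \<in> lists A"
    using assms val vals_in K_lists by (auto split: option.splits simp del: in_lists_conv_set)
  then show ?thesis
    unfolding evalw_mark_left[OF K_lists[OF assms(1)] assms(3)] evalw_mark[OF K_lists[OF assms(2)]]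
    using assms same_iff[OF assms(1,2)]
    by (simp add: pres_class_eq_iff head_rel_def split: option.splits del: in_lists_conv_set)
qed

lemma collect_mark:
  assumes "\<And>\<alpha> \<beta>. \<alpha> \<in> K \<Longrightarrow> \<beta> \<in> K \<Longrightarrow> P (mark \<alpha>) (mark \<beta>) \<longleftrightarrow> (\<alpha>, \<beta>) \<in> R" "R \<subseteq> K \<times> K"
  shows "{pad \<alpha> \<beta> | \<alpha> \<beta>. \<alpha> \<in> L \<and> \<beta> \<in> L \<and> P \<alpha> \<beta>} = {pad (mark \<alpha>) (mark \<beta>) | \<alpha> \<beta>. (\<alpha>, \<beta>) \<in> R}"
  unfolding L_def using assms by blast

text \<open>Both \<open>None\<close>, the absent multiplier, and \<open>Some None\<close>, the
  letter for the identity, leave the element unchanged, and on a cross-section equality of elements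
  is the diagonal. Only \<open>Some (Some b)\<close> is a proper multiplication.\<close>

definition step_right :: "'b option option \<Rightarrow> ('b list \<times> 'b list) set" where
  "step_right a = (case a of Some (Some b) \<Rightarrow> rel_right b | _ \<Rightarrow> {(\<alpha>, \<alpha>) | \<alpha>. \<alpha> \<in> K})"

definition step_left :: "'b option option \<Rightarrow> ('b list \<times> 'b list) set" where
  "step_left a = (case a of Some (Some b) \<Rightarrow> head_rel u v val K b | _ \<Rightarrow> {(\<alpha>, \<alpha>) | \<alpha>. \<alpha> \<in> K})"

lemma L_step:
  assumes "a \<in> insert None (Some ` B')"
  shows "L_right mult gen L a = {padR (mark \<alpha>) (mark \<beta>) | \<alpha> \<beta>. (\<alpha>, \<beta>) \<in> step_right a}"
    "L_right_pL mult gen L a = {padL (mark \<alpha>) (mark \<beta>) | \<alpha> \<beta>. (\<alpha>, \<beta>) \<in> step_right a}"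
    "L_left mult gen L a = {padR (mark \<alpha>) (mark \<beta>) | \<alpha> \<beta>. (\<alpha>, \<beta>) \<in> step_left a}"
    "L_left_pL mult gen L a = {padL (mark \<alpha>) (mark \<beta>) | \<alpha> \<beta>. (\<alpha>, \<beta>) \<in> step_left a}"
proof -
  have r: "evalw gen mult (mark \<alpha> @ optw a) = evalw gen mult (mark \<beta>) \<longleftrightarrow> (\<alpha>, \<beta>) \<in> step_right a"
    if "\<alpha> \<in> K" "\<beta> \<in> K" for \<alpha> \<beta>
    unfolding right_iff[OF that assms] step_right_def using that by (auto split: option.splits)
  have l: "evalw gen mult (optw a @ mark \<alpha>) = evalw gen mult (mark \<beta>) \<longleftrightarrow> (\<alpha>, \<beta>) \<in> step_left a"
    if "\<alpha> \<in> K" "\<beta> \<in> K" for \<alpha> \<beta>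
    unfolding left_iff[OF that assms] step_left_def using that by (auto split: option.splits)
  have sub: "step_right a \<subseteq> K \<times> K" "step_left a \<subseteq> K \<times> K"
    by (auto simp: step_right_def step_left_def head_rel_def split: option.splits)
  show "L_right mult gen L a = {padR (mark \<alpha>) (mark \<beta>) | \<alpha> \<beta>. (\<alpha>, \<beta>) \<in> step_right a}"
    unfolding L_right_def
    by (rule collect_mark[where pad=padR and P="\<lambda>\<alpha> \<beta>. evalw gen mult (\<alpha> @ optw a) = evalw gen mult \<beta>", OF r sub(1)])
  show "L_right_pL mult gen L a = {padL (mark \<alpha>) (mark \<beta>) | \<alpha> \<beta>. (\<alpha>, \<beta>) \<in> step_right a}"
    unfolding L_right_pL_def
    by (rule collect_mark[where pad=padL and P="\<lambda>\<alpha> \<beta>. evalw gen mult (\<alpha> @ optw a) = evalw gen mult \<beta>", OF r sub(1)])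
  show "L_left mult gen L a = {padR (mark \<alpha>) (mark \<beta>) | \<alpha> \<beta>. (\<alpha>, \<beta>) \<in> step_left a}"
    unfolding L_left_def
    by (rule collect_mark[where pad=padR and P="\<lambda>\<alpha> \<beta>. evalw gen mult (optw a @ \<alpha>) = evalw gen mult \<beta>", OF l sub(2)])
  show "L_left_pL mult gen L a = {padL (mark \<alpha>) (mark \<beta>) | \<alpha> \<beta>. (\<alpha>, \<beta>) \<in> step_left a}"
    unfolding L_left_pL_def
    by (rule collect_mark[where pad=padL and P="\<lambda>\<alpha> \<beta>. evalw gen mult (optw a @ \<alpha>) = evalw gen mult \<beta>", OF l sub(2)])
qed

lemma regular_mark_padR:
  assumes "regular (pad_alph B) {padR \<alpha> \<beta> | \<alpha> \<beta>. (\<alpha>, \<beta>) \<in> R}"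
  shows "regular (pad_alph B') {padR (mark \<alpha>) (mark \<beta>) | \<alpha> \<beta>. (\<alpha>, \<beta>) \<in> R}"
proof -
  have "{padR (mark \<alpha>) (mark \<beta>) | \<alpha> \<beta>. (\<alpha>, \<beta>) \<in> R} =
    conc {[(Some None, Some None)]} (map (map_prod (map_option Some) (map_option Some)) ` {padR \<alpha> \<beta> | \<alpha> \<beta>. (\<alpha>, \<beta>) \<in> R})"
    unfolding conc_def by (auto simp: padR_map)
  moreover have "regular (pad_alph B') {[(Some None, Some None)]}"
    using finite_pad_alph[of B'] finB by (intro regular_finite) auto
  ultimately show ?thesis
    using regular_pad_map[OF assms, of B' Some] finB by (auto intro: regular_conc)
qed

lemma tame_mark:
  assumes R: "tame B R"
  shows "tame B' {(mark \<alpha>, mark \<beta>) | \<alpha> \<beta>. (\<alpha>, \<beta>) \<in> R}"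
proof -
  let ?R = "{(map Some \<alpha>, map Some \<beta>) | \<alpha> \<beta>. (\<alpha>, \<beta>) \<in> R}"
  let ?f = "\<lambda>X. {(map Some \<alpha>, map Some \<beta>) | \<alpha> \<beta>. (\<alpha>, \<beta>) \<in> X}"
  have inj: "map Some x = map Some y \<longleftrightarrow> x = y" for x y :: "'b list" by (simp add: inj_map_eq_map)
  have "{quot ?R x y | x y. length x = length y} \<subseteq> insert {} (?f ` {quot R x y | x y. length x = length y})"
  proof
    fix X assume "X \<in> {quot ?R x y | x y. length x = length y}"
    then obtain x y where X: "X = quot ?R x y" "length x = length y" by auto
    show "X \<in> insert {} (?f ` {quot R x y | x y. length x = length y})"
    proof (cases "\<exists>x' y'. x = map Some x' \<and> y = map Some y'")
      case True
      then obtain x' y' where x': "x = map Some x'" "y = map Some y'" by blast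
      have "X = ?f (quot R x' y')"
      proof (intro set_eqI, clarify)
        fix \<alpha> \<beta>
        have "(\<alpha>, \<beta>) \<in> X \<longleftrightarrow> (\<exists>\<alpha>' \<beta>'. (\<alpha>', \<beta>') \<in> R \<and> map Some x' @ \<alpha> = map Some \<alpha>' \<and> map Some y' @ \<beta> = map Some \<beta>')"
          by (auto simp: X x' quot_def)
        also have "\<dots> \<longleftrightarrow> (\<alpha>, \<beta>) \<in> ?f (quot R x' y')"
          unfolding append_eq_map_conv inj quot_def by auto
        finally show "(\<alpha>, \<beta>) \<in> X \<longleftrightarrow> (\<alpha>, \<beta>) \<in> ?f (quot R x' y')" .
      qed
      then show ?thesis using X(2) x' by fastforce
    next
      case False
      then have "X = {}" by (auto simp: X quot_def append_eq_map_conv)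
      then show ?thesis by simp
    qed
  qed
  moreover have "finite {quot R x y | x y. length x = length y}" using R unfolding tame_def by blast
  ultimately have "finite {quot ?R x y | x y. length x = length y}"
    by (meson finite.insertI finite_imageI finite_subset)
  moreover obtain N where "\<And>\<alpha> \<beta>. (\<alpha>, \<beta>) \<in> R \<Longrightarrow> length \<alpha> \<le> length \<beta> + N \<and> length \<beta> \<le> length \<alpha> + N"
    using tame_bound[OF R] by blast
  then have "\<forall>(\<alpha>, \<beta>)\<in>?R. length \<alpha> \<le> length \<beta> + N \<and> length \<beta> \<le> length \<alpha> + N" by auto
  moreover have "?R \<subseteq> lists B' \<times> lists B'" using tame_lists[OF R] by fastforce
  moreover have "finite B'" using finB by simp
  ultimately have "tame B' ?R" unfolding tame_def by blast
  from tame_prepend[OF this, of "[None]" "[None]"] show ?thesis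
    by (rule back_subst[of "tame B'"]) auto
qed

lemma tame_Id_K: "tame B {(\<alpha>, \<alpha>) | \<alpha>. \<alpha> \<in> K}"
proof -
  have "{(\<alpha>, \<alpha>) | \<alpha>. \<alpha> \<in> K} = {(\<gamma>, \<gamma>) | \<gamma>. \<gamma> \<in> lists B} \<inter> K \<times> K" using K_lists by blast
  then show ?thesis using tame_Int_Times[OF tame_Id[OF finB] K K] by simp
qed

text \<open>Closure of \<open>K\<close> under prefixes makes every nonempty prefix of a marked word
  a marked word of \<open>L\<close> again. The relation of the prefix condition is then the equality
  relation, already known from \<open>L_right\<close> at \<open>None\<close>.\<close>

lemma prefix_automatic:
  assumes R: "\<And>b. b \<in> B \<Longrightarrow> regular (pad_alph B) {padR \<alpha> \<beta> | \<alpha> \<beta>. (\<alpha>, \<beta>) \<in> rel_right b}"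
    and pref: "\<And>\<alpha> \<beta>. \<alpha> @ \<beta> \<in> K \<Longrightarrow> \<alpha> \<in> K"
  shows "prefix_automatic (pres_carrier A u v) mult"
proof (rule prefix_automatic_structure_imp[where B=B' and gen=gen and L=L])
  have id: "regular (pad_alph B) {padR \<alpha> \<beta> | \<alpha> \<beta>. (\<alpha>, \<beta>) \<in> {(\<alpha>, \<alpha>) | \<alpha>. \<alpha> \<in> K}}"
    by (rule tame_regular_padR[OF tame_Id_K])
  have step: "regular (pad_alph B') (L_right mult gen L a)" if "a \<in> insert None (Some ` B')" for a
    unfolding L_step(1)[OF that]
    by (rule regular_mark_padR) (use that R id in \<open>auto simp: step_right_def split: option.splits\<close>)
  have "Pref L - {[]} = L"
  proof (intro set_eqI iffI)
    fix \<beta> assume "\<beta> \<in> Pref L - {[]}"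
    then obtain \<gamma> \<alpha> where "\<beta> @ \<gamma> = mark \<alpha>" "\<alpha> \<in> K" "\<beta> \<noteq> []" by (auto simp: Pref_def L_def)
    then obtain \<beta>' where "\<beta> = None # \<beta>'" "\<beta>' @ \<gamma> = map Some \<alpha>" by (cases \<beta>) auto
    then obtain \<alpha>1 \<alpha>2 where "\<beta>' = map Some \<alpha>1" "\<alpha> = \<alpha>1 @ \<alpha>2" by (auto simp: append_eq_map_conv)
    then show "\<beta> \<in> L" using pref \<open>\<alpha> \<in> K\<close> \<open>\<beta> = None # \<beta>'\<close> by (auto simp: L_def)
  next
    fix \<beta> assume "\<beta> \<in> L"
    then show "\<beta> \<in> Pref L - {[]}" by (auto simp: Pref_def L_def intro: exI[of _ "[]"])
  qed
  then have "{padR \<alpha> \<beta> | \<alpha> \<beta>. \<alpha> \<in> L \<and> \<beta> \<in> Pref L \<and> \<beta> \<noteq> [] \<and> evalw gen mult \<alpha> = evalw gen mult \<beta>} = L_right mult gen L None"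
    unfolding L_right_def optw_def by auto
  then show "prefix_automatic_structure (pres_carrier A u v) mult B' gen L"
    unfolding prefix_automatic_structure_def automatic_structure_def using base step by simp
qed

lemma biautomatic:
  assumes R: "\<And>b. b \<in> B \<Longrightarrow> tame B (rel_right b)"
    and L: "\<And>b. b \<in> B \<Longrightarrow> tame B (head_rel u v val K b)"
  shows "biautomatic (pres_carrier A u v) mult"
proof (rule biautomatic_structure_imp[where B=B' and gen=gen and L=L])
  have mk: "{pad (mark \<alpha>) (mark \<beta>) | \<alpha> \<beta>. (\<alpha>, \<beta>) \<in> X} =
    {pad \<alpha> \<beta> | \<alpha> \<beta>. (\<alpha>, \<beta>) \<in> {(mark \<alpha>, mark \<beta>) | \<alpha> \<beta>. (\<alpha>, \<beta>) \<in> X}}" for X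
    and pad :: "'b option list \<Rightarrow> 'b option list \<Rightarrow> ('b option option \<times> 'b option option) list"
    by blast
  have t: "tame B (step_right a)" "tame B (step_left a)" if "a \<in> insert None (Some ` B')" for a
    using that R L tame_Id_K by (auto simp: step_right_def step_left_def split: option.splits)
  have rR: "regular (pad_alph B') {padR (mark \<alpha>) (mark \<beta>) | \<alpha> \<beta>. (\<alpha>, \<beta>) \<in> X}" if "tame B X" for X
    by (subst mk[where pad=padR], rule tame_regular_padR, rule tame_mark[OF that])
  have rL: "regular (pad_alph B') {padL (mark \<alpha>) (mark \<beta>) | \<alpha> \<beta>. (\<alpha>, \<beta>) \<in> X}" if "tame B X" for X
    by (subst mk[where pad=padL], rule tame_regular_padL, rule tame_mark[OF that])
  show "biautomatic_structure (pres_carrier A u v) mult B' gen L"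
    unfolding biautomatic_structure_def
  proof (intro conjI[OF base] ballI conjI)
    fix a assume a: "a \<in> insert None (Some ` B')"
    show "regular (pad_alph B') (L_right mult gen L a)" unfolding L_step(1)[OF a] by (rule rR[OF t(1)[OF a]])
    show "regular (pad_alph B') (L_right_pL mult gen L a)" unfolding L_step(2)[OF a] by (rule rL[OF t(1)[OF a]])
    show "regular (pad_alph B') (L_left mult gen L a)" unfolding L_step(3)[OF a] by (rule rR[OF t(2)[OF a]])
    show "regular (pad_alph B') (L_left_pL mult gen L a)" unfolding L_step(4)[OF a] by (rule rL[OF t(2)[OF a]])
  qed
qed

end

section \<open>Passage to the mirror image of a presentation\<close>

lemma cross_section_rev:
  assumes "cross_section u v val K"
  shows "cross_section (rev u) (rev v) (\<lambda>b. rev (val b)) (rev ` K)"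
  using assms by (auto simp: cross_section_def vals_rev rel_cong_rev_iff)

lemma suffix_closed:
  assumes "\<And>b \<alpha>. b # \<alpha> \<in> K \<Longrightarrow> \<alpha> \<in> K" "\<alpha> @ \<beta> \<in> K"
  shows "\<beta> \<in> K"
  using assms(2) by (induction \<alpha>) (auto dest: assms(1))

lemma head_base_marked_words_rev:
  assumes "head_base A (rev u) (rev v) B val K"
  shows "marked_words A u v B (\<lambda>b. rev (val b)) (rev ` K)"
proof
  show "u \<in> lists A" "v \<in> lists A" "\<And>b. b \<in> B \<Longrightarrow> rev (val b) \<in> lists A" "regular B (rev ` K)"
    using assms by (auto simp: head_base_def intro: regular_rev)
  show "cross_section u v (\<lambda>b. rev (val b)) (rev ` K)"
    using cross_section_rev[of "rev u" "rev v" val K] assms by (simp add: head_base_def)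
  fix w assume "w \<in> lists A"
  then have "rev w \<in> lists A" by (metis in_lists_conv_set set_rev)
  from head_base_covers[OF assms this] obtain \<alpha> where "\<alpha> \<in> K" "rel_cong (rev u) (rev v) (rev w) (vals val \<alpha>)" by blast
  then have "rel_cong u v w (vals (\<lambda>b. rev (val b)) (rev \<alpha>))"
    unfolding vals_rev using rel_cong_rev_iff[of u v w "rev (vals val \<alpha>)"] by simp
  then show "\<exists>\<alpha>\<in>rev ` K. rel_cong u v w (vals (\<lambda>b. rev (val b)) \<alpha>)" using \<open>\<alpha> \<in> K\<close> by blast
qed

lemma rel_right_rev:
  "{(\<alpha>, \<beta>). \<alpha> \<in> rev ` K \<and> \<beta> \<in> rev ` K \<and>
     rel_cong u v (vals (\<lambda>b. rev (val b)) \<alpha> @ rev (val b)) (vals (\<lambda>b. rev (val b)) \<beta>)} =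
   (\<lambda>(\<alpha>, \<beta>). (rev \<alpha>, rev \<beta>)) ` head_rel (rev u) (rev v) val K b"
proof -
  have "rel_cong u v (vals (\<lambda>b. rev (val b)) (rev \<alpha>) @ rev (val b)) (vals (\<lambda>b. rev (val b)) (rev \<beta>)) \<longleftrightarrow>
    rel_cong (rev u) (rev v) (val b @ vals val \<alpha>) (vals val \<beta>)" for \<alpha> \<beta>
    using rel_cong_rev_iff[of u v "rev (val b @ vals val \<alpha>)" "rev (vals val \<beta>)"] by (simp add: vals_rev)
  then show ?thesis by (auto simp: head_rel_def image_iff)
qed

text \<open>Reversal turns left multiplication with left padding into right multiplication with
  right padding, which is the only combination that prefix automaticity demands, and closure under
  suffixes into closure under prefixes.\<close>

lemma head_regular_prefix_automatic:
  assumes H: "head_regular A (rev u) (rev v) B val K"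
  shows "prefix_automatic (pres_carrier A u v) (pres_mult A u v)"
proof -
  have hb: "head_base A (rev u) (rev v) B val K" using H by (simp add: head_regular_def)
  interpret marked_words A u v B "\<lambda>b. rev (val b)" "rev ` K"
    by (rule head_base_marked_words_rev[OF hb])
  show ?thesis
  proof (rule prefix_automatic)
    fix b assume "b \<in> B"
    then have "regular (pad_alph B) (rev ` {padL \<alpha> \<beta> | \<alpha> \<beta>. (\<alpha>, \<beta>) \<in> head_rel (rev u) (rev v) val K b})"
      using H by (auto simp: head_regular_def intro: regular_rev)
    moreover have "rev ` {padL \<alpha> \<beta> | \<alpha> \<beta>. (\<alpha>, \<beta>) \<in> head_rel (rev u) (rev v) val K b} =
      {padR \<alpha> \<beta> | \<alpha> \<beta>. (\<alpha>, \<beta>) \<in> (\<lambda>(\<alpha>, \<beta>). (rev \<alpha>, rev \<beta>)) ` head_rel (rev u) (rev v) val K b}"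
      by (force simp: padL_eq_rev image_iff)
    ultimately show "regular (pad_alph B) {padR \<alpha> \<beta> | \<alpha> \<beta>. (\<alpha>, \<beta>) \<in> rel_right b}"
      unfolding rel_right_rev by simp
  next
    fix \<alpha> \<beta> assume "\<alpha> @ \<beta> \<in> rev ` K"
    then have "rev \<beta> @ rev \<alpha> \<in> K" by (metis imageE rev_append rev_rev_ident)
    then have "rev \<alpha> \<in> K" using hb suffix_closed[of K] unfolding head_base_def by blast
    then show "\<alpha> \<in> rev ` K" by (metis image_eqI rev_rev_ident)
  qed
qed

text \<open>Both assumptions concern the same language read in opposite directions, since a
  biautomatic structure uses one language for the multiplications on both sides. Tameness supplies
  both paddings for each of them.\<close>

lemma head_tame_biautomatic:
  assumes L: "head_tame A u v B val K"
    and R: "head_tame A (rev u) (rev v) B (\<lambda>b. rev (val b)) (rev ` K)"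
  shows "biautomatic (pres_carrier A u v) (pres_mult A u v)"
proof -
  have "marked_words A u v B (\<lambda>b. rev (rev (val b))) (rev ` rev ` K)"
    by (rule head_base_marked_words_rev) (use R in \<open>simp add: head_tame_def\<close>)
  then interpret marked_words A u v B val K by (simp add: image_image)
  show ?thesis
  proof (rule biautomatic)
    fix b assume b: "b \<in> B"
    show "tame B (head_rel u v val K b)" using L b by (simp add: head_tame_def)
    have "tame B (head_rel (rev u) (rev v) (\<lambda>b. rev (val b)) (rev ` K) b)" using R b by (simp add: head_tame_def)
    from tame_rev[OF this] show "tame B (rel_right b)"
      unfolding rel_right_rev[symmetric] by (simp add: image_image)
  qed
qed

subsection \<open>Certificates for head multiplication\<close>

text \<open>A certificate \<open>(s', t', Bl, s, t, m)\<close> for multiplication by \<open>b\<close> relates \<open>s' X s \<gamma>\<close> to \<open>t' Y t \<gamma>\<close>,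
  where \<open>(X, Y)\<close> is a product of blocks from \<open>Bl\<close>: the word \<open>m\<close> produced from \<open>b s'\<close> travels through \<open>X\<close>,
  turning it into \<open>Y\<close>, and is absorbed by \<open>s\<close>.\<close>

type_synonym ('a, 'b) certificate =
  "'b list \<times> 'b list \<times> ('b list \<times> 'b list) set \<times> 'b list \<times> 'b list \<times> 'a list"

definition cert_rel :: "'b set \<Rightarrow> ('a, 'b) certificate \<Rightarrow> ('b list \<times> 'b list) set" where
  "cert_rel B = (\<lambda>(s', t', Bl, s, t, m).
     {(s' @ X @ s @ \<gamma>, t' @ Y @ t @ \<gamma>) | X Y \<gamma>. (X, Y) \<in> blocks Bl \<and> \<gamma> \<in> lists B})"

definition cert_ok :: "'a list \<Rightarrow> 'a list \<Rightarrow> 'b set \<Rightarrow> ('b \<Rightarrow> 'a list) \<Rightarrow> 'b \<Rightarrow> ('a, 'b) certificate \<Rightarrow> bool" where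
  "cert_ok u v B val b = (\<lambda>(s', t', Bl, s, t, m).
     s' \<in> lists B \<and> t' \<in> lists B \<and> s \<in> lists B \<and> t \<in> lists B \<and> finite Bl \<and>
     (\<forall>(x, y)\<in>Bl. x \<in> lists B \<and> y \<in> lists B \<and> length x = length y \<and>
        rel_cong u v (m @ vals val x) (vals val y @ m)) \<and>
     rel_cong u v (val b @ vals val s') (vals val t' @ m) \<and> rel_cong u v (m @ vals val s) (vals val t))"

text \<open>The certificates may overlap and may relate words outside \<open>K\<close>. Soundness
  together with the uniqueness of representatives selects the right pairs afterwards, so that here
  only the existence of one pair within \<open>K\<close> is required.\<close>

definition mult_ok :: "'a list \<Rightarrow> 'a list \<Rightarrow> 'b set \<Rightarrow> ('b \<Rightarrow> 'a list) \<Rightarrow> 'b list set \<Rightarrow> 'b \<Rightarrow> bool" where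
  "mult_ok u v B val K b \<longleftrightarrow> (\<exists>Ts. finite Ts \<and> (\<forall>\<tau>\<in>Ts. cert_ok u v B val b \<tau>) \<and>
     (\<forall>\<alpha>\<in>K. \<exists>\<beta>\<in>K. \<exists>\<tau>\<in>Ts. (\<alpha>, \<beta>) \<in> cert_rel B \<tau>))"

lemma tame_cert_rel:
  assumes "finite B" "cert_ok u v B val b \<tau>"
  shows "tame B (cert_rel B \<tau>)"
proof -
  obtain s' t' Bl s t m where \<tau>: "\<tau> = (s', t', Bl, s, t, m)" by (cases \<tau>)
  have ok: "s' \<in> lists B" "t' \<in> lists B" "s \<in> lists B" "t \<in> lists B" "finite Bl"
    "Bl \<subseteq> lists B \<times> lists B" "\<And>x y. (x, y) \<in> Bl \<Longrightarrow> length x = length y"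
    using assms(2) by (auto simp: \<tau> cert_ok_def)
  have "tame B {(s' @ \<alpha>, t' @ \<beta>) | \<alpha> \<beta>. (\<alpha>, \<beta>) \<in>
     {(X @ \<alpha>, Y @ \<beta>) | X Y \<alpha> \<beta>. (X, Y) \<in> blocks Bl \<and> (\<alpha>, \<beta>) \<in>
       {(s @ \<alpha>, t @ \<beta>) | \<alpha> \<beta>. (\<alpha>, \<beta>) \<in> {(\<gamma>, \<gamma>) | \<gamma>. \<gamma> \<in> lists B}}}}"
    by (intro tame_prepend tame_blocks tame_Id ok assms)
  also have "{(s' @ \<alpha>, t' @ \<beta>) | \<alpha> \<beta>. (\<alpha>, \<beta>) \<in>
     {(X @ \<alpha>, Y @ \<beta>) | X Y \<alpha> \<beta>. (X, Y) \<in> blocks Bl \<and> (\<alpha>, \<beta>) \<in>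
       {(s @ \<alpha>, t @ \<beta>) | \<alpha> \<beta>. (\<alpha>, \<beta>) \<in> {(\<gamma>, \<gamma>) | \<gamma>. \<gamma> \<in> lists B}}}} = cert_rel B \<tau>"
    (is "?X = ?Y")
  proof (intro set_eqI iffI)
    fix c assume "c \<in> ?X"
    then show "c \<in> ?Y" unfolding cert_rel_def \<tau> prod.case by auto
  next
    fix c assume "c \<in> ?Y"
    then obtain X Y \<gamma> where c: "c = (s' @ X @ s @ \<gamma>, t' @ Y @ t @ \<gamma>)" "(X, Y) \<in> blocks Bl" "\<gamma> \<in> lists B"
      unfolding cert_rel_def \<tau> prod.case by blast
    then have "(s @ \<gamma>, t @ \<gamma>) \<in> {(s @ \<alpha>, t @ \<beta>) | \<alpha> \<beta>. (\<alpha>, \<beta>) \<in> {(\<gamma>, \<gamma>) | \<gamma>. \<gamma> \<in> lists B}}" by blast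
    with c(2) have "(X @ s @ \<gamma>, Y @ t @ \<gamma>) \<in> {(X @ \<alpha>, Y @ \<beta>) | X Y \<alpha> \<beta>. (X, Y) \<in> blocks Bl \<and> (\<alpha>, \<beta>) \<in>
       {(s @ \<alpha>, t @ \<beta>) | \<alpha> \<beta>. (\<alpha>, \<beta>) \<in> {(\<gamma>, \<gamma>) | \<gamma>. \<gamma> \<in> lists B}}}"
      unfolding mem_Collect_eq by (intro exI[of _ X] exI[of _ Y] exI[of _ "s @ \<gamma>"] exI[of _ "t @ \<gamma>"]) simp
    then show "c \<in> ?X" unfolding c(1) mem_Collect_eq
      by (intro exI[of _ "X @ s @ \<gamma>"] exI[of _ "Y @ t @ \<gamma>"]) simp
  qed
  finally show ?thesis .
qed

lemma blocks_sound:
  assumes "(X, Y) \<in> blocks Bl" "\<And>x y. (x, y) \<in> Bl \<Longrightarrow> rel_cong u v (m @ vals val x) (vals val y @ m)"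
  shows "rel_cong u v (m @ vals val X) (vals val Y @ m)"
  using assms(1)
proof (induction rule: blocks_induct)
  case (Cons x y X Y)
  have "rel_cong u v (m @ vals val x @ vals val X) (vals val y @ m @ vals val X)"
    using rel_cong_append_right[OF assms(2)[OF Cons.hyps(1)], of "vals val X"] by simp
  also have "rel_cong u v (vals val y @ m @ vals val X) (vals val y @ vals val Y @ m)"
    by (rule rel_cong_append_left[OF Cons.IH])
  finally show ?case by simp
qed simp

lemma cert_sound:
  assumes "cert_ok u v B val b \<tau>" "(\<alpha>, \<beta>) \<in> cert_rel B \<tau>"
  shows "rel_cong u v (val b @ vals val \<alpha>) (vals val \<beta>)"
proof -
  obtain s' t' Bl s t m where \<tau>: "\<tau> = (s', t', Bl, s, t, m)" by (cases \<tau>)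
  obtain X Y \<gamma> where ab: "\<alpha> = s' @ X @ s @ \<gamma>" "\<beta> = t' @ Y @ t @ \<gamma>" "(X, Y) \<in> blocks Bl"
    using assms(2) by (auto simp: cert_rel_def \<tau>)
  let ?v = "vals val"
  have ok: "\<And>x y. (x, y) \<in> Bl \<Longrightarrow> rel_cong u v (m @ ?v x) (?v y @ m)"
    "rel_cong u v (val b @ ?v s') (?v t' @ m)" "rel_cong u v (m @ ?v s) (?v t)"
    using assms(1) by (auto simp: \<tau> cert_ok_def)
  have "rel_cong u v (val b @ ?v s' @ ?v X @ ?v s @ ?v \<gamma>) (?v t' @ m @ ?v X @ ?v s @ ?v \<gamma>)"
    using rel_cong_append_right[OF ok(2), of "?v X @ ?v s @ ?v \<gamma>"] by simp
  also have "rel_cong u v (?v t' @ m @ ?v X @ ?v s @ ?v \<gamma>) (?v t' @ ?v Y @ m @ ?v s @ ?v \<gamma>)"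
    using rel_cong_append[OF blocks_sound[OF ab(3) ok(1)], of "?v t'" "?v s @ ?v \<gamma>"] by simp
  also have "rel_cong u v (?v t' @ ?v Y @ m @ ?v s @ ?v \<gamma>) (?v t' @ ?v Y @ ?v t @ ?v \<gamma>)"
    using rel_cong_append[OF ok(3), of "?v t' @ ?v Y" "?v \<gamma>"] by simp
  finally show ?thesis by (simp add: ab)
qed

text \<open>A product has only one representative in \<open>K\<close>; a sound relation that offers
  some representative for each word therefore offers the right one.\<close>

lemma head_rel_eq:
  assumes "cross_section u v val K" "\<And>\<alpha> \<beta>. (\<alpha>, \<beta>) \<in> T \<Longrightarrow> rel_cong u v (val b @ vals val \<alpha>) (vals val \<beta>)"
    "\<And>\<alpha>. \<alpha> \<in> K \<Longrightarrow> \<exists>\<beta>\<in>K. (\<alpha>, \<beta>) \<in> T"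
  shows "head_rel u v val K b = T \<inter> K \<times> K"
proof (intro set_eqI iffI, clarify)
  fix \<alpha> \<beta> assume "(\<alpha>, \<beta>) \<in> head_rel u v val K b"
  then have ab: "\<alpha> \<in> K" "\<beta> \<in> K" "rel_cong u v (val b @ vals val \<alpha>) (vals val \<beta>)" by (auto simp: head_rel_def)
  then obtain \<beta>' where \<beta>': "\<beta>' \<in> K" "(\<alpha>, \<beta>') \<in> T" using assms(3) by blast
  have "rel_cong u v (vals val \<beta>) (vals val \<beta>')"
    using assms(2)[OF \<beta>'(2)] ab(3) rel_cong_trans rel_cong_sym by blast
  then have "\<beta> = \<beta>'" using assms(1) ab \<beta>' by (auto simp: cross_section_def)
  then show "(\<alpha>, \<beta>) \<in> T \<inter> K \<times> K" using ab \<beta>' by simp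
qed (auto simp: head_rel_def assms(2))

lemma mult_ok_tame:
  assumes "mult_ok u v B val K b" "cross_section u v val K" "regular B K"
  shows "tame B (head_rel u v val K b)"
    and "\<forall>\<alpha>\<in>K. \<exists>\<beta>\<in>K. rel_cong u v (val b @ vals val \<alpha>) (vals val \<beta>)"
proof -
  have fin: "finite B" using assms(3) by (rule regularD)
  obtain Ts where Ts: "finite Ts" "\<And>\<tau>. \<tau> \<in> Ts \<Longrightarrow> cert_ok u v B val b \<tau>"
    "\<And>\<alpha>. \<alpha> \<in> K \<Longrightarrow> \<exists>\<beta>\<in>K. \<exists>\<tau>\<in>Ts. (\<alpha>, \<beta>) \<in> cert_rel B \<tau>"
    using assms(1) unfolding mult_ok_def by blast
  let ?T = "\<Union>\<tau>\<in>Ts. cert_rel B \<tau>"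
  have "tame B ?T" using Ts(1,2)
  proof (induction Ts rule: finite_induct)
    case empty
    have "tame B ({(\<gamma>, \<gamma>) | \<gamma>. \<gamma> \<in> lists B} \<inter> {} \<times> {})"
      using fin by (intro tame_Int_Times tame_Id regular_finite) auto
    then show ?case by simp
  next
    case (insert \<tau> Ts)
    have "tame B (cert_rel B \<tau> \<union> (\<Union>\<tau>\<in>Ts. cert_rel B \<tau>))"
      by (rule tame_Un[OF tame_cert_rel[OF fin insert.prems] insert.IH]) (use insert.prems in auto)
    then show ?case by simp
  qed
  moreover have "head_rel u v val K b = ?T \<inter> K \<times> K"
  proof (rule head_rel_eq[OF assms(2)])
    show "rel_cong u v (val b @ vals val \<alpha>) (vals val \<beta>)" if "(\<alpha>, \<beta>) \<in> ?T" for \<alpha> \<beta>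
    proof -
      from that obtain \<tau> where "\<tau> \<in> Ts" "(\<alpha>, \<beta>) \<in> cert_rel B \<tau>" by blast
      then show ?thesis by (intro cert_sound[OF Ts(2)])
    qed
    show "\<exists>\<beta>\<in>K. (\<alpha>, \<beta>) \<in> ?T" if "\<alpha> \<in> K" for \<alpha> using Ts(3)[OF that] by auto
  qed
  ultimately show "tame B (head_rel u v val K b)" using tame_Int_Times[OF _ assms(3,3)] by simp
  show "\<forall>\<alpha>\<in>K. \<exists>\<beta>\<in>K. rel_cong u v (val b @ vals val \<alpha>) (vals val \<beta>)"
  proof
    fix \<alpha> assume "\<alpha> \<in> K"
    from Ts(3)[OF this] obtain \<beta> \<tau> where "\<beta> \<in> K" "\<tau> \<in> Ts" "(\<alpha>, \<beta>) \<in> cert_rel B \<tau>" by blast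
    then show "\<exists>\<beta>\<in>K. rel_cong u v (val b @ vals val \<alpha>) (vals val \<beta>)"
      by (intro bexI[of _ \<beta>] cert_sound[OF Ts(2)])
  qed
qed

lemma head_tameI:
  assumes "u \<in> lists A" "v \<in> lists A" "\<And>b. b \<in> B \<Longrightarrow> val b \<in> lists A" "\<And>a. a \<in> A \<Longrightarrow> \<exists>b\<in>B. val b = [a]"
    "regular B K" "[] \<in> K" "\<And>b \<alpha>. b # \<alpha> \<in> K \<Longrightarrow> \<alpha> \<in> K" "cross_section u v val K"
    "\<And>b. b \<in> B \<Longrightarrow> mult_ok u v B val K b"
  shows "head_tame A u v B val K"
  unfolding head_tame_def head_base_def
  using assms mult_ok_tame[OF assms(9,8,5)] regularD(1)[OF assms(5)] by blast

lemma mult_ok_Cons: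
  assumes "b \<in> B" "K \<subseteq> lists B" "\<And>\<alpha>. \<alpha> \<in> K \<Longrightarrow> b # \<alpha> \<in> K"
  shows "mult_ok u v B val K b"
proof -
  let ?\<tau> = "([], [], {}, [], [b], val b)"
  have "(\<alpha>, b # \<alpha>) \<in> cert_rel B ?\<tau>" if "\<alpha> \<in> K" for \<alpha>
    unfolding cert_rel_def prod.case using that assms(2) blocks_Nil[of "{}"] by force
  moreover have "cert_ok u v B val b ?\<tau>" using assms(1) by (auto simp: cert_ok_def)
  ultimately show ?thesis unfolding mult_ok_def using assms(3)
    by (intro exI[of _ "{?\<tau>}"]) blast
qed

lemma cert_relI:
  "(X, Y) \<in> blocks Bl \<Longrightarrow> \<gamma> \<in> lists B \<Longrightarrow> \<alpha> = s' @ X @ s @ \<gamma> \<Longrightarrow> \<beta> = t' @ Y @ t @ \<gamma> \<Longrightarrow>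
   (\<alpha>, \<beta>) \<in> cert_rel B (s', t', Bl, s, t, m)"
  unfolding cert_rel_def by blast

lemma cert_rel_stop:
  "\<gamma> \<in> lists B \<Longrightarrow> (s @ \<gamma>, t @ \<gamma>) \<in> cert_rel B ([], [], Bl, s, t, m)"
  by (rule cert_relI[OF blocks_Nil]) auto

lemma cert_rel_block:
  assumes "(x, y) \<in> Bl" "(\<alpha>, \<beta>) \<in> cert_rel B ([], [], Bl, s, t, m)"
  shows "(x @ \<alpha>, y @ \<beta>) \<in> cert_rel B ([], [], Bl, s, t, m)"
proof -
  obtain X Y \<gamma> where "(X, Y) \<in> blocks Bl" "\<gamma> \<in> lists B" "\<alpha> = X @ s @ \<gamma>" "\<beta> = Y @ t @ \<gamma>"
    using assms(2) by (auto simp: cert_rel_def)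
  then show ?thesis using blocks_Cons[OF assms(1)] by (intro cert_relI[of "x @ X" "y @ Y"]) auto
qed

lemma cert_rel_start:
  assumes "(\<alpha>, \<beta>) \<in> cert_rel B ([], [], Bl, s, t, m)"
  shows "(s' @ \<alpha>, t' @ \<beta>) \<in> cert_rel B (s', t', Bl, s, t, m)"
  using assms by (auto simp: cert_rel_def)

subsection \<open>Languages of words avoiding factors\<close>

definition avoid :: "'b set \<Rightarrow> 'b list set \<Rightarrow> 'b list set" where
  "avoid B F = {\<alpha> \<in> lists B. \<forall>f\<in>F. \<not> sublist f \<alpha>}"

lemma avoid_Nil [simp]: "[] \<in> avoid B F \<longleftrightarrow> [] \<notin> F"
  by (auto simp: avoid_def)

lemma avoid_Cons: "b # \<alpha> \<in> avoid B F \<longleftrightarrow> b \<in> B \<and> \<alpha> \<in> avoid B F \<and> (\<forall>f\<in>F. \<not> prefix f (b # \<alpha>))"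
  by (auto simp: avoid_def sublist_Cons_right)

lemma avoid_lists: "\<alpha> \<in> avoid B F \<Longrightarrow> \<alpha> \<in> lists B"
  by (simp add: avoid_def)

lemma avoid_append: "\<alpha> @ \<beta> \<in> avoid B F \<Longrightarrow> \<beta> \<in> avoid B F"
  by (induction \<alpha>) (auto simp: avoid_Cons)

lemma avoid_rev: "rev ` avoid B F = avoid B (rev ` F)"
proof (intro set_eqI iffI)
  fix \<alpha> assume "\<alpha> \<in> rev ` avoid B F"
  then show "\<alpha> \<in> avoid B (rev ` F)" by (auto simp: avoid_def)
next
  fix \<alpha> assume "\<alpha> \<in> avoid B (rev ` F)"
  then have "rev \<alpha> \<in> avoid B F" by (auto simp: avoid_def sublist_rev_right)
  then show "\<alpha> \<in> rev ` avoid B F" by (metis image_eqI rev_rev_ident)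
qed

text \<open>Regularity of \<open>F\<close> is assumed instead of finiteness because the system for
  \<open>aba = ba\<close> has infinitely many forbidden factors.\<close>

lemma regular_avoid:
  assumes "regular B F"
  shows "regular B (avoid B F)"
proof -
  have fin: "finite B" using assms by (rule regularD)
  have "avoid B F = lists B - conc (conc (lists B) F) (lists B)"
  proof (intro set_eqI iffI)
    fix \<alpha> assume "\<alpha> \<in> avoid B F"
    moreover have "sublist f ((p @ f) @ q)" for p f q :: "'a list" using sublist_appendI[of f p q] by simp
    ultimately show "\<alpha> \<in> lists B - conc (conc (lists B) F) (lists B)"
      unfolding avoid_def conc_def by blast
  next
    fix \<alpha> assume \<alpha>: "\<alpha> \<in> lists B - conc (conc (lists B) F) (lists B)"
    have "\<not> sublist f \<alpha>" if f: "f \<in> F" for f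
    proof
      assume "sublist f \<alpha>"
      then obtain p q where pq: "\<alpha> = p @ f @ q" by (auto simp: sublist_def)
      then have "p \<in> lists B" "q \<in> lists B" using \<alpha> by auto
      then have "(p @ f) @ q \<in> conc (conc (lists B) F) (lists B)" unfolding conc_def using f by blast
      then show False using \<alpha> pq by simp
    qed
    then show "\<alpha> \<in> avoid B F" using \<alpha> by (simp add: avoid_def)
  qed
  then show ?thesis using assms regular_lists[OF fin] by (auto intro!: regular_Diff regular_conc)
qed

lemma regular_avoid_finite: "finite B \<Longrightarrow> finite F \<Longrightarrow> F \<subseteq> lists B \<Longrightarrow> regular B (avoid B F)"
  by (intro regular_avoid regular_finite)

subsection \<open>Cross-sections\<close>

text \<open>If the generators act on \<open>K\<close> compatibly with the relation and \<open>K\<close> is the orbit of the empty word, then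
  the action recovers each word of \<open>K\<close> from the monoid element it represents.\<close>

lemma action_cross_section:
  assumes uv: "u \<in> lists A" "v \<in> lists A" and val: "\<And>b. b \<in> B \<Longrightarrow> val b \<in> lists A"
    and K: "K \<subseteq> lists B" "[] \<in> K" "\<And>b \<alpha>. b # \<alpha> \<in> K \<Longrightarrow> \<alpha> \<in> K"
    and inc: "\<And>a. a \<in> A \<Longrightarrow> inc a \<in> B"
    and closed: "\<And>b \<alpha>. b \<in> B \<Longrightarrow> \<alpha> \<in> K \<Longrightarrow> f b \<alpha> \<in> K"
    and cons: "\<And>b \<alpha>. b # \<alpha> \<in> K \<Longrightarrow> f b \<alpha> = b # \<alpha>"
    and rel: "\<And>\<alpha>. \<alpha> \<in> K \<Longrightarrow> foldr f (map inc u) \<alpha> = foldr f (map inc v) \<alpha>"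
    and ext: "\<And>b \<alpha>. b \<in> B \<Longrightarrow> \<alpha> \<in> K \<Longrightarrow> f b \<alpha> = foldr f (map inc (val b)) \<alpha>"
  shows "cross_section u v val K"
proof -
  let ?nf = "\<lambda>w. foldr f (map inc w) []"
  have closed': "foldr f (map inc w) \<alpha> \<in> K" if "w \<in> lists A" "\<alpha> \<in> K" for w \<alpha>
    using that by (induction w) (auto intro: closed inc)
  \<comment> \<open>The action is known to preserve \<open>K\<close> only for letters of
    \<open>A\<close>, which is why \<open>x\<close> is restricted. The suffix behind the place where
    the relation is applied is carried into \<open>K\<close> first, and there \<open>rel\<close>
    applies.\<close>
  have inv: "x \<in> lists A \<longrightarrow> ?nf x = ?nf y" if "rel_cong u v x y" for x y
    using that unfolding rel_cong_def
  proof (induction rule: rtranclp_induct)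
    case (step y z)
    show ?case
    proof
      assume x: "x \<in> lists A"
      then have "y \<in> lists A" using step.hyps(1) rel_cong_lists[of u v x y A] uv unfolding rel_cong_def by blast
      moreover obtain p q where "y = p @ u @ q \<and> z = p @ v @ q \<or> y = p @ v @ q \<and> z = p @ u @ q"
        using step.hyps(2) by (auto simp: rel_step_def)
      moreover from this have q: "q \<in> lists A" using calculation by auto
      ultimately have "?nf y = ?nf z" using rel[OF closed'[OF q K(2)]] by auto
      then show "?nf x = ?nf z" using step.IH x by simp
    qed
  qed simp
  have nf: "?nf (vals val \<alpha>) = \<alpha>" if "\<alpha> \<in> K" for \<alpha>
    using that
  proof (induction \<alpha>)
    case (Cons b \<alpha>)
    then have "\<alpha> \<in> K" "b \<in> B" using K by auto
    have "?nf (vals val (b # \<alpha>)) = foldr f (map inc (val b)) (?nf (vals val \<alpha>))" by simp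
    also have "\<dots> = f b \<alpha>" using Cons.IH[OF \<open>\<alpha> \<in> K\<close>] ext[OF \<open>b \<in> B\<close> \<open>\<alpha> \<in> K\<close>] by simp
    also have "\<dots> = b # \<alpha>" by (rule cons[OF Cons.prems])
    finally show ?case .
  qed simp
  show ?thesis unfolding cross_section_def
  proof (intro ballI impI)
    fix \<alpha> \<beta> assume ab: "\<alpha> \<in> K" "\<beta> \<in> K" "rel_cong u v (vals val \<alpha>) (vals val \<beta>)"
    have "vals val \<alpha> \<in> lists A" using vals_lists[of val B A] val ab(1) K(1) by blast
    then show "\<alpha> = \<beta>" using inv[OF ab(3)] nf ab by metis
  qed
qed

abbreviation (input) single :: "'a \<Rightarrow> 'a list" where "single a \<equiv> [a]"

lemma vals_single [simp]: "vals (\<lambda>a. [a]) \<alpha> = \<alpha>"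
  by (induction \<alpha>) auto

definition unbordered :: "'a list \<Rightarrow> bool" where
  "unbordered u \<longleftrightarrow> u \<noteq> [] \<and> (\<forall>p. prefix p u \<and> suffix p u \<longrightarrow> p = [] \<or> p = u)"

lemma unbordered_two: "x \<noteq> y \<Longrightarrow> unbordered [x, y]"
  by (auto simp: unbordered_def prefix_Cons suffix_Cons)

lemma unbordered_three: "x \<noteq> z \<Longrightarrow> unbordered [x, y, z]"
  by (auto simp: unbordered_def prefix_Cons suffix_Cons)

text \<open>Distinct occurrences of an unbordered word are disjoint, so the rule \<open>u \<rightarrow> v\<close> has the diamond
  property, whether or not it terminates.\<close>

lemma unbordered_cross_section:
  assumes u: "unbordered u"
  shows "cross_section u v single (avoid A {u})"
proof -
  define r where "r x y \<longleftrightarrow> (\<exists>p q. x = p @ u @ q \<and> y = p @ v @ q)" for x y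
  \<comment> \<open>If the second occurrence began inside the first, the common part
    \<open>s\<close> would be a nonempty proper border of \<open>u\<close>.\<close>
  have disj: "\<exists>w. q = w @ u @ q' \<and> p' = p @ u @ w" if "p @ u @ q = p' @ u @ q'" "length p < length p'" for p q p' q'
  proof -
    from that(2) append_cut_le[OF that(1)[symmetric]] obtain w where w: "p' = p @ w" "w @ u @ q' = u @ q" "w \<noteq> []"
      by auto
    show ?thesis
    proof (cases "length u \<le> length w")
      case True
      from append_cut_le[OF w(2) this] show ?thesis using w(1) by auto
    next
      case False
      then obtain s where s: "u = w @ s" "s @ q = u @ q'" using append_cut_le[OF w(2)[symmetric]] by auto
      have "prefix s (u @ q')" using s(2) by (metis prefixI)
      then have "prefix s u" by (rule prefix_length_prefix) (use s(1) in auto)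
      moreover have "suffix s u" using s by (auto simp: suffix_def)
      ultimately have False using u s w(3) False by (auto simp: unbordered_def)
      then show ?thesis ..
    qed
  qed
  have "strong_confluentp r"
  proof
    fix x y z assume "r x y" "r x z"
    then obtain p q p' q' where eq: "x = p @ u @ q" "y = p @ v @ q" "x = p' @ u @ q'" "z = p' @ v @ q'"
      unfolding r_def by blast
    consider "length p = length p'" | "length p < length p'" | "length p' < length p" by linarith
    then show "\<exists>t. r\<^sup>*\<^sup>* y t \<and> r\<^sup>=\<^sup>= z t"
    proof cases
      case 1
      then have "y = z" using eq by auto
      then show ?thesis by blast
    next
      case 2
      then obtain w where w: "q = w @ u @ q'" "p' = p @ u @ w" using disj[of p q p' q'] eq by auto
      have "r y (p @ v @ w @ v @ q')" unfolding r_def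
        by (intro exI[of _ "p @ v @ w"] exI[of _ q']) (simp add: eq w)
      moreover have "r z (p @ v @ w @ v @ q')" unfolding r_def
        by (intro exI[of _ p] exI[of _ "w @ v @ q'"]) (simp add: eq w)
      ultimately show ?thesis by blast
    next
      case 3
      then obtain w where w: "q' = w @ u @ q" "p = p' @ u @ w" using disj[of p' q' p q] eq by auto
      have "r y (p' @ v @ w @ v @ q)" unfolding r_def
        by (intro exI[of _ p'] exI[of _ "w @ v @ q"]) (simp add: eq w)
      moreover have "r z (p' @ v @ w @ v @ q)" unfolding r_def
        by (intro exI[of _ "p' @ v @ w"] exI[of _ q]) (simp add: eq w)
      ultimately show ?thesis by blast
    qed
  qed
  then have conf: "equivclp r = r\<^sup>*\<^sup>* OO r\<inverse>\<inverse>\<^sup>*\<^sup>*"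
    by (intro semiconfluentp_equivclp strong_confluentp_into_semiconfluentp)
  have "rel_step u v = symclp r"
    by (intro ext) (auto simp: rel_step_def symclp_def r_def)
  then have eqv: "rel_cong u v = equivclp r" by (simp add: rel_cong_def equivclp_def)
  have irr: "\<alpha> = \<beta>" if "r\<^sup>*\<^sup>* \<alpha> \<beta>" "\<alpha> \<in> avoid A {u}" for \<alpha> \<beta>
    using that by (cases rule: converse_rtranclpE) (auto simp: r_def avoid_def)
  show ?thesis unfolding cross_section_def vals_single eqv conf
  proof (intro ballI impI, elim relcomppE)
    fix \<alpha> \<beta> c assume "\<alpha> \<in> avoid A {u}" "\<beta> \<in> avoid A {u}" "r\<^sup>*\<^sup>* \<alpha> c" "r\<inverse>\<inverse>\<^sup>*\<^sup>* c \<beta>"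
    then show "\<alpha> = \<beta>" using irr[of \<alpha> c] irr[of \<beta> c] by (simp add: rtranclp_conversep)
  qed
qed

section \<open>One rewriting rule\<close>

text \<open>A letter other than \<open>x\<close> in front of a word avoiding \<open>u\<close> cannot
  create an occurrence of \<open>u\<close>, so only multiplication by the first letter of
  \<open>u\<close> needs certificates.\<close>

lemma one_rule_head_tame:
  assumes "finite A" "u \<in> lists A" "v \<in> lists A" "u = x # u'" "cross_section u v single (avoid A {u})"
    "mult_ok u v A single (avoid A {u}) x"
  shows "head_tame A u v A single (avoid A {u})"
proof (rule head_tameI)
  show "regular A (avoid A {u})" using assms by (intro regular_avoid_finite) auto
  fix b assume "b \<in> A"
  then show "mult_ok u v A single (avoid A {u}) b"
    using assms(4,6) by (cases "b = x") (auto intro!: mult_ok_Cons avoid_lists simp: avoid_Cons)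
qed (use assms in \<open>auto simp: avoid_Cons\<close>)

text \<open>By \<open>closed\<close>, one application of the rule at the head already yields a word
  of the cross-section. Two certificates without blocks suffice: one for this application and one
  for merely prepending \<open>x\<close>.\<close>

lemma mult_ok_bounded:
  assumes uv: "u \<in> lists A" "v \<in> lists A" "u = x # u'"
    and closed: "\<And>\<gamma>. u' @ \<gamma> \<in> avoid A {u} \<Longrightarrow> v @ \<gamma> \<in> avoid A {u}"
  shows "mult_ok u v A single (avoid A {u}) x"
proof -
  let ?\<tau> = "([], [], {}, u', v, [x]) :: ('a, 'a) certificate"
  let ?\<rho> = "([], [], {}, [], [x], [x]) :: ('a, 'a) certificate"
  show ?thesis unfolding mult_ok_def
  proof (intro exI[of _ "{?\<tau>, ?\<rho>}"] conjI ballI)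
    fix \<tau> assume "\<tau> \<in> {?\<tau>, ?\<rho>}"
    then show "cert_ok u v A single x \<tau>" using uv rel_cong_base[of u v] by (auto simp: cert_ok_def)
  next
    fix \<alpha> assume \<alpha>: "\<alpha> \<in> avoid A {u}"
    show "\<exists>\<beta>\<in>avoid A {u}. \<exists>\<tau>\<in>{?\<tau>, ?\<rho>}. (\<alpha>, \<beta>) \<in> cert_rel A \<tau>"
    proof (cases "prefix u' \<alpha>")
      case True
      then obtain \<gamma> where g: "\<alpha> = u' @ \<gamma>" by (auto simp: prefix_def)
      then have "\<gamma> \<in> lists A" using avoid_lists[OF \<alpha>] by auto
      then show ?thesis using closed \<alpha> g cert_rel_stop[of \<gamma> A u' v] by blast
    next
      case False
      then have "x # \<alpha> \<in> avoid A {u}" using \<alpha> uv by (auto simp: avoid_Cons)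
      then show ?thesis using cert_rel_stop[of \<alpha> A "[]" "[x]"] avoid_lists[OF \<alpha>] by force
    qed
  qed simp
qed

lemma avoid_append_no_overlap:
  assumes "v \<in> lists A" "\<gamma> \<in> avoid A {u}" "\<not> sublist u v"
    "\<And>s. s \<noteq> [] \<Longrightarrow> suffix s v \<Longrightarrow> \<not> prefix s u"
  shows "v @ \<gamma> \<in> avoid A {u}"
proof -
  have "\<not> sublist u (v @ \<gamma>)"
  proof
    assume "sublist u (v @ \<gamma>)"
    moreover have "\<not> sublist u \<gamma>" using assms(2) by (simp add: avoid_def)
    ultimately obtain s t where "u = s @ t" "suffix s v" "prefix t \<gamma>"
      using assms(3) by (auto simp: sublist_append)
    then show False using assms(4)[of s] \<open>\<not> sublist u \<gamma>\<close> by (cases "s = []") auto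
  qed
  moreover have "v @ \<gamma> \<in> lists A" using assms(1) avoid_lists[OF assms(2)] by simp
  ultimately show ?thesis by (simp add: avoid_def)
qed

text \<open>No nonempty suffix of \<open>v\<close> begins an occurrence of \<open>u\<close>, so the
  word written by the rule cannot trigger the rule again at its boundary to the remainder.\<close>

theorem head_tame_no_overlap:
  assumes "finite A" "u \<in> lists A" "v \<in> lists A" "unbordered u" "\<not> sublist u v"
    "\<And>s. s \<noteq> [] \<Longrightarrow> suffix s v \<Longrightarrow> \<not> prefix s u"
  shows "head_tame A u v A single (avoid A {u})"
proof -
  obtain x u' where u: "u = x # u'" using assms(4) by (cases u) (auto simp: unbordered_def)
  have "mult_ok u v A single (avoid A {u}) x"
  proof (rule mult_ok_bounded[OF assms(2,3) u])
    fix \<gamma> assume "u' @ \<gamma> \<in> avoid A {u}"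
    then show "v @ \<gamma> \<in> avoid A {u}"
      using assms(5,6) by (intro avoid_append_no_overlap[OF assms(3) avoid_append]) blast+
  qed
  then show ?thesis by (rule one_rule_head_tame[OF assms(1-3) u unbordered_cross_section[OF assms(4)]])
qed

subsection \<open>Cascading rules of equal length\<close>

lemma power_prefix_max:
  assumes "w \<noteq> []"
  shows "\<exists>n \<gamma>. \<alpha> = concat (replicate n w) @ \<gamma> \<and> \<not> prefix w \<gamma>"
proof (induction \<alpha> rule: length_induct)
  case (1 \<alpha>)
  show ?case
  proof (cases "prefix w \<alpha>")
    case True
    then obtain \<alpha>' where \<alpha>': "\<alpha> = w @ \<alpha>'" by (auto simp: prefix_def)
    then have "length \<alpha>' < length \<alpha>" using assms by simp
    then obtain n \<gamma> where "\<alpha>' = concat (replicate n w) @ \<gamma>" "\<not> prefix w \<gamma>" using 1 by blast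
    then show ?thesis using \<alpha>' by (intro exI[of _ "Suc n"] exI[of _ \<gamma>]) simp
  next
    case False
    then show ?thesis by (intro exI[of _ 0] exI[of _ \<alpha>]) simp
  qed
qed

lemma blocks_power: "(concat (replicate n w), concat (replicate n r)) \<in> blocks {(w, r)}"
  by (induction n) (auto intro: blocks_Cons)

text \<open>Read from left to right, the relation says that \<open>x # m'\<close> passes
  \<open>w\<close> and leaves \<open>r\<close> behind. The equal lengths of \<open>w\<close> and
  \<open>r\<close> keep the tapes synchronous, and the passage ends where no further copy of
  \<open>w\<close> follows.\<close>

lemma mult_ok_cascade:
  assumes uv: "u \<in> lists A" "v \<in> lists A" "u = x # m' @ w" "v = r @ x # m'" "length w = length r" "w \<noteq> []"
    and closed: "\<And>n \<gamma>. m' @ concat (replicate n w) @ \<gamma> \<in> avoid A {u} \<Longrightarrow> \<not> prefix w \<gamma> \<Longrightarrow>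
      concat (replicate n r) @ x # m' @ \<gamma> \<in> avoid A {u}"
  shows "mult_ok u v A single (avoid A {u}) x"
proof -
  let ?\<tau> = "(m', [], {(w, r)}, [], x # m', x # m') :: ('a, 'a) certificate"
  let ?\<rho> = "([], [], {}, [], [x], [x]) :: ('a, 'a) certificate"
  show ?thesis unfolding mult_ok_def
  proof (intro exI[of _ "{?\<tau>, ?\<rho>}"] conjI ballI)
    fix \<tau> assume "\<tau> \<in> {?\<tau>, ?\<rho>}"
    then show "cert_ok u v A single x \<tau>" using uv rel_cong_base[of u v] by (auto simp: cert_ok_def)
  next
    fix \<alpha> assume \<alpha>: "\<alpha> \<in> avoid A {u}"
    show "\<exists>\<beta>\<in>avoid A {u}. \<exists>\<tau>\<in>{?\<tau>, ?\<rho>}. (\<alpha>, \<beta>) \<in> cert_rel A \<tau>"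
    proof (cases "prefix m' \<alpha>")
      case True
      then obtain \<delta> where d: "\<alpha> = m' @ \<delta>" by (auto simp: prefix_def)
      obtain n \<gamma> where g: "\<delta> = concat (replicate n w) @ \<gamma>" "\<not> prefix w \<gamma>"
        using power_prefix_max[OF uv(6)] by blast
      have "\<gamma> \<in> lists A" using avoid_lists[OF \<alpha>] d g by auto
      then have "(\<alpha>, concat (replicate n r) @ x # m' @ \<gamma>) \<in> cert_rel A ?\<tau>"
        by (intro cert_relI[OF blocks_power]) (auto simp: d g)
      then show ?thesis using closed[of n \<gamma>] \<alpha> g d by blast
    next
      case False
      then have "x # \<alpha> \<in> avoid A {u}" using \<alpha> uv by (auto simp: avoid_Cons prefix_def)
      then show ?thesis using cert_rel_stop[of \<alpha> A "[]" "[x]"] avoid_lists[OF \<alpha>] by force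
    qed
  qed simp
qed

lemma avoid_power_append:
  assumes "\<beta> \<in> avoid A F" "\<And>k. concat (replicate k r) @ \<beta> \<in> avoid A F \<Longrightarrow> r @ concat (replicate k r) @ \<beta> \<in> avoid A F"
  shows "concat (replicate n r) @ \<beta> \<in> avoid A F"
  using assms by (induction n) auto

lemma head_tame_cascade_two:
  assumes "finite A" "x \<in> A" "y \<in> A" "p \<in> A" "x \<noteq> y"
  shows "head_tame A [x, y] [p, x] A single (avoid A {[x, y]})"
proof -
  have "mult_ok [x, y] [p, x] A single (avoid A {[x, y]}) x"
  proof (rule mult_ok_cascade[where m'="[]" and w="[y]" and r="[p]"])
    fix n \<gamma> assume "[] @ concat (replicate n [y]) @ \<gamma> \<in> avoid A {[x, y]}" "\<not> prefix [y] \<gamma>"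
    then have "x # \<gamma> \<in> avoid A {[x, y]}"
      using avoid_append[of "concat (replicate n [y])" \<gamma>] assms(2) by (auto simp: avoid_Cons)
    then have "concat (replicate n [p]) @ x # \<gamma> \<in> avoid A {[x, y]}"
    proof (rule avoid_power_append)
      fix k assume "concat (replicate k [p]) @ x # \<gamma> \<in> avoid A {[x, y]}"
      then show "[p] @ concat (replicate k [p]) @ x # \<gamma> \<in> avoid A {[x, y]}"
        using assms by (cases k) (auto simp: avoid_Cons)
    qed
    then show "concat (replicate n [p]) @ x # [] @ \<gamma> \<in> avoid A {[x, y]}" by simp
  qed (use assms in auto)
  then show ?thesis
    using assms by (intro one_rule_head_tame[OF _ _ _ refl] unbordered_cross_section unbordered_two) auto
qed

text \<open>In the excluded case the letter \<open>q = x\<close> left behind and the travelling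
  \<open>x\<close> can form a new \<open>xxz\<close> with a following \<open>z\<close>; that
  relation is treated separately.\<close>

lemma head_tame_cascade_one_two:
  assumes "finite A" "x \<in> A" "y \<in> A" "z \<in> A" "p \<in> A" "q \<in> A" "x \<noteq> z" "\<not> (q = x \<and> y = x)"
  shows "head_tame A [x, y, z] [p, q, x] A single (avoid A {[x, y, z]})"
proof -
  have "mult_ok [x, y, z] [p, q, x] A single (avoid A {[x, y, z]}) x"
  proof (rule mult_ok_cascade[where m'="[]" and w="[y, z]" and r="[p, q]"])
    fix n \<gamma> assume "[] @ concat (replicate n [y, z]) @ \<gamma> \<in> avoid A {[x, y, z]}" "\<not> prefix [y, z] \<gamma>"
    then have "x # \<gamma> \<in> avoid A {[x, y, z]}"
      using avoid_append[of "concat (replicate n [y, z])" \<gamma>] assms(2) by (auto simp: avoid_Cons)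
    then have "concat (replicate n [p, q]) @ x # \<gamma> \<in> avoid A {[x, y, z]}"
    proof (rule avoid_power_append)
      fix k assume "concat (replicate k [p, q]) @ x # \<gamma> \<in> avoid A {[x, y, z]}"
      then show "[p, q] @ concat (replicate k [p, q]) @ x # \<gamma> \<in> avoid A {[x, y, z]}"
        using assms by (cases k) (auto simp: avoid_Cons)
    qed
    then show "concat (replicate n [p, q]) @ x # [] @ \<gamma> \<in> avoid A {[x, y, z]}" by simp
  qed (use assms in auto)
  then show ?thesis
    using assms by (intro one_rule_head_tame[OF _ _ _ refl] unbordered_cross_section unbordered_three) auto
qed

lemma head_tame_cascade_two_one:
  assumes "finite A" "x \<in> A" "y \<in> A" "z \<in> A" "p \<in> A" "x \<noteq> z" "x \<noteq> y"
  shows "head_tame A [x, y, z] [p, x, y] A single (avoid A {[x, y, z]})"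
proof -
  have "mult_ok [x, y, z] [p, x, y] A single (avoid A {[x, y, z]}) x"
  proof (rule mult_ok_cascade[where m'="[y]" and w="[z]" and r="[p]"])
    fix n \<gamma> assume "[y] @ concat (replicate n [z]) @ \<gamma> \<in> avoid A {[x, y, z]}" "\<not> prefix [z] \<gamma>"
    then have "x # y # \<gamma> \<in> avoid A {[x, y, z]}"
      using avoid_append[of "y # concat (replicate n [z])" \<gamma>] assms by (auto simp: avoid_Cons)
    then have "concat (replicate n [p]) @ x # y # \<gamma> \<in> avoid A {[x, y, z]}"
    proof (rule avoid_power_append)
      fix k assume "concat (replicate k [p]) @ x # y # \<gamma> \<in> avoid A {[x, y, z]}"
      then show "[p] @ concat (replicate k [p]) @ x # y # \<gamma> \<in> avoid A {[x, y, z]}"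
        using assms by (cases k; cases "k - 1") (auto simp: avoid_Cons)
    qed
    then show "concat (replicate n [p]) @ x # [y] @ \<gamma> \<in> avoid A {[x, y, z]}" by simp
  qed (use assms in auto)
  then show ?thesis
    using assms by (intro one_rule_head_tame[OF _ _ _ refl] unbordered_cross_section unbordered_three) auto
qed

text \<open>In the remaining case \<open>xxz = pxx\<close> the square \<open>xx\<close> passes every \<open>x\<close>, and every \<open>z\<close> at the price of turning it
  into \<open>p\<close>.\<close>

fun pass_square :: "'a \<Rightarrow> 'a \<Rightarrow> 'a \<Rightarrow> 'a list \<Rightarrow> 'a list" where
  "pass_square x z p [] = [x, x]"
| "pass_square x z p (c # \<delta>) = (if c = z then p # pass_square x z p \<delta>
     else if c = x then x # pass_square x z p \<delta> else x # x # c # \<delta>)"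

lemma head_tame_square:
  assumes A: "finite A" "x \<in> A" "z \<in> A" "p \<in> A" and xz: "x \<noteq> z"
  shows "head_tame A [x, x, z] [p, x, x] A single (avoid A {[x, x, z]})"
proof -
  let ?K = "avoid A {[x, x, z]}" and ?g = "pass_square x z p"
  let ?Bl = "{([z], [p]), ([x], [x])}"
  let ?\<tau> = "([x], [], ?Bl, [], [x, x], [x, x]) :: ('a, 'a) certificate"
  let ?\<rho> = "([], [], {}, [], [x], [x]) :: ('a, 'a) certificate"
  \<comment> \<open>For \<open>p = x\<close> the letter written last might begin a new
    \<open>xxz\<close>; two further letters \<open>x\<close> behind it prevent this.\<close>
  have two: "\<exists>r. ?g \<delta> = x # x # r" if "p = x" for \<delta>
    by (induction \<delta>) (auto simp: that)
  have g_hd: "prefix [x, z] (?g \<delta>) \<Longrightarrow> \<exists>\<delta>'. \<delta> = x # z # \<delta>'" for \<delta>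
    using xz two[of \<delta>] by (cases \<delta>; cases "tl \<delta>") (auto split: if_splits)
  have gK: "\<delta> \<in> ?K \<Longrightarrow> ?g \<delta> \<in> ?K" for \<delta>
  proof (induction \<delta>)
    case (Cons c \<delta>)
    then show ?case using A xz two[of \<delta>] g_hd[of \<delta>] by (auto simp: avoid_Cons)
  qed (use A in \<open>auto simp: avoid_Cons\<close>)
  have g_rel: "\<delta> \<in> lists A \<Longrightarrow> (\<delta>, ?g \<delta>) \<in> cert_rel A ([], [], ?Bl, [], [x, x], [x, x])" for \<delta>
  proof (induction \<delta>)
    case Nil
    then show ?case using cert_rel_stop[of "[]" A "[]" "[x, x]"] by simp
  next
    case (Cons c \<delta>)
    then show ?case
      using cert_rel_block[of "[z]" "[p]" ?Bl \<delta> "?g \<delta>"] cert_rel_block[of "[x]" "[x]" ?Bl \<delta> "?g \<delta>"]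
        cert_rel_stop[of "c # \<delta>" A "[]" "[x, x]" ?Bl] by auto
  qed
  have "mult_ok [x, x, z] [p, x, x] A single ?K x"
    unfolding mult_ok_def
  proof (intro exI[of _ "{?\<tau>, ?\<rho>}"] conjI ballI)
    fix \<tau> assume "\<tau> \<in> {?\<tau>, ?\<rho>}"
    then show "cert_ok [x, x, z] [p, x, x] A single x \<tau>"
      using A rel_cong_base[of "[x, x, z]" "[p, x, x]"] by (auto simp: cert_ok_def)
  next
    fix \<alpha> assume \<alpha>: "\<alpha> \<in> ?K"
    show "\<exists>\<beta>\<in>?K. \<exists>\<tau>\<in>{?\<tau>, ?\<rho>}. (\<alpha>, \<beta>) \<in> cert_rel A \<tau>"
    proof (cases "\<exists>\<delta>. \<alpha> = x # \<delta>")
      case True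
      then obtain \<delta> where d: "\<alpha> = x # \<delta>" by blast
      then have "\<delta> \<in> ?K" "\<delta> \<in> lists A" using \<alpha> avoid_lists[OF \<alpha>] by (auto simp: avoid_Cons)
      then have "(\<alpha>, ?g \<delta>) \<in> cert_rel A ?\<tau>" "?g \<delta> \<in> ?K"
        using cert_rel_start[OF g_rel[of \<delta>], of "[x]" "[]"] gK d by auto
      then show ?thesis by blast
    next
      case False
      then have "x # \<alpha> \<in> ?K" using \<alpha> A by (cases \<alpha>) (auto simp: avoid_Cons)
      then show ?thesis using cert_rel_stop[of \<alpha> A "[]" "[x]"] avoid_lists[OF \<alpha>] by force
    qed
  qed simp
  then show ?thesis
    using A xz by (intro one_rule_head_tame[OF _ _ _ refl] unbordered_cross_section unbordered_three) auto
qed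

text \<open>The cases are the overlaps of a suffix of the right-hand side with a prefix of the
  left-hand side: of lengths one and two at once, of length one only, of length two only, and
  none.\<close>

theorem head_tame_three_three:
  assumes A: "finite A" "{x, y, z, p, q, r} \<subseteq> A" and neq: "x \<noteq> z" "[x, y, z] \<noteq> [p, q, r]"
  shows "head_tame A [x, y, z] [p, q, r] A single (avoid A {[x, y, z]})"
proof -
  consider "r = x" "q = x" "y = x" | "r = x" "\<not> (q = x \<and> y = x)" | "q = x" "r = y" "x \<noteq> y" | "r \<noteq> x" "\<not> (q = x \<and> r = y)"
    by blast
  then show ?thesis
  proof cases
    case 1
    then show ?thesis using head_tame_square[of A x z p] A neq by simp
  next
    case 2
    then show ?thesis using head_tame_cascade_one_two[of A x y z p q] A neq by simp
  next
    case 3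
    then show ?thesis using head_tame_cascade_two_one[of A x y z p] A neq by simp
  next
    case 4
    then show ?thesis using A neq
      by (intro head_tame_no_overlap unbordered_three) (auto simp: suffix_Cons sublist_Cons_right)
  qed
qed

theorem head_tame_two_two:
  assumes A: "finite A" "{x, y, p, q} \<subseteq> A" and neq: "x \<noteq> y" "[x, y] \<noteq> [p, q]"
  shows "head_tame A [x, y] [p, q] A single (avoid A {[x, y]})"
proof (cases "q = x")
  case True
  then show ?thesis using head_tame_cascade_two[of A x y p] A neq by simp
next
  case False
  then show ?thesis using A neq
    by (intro head_tame_no_overlap unbordered_two) (auto simp: suffix_Cons sublist_Cons_right)
qed

subsection \<open>Collapsing rules\<close>

lemma padL_append_same: "padL (\<alpha> @ \<gamma>) (\<beta> @ \<gamma>) = padL \<alpha> \<beta> @ padR \<gamma> \<gamma>"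
proof -
  have "rev (padR (rev \<gamma>) (rev \<gamma>)) = padR \<gamma> \<gamma>" for \<gamma> :: "'a list"
  proof -
    have *: "padR \<alpha> \<alpha> = map (\<lambda>x. (Some x, Some x)) \<alpha>" for \<alpha> :: "'a list" by (induction \<alpha>) auto
    show ?thesis by (simp add: * rev_map)
  qed
  then show ?thesis by (simp add: padL_eq_rev padR_append_same_length)
qed

lemma regular_padL_Times:
  assumes "regular B K" "regular B L"
  shows "regular (pad_alph B) {padL \<alpha> \<beta> | \<alpha> \<beta>. \<alpha> \<in> K \<and> \<beta> \<in> L}"
proof -
  have "{padL \<alpha> \<beta> | \<alpha> \<beta>. \<alpha> \<in> K \<and> \<beta> \<in> L} = rev ` {padR \<alpha> \<beta> | \<alpha> \<beta>. \<alpha> \<in> rev ` K \<and> \<beta> \<in> rev ` L}"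
    by (force simp: padL_eq_rev image_iff)
  then show ?thesis using regular_rev[OF regular_padR_Times[OF regular_rev[OF assms(1)] regular_rev[OF assms(2)]]] by simp
qed

text \<open>Here \<open>x # m'\<close> absorbs any power of \<open>w\<close>, so a word may be
  longer than its product by an unbounded amount, and the relation need not be tame. The two words
  still agree behind the absorbed power. Left padding aligns this common remainder, and in front of
  it a regular language is paired with a single word.\<close>

lemma head_regular_collapse:
  assumes A: "finite A" and uv: "u \<in> lists A" "u = x # m' @ w" "v = x # m'" "w \<noteq> []"
    and cross: "cross_section u v single (avoid A {u})"
    and closed: "\<And>n \<gamma>. m' @ concat (replicate n w) @ \<gamma> \<in> avoid A {u} \<Longrightarrow> \<not> prefix w \<gamma> \<Longrightarrow>
      x # m' @ \<gamma> \<in> avoid A {u}"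
  shows "head_regular A u v A single (avoid A {u})"
proof -
  let ?K = "avoid A {u}"
  let ?T1 = "{(m' @ concat (replicate n w) @ \<gamma>, x # m' @ \<gamma>) | n \<gamma>. \<gamma> \<in> lists A}"
  let ?T2 = "{(\<gamma>, x # \<gamma>) | \<gamma>. \<gamma> \<in> lists A}"
  have v: "v \<in> lists A" using uv by auto
  have reg: "regular A ?K" using A uv(1) by (intro regular_avoid_finite) auto
  have "regular A {concat (replicate n w) | n. True}" using A uv by (intro regular_power_star) auto
  then have "regular A (conc {m'} {concat (replicate n w) | n. True})" 
    using A uv by (intro regular_conc[OF regular_finite]) auto
  moreover have "conc {m'} {concat (replicate n w) | n. True} = {m' @ concat (replicate n w) | n. True}"
    by (auto simp: conc_def)
  ultimately have "regular (pad_alph A) {padL \<alpha> \<beta> | \<alpha> \<beta>. \<alpha> \<in> {m' @ concat (replicate n w) | n. True} \<and> \<beta> \<in> {x # m'}}"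
    using A uv by (intro regular_padL_Times[OF _ regular_finite]) auto
  note r1 = regular_conc[OF this regular_padR_Id[OF regular_lists[OF A]]]
  have T1: "regular (pad_alph A) {padL \<alpha> \<beta> | \<alpha> \<beta>. (\<alpha>, \<beta>) \<in> ?T1}"
  proof -
    have "conc {padL \<alpha> \<beta> | \<alpha> \<beta>. \<alpha> \<in> {m' @ concat (replicate n w) | n. True} \<and> \<beta> \<in> {x # m'}} {padR \<alpha> \<alpha> | \<alpha>. \<alpha> \<in> lists A}
      = {padL \<alpha> \<beta> | \<alpha> \<beta>. (\<alpha>, \<beta>) \<in> ?T1}" (is "?X = ?Y")
    proof (intro set_eqI iffI)
      fix z assume "z \<in> ?X"
      then obtain n \<gamma> where "z = padL (m' @ concat (replicate n w)) (x # m') @ padR \<gamma> \<gamma>" "\<gamma> \<in> lists A"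
        unfolding conc_def by blast
      then have "z = padL (m' @ concat (replicate n w) @ \<gamma>) (x # m' @ \<gamma>)" "\<gamma> \<in> lists A"
        using padL_append_same[of "m' @ concat (replicate n w)" \<gamma> "x # m'"] by simp_all
      then show "z \<in> ?Y" by blast
    next
      fix z assume "z \<in> ?Y"
      then obtain n \<gamma> where "z = padL (m' @ concat (replicate n w) @ \<gamma>) (x # m' @ \<gamma>)" "\<gamma> \<in> lists A" by blast
      then have "z = padL (m' @ concat (replicate n w)) (x # m') @ padR \<gamma> \<gamma>" "\<gamma> \<in> lists A"
        using padL_append_same[of "m' @ concat (replicate n w)" \<gamma> "x # m'"] by simp_all
      then show "z \<in> ?X" unfolding conc_def by blast
    qed
    with r1 show ?thesis by (simp only:)
  qed
  have "tame A ?T2"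
    using tame_prepend[OF tame_Id[OF A], of "[]" "[x]"] uv by (auto elim!: back_subst[of "tame A"])
  then have T2: "regular (pad_alph A) {padL \<alpha> \<beta> | \<alpha> \<beta>. (\<alpha>, \<beta>) \<in> ?T2}" by (rule tame_regular_padL)
  have eq: "rel_cong u v (x # m' @ concat (replicate n w)) (x # m')" for n
  proof (induction n)
    case (Suc n)
    have "rel_cong u v (u @ concat (replicate n w)) (v @ concat (replicate n w))"
      by (rule rel_cong_append_right[OF rel_cong_base])
    then show ?case using Suc.IH rel_cong_trans by (simp add: uv)
  qed simp
  have "[x] @ m' = x # m'" by simp
  have tot: "\<exists>\<beta>\<in>?K. (\<alpha>, \<beta>) \<in> ?T1 \<union> ?T2" if \<alpha>: "\<alpha> \<in> ?K" for \<alpha>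
  proof (cases "prefix m' \<alpha>")
    case True
    then obtain \<delta> where d: "\<alpha> = m' @ \<delta>" by (auto simp: prefix_def)
    obtain n \<gamma> where g: "\<delta> = concat (replicate n w) @ \<gamma>" "\<not> prefix w \<gamma>"
      using power_prefix_max[OF uv(4)] by blast
    have "\<gamma> \<in> lists A" using avoid_lists[OF \<alpha>] d g by auto
    then have "(\<alpha>, x # m' @ \<gamma>) \<in> ?T1" unfolding d g by blast
    moreover have "x # m' @ \<gamma> \<in> ?K" using closed[of n \<gamma>] \<alpha> g d by simp
    ultimately show ?thesis by (intro bexI[of _ "x # m' @ \<gamma>"] UnI1)
  next
    case False
    then have "x # \<alpha> \<in> ?K" using \<alpha> uv by (auto simp: avoid_Cons prefix_def)
    moreover have "(\<alpha>, x # \<alpha>) \<in> ?T2" using avoid_lists[OF \<alpha>] by blast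
    ultimately show ?thesis by (intro bexI[of _ "x # \<alpha>"] UnI2)
  qed
  have sound: "rel_cong u v (single x @ vals single \<alpha>) (vals single \<beta>)" if "(\<alpha>, \<beta>) \<in> ?T1 \<union> ?T2" for \<alpha> \<beta>
  proof (cases "(\<alpha>, \<beta>) \<in> ?T1")
    case True
    then obtain n \<gamma> where "\<alpha> = m' @ concat (replicate n w) @ \<gamma>" "\<beta> = x # m' @ \<gamma>" by blast
    then show ?thesis using rel_cong_append_right[OF eq[of n], of \<gamma>] by simp
  next
    case False
    then have "\<beta> = x # \<alpha>" using that by blast
    then show ?thesis by simp
  qed
  have x: "head_rel u v single ?K x = (?T1 \<union> ?T2) \<inter> ?K \<times> ?K"
    by (rule head_rel_eq[OF cross sound tot])
  have "{padL \<alpha> \<beta> | \<alpha> \<beta>. (\<alpha>, \<beta>) \<in> head_rel u v single ?K x} =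
    ({padL \<alpha> \<beta> | \<alpha> \<beta>. (\<alpha>, \<beta>) \<in> ?T1} \<union> {padL \<alpha> \<beta> | \<alpha> \<beta>. (\<alpha>, \<beta>) \<in> ?T2}) \<inter> {padL \<alpha> \<beta> | \<alpha> \<beta>. \<alpha> \<in> ?K \<and> \<beta> \<in> ?K}"
  proof -
    have "{padL \<alpha> \<beta> | \<alpha> \<beta>. (\<alpha>, \<beta>) \<in> (R \<union> S) \<inter> ?K \<times> ?K} =
     ({padL \<alpha> \<beta> | \<alpha> \<beta>. (\<alpha>, \<beta>) \<in> R} \<union> {padL \<alpha> \<beta> | \<alpha> \<beta>. (\<alpha>, \<beta>) \<in> S}) \<inter> {padL \<alpha> \<beta> | \<alpha> \<beta>. \<alpha> \<in> ?K \<and> \<beta> \<in> ?K}" for R S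
      by auto
    then show ?thesis unfolding x .
  qed
  then have rx: "regular (pad_alph A) {padL \<alpha> \<beta> | \<alpha> \<beta>. (\<alpha>, \<beta>) \<in> head_rel u v single ?K x}"
    using regular_Int[OF regular_Un[OF T1 T2] regular_padL_Times[OF reg reg]] by simp
  have ok: "mult_ok u v A single ?K b" if "b \<in> A" "b \<noteq> x" for b
    using that uv by (intro mult_ok_Cons) (auto intro!: avoid_lists simp: avoid_Cons)
  have rb: "regular (pad_alph A) {padL \<alpha> \<beta> | \<alpha> \<beta>. (\<alpha>, \<beta>) \<in> head_rel u v single ?K b}" if "b \<in> A" for b
  proof (cases "b = x")
    case False
    then show ?thesis using tame_regular_padL[OF mult_ok_tame(1)[OF ok cross reg]] that by blast
  qed (use rx in simp)
  have tb: "\<exists>\<beta>\<in>?K. rel_cong u v (single b @ vals single \<alpha>) (vals single \<beta>)" if "b \<in> A" "\<alpha> \<in> ?K" for b \<alpha>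
  proof (cases "b = x")
    case True
    then show ?thesis using tot[OF that(2)] sound by blast
  next
    case False
    then show ?thesis using mult_ok_tame(2)[OF ok cross reg] that by blast
  qed
  show ?thesis unfolding head_regular_def head_base_def
    using uv(1) v A reg cross rb tb uv(2) by (auto simp: avoid_Cons simp del: in_lists_conv_set)
qed

lemma head_regular_collapse_two:
  assumes "finite A" "x \<in> A" "y \<in> A" "x \<noteq> y"
  shows "head_regular A [x, y] [x] A single (avoid A {[x, y]})"
proof (rule head_regular_collapse[where m'="[]" and w="[y]"])
  fix n \<gamma> assume "[] @ concat (replicate n [y]) @ \<gamma> \<in> avoid A {[x, y]}" "\<not> prefix [y] \<gamma>"
  then show "x # [] @ \<gamma> \<in> avoid A {[x, y]}"
    using avoid_append[of "concat (replicate n [y])" \<gamma>] assms by (auto simp: avoid_Cons)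
qed (use assms in \<open>auto intro: unbordered_cross_section unbordered_two\<close>)

lemma head_regular_collapse_three_one:
  assumes "finite A" "x \<in> A" "y \<in> A" "z \<in> A" "x \<noteq> z"
  shows "head_regular A [x, y, z] [x] A single (avoid A {[x, y, z]})"
proof (rule head_regular_collapse[where m'="[]" and w="[y, z]"])
  fix n \<gamma> assume "[] @ concat (replicate n [y, z]) @ \<gamma> \<in> avoid A {[x, y, z]}" "\<not> prefix [y, z] \<gamma>"
  then show "x # [] @ \<gamma> \<in> avoid A {[x, y, z]}"
    using avoid_append[of "concat (replicate n [y, z])" \<gamma>] assms by (auto simp: avoid_Cons)
qed (use assms in \<open>auto intro: unbordered_cross_section unbordered_three\<close>)

lemma head_regular_collapse_three_two:
  assumes "finite A" "x \<in> A" "y \<in> A" "z \<in> A" "x \<noteq> z" "x \<noteq> y"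
  shows "head_regular A [x, y, z] [x, y] A single (avoid A {[x, y, z]})"
proof (rule head_regular_collapse[where m'="[y]" and w="[z]"])
  fix n \<gamma> assume "[y] @ concat (replicate n [z]) @ \<gamma> \<in> avoid A {[x, y, z]}" "\<not> prefix [z] \<gamma>"
  then show "x # [y] @ \<gamma> \<in> avoid A {[x, y, z]}"
    using avoid_append[of "y # concat (replicate n [z])" \<gamma>] assms by (auto simp: avoid_Cons)
qed (use assms in \<open>auto intro: unbordered_cross_section unbordered_three\<close>)

subsection \<open>Rules without cascades\<close>

definition rule_head :: "'a list \<Rightarrow> 'a list \<Rightarrow> 'a \<Rightarrow> 'a list \<Rightarrow> 'a list" where
  "rule_head u v c \<alpha> = (if prefix u (c # \<alpha>) then v @ drop (length u) (c # \<alpha>) else c # \<alpha>)"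

text \<open>This version also admits a left-hand side with borders: the cross-section comes from the
  action by head rewriting, and \<open>rel\<close> is the check that overlaps of \<open>u\<close>
  with itself are resolved.\<close>

lemma bounded_head_tame:
  assumes A: "finite A" and uv: "u \<in> lists A" "v \<in> lists A" "u = x # u'"
    and closed: "\<And>\<gamma>. u' @ \<gamma> \<in> avoid A {u} \<Longrightarrow> v @ \<gamma> \<in> avoid A {u}"
    and rel: "\<And>\<alpha>. \<alpha> \<in> avoid A {u} \<Longrightarrow> foldr (rule_head u v) u \<alpha> = foldr (rule_head u v) v \<alpha>"
  shows "head_tame A u v A single (avoid A {u})"
proof -
  let ?K = "avoid A {u}" and ?f = "rule_head u v"
  have "cross_section u v single ?K"
  proof (rule action_cross_section[where f="?f" and inc="\<lambda>a. a" and A=A and B=A])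
    show "?K \<subseteq> lists A" using avoid_lists by blast
    fix b \<alpha> assume "b \<in> A" "\<alpha> \<in> ?K"
    then show "?f b \<alpha> \<in> ?K" using closed uv(3) by (auto simp: rule_head_def avoid_Cons prefix_def)
  qed (use uv rel in \<open>auto simp: avoid_Cons rule_head_def\<close>)
  then show ?thesis using mult_ok_bounded[OF uv closed] by (intro one_rule_head_tame[OF A uv])
qed

lemma head_tame_power:
  assumes "finite A" "x \<in> A"
  shows "head_tame A [x, x] [] A single (avoid A {[x, x]})"
    "head_tame A [x, x] [x] A single (avoid A {[x, x]})"
    "head_tame A [x, x, x] [] A single (avoid A {[x, x, x]})"
    "head_tame A [x, x, x] [x] A single (avoid A {[x, x, x]})"
    "head_tame A [x, x, x] [x, x] A single (avoid A {[x, x, x]})"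
proof -
  have 2: "foldr (rule_head [x, x] v) [x, x] \<alpha> = foldr (rule_head [x, x] v) v \<alpha>"
    if "\<alpha> \<in> avoid A {[x, x]}" "v \<in> {[], [x]}" for \<alpha> v
    using that by (cases \<alpha>; cases "tl \<alpha>") (auto simp: rule_head_def avoid_Cons)
  have 3: "foldr (rule_head [x, x, x] v) [x, x, x] \<alpha> = foldr (rule_head [x, x, x] v) v \<alpha>"
    if "\<alpha> \<in> avoid A {[x, x, x]}" "v \<in> {[], [x], [x, x]}" for \<alpha> v
  proof -
    obtain n \<delta> where d: "\<alpha> = concat (replicate n [x]) @ \<delta>" "\<not> prefix [x] \<delta>"
      using power_prefix_max[of "[x]" \<alpha>] by auto
    have "\<not> prefix [x, x] \<delta>" "\<not> prefix [x, x, x] \<delta>" using d(2) by (cases \<delta>; auto)+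
    moreover have "n = 0 \<or> n = 1 \<or> n = 2"
    proof (rule ccontr)
      assume "\<not> ?thesis"
      then obtain k where "n = Suc (Suc (Suc k))" by (metis One_nat_def Suc_1 not0_implies_Suc)
      then show False using that(1) d(1) by (simp add: avoid_Cons)
    qed
    ultimately show ?thesis using d that(2) by (auto simp: rule_head_def numeral_2_eq_2)
  qed
  show "head_tame A [x, x] [] A single (avoid A {[x, x]})" "head_tame A [x, x] [x] A single (avoid A {[x, x]})"
    using assms 2 by (auto intro!: bounded_head_tame simp: avoid_Cons)
  show "head_tame A [x, x, x] [] A single (avoid A {[x, x, x]})" "head_tame A [x, x, x] [x] A single (avoid A {[x, x, x]})"
    "head_tame A [x, x, x] [x, x] A single (avoid A {[x, x, x]})"
    using assms 3 by (auto intro!: bounded_head_tame simp: avoid_Cons)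
qed

lemma head_tame_sandwich:
  assumes "finite A" "x \<in> A" "y \<in> A" "x \<noteq> y"
  shows "head_tame A [x, y, x] [x] A single (avoid A {[x, y, x]})"
    "head_tame A [x, y, x] [x, x] A single (avoid A {[x, y, x]})"
    "q \<in> A \<Longrightarrow> q \<noteq> y \<Longrightarrow> head_tame A [x, y, x] [x, q, x] A single (avoid A {[x, y, x]})"
proof -
  have *: "foldr (rule_head [x, y, x] v) [x, y, x] \<alpha> = foldr (rule_head [x, y, x] v) v \<alpha>"
    if "v = [x] \<or> v = [x, x] \<or> v = [x, q, x]" "q \<noteq> y" for \<alpha> v q
    using that assms(4) by (cases \<alpha>; cases "tl \<alpha>") (auto simp: rule_head_def)
  show "head_tame A [x, y, x] [x] A single (avoid A {[x, y, x]})"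
    "head_tame A [x, y, x] [x, x] A single (avoid A {[x, y, x]})"
    using assms *[of _ x] by (auto intro!: bounded_head_tame simp: avoid_Cons)
  show "head_tame A [x, y, x] [x, q, x] A single (avoid A {[x, y, x]})" if "q \<in> A" "q \<noteq> y"
    using assms *[of _ q] that by (auto intro!: bounded_head_tame simp: avoid_Cons)
qed

text \<open>The relation merely defines \<open>p\<close>: the monoid is free on the remaining
  letters, and multiplication by \<open>p\<close> prepends the fixed word \<open>w\<close>.\<close>

lemma head_tame_eliminate:
  assumes "finite A" "p \<in> A" "w \<in> lists A" "p \<notin> set w"
  shows "head_tame A [p] w A single (avoid A {[p]})"
proof (rule bounded_head_tame[OF assms(1) _ assms(3) refl])
  have w: "foldr (rule_head [p] w) w' \<alpha> = w' @ \<alpha>" if "p \<notin> set w'" for w' \<alpha>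
    using that by (induction w') (auto simp: rule_head_def)
  show "foldr (rule_head [p] w) [p] \<alpha> = foldr (rule_head [p] w) w \<alpha>" for \<alpha>
    using w[OF assms(4)] by (simp add: rule_head_def)
  fix \<gamma> assume "[] @ \<gamma> \<in> avoid A {[p]}"
  then show "w @ \<gamma> \<in> avoid A {[p]}" using assms(3,4) by (induction w) (auto simp: avoid_Cons)
qed (use assms in auto)

lemma head_tame_free:
  assumes "finite A" "u \<in> lists A"
  shows "head_tame A u u A single (avoid A {})"
proof (rule head_tameI)
  show "cross_section u u single (avoid A {})"
    unfolding cross_section_def using rel_cong_invariant[of u u _ _ "\<lambda>x. x"] by auto
  show "regular A (avoid A {})" using assms by (intro regular_avoid_finite) auto
  show "mult_ok u u A single (avoid A {}) b" if "b \<in> A" for b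
    using that by (intro mult_ok_Cons) (auto simp: avoid_Cons avoid_def)
qed (use assms in \<open>auto simp: avoid_Cons\<close>)

section \<open>Systems with an additional generator\<close>

subsection \<open>Head multiplication by passing through a word\<close>

fun stops :: "('b list \<times> 'b list) list \<Rightarrow> 'b list \<Rightarrow> 'b list" where
  "stops [] \<alpha> = \<alpha>"
| "stops ((s, t) # ps) \<alpha> = (if prefix s \<alpha> then t @ drop (length s) \<alpha> else stops ps \<alpha>)"

text \<open>Empty blocks are never picked, so that \<open>casc\<close>, which removes the picked
  block from its argument, terminates.\<close>

fun pick :: "('b list \<times> 'b list) list \<Rightarrow> 'b list \<Rightarrow> ('b list \<times> 'b list) option" where
  "pick [] \<alpha> = None"
| "pick ((x, y) # gs) \<alpha> = (if x \<noteq> [] \<and> prefix x \<alpha> then Some (x, y) else pick gs \<alpha>)"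

lemma pick_SomeD: "pick gs \<alpha> = Some (x, y) \<Longrightarrow> (x, y) \<in> set gs \<and> x \<noteq> [] \<and> prefix x \<alpha>"
  by (induction gs \<alpha> rule: pick.induct) (auto split: if_splits)

function casc :: "('b list \<times> 'b list) list \<Rightarrow> ('b list \<times> 'b list) list \<Rightarrow> 'b list \<Rightarrow> 'b list" where
  "casc gs ps \<alpha> = (case pick gs \<alpha> of Some (x, y) \<Rightarrow> y @ casc gs ps (drop (length x) \<alpha>) | None \<Rightarrow> stops ps \<alpha>)"
  by auto
termination
proof (relation "measure (\<lambda>(gs, ps, \<alpha>). length \<alpha>)")
  fix gs ps \<alpha> p x y assume "pick gs \<alpha> = Some p" "(x, y) = p"
  then have "x \<noteq> []" "prefix x \<alpha>" using pick_SomeD[of gs \<alpha> x y] by auto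
  then show "((gs, ps, drop (length x) \<alpha>), gs, ps, \<alpha>) \<in> measure (\<lambda>(gs, ps, \<alpha>). length \<alpha>)"
    by (auto simp: prefix_def)
qed simp

declare casc.simps [simp del]

lemma casc_Nil [simp]: "casc gs ps [] = stops ps []"
proof -
  have "pick gs [] = None" by (induction gs "[] :: 'a list" rule: pick.induct) auto
  then show ?thesis by (simp add: casc.simps)
qed

lemma casc_Cons [simp]: "casc gs ps (c # \<alpha>) =
    (case pick gs (c # \<alpha>) of Some (x, y) \<Rightarrow> y @ casc gs ps (drop (length x) (c # \<alpha>)) | None \<Rightarrow> stops ps (c # \<alpha>))"
  by (rule casc.simps)

lemma casc_no_blocks [simp]: "casc [] ps \<alpha> = stops ps \<alpha>"
  by (simp add: casc.simps)

text \<open>An entry \<open>(s', t', m, gs, ps)\<close> bundles certificates into a function: of several entries the first with a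
  matching \<open>s'\<close> is chosen, then \<open>m\<close> passes blocks from \<open>gs\<close> as long as possible and is absorbed by the first
  matching stop in \<open>ps\<close>.\<close>

type_synonym ('a, 'b) entry =
  "'b list \<times> 'b list \<times> 'a list \<times> ('b list \<times> 'b list) list \<times> ('b list \<times> 'b list) list"

fun run :: "('a, 'b) entry list \<Rightarrow> 'b list \<Rightarrow> 'b list" where
  "run [] \<alpha> = \<alpha>"
| "run ((s, t, m, gs, ps) # es) \<alpha> = (if prefix s \<alpha> then t @ casc gs ps (drop (length s) \<alpha>) else run es \<alpha>)"

text \<open>A plain replacement at the head: the travelling word is empty and is absorbed at
  once.\<close>

abbreviation simple :: "'b list \<Rightarrow> 'b list \<Rightarrow> ('a, 'b) entry" where
  "simple s t \<equiv> (s, t, [], [], [([], [])])"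

text \<open>The stop with an empty first component lets the travelling word come to rest anywhere.
  In the same way \<open>entries_ok\<close> demands an entry with empty \<open>s'\<close>. Together
  they ensure that \<open>run\<close> is described by a certificate on every word.\<close>

definition entry_ok :: "'a list \<Rightarrow> 'a list \<Rightarrow> 'b set \<Rightarrow> ('b \<Rightarrow> 'a list) \<Rightarrow> 'b \<Rightarrow> ('a, 'b) entry \<Rightarrow> bool" where
  "entry_ok u v B val b = (\<lambda>(s', t', m, gs, ps). s' \<in> lists B \<and> t' \<in> lists B \<and>
     (\<forall>(x, y)\<in>set gs. x \<in> lists B \<and> y \<in> lists B \<and> length x = length y \<and> rel_cong u v (m @ vals val x) (vals val y @ m)) \<and>
     (\<forall>(s, t)\<in>set ps. s \<in> lists B \<and> t \<in> lists B \<and> rel_cong u v (m @ vals val s) (vals val t)) \<and>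
     (\<exists>t. ([], t) \<in> set ps) \<and> rel_cong u v (val b @ vals val s') (vals val t' @ m))"

definition entries_ok :: "'a list \<Rightarrow> 'a list \<Rightarrow> 'b set \<Rightarrow> ('b \<Rightarrow> 'a list) \<Rightarrow> 'b \<Rightarrow> ('a, 'b) entry list \<Rightarrow> bool" where
  "entries_ok u v B val b es \<longleftrightarrow> (\<forall>e\<in>set es. entry_ok u v B val b e) \<and> (\<exists>e\<in>set es. fst e = [])"

lemma stops_cert:
  assumes "([], t0) \<in> set ps" "\<alpha> \<in> lists B"
  shows "\<exists>(s, t)\<in>set ps. (\<alpha>, stops ps \<alpha>) \<in> cert_rel B ([], [], Bl, s, t, m)"
  using assms(1)
proof (induction ps)
  case (Cons p ps)
  obtain s t where p: "p = (s, t)" by (cases p)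
  show ?case
  proof (cases "prefix s \<alpha>")
    case True
    then obtain \<gamma> where "\<alpha> = s @ \<gamma>" by (auto simp: prefix_def)
    then show ?thesis using cert_rel_stop[of \<gamma> B s t Bl m] assms(2) p by auto
  next
    case False
    then have "([], t0) \<in> set ps" using Cons.prems p by auto
    then show ?thesis using Cons.IH False p by auto
  qed
qed simp

lemma casc_cert:
  assumes "([], t0) \<in> set ps" "\<alpha> \<in> lists B"
  shows "\<exists>(s, t)\<in>set ps. (\<alpha>, casc gs ps \<alpha>) \<in> cert_rel B ([], [], set gs, s, t, m)"
  using assms
proof (induction gs ps \<alpha> rule: casc.induct)
  case (1 gs ps \<alpha>)
  show ?case
  proof (cases "pick gs \<alpha>")
    case None
    then show ?thesis using stops_cert[OF 1(2,3)] by (simp add: casc.simps)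
  next
    case (Some p)
    obtain x y where p: "p = (x, y)" by (cases p)
    have xy: "(x, y) \<in> set gs" "prefix x \<alpha>" using pick_SomeD[of gs \<alpha> x y] Some p by auto
    then obtain \<gamma> where g: "\<alpha> = x @ \<gamma>" by (auto simp: prefix_def)
    then have "drop (length x) \<alpha> = \<gamma>" "\<gamma> \<in> lists B" using 1(3) by auto
    then obtain s t where "(s, t) \<in> set ps" "(\<gamma>, casc gs ps \<gamma>) \<in> cert_rel B ([], [], set gs, s, t, m)"
      using 1(1)[OF Some p[symmetric] 1(2)] by auto
    then have "(x @ \<gamma>, y @ casc gs ps \<gamma>) \<in> cert_rel B ([], [], set gs, s, t, m)"
      by (intro cert_rel_block[OF xy(1)])
    moreover have "casc gs ps \<alpha> = y @ casc gs ps \<gamma>"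
      by (subst casc.simps) (simp add: Some p \<open>drop (length x) \<alpha> = \<gamma>\<close>)
    ultimately show ?thesis using \<open>(s, t) \<in> set ps\<close> g by auto
  qed
qed

lemma run_cert:
  assumes "\<And>e. e \<in> set es \<Longrightarrow> entry_ok u v B val b e" "\<exists>e\<in>set es. fst e = []" "\<alpha> \<in> lists B"
  shows "\<exists>(s', t', m, gs, ps)\<in>set es. \<exists>(s, t)\<in>set ps. (\<alpha>, run es \<alpha>) \<in> cert_rel B (s', t', set gs, s, t, m)"
  using assms(1,2)
proof (induction es)
  case (Cons e es)
  obtain s' t' m gs ps where e: "e = (s', t', m, gs, ps)" by (cases e)
  show ?case
  proof (cases "prefix s' \<alpha>")
    case True
    then obtain \<gamma> where g: "\<alpha> = s' @ \<gamma>" by (auto simp: prefix_def)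
    then have "\<gamma> \<in> lists B" using assms(3) by auto
    moreover obtain t0 where "([], t0) \<in> set ps" using Cons.prems(1)[of e] by (auto simp: e entry_ok_def)
    ultimately obtain s t where st: "(s, t) \<in> set ps" "(\<gamma>, casc gs ps \<gamma>) \<in> cert_rel B ([], [], set gs, s, t, m)"
      using casc_cert[of t0 ps \<gamma> B gs m] by auto
    from cert_rel_start[OF this(2), of s' t'] st(1) show ?thesis using True by (auto simp: e g)
  next
    case False
    then have "\<exists>e\<in>set es. fst e = []" using Cons.prems(2) e by auto
    then show ?thesis using Cons.IH Cons.prems(1) False by (auto simp: e)
  qed
qed simp

lemma mult_ok_run:
  assumes ok: "entries_ok u v B val b es" and K: "K \<subseteq> lists B" and closed: "\<And>\<alpha>. \<alpha> \<in> K \<Longrightarrow> run es \<alpha> \<in> K"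
  shows "mult_ok u v B val K b"
proof -
  let ?Ts = "\<Union>e\<in>set es. (case e of (s', t', m, gs, ps) \<Rightarrow> (\<lambda>(s, t). (s', t', set gs, s, t, m)) ` set ps)"
  have es: "\<And>e. e \<in> set es \<Longrightarrow> entry_ok u v B val b e" "\<exists>e\<in>set es. fst e = []"
    using ok by (auto simp: entries_ok_def)
  have "finite ?Ts" by (intro finite_UN_I) (auto split: prod.splits)
  moreover have "cert_ok u v B val b \<tau>" if "\<tau> \<in> ?Ts" for \<tau>
  proof -
    from that obtain e where e: "e \<in> set es" "\<tau> \<in> (case e of (s', t', m, gs, ps) \<Rightarrow> (\<lambda>(s, t). (s', t', set gs, s, t, m)) ` set ps)"
      by blast
    obtain s' t' m gs ps where e': "e = (s', t', m, gs, ps)" by (cases e)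
    obtain s t where "\<tau> = (s', t', set gs, s, t, m)" "(s, t) \<in> set ps" using e(2) by (auto simp: e')
    then show ?thesis using es(1)[OF e(1)] by (auto simp: e' entry_ok_def cert_ok_def)
  qed
  moreover have "\<exists>\<beta>\<in>K. \<exists>\<tau>\<in>?Ts. (\<alpha>, \<beta>) \<in> cert_rel B \<tau>" if \<alpha>: "\<alpha> \<in> K" for \<alpha>
  proof -
    obtain s' t' m gs ps s t where "(s', t', m, gs, ps) \<in> set es" "(s, t) \<in> set ps"
      "(\<alpha>, run es \<alpha>) \<in> cert_rel B (s', t', set gs, s, t, m)"
      using run_cert[OF es, of \<alpha>] \<alpha> K by fast
    moreover from this(1,2) have "(s', t', set gs, s, t, m) \<in> ?Ts" by force
    ultimately show ?thesis using closed[OF \<alpha>] by blast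
  qed
  ultimately show ?thesis unfolding mult_ok_def by (intro exI[of _ ?Ts] conjI ballI)
qed

section \<open>Alphabets with one letter added for a word\<close>

definition ext :: "'a set \<Rightarrow> 'a option set" where "ext A = insert None (Some ` A)"

definition extval :: "'a list \<Rightarrow> 'a option \<Rightarrow> 'a list" where "extval d = case_option d (\<lambda>a. [a])"

lemma ext_simps [simp]: "None \<in> ext A" "Some a \<in> ext A \<longleftrightarrow> a \<in> A"
  by (auto simp: ext_def)

lemma extval_simps [simp]: "extval d None = d" "extval d (Some a) = [a]"
  by (simp_all add: extval_def)

lemma finite_ext: "finite A \<Longrightarrow> finite (ext A)"
  by (simp add: ext_def)

lemma entries_ok_default: "b \<in> B \<Longrightarrow> entries_ok u v B val b [simple [] [b]]"
  by (simp add: entries_ok_def entry_ok_def)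

text \<open>The entries in \<open>es\<close> compute head multiplication on the words avoiding
  \<open>F\<close>, where \<open>None\<close> is the added letter and \<open>d\<close> its value.
  The cross-section property is kept out of the assumptions because it can come either from the
  action \<open>run\<close> itself or, for palindromes, from the mirrored system.\<close>

locale extended =
  fixes A :: "'a set" and u v d :: "'a list" and F :: "'a option list set" and es :: "'a option \<Rightarrow> ('a, 'a option) entry list"
  assumes fin: "finite A" and words: "u \<in> lists A" "v \<in> lists A" "d \<in> lists A"
    and F: "finite F" "F \<subseteq> lists (ext A)" "[] \<notin> F"
    and entries: "\<And>b. b \<in> ext A \<Longrightarrow> entries_ok u v (ext A) (extval d) b (es b)"
    and closed: "\<And>b \<alpha>. b \<in> ext A \<Longrightarrow> \<alpha> \<in> avoid (ext A) F \<Longrightarrow> run (es b) \<alpha> \<in> avoid (ext A) F"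
begin

abbreviation "K \<equiv> avoid (ext A) F"

lemma head_tame:
  assumes "cross_section u v (extval d) K"
  shows "head_tame A u v (ext A) (extval d) K"
proof (rule head_tameI[OF words(1,2)])
  show "extval d b \<in> lists A" if "b \<in> ext A" for b using that words(3) by (cases b) auto
  show "\<exists>b\<in>ext A. extval d b = [a]" if "a \<in> A" for a using that by (intro bexI[of _ "Some a"]) auto
  show "regular (ext A) K" using fin F by (intro regular_avoid_finite finite_ext)
  show "mult_ok u v (ext A) (extval d) K b" if "b \<in> ext A" for b
    by (rule mult_ok_run[OF entries[OF that] _ closed[OF that]]) (use avoid_lists in blast)
qed (use F(3) assms in \<open>auto simp: avoid_Cons\<close>)

lemma cross_section:
  assumes cons: "\<And>b \<alpha>. b # \<alpha> \<in> K \<Longrightarrow> run (es b) \<alpha> = b # \<alpha>"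
    and rel: "\<And>\<alpha>. \<alpha> \<in> K \<Longrightarrow> foldr (\<lambda>b. run (es b)) (map Some u) \<alpha> = foldr (\<lambda>b. run (es b)) (map Some v) \<alpha>"
    and new: "\<And>\<alpha>. \<alpha> \<in> K \<Longrightarrow> run (es None) \<alpha> = foldr (\<lambda>b. run (es b)) (map Some d) \<alpha>"
  shows "cross_section u v (extval d) K"
proof (rule action_cross_section[where f="\<lambda>b. run (es b)" and inc=Some and A=A and B="ext A"])
  show "K \<subseteq> lists (ext A)" using avoid_lists by blast
  show "extval d b \<in> lists A" if "b \<in> ext A" for b using that words(3) by (cases b) auto
  show "run (es b) \<alpha> = foldr (\<lambda>b. run (es b)) (map Some (extval d b)) \<alpha>" if "b \<in> ext A" "\<alpha> \<in> K" for b \<alpha>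
    using that new by (cases b) auto
qed (use words F(3) closed cons rel in \<open>auto simp: avoid_Cons\<close>)

end

subsection \<open>Relations requiring one-sided systems\<close>

abbreviation (input) N :: "'a option" where "N \<equiv> None"

text \<open>\<open>bba = ab\<close>: with \<open>N = ba\<close>, multiplication by \<open>b\<close> is the addition of one in binary notation.\<close>

lemma head_tame_bba_ab:
  assumes A: "finite A" "a \<in> A" "b \<in> A" "a \<noteq> b"
  shows "\<exists>K. head_tame A [b, b, a] [a, b] (ext A) (extval [b, a]) K"
proof -
  define fb where "fb = casc [([N], [Some a])] [([Some a], [N]), ([], [Some b])]"
  define es where "es c = (if c = Some b then
      [([], [], [b], [([N], [Some a])], [([Some a], [N]), ([], [Some b])])] else [simple [] [c]])" for c
  have fb: "fb [] = [Some b]" "fb (c # \<gamma>) = (if c = N then Some a # fb \<gamma> else if c = Some a then N # \<gamma> else Some b # c # \<gamma>)" for c \<gamma>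
    by (simp_all add: fb_def)
  have run: "run (es c) \<alpha> = (if c = Some b then fb \<alpha> else c # \<alpha>)" for c \<alpha>
    by (simp add: es_def fb_def)
  let ?F = "{[Some b, Some a], [Some b, N]}"
  have K: "\<alpha> \<in> avoid (ext A) ?F \<Longrightarrow> fb \<alpha> \<in> avoid (ext A) ?F" for \<alpha>
    by (induction \<alpha>) (use A in \<open>auto simp: avoid_Cons fb\<close>)
  interpret extended A "[b, b, a]" "[a, b]" "[b, a]" ?F es
  proof
    show "entries_ok [b, b, a] [a, b] (ext A) (extval [b, a]) c (es c)" if "c \<in> ext A" for c
      using that A entries_ok_default[OF that] rel_cong_base[of "[b, b, a]" "[a, b]"]
      by (auto simp: es_def entries_ok_def entry_ok_def)
    show "run (es c) \<alpha> \<in> avoid (ext A) ?F" if "c \<in> ext A" "\<alpha> \<in> avoid (ext A) ?F" for c \<alpha>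
      using that K by (auto simp: run avoid_Cons)
  qed (use A in auto)
  have "cross_section [b, b, a] [a, b] (extval [b, a]) K"
  proof (rule cross_section)
    show "run (es c) \<alpha> = c # \<alpha>" if "c # \<alpha> \<in> K" for c \<alpha>
      using that by (cases \<alpha>) (auto simp: run fb avoid_Cons)
  qed (use A in \<open>simp_all add: run fb\<close>)
  then show ?thesis using head_tame by blast
qed

text \<open>Rewriting \<open>cba\<close> to \<open>ac\<close> makes \<open>c\<close> pass each
  \<open>ba\<close> and leave a single \<open>a\<close>, which changes the length without bound.
  With \<open>N\<close> for \<open>cb\<close> the relation is oriented from \<open>ac\<close> to
  \<open>N a\<close>: now \<open>a\<close> passes each \<open>c\<close> and leaves one letter
  \<open>N\<close>. The overlap \<open>acb\<close> yields the further rule from \<open>a N\<close>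
  to \<open>N a b\<close>.\<close>

lemma head_tame_cba_ac:
  assumes A: "finite A" "a \<in> A" "b \<in> A" "c \<in> A" "a \<noteq> b" "b \<noteq> c" "a \<noteq> c"
  shows "\<exists>K. head_tame A [c, b, a] [a, c] (ext A) (extval [c, b]) K"
proof -
  let ?u = "[c, b, a]" and ?v = "[a, c]" and ?d = "[c, b]"
  define fa where "fa = casc [([Some c], [N])] [([N], [N, Some a, Some b]), ([], [Some a])]"
  define es where "es x = (if x = Some a then
      [([], [], [a], [([Some c], [N])], [([N], [N, Some a, Some b]), ([], [Some a])])]
      else if x = Some c then [simple [Some b] [N], simple [] [Some c]] else [simple [] [x]])" for x
  have fa: "fa [] = [Some a]" "fa (x # \<gamma>) = (if x = Some c then N # fa \<gamma> else if x = N then N # Some a # Some b # \<gamma> else Some a # x # \<gamma>)" for x \<gamma>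
    by (simp_all add: fa_def)
  have run: "run (es x) \<alpha> = (if x = Some a then fa \<alpha> else if x = Some c \<and> prefix [Some b] \<alpha> then N # tl \<alpha> else x # \<alpha>)" for x \<alpha>
    using A by (auto simp: es_def fa_def prefix_def)
  let ?F = "{[Some a, Some c], [Some c, Some b], [Some a, N]}"
  have K: "\<alpha> \<in> avoid (ext A) ?F \<Longrightarrow> fa \<alpha> \<in> avoid (ext A) ?F" for \<alpha>
    by (induction \<alpha>) (use A in \<open>auto simp: avoid_Cons fa\<close>)
  interpret extended A ?u ?v ?d ?F es
  proof
    show "entries_ok ?u ?v (ext A) (extval ?d) x (es x)" if "x \<in> ext A" for x
      using that A entries_ok_default[OF that] rel_cong_base[of ?u ?v, THEN rel_cong_sym] rel_cong_rule'[of ?u ?v "[]" "[b]"]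
      by (auto simp: es_def entries_ok_def entry_ok_def)
    show "run (es x) \<alpha> \<in> avoid (ext A) ?F" if "x \<in> ext A" "\<alpha> \<in> avoid (ext A) ?F" for x \<alpha>
      using that K A by (cases \<alpha>) (auto simp: run avoid_Cons)
  qed (use A in auto)
  have "cross_section ?u ?v (extval ?d) K"
  proof (rule cross_section)
    show "run (es x) \<alpha> = x # \<alpha>" if "x # \<alpha> \<in> K" for x \<alpha>
      using that A by (cases \<alpha>) (auto simp: run fa avoid_Cons)
    show "foldr (\<lambda>b. run (es b)) (map Some ?u) \<alpha> = foldr (\<lambda>b. run (es b)) (map Some ?v) \<alpha>" for \<alpha>
      using A by (cases \<alpha>) (auto simp: run fa)
  qed (use A in \<open>simp_all add: run fa\<close>)
  then show ?thesis using head_tame by blast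
qed

text \<open>The letter \<open>c\<close> passes each \<open>ba\<close> and leaves a \<open>c\<close>,
  two letters against one. With \<open>N\<close> for \<open>ba\<close> both sides of the block have
  length one.\<close>

lemma head_tame_cba_cc:
  assumes A: "finite A" "a \<in> A" "b \<in> A" "c \<in> A" "a \<noteq> b" "b \<noteq> c" "a \<noteq> c"
  shows "\<exists>K. head_tame A [c, b, a] [c, c] (ext A) (extval [b, a]) K"
proof -
  let ?u = "[c, b, a]" and ?v = "[c, c]" and ?d = "[b, a]"
  define fc where "fc = casc [([N], [Some c])] [([], [Some c])]"
  define es where "es x = (if x = Some c then [([], [], [c], [([N], [Some c])], [([], [Some c])])]
      else if x = Some b then [simple [Some a] [N], simple [] [Some b]] else [simple [] [x]])" for x
  have fc: "fc [] = [Some c]" "fc (x # \<gamma>) = (if x = N then Some c # fc \<gamma> else Some c # x # \<gamma>)" for x \<gamma>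
    by (simp_all add: fc_def)
  have fc_hd: "\<exists>r. fc \<alpha> = Some c # r" for \<alpha> by (cases \<alpha>) (auto simp: fc)
  have run: "run (es x) \<alpha> = (if x = Some c then fc \<alpha> else if x = Some b \<and> prefix [Some a] \<alpha> then N # tl \<alpha> else x # \<alpha>)" for x \<alpha>
    using A by (auto simp: es_def fc_def prefix_def)
  let ?F = "{[Some b, Some a], [Some c, N]}"
  have K: "\<alpha> \<in> avoid (ext A) ?F \<Longrightarrow> fc \<alpha> \<in> avoid (ext A) ?F" for \<alpha>
  proof (induction \<alpha>)
    case (Cons x \<alpha>)
    then show ?case using A fc_hd[of \<alpha>] by (auto simp: avoid_Cons fc)
  qed (use A in \<open>auto simp: avoid_Cons fc\<close>)
  interpret extended A ?u ?v ?d ?F es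
  proof
    show "entries_ok ?u ?v (ext A) (extval ?d) x (es x)" if "x \<in> ext A" for x
      using that A entries_ok_default[OF that] rel_cong_base[of ?u ?v]
      by (auto simp: es_def entries_ok_def entry_ok_def)
    show "run (es x) \<alpha> \<in> avoid (ext A) ?F" if "x \<in> ext A" "\<alpha> \<in> avoid (ext A) ?F" for x \<alpha>
      using that K A by (cases \<alpha>) (auto simp: run avoid_Cons)
  qed (use A in auto)
  have "cross_section ?u ?v (extval ?d) K"
  proof (rule cross_section)
    show "run (es x) \<alpha> = x # \<alpha>" if "x # \<alpha> \<in> K" for x \<alpha>
      using that A by (cases \<alpha>) (auto simp: run fc avoid_Cons)
    show "foldr (\<lambda>b. run (es b)) (map Some ?u) \<alpha> = foldr (\<lambda>b. run (es b)) (map Some ?v) \<alpha>" for \<alpha>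
      using A fc_hd[of \<alpha>] by (auto simp: run fc)
  qed (use A in \<open>simp_all add: run fc\<close>)
  then show ?thesis using head_tame by blast
qed

text \<open>The letter \<open>b\<close> passes each \<open>aa\<close> and leaves a \<open>b\<close>;
  \<open>N\<close> for \<open>aa\<close> makes this a block of length one. As a power of
  \<open>a\<close>, the new letter commutes with \<open>a\<close>, and it is moved to the left of
  \<open>a\<close>.\<close>

lemma head_tame_baa_bb:
  assumes A: "finite A" "a \<in> A" "b \<in> A" "a \<noteq> b"
  shows "\<exists>K. head_tame A [b, a, a] [b, b] (ext A) (extval [a, a]) K"
proof -
  let ?u = "[b, a, a]" and ?v = "[b, b]" and ?d = "[a, a]"
  define fa where "fa = casc [([N], [N])] [([Some a], [N]), ([], [Some a])]"
  define fb where "fb = casc [([N], [Some b])] [([], [Some b])]"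
  define es where "es x = (if x = Some a then [([], [], [a], [([N], [N])], [([Some a], [N]), ([], [Some a])])]
      else if x = Some b then [([], [], [b], [([N], [Some b])], [([], [Some b])])] else [simple [] [x]])" for x
  have fa: "fa [] = [Some a]" "fa (x # \<gamma>) = (if x = N then N # fa \<gamma> else if x = Some a then N # \<gamma> else Some a # x # \<gamma>)" for x \<gamma>
    by (simp_all add: fa_def)
  have fb: "fb [] = [Some b]" "fb (x # \<gamma>) = (if x = N then Some b # fb \<gamma> else Some b # x # \<gamma>)" for x \<gamma>
    by (simp_all add: fb_def)
  have fb_hd: "\<exists>r. fb \<alpha> = Some b # r" for \<alpha> by (cases \<alpha>) (auto simp: fb)
  have run: "run (es x) \<alpha> = (if x = Some a then fa \<alpha> else if x = Some b then fb \<alpha> else x # \<alpha>)" for x \<alpha>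
    using A by (auto simp: es_def fa_def fb_def)
  let ?F = "{[Some a, Some a], [Some a, N], [Some b, N]}"
  have Ka: "\<alpha> \<in> avoid (ext A) ?F \<Longrightarrow> fa \<alpha> \<in> avoid (ext A) ?F" for \<alpha>
    by (induction \<alpha>) (use A in \<open>auto simp: avoid_Cons fa\<close>)
  have Kb: "\<alpha> \<in> avoid (ext A) ?F \<Longrightarrow> fb \<alpha> \<in> avoid (ext A) ?F" for \<alpha>
  proof (induction \<alpha>)
    case (Cons x \<alpha>)
    then show ?case using A fb_hd[of \<alpha>] by (auto simp: avoid_Cons fb)
  qed (use A in \<open>auto simp: avoid_Cons fb\<close>)
  have faa: "\<alpha> \<in> avoid (ext A) ?F \<Longrightarrow> fa (fa \<alpha>) = N # \<alpha>" for \<alpha>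
  proof (induction \<alpha>)
    case (Cons x \<alpha>)
    then show ?case using A by (cases \<alpha>) (auto simp: avoid_Cons fa)
  qed (simp add: fa)
  interpret extended A ?u ?v ?d ?F es
  proof
    show "entries_ok ?u ?v (ext A) (extval ?d) x (es x)" if "x \<in> ext A" for x
      using that A entries_ok_default[OF that] rel_cong_base[of ?u ?v]
      by (auto simp: es_def entries_ok_def entry_ok_def)
    show "run (es x) \<alpha> \<in> avoid (ext A) ?F" if "x \<in> ext A" "\<alpha> \<in> avoid (ext A) ?F" for x \<alpha>
      using that Ka Kb A by (cases \<alpha>) (auto simp: run avoid_Cons)
  qed (use A in auto)
  have "cross_section ?u ?v (extval ?d) K"
  proof (rule cross_section)
    show "run (es x) \<alpha> = x # \<alpha>" if "x # \<alpha> \<in> K" for x \<alpha>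
      using that A by (cases \<alpha>) (auto simp: run fa fb avoid_Cons)
    show "foldr (\<lambda>b. run (es b)) (map Some ?u) \<alpha> = foldr (\<lambda>b. run (es b)) (map Some ?v) \<alpha>" if "\<alpha> \<in> K" for \<alpha>
      using A fb_hd[of \<alpha>] faa[OF that] by (auto simp: run fb)
  qed (use A faa in \<open>simp_all add: run\<close>)
  then show ?thesis using head_tame by blast
qed

text \<open>With \<open>N\<close> for \<open>aa\<close>, the word \<open>aaa\<close> is both
  \<open>a N\<close> and \<open>N a\<close>, so that \<open>ab = N a\<close>: the letter
  \<open>a\<close> passes \<open>b\<close> and turns it into \<open>N\<close>. Multiplying the
  relation by \<open>a\<close> on the left gives \<open>N b = N N\<close>, so \<open>N\<close> also
  turns the letters \<open>b\<close> behind it into \<open>N\<close>.\<close>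

lemma head_tame_aaa_ab:
  assumes A: "finite A" "a \<in> A" "b \<in> A" "a \<noteq> b"
  shows "\<exists>K. head_tame A [a, a, a] [a, b] (ext A) (extval [a, a]) K"
proof -
  let ?u = "[a, a, a]" and ?v = "[a, b]" and ?d = "[a, a]"
  define fa where "fa = casc [([Some b], [N]), ([N], [N])] [([Some a], [N]), ([], [Some a])]"
  define fn where "fn = casc [([Some b], [N])] [([], [N])]"
  define es where "es x = (if x = Some a then [([], [], [a], [([Some b], [N]), ([N], [N])], [([Some a], [N]), ([], [Some a])])]
      else if x = N then [([], [], [a, a], [([Some b], [N])], [([], [N])])] else [simple [] [x]])" for x
  have fa: "fa [] = [Some a]" "fa (x # \<gamma>) = (if x = Some b \<or> x = N then N # fa \<gamma> else if x = Some a then N # \<gamma> else Some a # x # \<gamma>)" for x \<gamma>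
    by (auto simp: fa_def)
  have fn: "fn [] = [N]" "fn (x # \<gamma>) = (if x = Some b then N # fn \<gamma> else N # x # \<gamma>)" for x \<gamma>
    by (simp_all add: fn_def)
  have run: "run (es x) \<alpha> = (if x = Some a then fa \<alpha> else if x = N then fn \<alpha> else x # \<alpha>)" for x \<alpha>
    using A by (auto simp: es_def fa_def fn_def)
  let ?F = "{[Some a, N], [Some a, Some a], [Some a, Some b], [N, Some b]}"
  have fa_hd: "\<exists>r. fa \<alpha> = N # r \<or> fa \<alpha> = Some a # r" for \<alpha> by (cases \<alpha>) (auto simp: fa)
  have fn_hd: "\<exists>r. fn \<alpha> = N # r" for \<alpha> by (cases \<alpha>) (auto simp: fn)
  have Ka: "\<alpha> \<in> avoid (ext A) ?F \<Longrightarrow> fa \<alpha> \<in> avoid (ext A) ?F" for \<alpha>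
  proof (induction \<alpha>)
    case (Cons x \<alpha>)
    then show ?case using A fa_hd[of \<alpha>] by (auto simp: avoid_Cons fa)
  qed (use A in \<open>auto simp: avoid_Cons fa\<close>)
  have Kn: "\<alpha> \<in> avoid (ext A) ?F \<Longrightarrow> fn \<alpha> \<in> avoid (ext A) ?F" for \<alpha>
  proof (induction \<alpha>)
    case (Cons x \<alpha>)
    then show ?case using A fn_hd[of \<alpha>] by (auto simp: avoid_Cons fn)
  qed (use A in \<open>auto simp: avoid_Cons fn\<close>)
  have faa: "\<alpha> \<in> avoid (ext A) ?F \<Longrightarrow> fa (fa \<alpha>) = fn \<alpha>" for \<alpha>
  proof (induction \<alpha>)
    case (Cons x \<alpha>)
    then show ?case using A by (cases \<alpha>) (auto simp: avoid_Cons fa fn)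
  qed (use A in \<open>simp add: fa fn\<close>)
  interpret extended A ?u ?v ?d ?F es
  proof
    show "entries_ok ?u ?v (ext A) (extval ?d) x (es x)" if "x \<in> ext A" for x
      using that A entries_ok_default[OF that] rel_cong_base[of ?u ?v, THEN rel_cong_sym] rel_cong_rule'[of ?u ?v "[a]" "[]"]
      by (auto simp: es_def entries_ok_def entry_ok_def)
    show "run (es x) \<alpha> \<in> avoid (ext A) ?F" if "x \<in> ext A" "\<alpha> \<in> avoid (ext A) ?F" for x \<alpha>
      using that Ka Kn A by (cases \<alpha>) (auto simp: run avoid_Cons)
  qed (use A in auto)
  have "cross_section ?u ?v (extval ?d) K"
  proof (rule cross_section)
    show "run (es x) \<alpha> = x # \<alpha>" if "x # \<alpha> \<in> K" for x \<alpha>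
      using that A by (cases \<alpha>) (auto simp: run fa fn avoid_Cons)
    show "foldr (\<lambda>b. run (es b)) (map Some ?u) \<alpha> = foldr (\<lambda>b. run (es b)) (map Some ?v) \<alpha>" if "\<alpha> \<in> K" for \<alpha>
      using A fa_hd[of \<alpha>] faa[OF Ka[OF that]] by (auto simp: run fa fn)
  qed (use A faa in \<open>simp_all add: run\<close>)
  then show ?thesis using head_tame by blast
qed

text \<open>The word \<open>aba\<close> overlaps itself in \<open>ababa\<close>. With
  \<open>N\<close> for \<open>ab\<close> it becomes \<open>N a\<close>, and the relation oriented
  from \<open>ac\<close> to \<open>N a\<close> lets \<open>a\<close> pass \<open>c\<close>. The two
  forbidden factors \<open>ac\<close> and \<open>ab\<close> have no overlaps.\<close>

lemma head_tame_aba_ac: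
  assumes A: "finite A" "a \<in> A" "b \<in> A" "c \<in> A" "a \<noteq> b" "b \<noteq> c" "a \<noteq> c"
  shows "\<exists>K. head_tame A [a, b, a] [a, c] (ext A) (extval [a, b]) K"
proof -
  let ?u = "[a, b, a]" and ?v = "[a, c]" and ?d = "[a, b]"
  define fa where "fa = casc [([Some c], [N])] [([Some b], [N]), ([], [Some a])]"
  define es where "es x = (if x = Some a then [([], [], [a], [([Some c], [N])], [([Some b], [N]), ([], [Some a])])]
     else [simple [] [x]])" for x
  have fa: "fa [] = [Some a]" "fa (x # \<gamma>) = (if x = Some c then N # fa \<gamma> else if x = Some b then N # \<gamma> else Some a # x # \<gamma>)" for x \<gamma>
    by (simp_all add: fa_def)
  have run: "run (es x) \<alpha> = (if x = Some a then fa \<alpha> else x # \<alpha>)" for x \<alpha>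
    by (simp add: es_def fa_def)
  let ?F = "{[Some a, Some c], [Some a, Some b]}"
  have K: "\<alpha> \<in> avoid (ext A) ?F \<Longrightarrow> fa \<alpha> \<in> avoid (ext A) ?F" for \<alpha>
    by (induction \<alpha>) (use A in \<open>auto simp: avoid_Cons fa\<close>)
  interpret extended A ?u ?v ?d ?F es
  proof
    show "entries_ok ?u ?v (ext A) (extval ?d) x (es x)" if "x \<in> ext A" for x
      using that A entries_ok_default[OF that] rel_cong_base[of ?u ?v, THEN rel_cong_sym]
      by (auto simp: es_def entries_ok_def entry_ok_def)
    show "run (es x) \<alpha> \<in> avoid (ext A) ?F" if "x \<in> ext A" "\<alpha> \<in> avoid (ext A) ?F" for x \<alpha>
      using that K A by (auto simp: run avoid_Cons)
  qed (use A in auto)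
  have "cross_section ?u ?v (extval ?d) K"
  proof (rule cross_section)
    show "run (es x) \<alpha> = x # \<alpha>" if "x # \<alpha> \<in> K" for x \<alpha>
      using that A by (cases \<alpha>) (auto simp: run fa avoid_Cons)
  qed (use A in \<open>simp_all add: run fa\<close>)
  then show ?thesis using head_tame by blast
qed

subsection \<open>Two-sided systems\<close>

text \<open>A relation between palindromes is its own mirror image, and so are the values of the
  generators. The action therefore has to be analysed for one direction only; for the other one,
  closure under multiplication remains to be shown.\<close>

lemma cross_section_palindrome:
  assumes "cross_section u v (extval d) (avoid (ext A) F)" "rev u = u" "rev v = v" "rev d = d"
  shows "cross_section u v (extval d) (avoid (ext A) (rev ` F))"
proof -
  have "(\<lambda>b. rev (extval d b)) = extval d"
  proof
    fix b show "rev (extval d b) = extval d b" using assms(4) by (cases b) auto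
  qed
  then show ?thesis using cross_section_rev[OF assms(1)] assms(2,3) by (simp add: avoid_rev)
qed

text \<open>Here \<open>f\<close> is multiplication by \<open>c\<close>, where \<open>N\<close>
  stands for the power \<open>c # r\<close> and commutes with \<open>c\<close>, and the iterate
  along \<open>r\<close> is multiplication by \<open>r\<close>. A word beginning with
  \<open>c\<close> is itself a value of \<open>f\<close>; since \<open>f\<close> commutes with its
  iterates, this letter can be taken out and the induction hypothesis applied to the rest.\<close>

lemma collect_power:
  fixes c :: 'a and r :: "'a list" and A :: "'a set"
  defines "f \<equiv> casc [([N], [N])] [(map Some r, [N]), ([], [Some c])]" and "X \<equiv> {map Some (c # r), [Some c, N]}"
  assumes c: "c \<in> A" and r: "r = [c] \<or> r = [c, c]"
  shows "\<alpha> \<in> avoid (ext A) X \<Longrightarrow> f (foldr (\<lambda>_. f) r \<alpha>) = N # \<alpha>"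
    and "Some c # \<alpha> \<in> avoid (ext A) X \<Longrightarrow> f \<alpha> = Some c # \<alpha>"
proof -
  have ne: "r \<noteq> []" using r by auto
  have f: "f [] = [Some c]"
    "f (e # \<gamma>) = (if e = N then N # f \<gamma> else if prefix (map Some r) (e # \<gamma>) then N # drop (length r) (e # \<gamma>) else Some c # e # \<gamma>)"
    for e \<gamma> using ne by (auto simp: f_def)
  let ?Z = "foldr (\<lambda>_. f) r"
  show cons: "f \<gamma> = Some c # \<gamma>" if "Some c # \<gamma> \<in> avoid (ext A) X" for \<gamma>
  proof -
    have "\<not> prefix (map Some r) \<gamma>" "\<not> prefix [N] \<gamma>" using that by (auto simp: avoid_Cons X_def)
    then show ?thesis by (cases \<gamma>) (simp_all add: f)
  qed
  have ZN: "?Z (N # \<alpha>) = N # ?Z \<alpha>" "f (N # \<alpha>) = N # f \<alpha>" for \<alpha> using r by (auto simp: f)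
  have Zf: "?Z (f \<alpha>) = f (?Z \<alpha>)" for \<alpha> using r by auto
  have Zcons: "?Z \<gamma> = map Some r @ \<gamma>" if "\<gamma> \<in> avoid (ext A) X" "\<not> prefix [Some c] \<gamma>" "\<not> prefix [N] \<gamma>" for \<gamma>
  proof -
    have "map Some r @ \<gamma> \<in> avoid (ext A) X" using that r c by (cases \<gamma>) (auto simp: avoid_Cons X_def)
    then show ?thesis using r cons by (auto simp: avoid_Cons)
  qed
  have fr: "f (map Some r @ \<gamma>) = N # \<gamma>" for \<gamma> using r by (auto simp: f)
  show "f (?Z \<alpha>) = N # \<alpha>" if "\<alpha> \<in> avoid (ext A) X" for \<alpha>
    using that
  proof (induction \<alpha>)
    case Nil
    then show ?case using Zcons[of "[]"] fr[of "[]"] by simp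
  next
    case (Cons e \<alpha>)
    then have \<alpha>: "\<alpha> \<in> avoid (ext A) X" by (simp add: avoid_Cons)
    consider "e = N" | "e = Some c" | "e \<noteq> N" "e \<noteq> Some c" by blast
    then show ?case
    proof cases
      case 1
      then show ?thesis using Cons.IH[OF \<alpha>] by (simp add: ZN)
    next
      case 2
      then have e: "f \<alpha> = e # \<alpha>" using cons Cons.prems by simp
      have "f (?Z (e # \<alpha>)) = f (f (?Z \<alpha>))" unfolding e[symmetric] Zf ..
      then show ?thesis using Cons.IH[OF \<alpha>] e by (simp add: ZN)
    next
      case 3
      then show ?thesis using Zcons[OF Cons.prems] fr by auto
    qed
  qed
qed

text \<open>In the systems with \<open>N\<close> central (up to an automorphism), \<open>N\<close> commutes with the letters of the relation and
  is collected at one end of each block of such letters.\<close>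

lemma head_tame_powers:
  assumes A: "finite A" "a \<in> A" "b \<in> A" "a \<noteq> b" and ra: "ra = [a] \<or> ra = [a, a]" and rb: "rb = [b] \<or> rb = [b, b]"
  shows "\<exists>K. head_tame A (a # ra) (b # rb) (ext A) (extval (a # ra)) K \<and>
    head_tame A (a # ra) (b # rb) (ext A) (extval (a # ra)) (rev ` K)"
proof -
  let ?u = "a # ra" and ?v = "b # rb"
  let ?F = "{map Some ?u, map Some ?v, [Some a, N], [Some b, N]}"
  let ?G = "{map Some ?u, map Some ?v, [N, Some a], [N, Some b]}"
  \<comment> \<open>The letter \<open>b\<close> commutes with its own power \<open>?v\<close>, hence
    with the congruent word \<open>?u\<close>.\<close>
  have comm: "rel_cong ?u ?v (b # ?u) (?u @ [b])" "rel_cong ?u ?v (?u @ [b]) (b # ?u)"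
  proof -
    have "rel_cong ?u ?v (?u @ [b]) (?v @ [b])" using rel_cong_rule[of ?u ?v "[]" "[b]"] by simp
    moreover have "?v @ [b] = [b] @ ?v" using rb by auto
    moreover have "rel_cong ?u ?v ([b] @ ?v) ([b] @ ?u)" using rel_cong_rule'[of ?u ?v "[b]" "[]"] by simp
    ultimately show "rel_cong ?u ?v (?u @ [b]) (b # ?u)" using rel_cong_trans by auto
    then show "rel_cong ?u ?v (b # ?u) (?u @ [b])" by (rule rel_cong_sym)
  qed
  note eqs = comm rel_cong_base[of ?u ?v] rel_cong_base[of ?u ?v, THEN rel_cong_sym]
  define f where "f c r = casc [([N], [N])] [(map Some r, [N]), ([], [Some c])]" for c :: 'a and r
  define es where "es c = (if c = Some a then [([], [], [a], [([N], [N])], [(map Some ra, [N]), ([], [Some a])])]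
    else if c = Some b then [([], [], [b], [([N], [N])], [(map Some rb, [N]), ([], [Some b])])]
    else [simple [] [c]])" for c
  have ff: "f c r [] = [Some c]"
    "f c r (e # \<gamma>) = (if e = N then N # f c r \<gamma> else if prefix (map Some r) (e # \<gamma>) then N # drop (length r) (e # \<gamma>) else Some c # e # \<gamma>)"
    if "r \<noteq> []" for c r e \<gamma>
    using that by (auto simp: f_def)
  have run: "run (es c) \<alpha> = (if c = Some a then f a ra \<alpha> else if c = Some b then f b rb \<alpha> else c # \<alpha>)" for c \<alpha>
    by (simp add: es_def f_def)
  have drop_K: "\<alpha> \<in> avoid (ext A) X \<Longrightarrow> drop n \<alpha> \<in> avoid (ext A) X" for n \<alpha> X
    using avoid_append[of "take n \<alpha>" "drop n \<alpha>"] by simp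
  have Kf: "f c r \<alpha> \<in> avoid (ext A) ?F" if "\<alpha> \<in> avoid (ext A) ?F" "(c, r) = (a, ra) \<or> (c, r) = (b, rb)" for c r \<alpha>
    using that(1)
  proof (induction \<alpha>)
    case Nil
    have "r \<noteq> []" using that(2) ra rb by auto
    then show ?case using that(2) ra rb A by (auto simp: ff avoid_Cons)
  next
    case (Cons e \<alpha>)
    have r: "r \<noteq> []" using that(2) ra rb by auto
    consider "e = N" | "e \<noteq> N" "prefix (map Some r) (e # \<alpha>)" | "e \<noteq> N" "\<not> prefix (map Some r) (e # \<alpha>)" by blast
    then show ?case
    proof cases
      case 1
      then show ?thesis using Cons by (simp add: ff[OF r] avoid_Cons)
    next
      case 2
      then have "f c r (e # \<alpha>) = N # drop (length r) (e # \<alpha>)" by (auto simp: ff[OF r])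
      then show ?thesis using drop_K[OF Cons.prems, of "length r"] by (simp add: avoid_Cons)
    next
      case 3
      then have "f c r (e # \<alpha>) = Some c # e # \<alpha>" by (simp add: ff[OF r])
      moreover have "Some c # e # \<alpha> \<in> avoid (ext A) ?F"
        using 3 that(2) A Cons.prems by (auto simp: avoid_Cons[of "Some c"])
      ultimately show ?thesis by simp
    qed
  qed
  have sub: "avoid (ext A) ?F \<subseteq> avoid (ext A) {map Some ?u, [Some a, N]}"
    "avoid (ext A) ?F \<subseteq> avoid (ext A) {map Some ?v, [Some b, N]}"
    by (auto simp: avoid_def)
  interpret K: extended A ?u ?v ?u ?F es
  proof
    show "entries_ok ?u ?v (ext A) (extval ?u) c (es c)" if "c \<in> ext A" for c
      using that A ra rb entries_ok_default[OF that] eqs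
      by (auto simp: es_def entries_ok_def entry_ok_def)
    show "run (es c) \<alpha> \<in> avoid (ext A) ?F" if "c \<in> ext A" "\<alpha> \<in> avoid (ext A) ?F" for c \<alpha>
      using that Kf[OF that(2), of a ra] Kf[OF that(2), of b rb] by (auto simp: run avoid_Cons)
  qed (use A ra rb in auto)
  have cross: "cross_section ?u ?v (extval ?u) (avoid (ext A) ?F)"
  proof (rule K.cross_section)
    show "run (es c) \<alpha> = c # \<alpha>" if "c # \<alpha> \<in> avoid (ext A) ?F" for c \<alpha>
      using that collect_power(2)[OF A(2) ra, of \<alpha>] collect_power(2)[OF A(3) rb, of \<alpha>] sub by (auto simp: run f_def)
    have fu: "foldr (\<lambda>b. run (es b)) (map Some ?u) \<alpha> = N # \<alpha>" if "\<alpha> \<in> avoid (ext A) ?F" for \<alpha>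
      using collect_power(1)[OF A(2) ra subsetD[OF sub(1) that]] ra by (auto simp: run f_def)
    have fv: "foldr (\<lambda>b. run (es b)) (map Some ?v) \<alpha> = N # \<alpha>" if "\<alpha> \<in> avoid (ext A) ?F" for \<alpha>
      using collect_power(1)[OF A(3) rb subsetD[OF sub(2) that]] rb A(4) by (auto simp: run f_def)
    show "foldr (\<lambda>b. run (es b)) (map Some ?u) \<alpha> = foldr (\<lambda>b. run (es b)) (map Some ?v) \<alpha>" if "\<alpha> \<in> avoid (ext A) ?F" for \<alpha>
      unfolding fu[OF that] fv[OF that] ..
    show "run (es N) \<alpha> = foldr (\<lambda>b. run (es b)) (map Some ?u) \<alpha>" if "\<alpha> \<in> avoid (ext A) ?F" for \<alpha>
      unfolding fu[OF that] by (simp add: run)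
  qed
  \<comment> \<open>In the mirrored language \<open>N\<close> stands behind the letters
    \<open>a\<close> and \<open>b\<close>, so an \<open>N\<close> produced at the head travels
    through the whole leading block of these letters.\<close>
  define ins where "ins = casc [([Some a], [Some a]), ([Some b], [Some b])] [([], [N])]"
  have ins: "ins [] = [N]" "ins (c # \<gamma>) = (if c = Some a \<or> c = Some b then c # ins \<gamma> else N # c # \<gamma>)" for c \<gamma>
    by (auto simp: ins_def)
  have pre: "prefix (map Some w) (ins \<gamma>) \<longleftrightarrow> prefix (map Some w) \<gamma>" if "set w \<subseteq> {a, b}" for w \<gamma>
    using that
  proof (induction w arbitrary: \<gamma>)
    case (Cons c w)
    then show ?case by (cases \<gamma>) (auto simp: ins)
  qed simp
  have Kins: "\<gamma> \<in> avoid (ext A) ?G \<Longrightarrow> ins \<gamma> \<in> avoid (ext A) ?G" for \<gamma>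
  proof (induction \<gamma>)
    case (Cons c \<gamma>)
    have "set ra \<subseteq> {a, b}" "set rb \<subseteq> {a, b}" using ra rb by auto
    then show ?case using Cons A pre[of ra \<gamma>] pre[of rb \<gamma>] by (auto simp: ins avoid_Cons)
  qed (use A in \<open>auto simp: ins avoid_Cons\<close>)
  let ?gs = "[([Some a], [Some a]), ([Some b], [Some b])]"
  define es' where "es' c = (if c = Some a then [(map Some ra, [], ?u, ?gs, [([], [N])]), simple [] [Some a]]
    else if c = Some b then [(map Some rb, [], ?u, ?gs, [([], [N])]), simple [] [Some b]]
    else if c = N then [([], [], ?u, ?gs, [([], [N])])] else [simple [] [c]])" for c
  have run': "run (es' c) \<alpha> = (if c = Some a \<and> prefix (map Some ra) \<alpha> then ins (drop (length ra) \<alpha>)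
    else if c = Some b \<and> prefix (map Some rb) \<alpha> then ins (drop (length rb) \<alpha>) else if c = N then ins \<alpha> else c # \<alpha>)" for c \<alpha>
    using A(4) by (auto simp: es'_def ins_def)
  note Kdrop = drop_K[where X="?G"]
  interpret K': extended A ?u ?v ?u ?G es'
  proof
    show "entries_ok ?u ?v (ext A) (extval ?u) c (es' c)" if "c \<in> ext A" for c
      using that A ra rb entries_ok_default[OF that] eqs
      by (auto simp: es'_def entries_ok_def entry_ok_def)
    show "run (es' c) \<alpha> \<in> avoid (ext A) ?G" if "c \<in> ext A" "\<alpha> \<in> avoid (ext A) ?G" for c \<alpha>
      using that Kins[OF Kdrop[OF that(2), of "length ra"]] Kins[OF Kdrop[OF that(2), of "length rb"]] Kins[OF that(2)] A(4)
      by (auto simp: run' avoid_Cons)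
  qed (use A ra rb in auto)
  have rv: "rev ` ?F = ?G" using ra rb by auto
  have "rev ?u = ?u" "rev ?v = ?v" using ra rb by auto
  then have "head_tame A ?u ?v (ext A) (extval ?u) (rev ` avoid (ext A) ?F)"
    using K'.head_tame cross_section_palindrome[OF cross] by (simp only: avoid_rev rv)
  then show ?thesis using K.head_tame[OF cross] by blast
qed

text \<open>The power of \<open>y\<close> denoted by \<open>N\<close> equals both
  \<open>xyxy\<close> and \<open>yxyx\<close>, hence it commutes with \<open>x\<close> and
  \<open>y\<close>. Its commutation with \<open>x\<close> is exactly what the overlap
  \<open>xyxyx\<close> of the left-hand side with itself requires.\<close>

lemma head_tame_sandwich_power:
  assumes A: "finite A" "x \<in> A" "y \<in> A" "x \<noteq> y" and yk: "yk = [y] \<or> yk = [y, y] \<or> yk = [y, y, y]"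
  shows "\<exists>K. head_tame A [x, y, x] yk (ext A) (extval (y # yk)) K \<and>
    head_tame A [x, y, x] yk (ext A) (extval (y # yk)) (rev ` K)"
proof -
  let ?u = "[x, y, x]" and ?v = yk and ?d = "y # yk"
  let ?F = "{map Some ?u, map Some ?d, [Some x, N], [Some y, N]}"
  let ?G = "{map Some ?u, map Some ?d, [N, Some x], [N, Some y]}"
  have yk': "yk @ [y] = y # yk" "set yk \<subseteq> {y}" using yk by auto
  have comm: "rel_cong ?u ?v (x # y # yk) (y # yk @ [x])" "rel_cong ?u ?v (y # yk @ [x]) (x # y # yk)"
  proof -
    have "rel_cong ?u ?v (x # y # yk) ([x, y] @ [x, y, x])" using rel_cong_rule'[of ?u ?v "[x, y]" "[]"] by simp
    also have "rel_cong ?u ?v ([x, y] @ [x, y, x]) (yk @ [y, x])" using rel_cong_rule[of ?u ?v "[]" "[y, x]"] by simp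
    also have "yk @ [y, x] = y # yk @ [x]" using yk'(1) by (metis append_Cons append_assoc append_Nil)
    finally show "rel_cong ?u ?v (x # y # yk) (y # yk @ [x])" .
    then show "rel_cong ?u ?v (y # yk @ [x]) (x # y # yk)" by (rule rel_cong_sym)
  qed
  have yxy: "rel_cong ?u ?v [x, y, x, y] (y # yk)"
    using rel_cong_rule[of ?u ?v "[]" "[y]"] yk'(1) by simp
  note eqs = comm yxy rel_cong_base[of ?u ?v]
  define fy where "fy = casc [([N], [N])] [(map Some yk, [N]), ([], [Some y])]"
  \<comment> \<open>Behind \<open>x\<close>, the word \<open>yxy\<close> completes
    \<open>xyxy = N\<close>. It has to be tried before \<open>yx\<close>, which completes only
    \<open>xyx\<close>: a letter \<open>y\<close> following there would produce a forbidden power of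
    \<open>y\<close>.\<close>
  define fx where "fx = casc [([N], [N])] [([Some y, Some x, Some y], [N]), ([Some y, Some x], map Some yk), ([], [Some x])]"
  define es where "es c = (if c = Some y then [([], [], [y], [([N], [N])], [(map Some yk, [N]), ([], [Some y])])]
    else if c = Some x then [([], [], [x], [([N], [N])], [([Some y, Some x, Some y], [N]), ([Some y, Some x], map Some yk), ([], [Some x])])]
    else [simple [] [c]])" for c
  have fy: "fy [] = [Some y]"
    "fy (e # \<gamma>) = (if e = N then N # fy \<gamma> else if prefix (map Some yk) (e # \<gamma>) then N # drop (length yk) (e # \<gamma>) else Some y # e # \<gamma>)" for e \<gamma>
    using yk by (auto simp: fy_def)
  have fx: "fx [] = [Some x]"
    "fx (e # \<gamma>) = (if e = N then N # fx \<gamma> else if e = Some y \<and> prefix [Some x, Some y] \<gamma> then N # drop 2 \<gamma>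
       else if e = Some y \<and> prefix [Some x] \<gamma> then map Some yk @ tl \<gamma> else Some x # e # \<gamma>)" for e \<gamma>
    by (auto simp: fx_def prefix_def)
  have run: "run (es c) \<alpha> = (if c = Some y then fy \<alpha> else if c = Some x then fx \<alpha> else c # \<alpha>)" for c \<alpha>
    using A(4) by (simp add: es_def fy_def fx_def)
  have drop_K: "\<alpha> \<in> avoid (ext A) X \<Longrightarrow> drop n \<alpha> \<in> avoid (ext A) X" for n \<alpha> X
    using avoid_append[of "take n \<alpha>" "drop n \<alpha>"] by simp
  have yne: "yk \<noteq> []" "map Some yk \<noteq> []" using yk by auto
  have consY: "fy \<gamma> = Some y # \<gamma>" if "Some y # \<gamma> \<in> avoid (ext A) ?F" for \<gamma>
  proof -
    have "\<not> prefix (map Some yk) \<gamma>" "\<not> prefix [N] \<gamma>" using that by (auto simp: avoid_Cons)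
    then show ?thesis by (cases \<gamma>) (simp_all add: fy)
  qed
  have consX: "fx \<gamma> = Some x # \<gamma>" if "Some x # \<gamma> \<in> avoid (ext A) ?F" for \<gamma>
  proof -
    have "\<not> prefix [Some y, Some x] \<gamma>" "\<not> prefix [N] \<gamma>" using that by (auto simp: avoid_Cons)
    then show ?thesis by (cases \<gamma>) (auto simp: fx prefix_def)
  qed
  have powK: "map Some yk @ \<gamma> \<in> avoid (ext A) ?F" if "\<gamma> \<in> avoid (ext A) ?F" "\<not> prefix [Some y] \<gamma>" "\<not> prefix [N] \<gamma>" for \<gamma>
    using that yk A by (cases \<gamma>) (auto simp: avoid_Cons)
  have Ky: "fy \<alpha> \<in> avoid (ext A) ?F" if "\<alpha> \<in> avoid (ext A) ?F" for \<alpha>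
    using that
  proof (induction \<alpha>)
    case Nil
    then show ?case using yne A by (auto simp: fy avoid_Cons)
  next
    case (Cons e \<alpha>)
    consider "e = N" | "e \<noteq> N" "prefix (map Some yk) (e # \<alpha>)" | "e \<noteq> N" "\<not> prefix (map Some yk) (e # \<alpha>)" by blast
    then show ?case
    proof cases
      case 1
      then show ?thesis using Cons by (simp add: fy avoid_Cons)
    next
      case 2
      then have "fy (e # \<alpha>) = N # drop (length yk) (e # \<alpha>)" by (auto simp: fy)
      then show ?thesis using drop_K[OF Cons.prems, of "length yk"] by (simp add: avoid_Cons)
    next
      case 3
      then have "Some y # e # \<alpha> \<in> avoid (ext A) ?F" using A Cons.prems by (auto simp: avoid_Cons[of "Some y"])
      then show ?thesis using consY by simp
    qed
  qed
  have Kx: "fx \<alpha> \<in> avoid (ext A) ?F" if "\<alpha> \<in> avoid (ext A) ?F" for \<alpha>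
    using that
  proof (induction \<alpha>)
    case Nil
    then show ?case using A by (auto simp: fx avoid_Cons)
  next
    case (Cons e \<alpha>)
    consider "e = N" | \<gamma> where "e = Some y" "\<alpha> = Some x # Some y # \<gamma>"
      | \<gamma> where "e = Some y" "\<alpha> = Some x # \<gamma>" "\<not> prefix [Some y] \<gamma>"
      | "e \<noteq> N" "\<not> (e = Some y \<and> prefix [Some x] \<alpha>)"
      by (auto simp: prefix_def)
    then show ?case
    proof cases
      case 1
      then show ?thesis using Cons by (simp add: fx avoid_Cons)
    next
      case (2 \<gamma>)
      then show ?thesis using Cons.prems by (simp add: fx avoid_Cons)
    next
      case (3 \<gamma>)
      then show ?thesis using Cons.prems powK[of \<gamma>] by (simp add: fx avoid_Cons)
    next
      case 4
      then have "Some x # e # \<alpha> \<in> avoid (ext A) ?F" using A Cons.prems by (auto simp: avoid_Cons[of "Some x"])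
      then show ?thesis using consX by simp
    qed
  qed
  define Y where "Y = foldr (\<lambda>_. fy) yk"
  have Yfy: "Y (fy \<alpha>) = fy (Y \<alpha>)" for \<alpha> using yk by (auto simp: Y_def)
  have YN: "Y (N # \<alpha>) = N # Y \<alpha>" for \<alpha> using yk by (auto simp: Y_def fy)
  have fyN: "fy (N # \<alpha>) = N # fy \<alpha>" "fx (N # \<alpha>) = N # fx \<alpha>" for \<alpha> by (simp_all add: fy fx)
  have Ycons: "Y \<gamma> = map Some yk @ \<gamma>" if "\<gamma> \<in> avoid (ext A) ?F" "\<not> prefix [Some y] \<gamma>" "\<not> prefix [N] \<gamma>" for \<gamma>
    using powK[OF that] yk consY by (auto simp: Y_def avoid_Cons)
  have fyY: "fy (map Some yk @ \<gamma>) = N # \<gamma>" for \<gamma> using yk by (auto simp: fy)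
  have fyY': "fy (Y \<alpha>) = N # \<alpha>" if "\<alpha> \<in> avoid (ext A) ?F" for \<alpha>
    using that
  proof (induction \<alpha>)
    case Nil
    then show ?case using Ycons[of "[]"] fyY[of "[]"] by simp
  next
    case (Cons e \<alpha>)
    then have \<alpha>: "\<alpha> \<in> avoid (ext A) ?F" by (simp add: avoid_Cons)
    consider "e = N" | "e = Some y" | "e \<noteq> N" "e \<noteq> Some y" by blast
    then show ?case
    proof cases
      case 1
      then show ?thesis using Cons.IH[OF \<alpha>] by (simp add: YN fyN)
    next
      case 2
      then have e: "fy \<alpha> = e # \<alpha>" using consY Cons.prems by simp
      have "fy (Y (e # \<alpha>)) = fy (fy (Y \<alpha>))" by (simp add: Yfy flip: e)
      then show ?thesis using Cons.IH[OF \<alpha>] e by (simp add: fyN)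
    next
      case 3
      then show ?thesis using Ycons[OF Cons.prems] fyY by auto
    qed
  qed
  \<comment> \<open>The cases follow the effect of the first multiplication by \<open>x\<close>: it
    passes an \<open>N\<close>, completes \<open>xyxy\<close>, completes \<open>xyx\<close>, or
    leaves \<open>x\<close> at the head.\<close>
  have xyx: "fx (fy (fx \<alpha>)) = Y \<alpha>" if "\<alpha> \<in> avoid (ext A) ?F" for \<alpha>
    using that
  proof (induction \<alpha>)
    case Nil
    have "fy [Some x] = [Some y, Some x]" using A yk by (intro consY) (auto simp: avoid_Cons)
    then show ?case using A Ycons[of "[]"] by (simp add: fx)
  next
    case (Cons e \<alpha>)
    then have \<alpha>: "\<alpha> \<in> avoid (ext A) ?F" by (simp add: avoid_Cons)
    consider "e = N" | \<gamma> where "e = Some y" "\<alpha> = Some x # Some y # \<gamma>"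
      | \<gamma> where "e = Some y" "\<alpha> = Some x # \<gamma>" "\<not> prefix [Some y] \<gamma>"
      | "e \<noteq> N" "\<not> (e = Some y \<and> prefix [Some x] \<alpha>)"
      by (auto simp: prefix_def)
    then show ?case
    proof cases
      case 1
      then show ?thesis using Cons.IH[OF \<alpha>] by (simp add: YN fyN)
    next
      case (2 \<gamma>)
      have "fy \<gamma> = Some y # \<gamma>" "fx (Some y # \<gamma>) = Some x # Some y # \<gamma>" "fy \<alpha> = e # \<alpha>"
        using \<alpha> Cons.prems 2 by (auto intro!: consX consY simp: avoid_Cons)
      moreover have "fx (e # \<alpha>) = N # \<gamma>" using 2 by (simp add: fx)
      moreover have "Y (e # \<alpha>) = N # \<alpha>" using fyY'[OF \<alpha>] Yfy[of \<alpha>] \<open>fy \<alpha> = e # \<alpha>\<close> by simp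
      ultimately show ?thesis using 2 by (simp add: fyN)
    next
      case (3 \<gamma>)
      have "fy \<alpha> = e # \<alpha>" "fx \<gamma> = Some x # \<gamma>"
        using \<alpha> Cons.prems 3 by (auto intro!: consX consY simp: avoid_Cons)
      moreover have "fx (e # \<alpha>) = map Some yk @ \<gamma>" using 3 by (simp add: fx)
      moreover have "Y (e # \<alpha>) = N # \<alpha>" using fyY'[OF \<alpha>] Yfy[of \<alpha>] \<open>fy \<alpha> = e # \<alpha>\<close> by simp
      ultimately show ?thesis using 3 by (simp add: fyN fyY)
    next
      case 4
      then have xe: "Some x # e # \<alpha> \<in> avoid (ext A) ?F" using A Cons.prems by (auto simp: avoid_Cons[of "Some x"])
      moreover have "Some y # Some x # e # \<alpha> \<in> avoid (ext A) ?F"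
        using xe A yk by (auto simp: avoid_Cons[of "Some y"])
      ultimately have l: "fx (fy (fx (e # \<alpha>))) = fx (Some y # Some x # e # \<alpha>)"
        using consX consY by simp
      show ?thesis
      proof (cases "e = Some y")
        case True
        then have "fy \<alpha> = e # \<alpha>" using consY Cons.prems by simp
        then have "Y (e # \<alpha>) = N # \<alpha>" using fyY'[OF \<alpha>] Yfy[of \<alpha>] by simp
        then show ?thesis using l True by (simp add: fx)
      next
        case False
        then show ?thesis using l 4 Ycons[OF Cons.prems] by (auto simp: fx)
      qed
    qed
  qed
  have Yrun: "foldr (\<lambda>b. run (es b)) (map Some yk) = Y"
    using yk by (auto simp: Y_def run fun_eq_iff)
  interpret K: extended A ?u ?v ?d ?F es
  proof
    show "entries_ok ?u ?v (ext A) (extval ?d) c (es c)" if "c \<in> ext A" for c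
      using that A yk entries_ok_default[OF that] eqs
      by (auto simp: es_def entries_ok_def entry_ok_def)
    show "run (es c) \<alpha> \<in> avoid (ext A) ?F" if "c \<in> ext A" "\<alpha> \<in> avoid (ext A) ?F" for c \<alpha>
      using that Kx[OF that(2)] Ky[OF that(2)] by (auto simp: run avoid_Cons)
  qed (use A yk in auto)
  have cross: "cross_section ?u ?v (extval ?d) (avoid (ext A) ?F)"
  proof (rule K.cross_section)
    show "run (es c) \<alpha> = c # \<alpha>" if "c # \<alpha> \<in> avoid (ext A) ?F" for c \<alpha>
      using that consX consY by (auto simp: run)
    show "foldr (\<lambda>b. run (es b)) (map Some ?u) \<alpha> = foldr (\<lambda>b. run (es b)) (map Some ?v) \<alpha>" if "\<alpha> \<in> avoid (ext A) ?F" for \<alpha>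
      using xyx[OF that] A(4) by (simp add: run Yrun)
    show "run (es N) \<alpha> = foldr (\<lambda>b. run (es b)) (map Some ?d) \<alpha>" if "\<alpha> \<in> avoid (ext A) ?F" for \<alpha>
      using fyY'[OF that] by (simp add: run Yrun)
  qed
  define ins where "ins = casc [([Some x], [Some x]), ([Some y], [Some y])] [([], [N])]"
  have ins: "ins [] = [N]" "ins (c # \<gamma>) = (if c = Some x \<or> c = Some y then c # ins \<gamma> else N # c # \<gamma>)" for c \<gamma>
    by (auto simp: ins_def)
  have pre: "prefix (map Some w) (ins \<gamma>) \<longleftrightarrow> prefix (map Some w) \<gamma>" if "set w \<subseteq> {x, y}" for w \<gamma>
    using that
  proof (induction w arbitrary: \<gamma>)
    case (Cons c w)
    then show ?case by (cases \<gamma>) (auto simp: ins)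
  qed simp
  have Kins: "\<gamma> \<in> avoid (ext A) ?G \<Longrightarrow> ins \<gamma> \<in> avoid (ext A) ?G" for \<gamma>
  proof (induction \<gamma>)
    case (Cons c \<gamma>)
    have "set yk \<subseteq> {x, y}" using yk by auto
    then show ?case using Cons A pre[of yk \<gamma>] pre[of "[y, x]" \<gamma>] by (auto simp: ins avoid_Cons)
  qed (use A in \<open>auto simp: ins avoid_Cons\<close>)
  let ?gs = "[([Some x], [Some x]), ([Some y], [Some y])]"
  define es' where "es' c = (if c = Some y then [(map Some yk, [], ?d, ?gs, [([], [N])]), simple [] [Some y]]
    else if c = Some x then [([Some y, Some x, Some y], [], ?d, ?gs, [([], [N])]), simple [Some y, Some x] (map Some yk), simple [] [Some x]]
    else if c = N then [([], [], ?d, ?gs, [([], [N])])] else [simple [] [c]])" for c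
  have run': "run (es' c) \<alpha> = (if c = Some y \<and> prefix (map Some yk) \<alpha> then ins (drop (length yk) \<alpha>)
    else if c = Some x \<and> prefix [Some y, Some x, Some y] \<alpha> then ins (drop 3 \<alpha>)
    else if c = Some x \<and> prefix [Some y, Some x] \<alpha> then map Some yk @ drop 2 \<alpha> else if c = N then ins \<alpha> else c # \<alpha>)" for c \<alpha>
    using A(4) by (auto simp: es'_def ins_def numeral_2_eq_2 numeral_3_eq_3)
  note Kdrop = drop_K[where X="?G"]
  have Kyx: "map Some yk @ \<gamma> \<in> avoid (ext A) ?G" if "Some y # Some x # \<gamma> \<in> avoid (ext A) ?G" "\<not> prefix [Some y] \<gamma>" for \<gamma>
    using that yk A by (cases \<gamma>) (auto simp: avoid_Cons)
  interpret K': extended A ?u ?v ?d ?G es'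
  proof
    show "entries_ok ?u ?v (ext A) (extval ?d) c (es' c)" if "c \<in> ext A" for c
      using that A yk entries_ok_default[OF that] eqs
      by (auto simp: es'_def entries_ok_def entry_ok_def)
    show "run (es' c) \<alpha> \<in> avoid (ext A) ?G" if "c \<in> ext A" "\<alpha> \<in> avoid (ext A) ?G" for c \<alpha>
      using that Kins[OF Kdrop[OF that(2), of "length yk"]] Kins[OF Kdrop[OF that(2), of 3]] Kins[OF that(2)] A(4)
        Kyx[of "drop 2 \<alpha>"]
      by (auto simp: run' avoid_Cons elim!: prefixE)
  qed (use A yk in auto)
  have rv: "rev ` ?F = ?G" using yk by auto
  have "rev ?u = ?u" "rev ?v = ?v" "rev ?d = ?d" using yk by auto
  then have "head_tame A ?u ?v (ext A) (extval ?d) (rev ` avoid (ext A) ?F)"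
    using K'.head_tame cross_section_palindrome[OF cross] by (simp only: avoid_rev rv)
  then show ?thesis using K.head_tame[OF cross] by blast
qed

text \<open>The letter \<open>N\<close> for \<open>aba = bab\<close> is the Garside element of the
  braid monoid on three strands. It satisfies \<open>a N = N b\<close> and \<open>b N = N a\<close>,
  so that it interchanges the two letters instead of commuting with them.\<close>

lemma head_tame_braid:
  assumes A: "finite A" "a \<in> A" "b \<in> A" "a \<noteq> b"
  shows "\<exists>K. head_tame A [a, b, a] [b, a, b] (ext A) (extval [a, b, a]) K \<and>
    head_tame A [a, b, a] [b, a, b] (ext A) (extval [a, b, a]) (rev ` K)"
proof -
  let ?u = "[a, b, a]" and ?v = "[b, a, b]"
  let ?F = "{map Some ?u, map Some ?v, [Some a, N], [Some b, N]}"
  let ?G = "{map Some ?u, map Some ?v, [N, Some a], [N, Some b]}"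
  have an: "rel_cong ?u ?v [a, a, b, a] [a, b, a, b]" "rel_cong ?u ?v [b, a, b, a] [a, b, a, a]"
    using rel_cong_rule[of ?u ?v "[a]" "[]"] rel_cong_rule'[of ?u ?v "[]" "[a]"] by simp_all
  note na = an[THEN rel_cong_sym]
  have ann: "rel_cong ?u ?v [a, a, b, a, a, b, a] [a, b, a, a, b, a, a]" "rel_cong ?u ?v [b, a, b, a, a, b, a] [a, b, a, a, b, a, b]"
  proof -
    have "rel_cong ?u ?v [a, a, b, a, a, b, a] [a, b, a, b, a, b, a]" "rel_cong ?u ?v [a, b, a, b, a, b, a] [a, b, a, a, b, a, a]"
      "rel_cong ?u ?v [b, a, b, a, a, b, a] [a, b, a, a, a, b, a]" "rel_cong ?u ?v [a, b, a, a, a, b, a] [a, b, a, a, b, a, b]"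
      using rel_cong_append_right[OF an(1), of "[a, b, a]"] rel_cong_append_left[OF an(2), of "[a, b, a]"]
        rel_cong_append_right[OF an(2), of "[a, b, a]"] rel_cong_append_left[OF an(1), of "[a, b, a]"] by simp_all
    then show "rel_cong ?u ?v [a, a, b, a, a, b, a] [a, b, a, a, b, a, a]" "rel_cong ?u ?v [b, a, b, a, a, b, a] [a, b, a, a, b, a, b]"
      using rel_cong_trans by blast+
  qed
  have nab: "rel_cong ?u ?v [a, a, b, a, a, b] [a, b, a, a, b, a]" "rel_cong ?u ?v [b, a, b, a, b, a] [a, b, a, a, b, a]"
  proof -
    have "rel_cong ?u ?v [a, a, b, a, a, b] [a, b, a, b, a, b]" "rel_cong ?u ?v [a, b, a, b, a, b] [a, b, a, a, b, a]"
      using rel_cong_append_right[OF an(1), of "[a, b]"] rel_cong_rule'[of ?u ?v "[a, b, a]" "[]"] by simp_all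
    then show "rel_cong ?u ?v [a, a, b, a, a, b] [a, b, a, a, b, a]" using rel_cong_trans by blast
    show "rel_cong ?u ?v [b, a, b, a, b, a] [a, b, a, a, b, a]"
      using rel_cong_append_right[OF an(2), of "[b, a]"] by simp
  qed
  note eqs = an na ann nab rel_cong_base[of ?u ?v] rel_cong_base[of ?u ?v, THEN rel_cong_sym]
  \<comment> \<open>A certificate transports one fixed word, whereas \<open>a\<close> becomes
    \<open>b\<close> on passing a single \<open>N\<close>. Therefore the blocks consist of two
    letters \<open>N\<close>, and a remaining odd \<open>N\<close> belongs to the stop.\<close>
  define f where "f c e = casc [([N, N], [N, N])] [([N, Some c, Some e], [N, N]), ([N], [N, Some e]), ([Some e, Some c], [N]), ([], [Some c])]" for c e :: 'a
  define es where "es c = (if c = Some a then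
      [([], [], [a], [([N, N], [N, N])], [([N, Some a, Some b], [N, N]), ([N], [N, Some b]), ([Some b, Some a], [N]), ([], [Some a])])]
    else if c = Some b then
      [([], [], [b], [([N, N], [N, N])], [([N, Some b, Some a], [N, N]), ([N], [N, Some a]), ([Some a, Some b], [N]), ([], [Some b])])]
    else [simple [] [c]])" for c
  have f0: "f c e [] = [Some c]" "f c e (Some i # \<gamma>) = (if i = e \<and> prefix [Some c] \<gamma> then N # tl \<gamma> else Some c # Some i # \<gamma>)" for c e i \<gamma>
    by (auto simp: f_def prefix_def)
  \<comment> \<open>This replaces the description by pairs of letters \<open>N\<close> by a
    recursion over single ones, in which \<open>c\<close> and \<open>e\<close> change
    places.\<close>
  have fN': "f c e (N # \<gamma>) = N # f e c \<gamma> \<and> f e c (N # \<gamma>) = N # f c e \<gamma>" for c e \<gamma>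
  proof (induction \<gamma>)
    case Nil
    then show ?case by (simp add: f_def)
  next
    case (Cons i \<gamma>)
    show ?case
    proof (cases i)
      case None
      have "f c e (N # N # \<gamma>) = N # N # f c e \<gamma>" for c e by (simp add: f_def)
      then show ?thesis using Cons None by simp
    next
      case (Some j)
      then show ?thesis by (auto simp: f_def prefix_def)
    qed
  qed
  then have f: "f c e [] = [Some c]" "f c e (i # \<gamma>) = (if i = N then N # f e c \<gamma> else if i = Some e \<and> prefix [Some c] \<gamma> then N # tl \<gamma> else Some c # i # \<gamma>)" for c e i \<gamma>
    using f0 by (cases i; auto)+
  have run: "run (es c) \<alpha> = (if c = Some a then f a b \<alpha> else if c = Some b then f b a \<alpha> else c # \<alpha>)" for c \<alpha>
    using A(4) by (simp add: es_def f_def)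
  have Kf: "f a b \<alpha> \<in> avoid (ext A) ?F \<and> f b a \<alpha> \<in> avoid (ext A) ?F" if "\<alpha> \<in> avoid (ext A) ?F" for \<alpha>
    using that
  proof (induction \<alpha>)
    case Nil
    then show ?case using A by (auto simp: f avoid_Cons)
  next
    case (Cons e \<alpha>)
    then show ?case using A by (cases \<alpha>) (auto simp: f avoid_Cons)
  qed
  have cons: "f c e \<gamma> = Some c # \<gamma>" if "Some c # \<gamma> \<in> avoid (ext A) ?F" "(c, e) = (a, b) \<or> (c, e) = (b, a)" for c e \<gamma>
  proof -
    have "\<not> prefix [Some e, Some c] \<gamma>" "\<not> prefix [N] \<gamma>" using that by (auto simp: avoid_Cons)
    then show ?thesis by (cases \<gamma>) (auto simp: f prefix_def)
  qed
  \<comment> \<open>The induction treats both orders of the two letters at once, since passing an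
    \<open>N\<close> interchanges them.\<close>
  have f3: "f c e (f e c (f c e \<alpha>)) = N # \<alpha>" if "\<alpha> \<in> avoid (ext A) ?F" "(c, e) = (a, b) \<or> (c, e) = (b, a)" for c e \<alpha>
    using that
  proof (induction \<alpha> arbitrary: c e)
    case Nil
    then show ?case using A by (auto simp: f)
  next
    case (Cons i \<alpha>)
    have \<alpha>: "\<alpha> \<in> avoid (ext A) ?F" using Cons.prems by (simp add: avoid_Cons)
    have ce: "c \<noteq> e" "(e, c) = (a, b) \<or> (e, c) = (b, a)" using Cons.prems(2) A(4) by auto
    consider "i = N" | \<gamma> where "i = Some e" "\<alpha> = Some c # \<gamma>" | "i = Some e" "\<not> prefix [Some c] \<alpha>" | "i \<noteq> N" "i \<noteq> Some e"
      by (auto simp: prefix_def)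
    then show ?case
    proof cases
      case 1
      then show ?thesis using Cons.IH[OF \<alpha> ce(2)] by (simp add: f)
    next
      case (2 \<gamma>)
      have "f c e \<gamma> = Some c # \<gamma>" by (rule cons[OF _ Cons.prems(2)]) (use \<alpha> 2 in simp)
      moreover have "f e c (Some c # \<gamma>) = Some e # Some c # \<gamma>" by (rule cons[OF _ ce(2)]) (use Cons.prems 2 in simp)
      moreover have "f c e (i # \<alpha>) = N # \<gamma>" using 2 by (simp add: f)
      ultimately show ?thesis using 2 by (simp add: f)
    next
      case 3
      have "f e c \<alpha> = Some e # \<alpha>" by (rule cons[OF _ ce(2)]) (use Cons.prems 3 in simp)
      then show ?thesis using 3 ce(1) by (simp add: f)
    next
      case 4
      then show ?thesis using ce(1) by (auto simp: f)
    qed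
  qed
  interpret K: extended A ?u ?v ?u ?F es
  proof
    show "entries_ok ?u ?v (ext A) (extval ?u) c (es c)" if "c \<in> ext A" for c
      using that A entries_ok_default[OF that] eqs
      by (auto simp: es_def entries_ok_def entry_ok_def)
    show "run (es c) \<alpha> \<in> avoid (ext A) ?F" if "c \<in> ext A" "\<alpha> \<in> avoid (ext A) ?F" for c \<alpha>
      using that Kf[OF that(2)] by (auto simp: run avoid_Cons)
  qed (use A in auto)
  have cross: "cross_section ?u ?v (extval ?u) (avoid (ext A) ?F)"
  proof (rule K.cross_section)
    show "run (es c) \<alpha> = c # \<alpha>" if "c # \<alpha> \<in> avoid (ext A) ?F" for c \<alpha>
      using that cons[of a \<alpha> b] cons[of b \<alpha> a] by (auto simp: run)
    show "foldr (\<lambda>b. run (es b)) (map Some ?u) \<alpha> = foldr (\<lambda>b. run (es b)) (map Some ?v) \<alpha>" if "\<alpha> \<in> avoid (ext A) ?F" for \<alpha>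
      using f3[OF that, of a b] f3[OF that, of b a] A(4) by (simp add: run)
    show "run (es N) \<alpha> = foldr (\<lambda>b. run (es b)) (map Some ?u) \<alpha>" if "\<alpha> \<in> avoid (ext A) ?F" for \<alpha>
      using f3[OF that, of a b] A(4) by (simp add: run)
  qed
  let ?gs = "[([Some a], [Some b]), ([Some b], [Some a])]"
  define ins where "ins = casc ?gs [([], [N])]"
  have ins: "ins [] = [N]" "ins (c # \<gamma>) = (if c = Some a then Some b # ins \<gamma> else if c = Some b then Some a # ins \<gamma> else N # c # \<gamma>)" for c \<gamma>
    by (auto simp: ins_def)
  have pre: "prefix [Some a, Some b] (ins \<gamma>) \<longleftrightarrow> prefix [Some b, Some a] \<gamma>" "prefix [Some b, Some a] (ins \<gamma>) \<longleftrightarrow> prefix [Some a, Some b] \<gamma>" for \<gamma>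
    using A(4) by (cases \<gamma>; cases "tl \<gamma>"; auto simp: ins)+
  have Kins: "\<gamma> \<in> avoid (ext A) ?G \<Longrightarrow> ins \<gamma> \<in> avoid (ext A) ?G" for \<gamma>
  proof (induction \<gamma>)
    case (Cons c \<gamma>)
    then show ?case using A pre[of \<gamma>] by (auto simp: ins avoid_Cons)
  qed (use A in \<open>auto simp: ins avoid_Cons\<close>)
  define es' where "es' c = (if c = Some a then [([Some b, Some a], [], ?u, ?gs, [([], [N])]), simple [] [Some a]]
    else if c = Some b then [([Some a, Some b], [], ?u, ?gs, [([], [N])]), simple [] [Some b]]
    else if c = N then [([], [], ?u, ?gs, [([], [N])])] else [simple [] [c]])" for c
  have run': "run (es' c) \<alpha> = (if c = Some a \<and> prefix [Some b, Some a] \<alpha> then ins (drop 2 \<alpha>)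
    else if c = Some b \<and> prefix [Some a, Some b] \<alpha> then ins (drop 2 \<alpha>) else if c = N then ins \<alpha> else c # \<alpha>)" for c \<alpha>
    using A(4) by (auto simp: es'_def ins_def numeral_2_eq_2)
  have Kdrop: "\<alpha> \<in> avoid (ext A) ?G \<Longrightarrow> drop n \<alpha> \<in> avoid (ext A) ?G" for n \<alpha>
    using avoid_append[of "take n \<alpha>" "drop n \<alpha>"] by simp
  interpret K': extended A ?u ?v ?u ?G es'
  proof
    show "entries_ok ?u ?v (ext A) (extval ?u) c (es' c)" if "c \<in> ext A" for c
      using that A entries_ok_default[OF that] eqs
      by (auto simp: es'_def entries_ok_def entry_ok_def)
    show "run (es' c) \<alpha> \<in> avoid (ext A) ?G" if "c \<in> ext A" "\<alpha> \<in> avoid (ext A) ?G" for c \<alpha>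
      using that Kins[OF Kdrop[OF that(2), of 2]] Kins[OF that(2)] A(4)
      by (auto simp: run' avoid_Cons)
  qed (use A in auto)
  have rv: "rev ` ?F = ?G" by auto
  have "rev ?u = ?u" "rev ?v = ?v" by auto
  then have "head_tame A ?u ?v (ext A) (extval ?u) (rev ` avoid (ext A) ?F)"
    using K'.head_tame cross_section_palindrome[OF cross] by (simp only: avoid_rev rv)
  then show ?thesis using K.head_tame[OF cross] by blast
qed

text \<open>The letter \<open>N\<close> for \<open>xyx = pqp\<close> does not commute with single
  letters, but the overlaps \<open>xyxyx\<close> and \<open>pqpqp\<close> give
  \<open>xyN = Nyx\<close> and \<open>pqN = Nqp\<close>. Either side of these equations can be
  forbidden, and the two choices are mirror images of each other.\<close>

lemma head_tame_two_sandwiches: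
  assumes A: "finite A" "x \<in> A" "y \<in> A" "p \<in> A" "q \<in> A" and neq: "x \<noteq> y" "p \<noteq> q" "x \<noteq> p" "x \<noteq> q"
  shows "\<exists>K. head_tame A [x, y, x] [p, q, p] (ext A) (extval [x, y, x]) K \<and>
    head_tame A [x, y, x] [p, q, p] (ext A) (extval [x, y, x]) (rev ` K)"
proof -
  let ?u = "[x, y, x]" and ?v = "[p, q, p]"
  let ?F = "{map Some ?u, map Some ?v, [N, Some y, Some x], [N, Some q, Some p]}"
  let ?G = "{map Some ?u, map Some ?v, [Some x, Some y, N], [Some p, Some q, N]}"
  have pq: "rel_cong ?u ?v [p, q, x, y, x] [x, y, x, q, p]" "rel_cong ?u ?v [x, y, x, q, p] [p, q, x, y, x]"
  proof -
    have "rel_cong ?u ?v [p, q, x, y, x] [p, q, p, q, p]" "rel_cong ?u ?v [p, q, p, q, p] [x, y, x, q, p]"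
      using rel_cong_rule[of ?u ?v "[p, q]" "[]"] rel_cong_rule'[of ?u ?v "[]" "[q, p]"] by simp_all
    then show "rel_cong ?u ?v [p, q, x, y, x] [x, y, x, q, p]" using rel_cong_trans by blast
    then show "rel_cong ?u ?v [x, y, x, q, p] [p, q, x, y, x]" by (rule rel_cong_sym)
  qed
  note eqs = pq rel_cong_base[of ?u ?v] rel_cong_base[of ?u ?v, THEN rel_cong_sym]
  \<comment> \<open>Because of \<open>xyN = Nyx\<close> the letter \<open>x\<close> passes the block
    \<open>yN\<close> and turns it into \<open>Ny\<close>; likewise \<open>p\<close> passes
    \<open>qN\<close>.\<close>
  define f where "f c e = casc [([Some e, N], [N, Some e])] [([Some e, Some c], [N]), ([], [Some c])]" for c e :: 'a
  define es where "es c = (if c = Some x then [([], [], [x], [([Some y, N], [N, Some y])], [([Some y, Some x], [N]), ([], [Some x])])]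
    else if c = Some p then [([], [], [p], [([Some q, N], [N, Some q])], [([Some q, Some p], [N]), ([], [Some p])])]
    else [simple [] [c]])" for c
  have f: "f c e [] = [Some c]" "f c e (i # \<gamma>) = (if i = Some e \<and> prefix [N] \<gamma> then N # Some e # f c e (tl \<gamma>)
     else if i = Some e \<and> prefix [Some c] \<gamma> then N # tl \<gamma> else Some c # i # \<gamma>)" for c e i \<gamma>
    by (auto simp: f_def prefix_def)
  have run: "run (es c) \<alpha> = (if c = Some x then f x y \<alpha> else if c = Some p then f p q \<alpha> else c # \<alpha>)" for c \<alpha>
    using neq by (simp add: es_def f_def)
  have f_hd: "\<exists>r. f c e \<gamma> = N # r \<or> f c e \<gamma> = Some c # r" for c e \<gamma> by (cases \<gamma>) (auto simp: f)
  let ?P = "\<lambda>c e. (c, e) = (x, y) \<or> (c, e) = (p, q)"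
  have consG: "Some c # \<gamma> \<in> avoid (ext A) ?G"
    if "\<gamma> \<in> avoid (ext A) ?G" "\<not> prefix [Some e, Some c] \<gamma>" "\<not> prefix [Some e, N] \<gamma>" "?P c e" for c e \<gamma>
    using that A neq by (auto simp: avoid_Cons)
  have cons: "f c e \<gamma> = Some c # \<gamma>" if "Some c # \<gamma> \<in> avoid (ext A) ?G" "?P c e" for c e \<gamma>
  proof -
    have "\<not> prefix [Some e, Some c] \<gamma>" "\<not> prefix [Some e, N] \<gamma>" using that by (auto simp: avoid_Cons)
    then show ?thesis by (cases \<gamma>) (auto simp: f prefix_def)
  qed
  have midG: "Some e # f c e \<gamma> \<in> avoid (ext A) ?G" if "f c e \<gamma> \<in> avoid (ext A) ?G" "?P c e" for c e \<gamma>
    using that f_hd[of c e \<gamma>] A neq by (auto simp: avoid_Cons)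
  \<comment> \<open>The induction is on the length because a block consumes two letters at
    once.\<close>
  have Kf: "f c e \<alpha> \<in> avoid (ext A) ?G" if "\<alpha> \<in> avoid (ext A) ?G" "?P c e" for c e \<alpha>
    using that(1)
  proof (induction \<alpha> rule: length_induct)
    case (1 \<alpha>)
    consider \<gamma> where "\<alpha> = Some e # N # \<gamma>" | \<gamma> where "\<alpha> = Some e # Some c # \<gamma>" | "\<not> prefix [Some e, Some c] \<alpha>" "\<not> prefix [Some e, N] \<alpha>"
      by (auto simp: prefix_def)
    then show ?case
    proof cases
      case (1 \<gamma>)
      then have "\<gamma> \<in> avoid (ext A) ?G" using "1.prems" by (simp add: avoid_Cons)
      then have "f c e \<gamma> \<in> avoid (ext A) ?G" using "1.IH" 1 by simp
      then show ?thesis using midG[OF _ that(2)] 1 by (simp add: f avoid_Cons[of N])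
    next
      case (2 \<gamma>)
      then show ?thesis using "1.prems" by (simp add: f avoid_Cons)
    next
      case 3
      then show ?thesis using consG[OF "1.prems" _ _ that(2)] cons[OF _ that(2)] by simp
    qed
  qed
  have triple: "f c e (Some e # f c e \<alpha>) = N # \<alpha>" if "\<alpha> \<in> avoid (ext A) ?G" "?P c e" for c e \<alpha>
    using that(1)
  proof (induction \<alpha> rule: length_induct)
    case (1 \<alpha>)
    consider \<gamma> where "\<alpha> = Some e # N # \<gamma>" | \<gamma> where "\<alpha> = Some e # Some c # \<gamma>" | "\<not> prefix [Some e, Some c] \<alpha>" "\<not> prefix [Some e, N] \<alpha>"
      by (auto simp: prefix_def)
    then show ?case
    proof cases
      case (1 \<gamma>)
      then have "\<gamma> \<in> avoid (ext A) ?G" using "1.prems" by (simp add: avoid_Cons)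
      then have "f c e (Some e # f c e \<gamma>) = N # \<gamma>" using "1.IH" 1 by simp
      moreover have "f c e \<alpha> = N # Some e # f c e \<gamma>" "f c e (Some e # N # \<delta>) = N # Some e # f c e \<delta>" for \<delta>
        using 1 by (simp_all add: f(2))
      ultimately show ?thesis using 1 by simp
    next
      case (2 \<gamma>)
      have "f c e \<gamma> = Some c # \<gamma>" by (rule cons[OF _ that(2)]) (use "1.prems" 2 in \<open>simp add: avoid_Cons[of "Some e"]\<close>)
      moreover have "f c e \<alpha> = N # \<gamma>" "f c e (Some e # N # \<delta>) = N # Some e # f c e \<delta>" for \<delta>
        using 2 by (simp_all add: f(2))
      ultimately show ?thesis using 2 by simp
    next
      case 3
      have "f c e \<alpha> = Some c # \<alpha>" using consG[OF "1.prems" 3 that(2)] cons[OF _ that(2)] by simp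
      then show ?thesis by (simp add: f)
    qed
  qed
  interpret K': extended A ?u ?v ?u ?G es
  proof
    show "entries_ok ?u ?v (ext A) (extval ?u) c (es c)" if "c \<in> ext A" for c
      using that A neq entries_ok_default[OF that] eqs by (auto simp: es_def entries_ok_def entry_ok_def)
    show "run (es c) \<alpha> \<in> avoid (ext A) ?G" if "c \<in> ext A" "\<alpha> \<in> avoid (ext A) ?G" for c \<alpha>
      using that Kf[OF that(2), of x y] Kf[OF that(2), of p q] by (auto simp: run avoid_Cons)
  qed (use A in auto)
  have mid: "run (es (Some y)) (f x y \<alpha>) = Some y # f x y \<alpha>" "run (es (Some q)) (f p q \<alpha>) = Some q # f p q \<alpha>" for \<alpha>
    using f_hd[of x y \<alpha>] neq by (auto simp: run f)
  have cross: "cross_section ?u ?v (extval ?u) (avoid (ext A) ?G)"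
  proof (rule K'.cross_section)
    show "run (es c) \<alpha> = c # \<alpha>" if "c # \<alpha> \<in> avoid (ext A) ?G" for c \<alpha>
      using that cons[of x \<alpha> y] cons[of p \<alpha> q] by (auto simp: run)
    have "foldr (\<lambda>b. run (es b)) (map Some ?u) \<alpha> = N # \<alpha>" "foldr (\<lambda>b. run (es b)) (map Some ?v) \<alpha> = N # \<alpha>"
      if "\<alpha> \<in> avoid (ext A) ?G" for \<alpha>
    proof -
      have "foldr (\<lambda>b. run (es b)) (map Some ?u) \<alpha> = f x y (run (es (Some y)) (f x y \<alpha>))"
        "foldr (\<lambda>b. run (es b)) (map Some ?v) \<alpha> = f p q (run (es (Some q)) (f p q \<alpha>))"
        using neq by (simp_all add: run[of "Some x"] run[of "Some p"])
      then show "foldr (\<lambda>b. run (es b)) (map Some ?u) \<alpha> = N # \<alpha>" "foldr (\<lambda>b. run (es b)) (map Some ?v) \<alpha> = N # \<alpha>"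
        unfolding mid using triple[OF that, of x y] triple[OF that, of p q] by simp_all
    qed
    then show "foldr (\<lambda>b. run (es b)) (map Some ?u) \<alpha> = foldr (\<lambda>b. run (es b)) (map Some ?v) \<alpha>"
      "run (es N) \<alpha> = foldr (\<lambda>b. run (es b)) (map Some ?u) \<alpha>" if "\<alpha> \<in> avoid (ext A) ?G" for \<alpha>
      using that run[of N \<alpha>] by (simp_all only: if_False option.distinct)
  qed
  \<comment> \<open>With \<open>Nyx\<close> and \<open>Nqp\<close> forbidden instead,
    \<open>N\<close> travels to the right through the pairs \<open>yx\<close> and \<open>qp\<close>
    and reverses them.\<close>
  let ?gs = "[([Some y, Some x], [Some x, Some y]), ([Some q, Some p], [Some p, Some q])]"
  define pass where "pass = casc ?gs [([], [N])]"
  have pass: "pass [] = [N]" "pass (i # \<gamma>) = (if i = Some y \<and> prefix [Some x] \<gamma> then Some x # Some y # pass (tl \<gamma>)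
     else if i = Some q \<and> prefix [Some p] \<gamma> then Some p # Some q # pass (tl \<gamma>) else N # i # \<gamma>)" for i \<gamma>
    by (auto simp: pass_def prefix_def)
  have pass_hd: "pass \<gamma> = N # \<gamma> \<or> (\<exists>\<delta>. \<gamma> = Some y # Some x # \<delta> \<and> pass \<gamma> = Some x # Some y # pass \<delta>) \<or>
     (\<exists>\<delta>. \<gamma> = Some q # Some p # \<delta> \<and> pass \<gamma> = Some p # Some q # pass \<delta>)" for \<gamma>
    by (cases \<gamma>) (auto simp: pass prefix_def)
  have Kpass: "\<alpha> \<in> avoid (ext A) ?F \<Longrightarrow> pass \<alpha> \<in> avoid (ext A) ?F" for \<alpha>
  proof (induction \<alpha> rule: length_induct)
    case (1 \<alpha>)
    consider \<gamma> where "\<alpha> = Some y # Some x # \<gamma>" | \<gamma> where "\<alpha> = Some q # Some p # \<gamma>"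
      | "\<not> prefix [Some y, Some x] \<alpha>" "\<not> prefix [Some q, Some p] \<alpha>"
      by (auto simp: prefix_def)
    then show ?case
    proof cases
      case (1 \<gamma>)
      then have g: "\<gamma> \<in> avoid (ext A) ?F" "\<not> prefix [Some y, Some x] \<gamma>" using "1.prems" by (auto simp: avoid_Cons)
      then have "pass \<gamma> \<in> avoid (ext A) ?F" using "1.IH" 1 by simp
      moreover have "pass \<alpha> = Some x # Some y # pass \<gamma>" using 1 by (simp add: pass)
      ultimately show ?thesis using pass_hd[of \<gamma>] g(2) A neq by (auto simp: avoid_Cons)
    next
      case (2 \<gamma>)
      then have g: "\<gamma> \<in> avoid (ext A) ?F" "\<not> prefix [Some q, Some p] \<gamma>" using "1.prems" by (auto simp: avoid_Cons)
      then have "pass \<gamma> \<in> avoid (ext A) ?F" using "1.IH" 2 by simp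
      moreover have "pass \<alpha> = Some p # Some q # pass \<gamma>" using 2 neq by (simp add: pass)
      ultimately show ?thesis using pass_hd[of \<gamma>] g(2) A neq by (auto simp: avoid_Cons)
    next
      case 3
      then have "pass \<alpha> = N # \<alpha>" by (cases \<alpha>) (auto simp: pass prefix_def)
      then show ?thesis using 3 "1.prems" by (simp add: avoid_Cons)
    qed
  qed
  define es' where "es' c = (if c = Some x then [([Some y, Some x], [], ?u, ?gs, [([], [N])]), simple [] [Some x]]
    else if c = Some p then [([Some q, Some p], [], ?u, ?gs, [([], [N])]), simple [] [Some p]]
    else if c = N then [([], [], ?u, ?gs, [([], [N])])] else [simple [] [c]])" for c
  have run': "run (es' c) \<alpha> = (if c = Some x \<and> prefix [Some y, Some x] \<alpha> then pass (drop 2 \<alpha>)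
    else if c = Some p \<and> prefix [Some q, Some p] \<alpha> then pass (drop 2 \<alpha>) else if c = N then pass \<alpha> else c # \<alpha>)" for c \<alpha>
    using neq by (auto simp: es'_def pass_def numeral_2_eq_2)
  have Kdrop: "\<alpha> \<in> avoid (ext A) ?F \<Longrightarrow> drop n \<alpha> \<in> avoid (ext A) ?F" for n \<alpha>
    using avoid_append[of "take n \<alpha>" "drop n \<alpha>"] by simp
  interpret K: extended A ?u ?v ?u ?F es'
  proof
    show "entries_ok ?u ?v (ext A) (extval ?u) c (es' c)" if "c \<in> ext A" for c
      using that A neq entries_ok_default[OF that] eqs by (auto simp: es'_def entries_ok_def entry_ok_def)
    show "run (es' c) \<alpha> \<in> avoid (ext A) ?F" if "c \<in> ext A" "\<alpha> \<in> avoid (ext A) ?F" for c \<alpha>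
      using that Kpass[OF Kdrop[OF that(2), of 2]] Kpass[OF that(2)] neq by (auto simp: run' avoid_Cons)
  qed (use A in auto)
  have rv: "rev ` ?G = ?F" by auto
  have "rev ?u = ?u" "rev ?v = ?v" by auto
  then have "head_tame A ?u ?v (ext A) (extval ?u) (rev ` avoid (ext A) ?G)"
    using K.head_tame cross_section_palindrome[OF cross] by (simp only: avoid_rev rv)
  then show ?thesis using K'.head_tame[OF cross] by blast
qed

text \<open>As a power of \<open>p\<close> the letter \<open>N\<close> commutes with
  \<open>p\<close>, whereas for \<open>x\<close> and \<open>y\<close> only \<open>xyN = Nyx\<close>
  is available. The system combines the passing through single letters \<open>p\<close> with that
  through pairs of letters.\<close>

lemma head_tame_sandwich_other_power:
  assumes A: "finite A" "x \<in> A" "y \<in> A" "p \<in> A" and neq: "x \<noteq> y" "p \<noteq> x" "p \<noteq> y" and rp: "rp = [p] \<or> rp = [p, p]"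
  shows "\<exists>K. head_tame A [x, y, x] (p # rp) (ext A) (extval [x, y, x]) K \<and>
    head_tame A [x, y, x] (p # rp) (ext A) (extval [x, y, x]) (rev ` K)"
proof -
  let ?u = "[x, y, x]" and ?v = "p # rp"
  let ?F = "{map Some ?u, map Some ?v, [N, Some y, Some x], [N, Some p]}"
  let ?G = "{map Some ?u, map Some ?v, [Some x, Some y, N], [Some p, N]}"
  have pu: "rel_cong ?u ?v [p, x, y, x] [x, y, x, p]" "rel_cong ?u ?v [x, y, x, p] [p, x, y, x]"
  proof -
    have "rel_cong ?u ?v [p, x, y, x] (p # ?v)" "rel_cong ?u ?v (?v @ [p]) [x, y, x, p]"
      using rel_cong_rule[of ?u ?v "[p]" "[]"] rel_cong_rule'[of ?u ?v "[]" "[p]"] by simp_all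
    moreover have "p # ?v = ?v @ [p]" using rp by auto
    ultimately show "rel_cong ?u ?v [p, x, y, x] [x, y, x, p]" using rel_cong_trans by metis
    then show "rel_cong ?u ?v [x, y, x, p] [p, x, y, x]" by (rule rel_cong_sym)
  qed
  note eqs = pu rel_cong_base[of ?u ?v] rel_cong_base[of ?u ?v, THEN rel_cong_sym]
  define fx where "fx = casc [([Some y, N], [N, Some y])] [([Some y, Some x], [N]), ([], [Some x])]"
  define fp where "fp = casc [([N], [N])] [(map Some rp, [N]), ([], [Some p])]"
  define es where "es c = (if c = Some x then [([], [], [x], [([Some y, N], [N, Some y])], [([Some y, Some x], [N]), ([], [Some x])])]
    else if c = Some p then [([], [], [p], [([N], [N])], [(map Some rp, [N]), ([], [Some p])])]
    else [simple [] [c]])" for c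
  have fx: "fx [] = [Some x]" "fx (i # \<gamma>) = (if i = Some y \<and> prefix [N] \<gamma> then N # Some y # fx (tl \<gamma>)
     else if i = Some y \<and> prefix [Some x] \<gamma> then N # tl \<gamma> else Some x # i # \<gamma>)" for i \<gamma>
    by (auto simp: fx_def prefix_def)
  have fp: "fp [] = [Some p]"
    "fp (e # \<gamma>) = (if e = N then N # fp \<gamma> else if prefix (map Some rp) (e # \<gamma>) then N # drop (length rp) (e # \<gamma>) else Some p # e # \<gamma>)"
    for e \<gamma> using rp by (auto simp: fp_def)
  have run: "run (es c) \<alpha> = (if c = Some x then fx \<alpha> else if c = Some p then fp \<alpha> else c # \<alpha>)" for c \<alpha>
    using neq by (simp add: es_def fx_def fp_def)
  have drop_K: "\<alpha> \<in> avoid (ext A) X \<Longrightarrow> drop n \<alpha> \<in> avoid (ext A) X" for n \<alpha> X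
    using avoid_append[of "take n \<alpha>" "drop n \<alpha>"] by simp
  have consGx: "Some x # \<gamma> \<in> avoid (ext A) ?G"
    if "\<gamma> \<in> avoid (ext A) ?G" "\<not> prefix [Some y, Some x] \<gamma>" "\<not> prefix [Some y, N] \<gamma>" for \<gamma>
    using that A neq by (auto simp: avoid_Cons)
  have consx: "fx \<gamma> = Some x # \<gamma>" if "Some x # \<gamma> \<in> avoid (ext A) ?G" for \<gamma>
  proof -
    have "\<not> prefix [Some y, Some x] \<gamma>" "\<not> prefix [Some y, N] \<gamma>" using that by (auto simp: avoid_Cons)
    then show ?thesis by (cases \<gamma>) (auto simp: fx prefix_def)
  qed
  have sub: "avoid (ext A) ?G \<subseteq> avoid (ext A) {map Some (p # rp), [Some p, N]}"
    by (auto simp: avoid_def)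
  have consp: "fp \<gamma> = Some p # \<gamma>" if "Some p # \<gamma> \<in> avoid (ext A) ?G" for \<gamma>
    unfolding fp_def using collect_power(2)[OF A(4) rp subsetD[OF sub that]] by simp
  have Kx: "fx \<alpha> \<in> avoid (ext A) ?G" if "\<alpha> \<in> avoid (ext A) ?G" for \<alpha>
    using that
  proof (induction \<alpha> rule: length_induct)
    case (1 \<alpha>)
    consider \<gamma> where "\<alpha> = Some y # N # \<gamma>" | \<gamma> where "\<alpha> = Some y # Some x # \<gamma>" | "\<not> prefix [Some y, Some x] \<alpha>" "\<not> prefix [Some y, N] \<alpha>"
      by (auto simp: prefix_def)
    then show ?case
    proof cases
      case (1 \<gamma>)
      then have "\<gamma> \<in> avoid (ext A) ?G" using "1.prems" by (simp add: avoid_Cons)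
      then have "fx \<gamma> \<in> avoid (ext A) ?G" using "1.IH" 1 by simp
      then show ?thesis using 1 A neq by (simp add: fx avoid_Cons)
    next
      case (2 \<gamma>)
      then show ?thesis using "1.prems" by (simp add: fx avoid_Cons)
    next
      case 3
      then show ?thesis using consGx[OF "1.prems"] consx by simp
    qed
  qed
  have Kp: "fp \<alpha> \<in> avoid (ext A) ?G" if "\<alpha> \<in> avoid (ext A) ?G" for \<alpha>
    using that
  proof (induction \<alpha>)
    case Nil
    then show ?case using rp A by (auto simp: fp avoid_Cons)
  next
    case (Cons e \<alpha>)
    consider "e = N" | "e \<noteq> N" "prefix (map Some rp) (e # \<alpha>)" | "e \<noteq> N" "\<not> prefix (map Some rp) (e # \<alpha>)" by blast
    then show ?case
    proof cases
      case 1
      then show ?thesis using Cons by (simp add: fp avoid_Cons)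
    next
      case 2
      then have "fp (e # \<alpha>) = N # drop (length rp) (e # \<alpha>)" by (auto simp: fp)
      then show ?thesis using drop_K[OF Cons.prems, of "length rp"] by (simp add: avoid_Cons)
    next
      case 3
      then have "Some p # e # \<alpha> \<in> avoid (ext A) ?G" using A neq Cons.prems by (auto simp: avoid_Cons[of "Some p"])
      then show ?thesis using consp by simp
    qed
  qed
  have triple: "fx (Some y # fx \<alpha>) = N # \<alpha>" if "\<alpha> \<in> avoid (ext A) ?G" for \<alpha>
    using that
  proof (induction \<alpha> rule: length_induct)
    case (1 \<alpha>)
    consider \<gamma> where "\<alpha> = Some y # N # \<gamma>" | \<gamma> where "\<alpha> = Some y # Some x # \<gamma>" | "\<not> prefix [Some y, Some x] \<alpha>" "\<not> prefix [Some y, N] \<alpha>"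
      by (auto simp: prefix_def)
    then show ?case
    proof cases
      case (1 \<gamma>)
      then have "\<gamma> \<in> avoid (ext A) ?G" using "1.prems" by (simp add: avoid_Cons)
      then have "fx (Some y # fx \<gamma>) = N # \<gamma>" using "1.IH" 1 by simp
      moreover have "fx \<alpha> = N # Some y # fx \<gamma>" "fx (Some y # N # \<delta>) = N # Some y # fx \<delta>" for \<delta>
        using 1 by (simp_all add: fx(2))
      ultimately show ?thesis using 1 by simp
    next
      case (2 \<gamma>)
      have "fx \<gamma> = Some x # \<gamma>" by (rule consx) (use "1.prems" 2 in \<open>simp add: avoid_Cons[of "Some y"]\<close>)
      moreover have "fx \<alpha> = N # \<gamma>" "fx (Some y # N # \<delta>) = N # Some y # fx \<delta>" for \<delta>
        using 2 by (simp_all add: fx(2))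
      ultimately show ?thesis using 2 by simp
    next
      case 3
      have "fx \<alpha> = Some x # \<alpha>" using consGx[OF "1.prems" 3] consx by simp
      then show ?thesis by (simp add: fx)
    qed
  qed
  interpret K': extended A ?u ?v ?u ?G es
  proof
    show "entries_ok ?u ?v (ext A) (extval ?u) c (es c)" if "c \<in> ext A" for c
      using that A neq rp entries_ok_default[OF that] eqs by (auto simp: es_def entries_ok_def entry_ok_def)
    show "run (es c) \<alpha> \<in> avoid (ext A) ?G" if "c \<in> ext A" "\<alpha> \<in> avoid (ext A) ?G" for c \<alpha>
      using that Kx[OF that(2)] Kp[OF that(2)] by (auto simp: run avoid_Cons)
  qed (use A rp in auto)
  have cross: "cross_section ?u ?v (extval ?u) (avoid (ext A) ?G)"
  proof (rule K'.cross_section)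
    show "run (es c) \<alpha> = c # \<alpha>" if "c # \<alpha> \<in> avoid (ext A) ?G" for c \<alpha>
      using that consx consp by (auto simp: run)
    have u: "foldr (\<lambda>b. run (es b)) (map Some ?u) \<alpha> = N # \<alpha>" if "\<alpha> \<in> avoid (ext A) ?G" for \<alpha>
      using triple[OF that] neq by (simp add: run)
    have v: "foldr (\<lambda>b. run (es b)) (map Some ?v) \<alpha> = N # \<alpha>" if "\<alpha> \<in> avoid (ext A) ?G" for \<alpha>
    proof -
      have "fp (foldr (\<lambda>_. fp) rp \<alpha>) = N # \<alpha>"
        unfolding fp_def by (rule collect_power(1)[OF A(4) rp subsetD[OF sub that]])
      then show ?thesis using rp neq by (auto simp: run)
    qed
    show "foldr (\<lambda>b. run (es b)) (map Some ?u) \<alpha> = foldr (\<lambda>b. run (es b)) (map Some ?v) \<alpha>"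
      if "\<alpha> \<in> avoid (ext A) ?G" for \<alpha> unfolding u[OF that] v[OF that] ..
    show "run (es N) \<alpha> = foldr (\<lambda>b. run (es b)) (map Some ?u) \<alpha>" if "\<alpha> \<in> avoid (ext A) ?G" for \<alpha>
      unfolding u[OF that] by (simp add: run)
  qed
  let ?gs = "[([Some y, Some x], [Some x, Some y]), ([Some p], [Some p])]"
  define pass where "pass = casc ?gs [([], [N])]"
  have pass: "pass [] = [N]" "pass (i # \<gamma>) = (if i = Some y \<and> prefix [Some x] \<gamma> then Some x # Some y # pass (tl \<gamma>)
     else if i = Some p then Some p # pass \<gamma> else N # i # \<gamma>)" for i \<gamma>
    by (auto simp: pass_def prefix_def)
  have pre: "prefix [Some p] (pass \<gamma>) \<longleftrightarrow> prefix [Some p] \<gamma>" "prefix [Some p, Some p] (pass \<gamma>) \<longleftrightarrow> prefix [Some p, Some p] \<gamma>"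
    "prefix [Some x] (pass \<gamma>) \<longleftrightarrow> prefix [Some y, Some x] \<gamma>" for \<gamma>
    using neq by (cases \<gamma>; cases "tl \<gamma>"; auto simp: pass prefix_def)+
  have Kpass: "\<alpha> \<in> avoid (ext A) ?F \<Longrightarrow> pass \<alpha> \<in> avoid (ext A) ?F" for \<alpha>
  proof (induction \<alpha> rule: length_induct)
    case (1 \<alpha>)
    consider \<gamma> where "\<alpha> = Some y # Some x # \<gamma>" | \<gamma> where "\<alpha> = Some p # \<gamma>"
      | "\<not> prefix [Some y, Some x] \<alpha>" "\<not> prefix [Some p] \<alpha>"
      by (auto simp: prefix_def)
    then show ?case
    proof cases
      case (1 \<gamma>)
      then have g: "\<gamma> \<in> avoid (ext A) ?F" "\<not> prefix [Some y, Some x] \<gamma>" using "1.prems" by (auto simp: avoid_Cons)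
      then have "pass \<gamma> \<in> avoid (ext A) ?F" using "1.IH" 1 by simp
      moreover have "pass \<alpha> = Some x # Some y # pass \<gamma>" using 1 by (simp add: pass)
      moreover have "\<not> prefix [Some x] (pass \<gamma>)" using g(2) pre(3) by blast
      ultimately show ?thesis using A neq by (auto simp: avoid_Cons)
    next
      case (2 \<gamma>)
      then have g: "\<gamma> \<in> avoid (ext A) ?F" "\<not> prefix (map Some rp) \<gamma>" using "1.prems" by (auto simp: avoid_Cons)
      then have "pass \<gamma> \<in> avoid (ext A) ?F" using "1.IH" 2 by simp
      moreover have "pass \<alpha> = Some p # pass \<gamma>" using 2 neq by (simp add: pass)
      moreover have "\<not> prefix (map Some rp) (pass \<gamma>)" using g(2) rp pre by auto
      ultimately show ?thesis using A neq by (auto simp: avoid_Cons)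
    next
      case 3
      then have "pass \<alpha> = N # \<alpha>" by (cases \<alpha>) (auto simp: pass prefix_def)
      then show ?thesis using 3 "1.prems" by (simp add: avoid_Cons)
    qed
  qed
  define es' where "es' c = (if c = Some x then [([Some y, Some x], [], ?u, ?gs, [([], [N])]), simple [] [Some x]]
    else if c = Some p then [(map Some rp, [], ?u, ?gs, [([], [N])]), simple [] [Some p]]
    else if c = N then [([], [], ?u, ?gs, [([], [N])])] else [simple [] [c]])" for c
  have run': "run (es' c) \<alpha> = (if c = Some x \<and> prefix [Some y, Some x] \<alpha> then pass (drop 2 \<alpha>)
    else if c = Some p \<and> prefix (map Some rp) \<alpha> then pass (drop (length rp) \<alpha>) else if c = N then pass \<alpha> else c # \<alpha>)" for c \<alpha>
    using neq by (auto simp: es'_def pass_def numeral_2_eq_2)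
  interpret K: extended A ?u ?v ?u ?F es'
  proof
    show "entries_ok ?u ?v (ext A) (extval ?u) c (es' c)" if "c \<in> ext A" for c
      using that A neq rp entries_ok_default[OF that] eqs by (auto simp: es'_def entries_ok_def entry_ok_def)
    show "run (es' c) \<alpha> \<in> avoid (ext A) ?F" if "c \<in> ext A" "\<alpha> \<in> avoid (ext A) ?F" for c \<alpha>
      using that Kpass[OF drop_K[OF that(2), of 2]] Kpass[OF drop_K[OF that(2), of "length rp"]] Kpass[OF that(2)] neq
      by (auto simp: run' avoid_Cons)
  qed (use A rp in auto)
  have rv: "rev ` ?G = ?F" using rp by auto
  have "rev ?u = ?u" "rev ?v = ?v" using rp by auto
  then have "head_tame A ?u ?v (ext A) (extval ?u) (rev ` avoid (ext A) ?G)"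
    using K.head_tame cross_section_palindrome[OF cross] by (simp only: avoid_rev rv)
  then show ?thesis using K'.head_tame[OF cross] by blast
qed

text \<open>If \<open>aba = 1\<close>, then \<open>a\<close> has the inverse \<open>N = ab = ba\<close>, and \<open>b = N\<^sup>2\<close>.\<close>

lemma head_tame_sandwich_one:
  assumes A: "finite A" "a \<in> A" "b \<in> A" "a \<noteq> b"
  defines "F \<equiv> {[Some b], [Some a, N], [N, Some a]}"
  assumes w: "w = [a, b] \<or> w = [b, a]"
  shows "head_tame A [a, b, a] [] (ext A) (extval w) (avoid (ext A) F)"
proof -
  let ?u = "[a, b, a]" and ?v = "[] :: 'a list"
  have ab: "rel_cong ?u ?v [a, b] [b, a]"
  proof -
    have "rel_cong ?u ?v [a, b] [a, b, a, b, a]" "rel_cong ?u ?v [a, b, a, b, a] [b, a]"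
      using rel_cong_rule'[of ?u ?v "[a, b]" "[]"] rel_cong_rule[of ?u ?v "[]" "[b, a]"] by simp_all
    then show ?thesis by (rule rel_cong_trans)
  qed
  have aab: "rel_cong ?u ?v [a, a, b] []" "rel_cong ?u ?v [b, a, a] []"
  proof -
    have "rel_cong ?u ?v [a, a, b] [a, b, a]" "rel_cong ?u ?v [b, a, a] [a, b, a]"
      using rel_cong_append_left[OF ab, of "[a]"] rel_cong_append_right[OF ab[THEN rel_cong_sym], of "[a]"] by simp_all
    then show "rel_cong ?u ?v [a, a, b] []" "rel_cong ?u ?v [b, a, a] []"
      using rel_cong_base[of ?u ?v] rel_cong_trans by blast+
  qed
  have b: "rel_cong ?u ?v [b] [a, b, a, b]" "rel_cong ?u ?v [b] [b, a, b, a]"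
    using rel_cong_rule'[of ?u ?v "[]" "[b]"] rel_cong_rule'[of ?u ?v "[b]" "[]"] by simp_all
  note eqs = ab ab[THEN rel_cong_sym] aab b rel_cong_base[of ?u ?v]
  \<comment> \<open>Since \<open>b\<close> equals \<open>N N\<close> and \<open>N\<close> is inverse
    to \<open>a\<close>, multiplication by \<open>b\<close> cancels up to two letters
    \<open>a\<close> and writes an \<open>N\<close> for each one that is missing.\<close>
  define es :: "'a option \<Rightarrow> ('a, 'a option) entry list" where
    "es c = (if c = Some a then [simple [N] [], simple [] [Some a]]
    else if c = N then [simple [Some a] [], simple [] [N]]
    else if c = Some b then [simple [Some a, Some a] [], simple [Some a] [N], simple [] [N, N]]
    else [simple [] [c]])" for c
  have run: "run (es c) \<alpha> = (if c = Some a then (if prefix [N] \<alpha> then tl \<alpha> else Some a # \<alpha>)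
    else if c = N then (if prefix [Some a] \<alpha> then tl \<alpha> else N # \<alpha>)
    else if c = Some b then (if prefix [Some a, Some a] \<alpha> then drop 2 \<alpha> else if prefix [Some a] \<alpha> then N # tl \<alpha> else N # N # \<alpha>)
    else c # \<alpha>)" for c \<alpha>
    using A(4) by (auto simp: es_def prefix_def)
  interpret extended A ?u ?v w F es
  proof
    show "entries_ok ?u ?v (ext A) (extval w) c (es c)" if "c \<in> ext A" for c
      using that A w entries_ok_default[OF that] eqs by (auto simp: es_def entries_ok_def entry_ok_def)
    show "run (es c) \<alpha> \<in> avoid (ext A) F" if "c \<in> ext A" "\<alpha> \<in> avoid (ext A) F" for c \<alpha>
      using that A by (cases \<alpha>; cases "tl \<alpha>") (auto simp: run avoid_Cons F_def)
  qed (use A w in \<open>auto simp: F_def\<close>)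
  have "cross_section ?u ?v (extval w) K"
  proof (rule cross_section)
    show "run (es c) \<alpha> = c # \<alpha>" if "c # \<alpha> \<in> K" for c \<alpha>
      using that A(4) by (cases \<alpha>) (auto simp: run avoid_Cons F_def)
    show "foldr (\<lambda>b. run (es b)) (map Some ?u) \<alpha> = foldr (\<lambda>b. run (es b)) (map Some ?v) \<alpha>" if "\<alpha> \<in> K" for \<alpha>
      using that A(4) by (cases \<alpha>; cases "tl \<alpha>") (auto simp: run avoid_Cons F_def)
    show "run (es N) \<alpha> = foldr (\<lambda>b. run (es b)) (map Some w) \<alpha>" if "\<alpha> \<in> K" for \<alpha>
    proof -
      consider \<delta> where "\<alpha> = Some a # Some a # \<delta>" "\<not> prefix [N] \<delta>"
        | \<delta> where "\<alpha> = Some a # \<delta>" "\<not> prefix [Some a] \<delta>" "\<not> prefix [N] \<delta>"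
        | \<delta> where "\<alpha> = N # \<delta>" "\<not> prefix [Some a] \<delta>"
        | "\<not> prefix [Some a] \<alpha>" "\<not> prefix [N] \<alpha>"
      proof (cases \<alpha>)
        case (Cons c \<gamma>)
        then show ?thesis using that \<open>\<alpha> \<in> K\<close> by (cases \<gamma>) (auto simp: avoid_Cons F_def)
      qed (use that in simp)
      then show ?thesis
      proof cases
        case (1 \<delta>)
        then show ?thesis using w A(4) by (auto simp: run)
      next
        case (2 \<delta>)
        then show ?thesis using w A(4) by (auto simp: run)
      next
        case (3 \<delta>)
        have "\<not> prefix [Some a, Some a] \<delta>" using 3(2) by (auto simp: prefix_def)
        then show ?thesis using 3 w A(4) by (auto simp: run)
      next
        case 4
        have "\<not> prefix [Some a, Some a] \<alpha>" using 4(1) by (auto simp: prefix_def)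
        then show ?thesis using 4 w A(4) by (auto simp: run)
      qed
    qed
  qed
  then show ?thesis by (rule head_tame)
qed

text \<open>For \<open>aba = ba\<close> the completed system is infinite: \<open>a b\<^sup>n a = b\<^sup>n a\<close> for all \<open>n \<ge> 1\<close>.\<close>

lemma head_tame_aba_ba:
  assumes A: "finite A" "a \<in> A" "b \<in> A" "a \<noteq> b"
  shows "\<exists>K. head_tame A [a, b, a] [b, a] A single K"
proof -
  let ?u = "[a, b, a]" and ?v = "[b, a]"
  define bs where "bs n = concat (replicate n [b])" for n
  have bs: "bs 0 = []" "bs (Suc n) = b # bs n" for n by (simp_all add: bs_def)
  define F where "F = {[a, b] @ bs n @ [a] | n. True}"
  let ?K = "avoid A F"
  have "F = conc (conc {[a, b]} {bs n | n. True}) {[a]}" unfolding F_def conc_def by auto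
  moreover have "regular A {bs n | n. True}" unfolding bs_def using A by (intro regular_power_star) auto
  ultimately have "regular A F" using A by (auto intro!: regular_conc regular_finite)
  then have reg: "regular A ?K" by (rule regular_avoid)
  have ne: "[] \<notin> F" by (auto simp: F_def)
  define good where "good \<alpha> \<longleftrightarrow> (\<exists>n \<gamma>. \<alpha> = b # bs n @ a # \<gamma>)" for \<alpha>
  have goodF: "(\<exists>f\<in>F. prefix f (a # \<alpha>)) \<longleftrightarrow> good \<alpha>" for \<alpha>
  proof
    assume "\<exists>f\<in>F. prefix f (a # \<alpha>)"
    then obtain n zs where "a # \<alpha> = [a, b] @ bs n @ a # zs" by (auto simp: F_def prefix_def)
    then show "good \<alpha>" unfolding good_def by (intro exI[of _ n] exI[of _ zs]) simp
  next
    assume "good \<alpha>"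
    then obtain n \<gamma> where "\<alpha> = b # bs n @ a # \<gamma>" by (auto simp: good_def)
    then have "prefix ([a, b] @ bs n @ [a]) (a # \<alpha>)" by simp
    then show "\<exists>f\<in>F. prefix f (a # \<alpha>)" unfolding F_def by blast
  qed
  have notF: "\<not> prefix f (c # \<alpha>)" if "f \<in> F" "c \<noteq> a" for f c \<alpha>
    using that by (auto simp: F_def)
  define f where "f c \<alpha> = (if c = a \<and> good \<alpha> then \<alpha> else c # \<alpha>)" for c \<alpha>
  have good_b: "good (b # \<alpha>) \<longleftrightarrow> good \<alpha> \<or> (\<exists>\<gamma>. \<alpha> = a # \<gamma>)" for \<alpha>
  proof
    assume "good (b # \<alpha>)"
    then obtain n \<gamma> where "\<alpha> = bs n @ a # \<gamma>" by (auto simp: good_def)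
    then show "good \<alpha> \<or> (\<exists>\<gamma>. \<alpha> = a # \<gamma>)" by (cases n) (auto simp: bs good_def)
  next
    assume "good \<alpha> \<or> (\<exists>\<gamma>. \<alpha> = a # \<gamma>)"
    then show "good (b # \<alpha>)"
    proof
      assume "good \<alpha>"
      then obtain n \<gamma> where "\<alpha> = b # bs n @ a # \<gamma>" by (auto simp: good_def)
      then show ?thesis unfolding good_def by (intro exI[of _ "Suc n"] exI[of _ \<gamma>]) (simp add: bs)
    next
      assume "\<exists>\<gamma>. \<alpha> = a # \<gamma>"
      then show ?thesis unfolding good_def by (metis append_Nil bs(1))
    qed
  qed
  have fK: "f c \<alpha> \<in> ?K" if "c \<in> A" "\<alpha> \<in> ?K" for c \<alpha>
    using that goodF[of \<alpha>] notF[of _ c \<alpha>] by (auto simp: f_def avoid_Cons)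
  have cross: "cross_section ?u ?v single ?K"
  proof (rule action_cross_section[where f=f and inc="\<lambda>a. a" and A=A and B=A])
    show "f c \<alpha> = c # \<alpha>" if "c # \<alpha> \<in> ?K" for c \<alpha>
      using that goodF[of \<alpha>] by (auto simp: f_def avoid_Cons)
    show "foldr f (map (\<lambda>a. a) ?u) \<alpha> = foldr f (map (\<lambda>a. a) ?v) \<alpha>" for \<alpha>
      using A(4) by (auto simp: f_def good_b)
    show "?K \<subseteq> lists A" using avoid_lists by blast
  qed (use A ne fK in \<open>auto simp: avoid_Cons f_def\<close>)
  have eq: "rel_cong ?u ?v (a # b # bs n @ a # \<gamma>) (b # bs n @ a # \<gamma>)" for n \<gamma>
  proof (induction n)
    case 0
    then show ?case using rel_cong_rule[of ?u ?v "[]" \<gamma>] by (simp add: bs)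
  next
    case (Suc n)
    let ?w = "b # bs n @ a # \<gamma>"
    have w: "?w = bs (Suc n) @ a # \<gamma>" by (simp add: bs)
    have "rel_cong ?u ?v (a # b # ?w) (a # b # a # ?w)"
      using rel_cong_append_left[OF Suc.IH[THEN rel_cong_sym], of "[a, b]"] by simp
    also have "rel_cong ?u ?v (a # b # a # ?w) (b # a # ?w)" using rel_cong_rule[of ?u ?v "[]" ?w] by simp
    also have "rel_cong ?u ?v (b # a # ?w) (b # ?w)" using rel_cong_append_left[OF Suc.IH, of "[b]"] by simp
    finally show ?case by (simp add: bs)
  qed
  let ?T1 = "cert_rel A (([b], [b], {([b], [b])}, [a], [a], []) :: ('a, 'a) certificate)"
  let ?T2 = "cert_rel A ([], [], {}, [], [a], [a])"
  have blk: "(X, Y) \<in> blocks {([b], [b])} \<longleftrightarrow> (\<exists>n. X = bs n \<and> Y = bs n)" for X Y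
  proof
    show "(X, Y) \<in> blocks {([b], [b])} \<Longrightarrow> \<exists>n. X = bs n \<and> Y = bs n"
      by (induction rule: blocks_induct) (auto intro: exI[of _ 0] exI[of _ "Suc _"] simp: bs)
    show "\<exists>n. X = bs n \<and> Y = bs n \<Longrightarrow> (X, Y) \<in> blocks {([b], [b])}"
      using blocks_power[of _ "[b]" "[b]"] by (auto simp: bs_def)
  qed
  \<comment> \<open>The letter \<open>a\<close> is absorbed only on account of the \<open>a\<close>
    behind the powers of \<open>b\<close>, so the first relation does not come from a travelling
    word in this monoid. Tameness depends on the shape of a certificate alone and is obtained under
    a trivial valuation; the soundness in the monoid is shown separately.\<close>
  have tame: "tame A (?T1 \<union> ?T2)"
  proof (rule tame_Un)
    show "tame A ?T1" by (rule tame_cert_rel[where u="[]" and v="[]" and val="\<lambda>_. []" and b=a]) (use A in \<open>auto simp: cert_ok_def\<close>)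
    show "tame A ?T2" by (rule tame_cert_rel[where u="[]" and v="[]" and val=single and b=a]) (use A in \<open>auto simp: cert_ok_def\<close>)
  qed
  have T1: "(\<alpha>, \<beta>) \<in> ?T1 \<longleftrightarrow> (\<exists>n \<gamma>. \<alpha> = b # bs n @ a # \<gamma> \<and> \<beta> = \<alpha> \<and> \<gamma> \<in> lists A)" for \<alpha> \<beta>
    unfolding cert_rel_def prod.case by (auto simp: blk)
  have T2: "(\<alpha>, \<beta>) \<in> ?T2 \<longleftrightarrow> \<beta> = a # \<alpha> \<and> \<alpha> \<in> lists A" for \<alpha> \<beta>
    by (auto simp: cert_rel_def blocks_def)
  have sound: "rel_cong ?u ?v (single a @ vals single \<alpha>) (vals single \<beta>)" if "(\<alpha>, \<beta>) \<in> ?T1 \<union> ?T2" for \<alpha> \<beta>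
    using that eq by (auto simp: T1 T2)
  have tot: "\<exists>\<beta>\<in>?K. (\<alpha>, \<beta>) \<in> ?T1 \<union> ?T2" if \<alpha>: "\<alpha> \<in> ?K" for \<alpha>
  proof (intro bexI[of _ "f a \<alpha>"] fK A \<alpha>)
    show "(\<alpha>, f a \<alpha>) \<in> ?T1 \<union> ?T2"
    proof (cases "good \<alpha>")
      case True
      then obtain n \<gamma> where g: "\<alpha> = b # bs n @ a # \<gamma>" by (auto simp: good_def)
      then have "\<gamma> \<in> lists A" using avoid_lists[OF \<alpha>] by auto
      then have "(\<alpha>, \<alpha>) \<in> ?T1" unfolding T1 using g by blast
      then show ?thesis using True by (simp add: f_def)
    next
      case False
      then show ?thesis using avoid_lists[OF \<alpha>] by (simp add: T2 f_def)
    qed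
  qed
  have "head_rel ?u ?v single ?K a = (?T1 \<union> ?T2) \<inter> ?K \<times> ?K" by (rule head_rel_eq[OF cross sound tot])
  then have ta: "tame A (head_rel ?u ?v single ?K a)" using tame_Int_Times[OF tame reg reg] by simp
  have ok: "mult_ok ?u ?v A single ?K c" if "c \<in> A" "c \<noteq> a" for c
    using that notF[of _ c] by (intro mult_ok_Cons) (auto intro!: avoid_lists simp: avoid_Cons)
  have tc: "tame A (head_rel ?u ?v single ?K c)" if "c \<in> A" for c
    using ta mult_ok_tame(1)[OF ok cross reg] that by (cases "c = a") auto
  have cov: "\<exists>\<beta>\<in>?K. rel_cong ?u ?v (single c @ vals single \<alpha>) (vals single \<beta>)" if "c \<in> A" "\<alpha> \<in> ?K" for c \<alpha>
  proof (cases "c = a")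
    case True
    then show ?thesis using tot[OF that(2)] sound by blast
  next
    case False
    then show ?thesis using mult_ok_tame(2)[OF ok cross reg] that by blast
  qed
  have "head_tame A ?u ?v A single ?K"
    unfolding head_tame_def head_base_def
    using A reg cross tc cov ne by (auto simp: avoid_Cons simp del: vals_single)
  then show ?thesis by blast
qed

section \<open>Non-automaticity\<close>

subsection \<open>Pumping\<close>

lemma padR_append_longer:
  "length \<beta> \<le> length x \<Longrightarrow> padR (x @ y) \<beta> = padR x \<beta> @ padR y []"
proof (induction x \<beta> rule: list_induct2')
  case (2 a x)
  have "padR (z @ y) [] = padR z [] @ padR y ([] :: 'a list)" for z by (induction z) auto
  then show ?case .
qed auto

lemma derivs_collide:
  fixes w :: "nat \<Rightarrow> 'c list"
  assumes "regular \<Sigma> P"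
  shows "\<exists>k k'. k \<noteq> k' \<and> deriv P (w k) = deriv P (w k')"
proof (rule ccontr)
  assume "\<not> ?thesis"
  then have "inj (\<lambda>k. deriv P (w k))" by (auto simp: inj_def)
  moreover have "finite (range (\<lambda>k. deriv P (w k)))"
    by (rule finite_subset[OF _ regularD(3)[OF assms]]) auto
  ultimately show False using finite_imageD[of "\<lambda>k. deriv P (w k)" UNIV] by simp
qed

text \<open>While the shorter tape has already ended, the automaton only sees the longer one, and exchanging the
  remainders of two words in the same state must not change the additive quantity \<open>cnt\<close>.\<close>

lemma exchange_padR:
  fixes cnt :: "'b list \<Rightarrow> nat"
  assumes reg: "regular \<Sigma> {padR \<alpha> \<beta> | \<alpha> \<beta>. (\<alpha>, \<beta>) \<in> R}"
    and add: "\<And>x y. cnt (x @ y) = cnt x + cnt y"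
    and R: "\<And>\<alpha> \<beta>. (\<alpha>, \<beta>) \<in> R \<Longrightarrow> c + cnt \<alpha> = cnt \<beta>"
    and ex: "\<And>k. \<exists>x y \<beta>. (x @ y, \<beta>) \<in> R \<and> length \<beta> \<le> length x \<and> cnt x = 0 \<and> cnt y = k + off"
  shows False
proof -
  let ?P = "{padR \<alpha> \<beta> | \<alpha> \<beta>. (\<alpha>, \<beta>) \<in> R}"
  obtain x y \<beta> where xy: "\<And>k. (x k @ y k, \<beta> k) \<in> R" "\<And>k. length (\<beta> k) \<le> length (x k)"
    "\<And>k. cnt (x k) = 0" "\<And>k. cnt (y k) = k + off"
    using ex by metis
  obtain k k' where k: "k \<noteq> k'" "deriv ?P (padR (x k) (\<beta> k)) = deriv ?P (padR (x k') (\<beta> k'))"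
    using derivs_collide[OF reg, of "\<lambda>k. padR (x k) (\<beta> k)"] by blast
  have "padR (x k' @ y k') (\<beta> k') \<in> ?P" using xy(1) by blast
  then have "padR (y k') [] \<in> deriv ?P (padR (x k') (\<beta> k'))"
    unfolding padR_append_longer[OF xy(2)] by (simp add: deriv_def)
  then have "padR (y k') [] \<in> deriv ?P (padR (x k) (\<beta> k))" using k(2) by simp
  then have "padR (x k @ y k') (\<beta> k) \<in> ?P"
    unfolding padR_append_longer[OF xy(2)] deriv_def by simp
  then have "(x k @ y k', \<beta> k) \<in> R" by auto
  then have "c + cnt (x k @ y k') = c + cnt (x k @ y k)" using R xy(1) by metis
  then show False using xy(3,4) k(1) by (simp add: add)
qed

lemma exchange_padL:
  fixes cnt :: "'b list \<Rightarrow> nat"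
  assumes reg: "regular \<Sigma> {padL \<alpha> \<beta> | \<alpha> \<beta>. (\<alpha>, \<beta>) \<in> R}"
    and add: "\<And>x y. cnt (x @ y) = cnt x + cnt y"
    and R: "\<And>\<alpha> \<beta>. (\<alpha>, \<beta>) \<in> R \<Longrightarrow> c + cnt \<alpha> = cnt \<beta>"
    and ex: "\<And>k. \<exists>x y \<beta>. (y @ x, \<beta>) \<in> R \<and> length \<beta> \<le> length x \<and> cnt x = 0 \<and> cnt y = k + off"
  shows False
proof (rule exchange_padR[where R="(\<lambda>(\<alpha>, \<beta>). (rev \<alpha>, rev \<beta>)) ` R" and cnt="\<lambda>x. cnt (rev x)"])
  have "{padR \<alpha> \<beta> | \<alpha> \<beta>. (\<alpha>, \<beta>) \<in> (\<lambda>(\<alpha>, \<beta>). (rev \<alpha>, rev \<beta>)) ` R} = rev ` {padL \<alpha> \<beta> | \<alpha> \<beta>. (\<alpha>, \<beta>) \<in> R}"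
    by (force simp: padL_eq_rev image_iff)
  then show "regular \<Sigma> {padR \<alpha> \<beta> | \<alpha> \<beta>. (\<alpha>, \<beta>) \<in> (\<lambda>(\<alpha>, \<beta>). (rev \<alpha>, rev \<beta>)) ` R}"
    using regular_rev[OF reg] by simp
  show "c + cnt (rev \<alpha>) = cnt (rev \<beta>)" if "(\<alpha>, \<beta>) \<in> (\<lambda>(\<alpha>, \<beta>). (rev \<alpha>, rev \<beta>)) ` R" for \<alpha> \<beta>
    using that R by auto
  fix k
  obtain x y \<beta> where "(y @ x, \<beta>) \<in> R" "length \<beta> \<le> length x" "cnt x = 0" "cnt y = k + off" using ex by metis
  moreover from this(1) have "(rev x @ rev y, rev \<beta>) \<in> (\<lambda>(\<alpha>, \<beta>). (rev \<alpha>, rev \<beta>)) ` R" by force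
  ultimately show "\<exists>x y \<beta>. (x @ y, \<beta>) \<in> (\<lambda>(\<alpha>, \<beta>). (rev \<alpha>, rev \<beta>)) ` R \<and> length \<beta> \<le> length x \<and>
      cnt (rev x) = 0 \<and> cnt (rev y) = k + off"
    by (intro exI[of _ "rev x"] exI[of _ "rev y"] exI[of _ "rev \<beta>"]) simp
qed (use add in simp)

lemma padR_swap: "map prod.swap (padR \<alpha> \<beta>) = padR \<beta> \<alpha>"
  by (simp add: padR_def Let_def max.commute zip_commute[of "map Some \<beta> @ _"] case_prod_unfold prod.swap_def)

lemma not_inj_on_atMost: "\<not> inj_on g {..M} \<Longrightarrow> \<exists>i j. i < j \<and> j \<le> M \<and> g i = g j" for M :: nat
  unfolding inj_on_def by (metis atMost_iff linorder_neqE_nat)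

text \<open>Pumping downwards: behind the end of \<open>\<beta>\<close> the automaton reads one tape
  only. If that stretch has more letters than there are derivatives, two of its positions share a
  derivative, and the part between them can be removed while \<open>\<beta>\<close> is kept.\<close>

lemma shorten_first:
  assumes reg: "regular \<Sigma> {padR \<alpha> \<beta> | \<alpha> \<beta>. (\<alpha>, \<beta>) \<in> R}"
  shows "\<exists>M. \<forall>(\<alpha>, \<beta>)\<in>R. \<exists>\<alpha>'. (\<alpha>', \<beta>) \<in> R \<and> length \<alpha>' \<le> length \<beta> + M"
proof -
  let ?P = "{padR \<alpha> \<beta> | \<alpha> \<beta>. (\<alpha>, \<beta>) \<in> R}"
  define M where "M = card (range (deriv ?P))"
  have "\<exists>\<alpha>'. (\<alpha>', \<beta>) \<in> R \<and> length \<alpha>' \<le> length \<beta> + M" if "(\<alpha>, \<beta>) \<in> R" for \<alpha> \<beta>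
    using that
  proof (induction \<alpha> rule: length_induct)
    case (1 \<alpha>)
    show ?case
    proof (cases "length \<alpha> \<le> length \<beta> + M")
      case True
      then show ?thesis using 1 by blast
    next
      case False
      define x where "x = take (length \<beta>) \<alpha>"
      define y where "y = drop (length \<beta>) \<alpha>"
      have x: "length x = length \<beta>" "\<alpha> = x @ y" "length y > M" using False by (auto simp: x_def y_def)
      let ?g = "\<lambda>i. deriv ?P (padR (x @ take i y) \<beta>)"
      have "\<not> inj_on ?g {..M}"
      proof
        assume "inj_on ?g {..M}"
        then have "card (?g ` {..M}) = Suc M" by (simp add: card_image)
        moreover have "card (?g ` {..M}) \<le> M"
          unfolding M_def by (rule card_mono[OF regularD(3)[OF reg]]) auto
        ultimately show False by simp
      qed
      then obtain i j where ij: "i < j" "j \<le> M" "?g i = ?g j"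
        using not_inj_on_atMost[of ?g M] by blast
      have "padR (x @ y) \<beta> = padR (x @ take j y) \<beta> @ padR (drop j y) []"
        using padR_append_longer[of \<beta> "x @ take j y" "drop j y"] x by simp
      moreover have "padR (x @ y) \<beta> \<in> ?P" using 1(2) unfolding x(2)[symmetric] by blast
      ultimately have "padR (drop j y) [] \<in> ?g j" by (simp only: deriv_def mem_Collect_eq)
      then have "padR (drop j y) [] \<in> ?g i" unfolding ij(3) .
      then have "padR (x @ take i y) \<beta> @ padR (drop j y) [] \<in> ?P" unfolding deriv_def mem_Collect_eq .
      then have "padR ((x @ take i y) @ drop j y) \<beta> \<in> ?P"
        using padR_append_longer[of \<beta> "x @ take i y" "drop j y"] x by simp
      then have "((x @ take i y) @ drop j y, \<beta>) \<in> R" by auto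
      moreover have "length ((x @ take i y) @ drop j y) < length \<alpha>" using ij x by simp
      ultimately show ?thesis using 1 by blast
    qed
  qed
  then show ?thesis by blast
qed

lemma shorten_second:
  assumes reg: "regular (pad_alph B) {padR \<alpha> \<beta> | \<alpha> \<beta>. (\<alpha>, \<beta>) \<in> R}"
  shows "\<exists>M. \<forall>(\<alpha>, \<beta>)\<in>R. \<exists>\<beta>'. (\<alpha>, \<beta>') \<in> R \<and> length \<beta>' \<le> length \<alpha> + M"
proof -
  have "{padR \<alpha> \<beta> | \<alpha> \<beta>. (\<alpha>, \<beta>) \<in> R\<inverse>} = map prod.swap ` {padR \<alpha> \<beta> | \<alpha> \<beta>. (\<alpha>, \<beta>) \<in> R}"
    by (auto simp: padR_swap image_iff) (metis padR_swap)+
  moreover have "regular (pad_alph B) (map prod.swap ` {padR \<alpha> \<beta> | \<alpha> \<beta>. (\<alpha>, \<beta>) \<in> R})"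
    by (rule regular_map[OF reg regularD(1)[OF reg]]) (auto simp: pad_alph_def)
  ultimately have "regular (pad_alph B) {padR \<alpha> \<beta> | \<alpha> \<beta>. (\<alpha>, \<beta>) \<in> R\<inverse>}" by simp
  from shorten_first[OF this] show ?thesis by fastforce
qed

subsection \<open>Arbitrary generators of a presented monoid\<close>

lemma rel_cong_irreducible:
  assumes "rel_cong u v x y" "\<not> sublist u x" "\<not> sublist v x"
  shows "y = x"
  using assms(1) unfolding rel_cong_def
proof (induction rule: rtranclp_induct)
  case (step y z)
  then show ?case using assms(2,3) by (auto simp: rel_step_def)
qed simp

lemma count_invariant:
  assumes "rel_cong u v x y" "count_list u e = count_list v e"
  shows "count_list x e = count_list y e"
  using rel_cong_invariant[OF assms(1), of "\<lambda>x. count_list x e"] assms(2) by simp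

text \<open>Nothing is known about the generators of a given structure except that they are classes.
  A choice of a word \<open>val\<close> for each of them allows words over \<open>B\<close> to be
  compared with words over \<open>A\<close>.\<close>

locale presented_structure =
  fixes A :: "'a set" and u v :: "'a list" and B :: "'b set" and gen :: "'b \<Rightarrow> 'a list set" and L :: "'b list set"
    and val :: "'b \<Rightarrow> 'a list"
  assumes base: "structure_base (pres_carrier A u v) (pres_mult A u v) B gen L"
    and words: "u \<in> lists A" "v \<in> lists A"
    and val: "\<And>b. b \<in> B \<Longrightarrow> val b \<in> lists A" "\<And>b. b \<in> B \<Longrightarrow> gen b = pres_class A u v (val b)"
begin

abbreviation "mult \<equiv> pres_mult A u v"

lemma L_lists: "\<alpha> \<in> L \<Longrightarrow> \<alpha> \<in> lists B" "\<alpha> \<in> L \<Longrightarrow> \<alpha> \<noteq> []"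
  using base by (auto simp: structure_base_def)

lemma vals_A: "\<alpha> \<in> lists B \<Longrightarrow> vals val \<alpha> \<in> lists A"
  using vals_lists[of val B A] val(1) by blast

lemma evalw_val:
  assumes "\<alpha> \<in> lists B" "\<alpha> \<noteq> []"
  shows "evalw gen mult \<alpha> = pres_class A u v (vals val \<alpha>)"
proof -
  have "evalw gen mult (map id \<alpha>) = evalw (\<lambda>b. pres_class A u v (val b)) mult \<alpha>"
    by (rule evalw_map) (use assms val in auto)
  then show ?thesis using evalw_pres_class[of B val A \<alpha> u v] assms val(1) by simp
qed

lemma represent:
  assumes "w \<in> lists A"
  obtains \<alpha> where "\<alpha> \<in> L" "rel_cong u v w (vals val \<alpha>)"
proof -
  have "pres_class A u v w \<in> evalw gen mult ` L"
    using base assms unfolding structure_base_def pres_carrier_def by blast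
  then obtain \<alpha> where "\<alpha> \<in> L" "pres_class A u v w = pres_class A u v (vals val \<alpha>)"
    using evalw_val L_lists by auto
  then show thesis using that pres_class_eq_iff[OF assms vals_A] L_lists by blast
qed

lemma right_eq:
  assumes g: "g \<in> B"
  shows "L_right mult gen L (Some g) = {padR \<alpha> \<beta> | \<alpha> \<beta>. (\<alpha>, \<beta>) \<in> {(\<alpha>, \<beta>). \<alpha> \<in> L \<and> \<beta> \<in> L \<and> rel_cong u v (vals val \<alpha> @ val g) (vals val \<beta>)}}"
    "L_right_pL mult gen L (Some g) = {padL \<alpha> \<beta> | \<alpha> \<beta>. (\<alpha>, \<beta>) \<in> {(\<alpha>, \<beta>). \<alpha> \<in> L \<and> \<beta> \<in> L \<and> rel_cong u v (vals val \<alpha> @ val g) (vals val \<beta>)}}"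
    "L_left mult gen L (Some g) = {padR \<alpha> \<beta> | \<alpha> \<beta>. (\<alpha>, \<beta>) \<in> {(\<alpha>, \<beta>). \<alpha> \<in> L \<and> \<beta> \<in> L \<and> rel_cong u v (val g @ vals val \<alpha>) (vals val \<beta>)}}"
proof -
  have r: "evalw gen mult (\<alpha> @ optw (Some g)) = evalw gen mult \<beta> \<longleftrightarrow> rel_cong u v (vals val \<alpha> @ val g) (vals val \<beta>)"
    if "\<alpha> \<in> L" "\<beta> \<in> L" for \<alpha> \<beta>
    using that g L_lists evalw_val[of "\<alpha> @ [g]"] evalw_val[of \<beta>] vals_A[of "\<alpha> @ [g]"] vals_A[of \<beta>]
    by (simp add: optw_def pres_class_eq_iff)
  have l: "evalw gen mult (optw (Some g) @ \<alpha>) = evalw gen mult \<beta> \<longleftrightarrow> rel_cong u v (val g @ vals val \<alpha>) (vals val \<beta>)"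
    if "\<alpha> \<in> L" "\<beta> \<in> L" for \<alpha> \<beta>
    using that g L_lists evalw_val[of "g # \<alpha>"] evalw_val[of \<beta>] vals_A[of "g # \<alpha>"] vals_A[of \<beta>]
    by (simp add: optw_def pres_class_eq_iff)
  show "L_right mult gen L (Some g) = {padR \<alpha> \<beta> | \<alpha> \<beta>. (\<alpha>, \<beta>) \<in> {(\<alpha>, \<beta>). \<alpha> \<in> L \<and> \<beta> \<in> L \<and> rel_cong u v (vals val \<alpha> @ val g) (vals val \<beta>)}}"
    unfolding L_right_def using r by blast
  show "L_right_pL mult gen L (Some g) = {padL \<alpha> \<beta> | \<alpha> \<beta>. (\<alpha>, \<beta>) \<in> {(\<alpha>, \<beta>). \<alpha> \<in> L \<and> \<beta> \<in> L \<and> rel_cong u v (vals val \<alpha> @ val g) (vals val \<beta>)}}"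
    unfolding L_right_pL_def using r by blast
  show "L_left mult gen L (Some g) = {padR \<alpha> \<beta> | \<alpha> \<beta>. (\<alpha>, \<beta>) \<in> {(\<alpha>, \<beta>). \<alpha> \<in> L \<and> \<beta> \<in> L \<and> rel_cong u v (val g @ vals val \<alpha>) (vals val \<beta>)}}"
    unfolding L_left_def using l by blast
qed

text \<open>The class of such a letter is a singleton. A word of \<open>L\<close> representing it
  therefore has this letter as its literal value, which is contributed by a single generator, all
  others in the word having empty value.\<close>

lemma letter_generator:
  assumes "c \<in> A" "\<not> sublist u [c]" "\<not> sublist v [c]"
  shows "\<exists>g\<in>B. val g = [c]"
proof -
  obtain \<alpha> where "\<alpha> \<in> L" "rel_cong u v [c] (vals val \<alpha>)" using represent[of "[c]"] assms(1) by auto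
  then have "\<alpha> \<in> lists B" "vals val \<alpha> = [c]" using rel_cong_irreducible assms(2,3) L_lists by blast+
  then show ?thesis by (induction \<alpha>) (auto simp: append_eq_Cons_conv)
qed

lemma length_bound: "\<exists>M. \<forall>\<alpha>\<in>lists B. length (vals val \<alpha>) \<le> M * length \<alpha>"
proof -
  have fin: "finite B" using base by (simp add: structure_base_def)
  have *: "length (val b) \<le> (\<Sum>b\<in>B. length (val b))" if "b \<in> B" for b
    using member_le_sum[of b B "\<lambda>b. length (val b)"] that fin by simp
  have "length (vals val \<alpha>) \<le> (\<Sum>b\<in>B. length (val b)) * length \<alpha>" if "\<alpha> \<in> lists B" for \<alpha>
    using that by (induction \<alpha>) (use * in \<open>auto intro: add_mono\<close>)
  then show ?thesis by blast
qed

text \<open>A word whose value starts with sufficiently many letters other than \<open>e\<close> outlasts a given word \<open>\<beta>\<close> before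
  the first letter \<open>e\<close> is produced.\<close>

lemma long_prefix:
  assumes M: "\<forall>\<alpha>\<in>lists B. length (vals val \<alpha>) \<le> M * length \<alpha>" and \<alpha>: "\<alpha> \<in> lists B"
    and i: "M * n < length (vals val \<alpha>)" "e \<notin> set (take (M * n) (vals val \<alpha>))"
  shows "\<exists>x y. \<alpha> = x @ y \<and> length x = n \<and> e \<notin> set (vals val x)"
proof -
  have "M * n < M * length \<alpha>" using M \<alpha> i(1) by (meson order_less_le_trans)
  then have n: "n < length \<alpha>" by simp
  let ?x = "take n \<alpha>"
  have "?x \<in> lists B" using \<alpha> by (auto dest: in_set_takeD)
  from bspec[OF M this] n have "length (vals val ?x) \<le> M * n" by simp
  moreover have "vals val \<alpha> = vals val ?x @ vals val (drop n \<alpha>)" by (simp flip: vals_simps(3))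
  ultimately have "set (vals val ?x) \<subseteq> set (take (M * n) (vals val \<alpha>))" by auto
  then show ?thesis using i(2) n by (intro exI[of _ ?x] exI[of _ "drop n \<alpha>"]) auto
qed

lemma long_suffix:
  assumes M: "\<forall>\<alpha>\<in>lists B. length (vals val \<alpha>) \<le> M * length \<alpha>" and \<alpha>: "\<alpha> \<in> lists B"
    and i: "M * n < length (vals val \<alpha>)" "e \<notin> set (take (M * n) (rev (vals val \<alpha>)))"
  shows "\<exists>x y. \<alpha> = y @ x \<and> length x = n \<and> e \<notin> set (vals val x)"
proof -
  have "M * n < M * length \<alpha>" using M \<alpha> i(1) by (meson order_less_le_trans)
  then have n: "n < length \<alpha>" by simp
  let ?x = "drop (length \<alpha> - n) \<alpha>"
  have "?x \<in> lists B" "length ?x = n" using \<alpha> n by (auto dest: in_set_dropD)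
  with bspec[OF M this(1)] have "length (vals val ?x) \<le> M * n" by (simp only:)
  moreover have "vals val \<alpha> = vals val (take (length \<alpha> - n) \<alpha>) @ vals val ?x" by (simp flip: vals_simps(3))
  ultimately have "set (vals val ?x) \<subseteq> set (take (M * n) (rev (vals val \<alpha>)))" by auto
  then show ?thesis using i(2) \<open>length ?x = n\<close> by (intro exI[of _ ?x] exI[of _ "take (length \<alpha> - n) \<alpha>"]) auto
qed

text \<open>For each \<open>k\<close> there are words \<open>w\<close> starting with arbitrarily many letters other than \<open>e\<close> that all yield the
  same product \<open>z\<close>: the automaton would have to remember \<open>k\<close>.\<close>

lemma collapse_padR:
  assumes reg: "regular \<Sigma> {padR \<alpha> \<beta> | \<alpha> \<beta>. (\<alpha>, \<beta>) \<in> R}" and e: "count_list u e = count_list v e"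
    and R: "\<And>\<alpha> \<beta>. (\<alpha>, \<beta>) \<in> R \<Longrightarrow> c + count_list (vals val \<alpha>) e = count_list (vals val \<beta>) e"
    and ex: "\<And>k. \<exists>z\<in>lists A. \<forall>i. \<exists>w\<in>lists A. count_list w e = k + off \<and>
      (\<forall>w'. rel_cong u v w w' \<longrightarrow> i < length w' \<and> e \<notin> set (take i w')) \<and>
      (\<forall>\<alpha>\<in>L. \<forall>\<beta>\<in>L. rel_cong u v w (vals val \<alpha>) \<longrightarrow> rel_cong u v z (vals val \<beta>) \<longrightarrow> (\<alpha>, \<beta>) \<in> R)"
  shows False
proof (rule exchange_padR[OF reg, where cnt="\<lambda>\<alpha>. count_list (vals val \<alpha>) e" and c=c and off=off])
  fix k
  obtain M where M: "\<forall>\<alpha>\<in>lists B. length (vals val \<alpha>) \<le> M * length \<alpha>" using length_bound by blast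
  obtain z where z: "z \<in> lists A" and ex': "\<And>i. \<exists>w\<in>lists A. count_list w e = k + off \<and>
      (\<forall>w'. rel_cong u v w w' \<longrightarrow> i < length w' \<and> e \<notin> set (take i w')) \<and>
      (\<forall>\<alpha>\<in>L. \<forall>\<beta>\<in>L. rel_cong u v w (vals val \<alpha>) \<longrightarrow> rel_cong u v z (vals val \<beta>) \<longrightarrow> (\<alpha>, \<beta>) \<in> R)"
    using ex[of k] by blast
  obtain \<beta> where \<beta>: "\<beta> \<in> L" "rel_cong u v z (vals val \<beta>)" using represent[OF z] by blast
  obtain w where w: "w \<in> lists A" "count_list w e = k + off"
    "\<And>w'. rel_cong u v w w' \<Longrightarrow> M * length \<beta> < length w' \<and> e \<notin> set (take (M * length \<beta>) w')"
    "\<And>\<alpha> \<beta>. \<alpha> \<in> L \<Longrightarrow> \<beta> \<in> L \<Longrightarrow> rel_cong u v w (vals val \<alpha>) \<Longrightarrow> rel_cong u v z (vals val \<beta>) \<Longrightarrow> (\<alpha>, \<beta>) \<in> R"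
    using ex'[of "M * length \<beta>"] by blast
  obtain \<alpha> where \<alpha>: "\<alpha> \<in> L" "rel_cong u v w (vals val \<alpha>)" using represent[OF w(1)] by blast
  obtain x y where xy: "\<alpha> = x @ y" "length x = length \<beta>" "e \<notin> set (vals val x)"
    using long_prefix[OF M L_lists(1)[OF \<alpha>(1)], of "length \<beta>" e] w(3)[OF \<alpha>(2)] by blast
  have "count_list (vals val x) e = 0" using xy(3) by (simp add: count_list_0_iff)
  moreover have "count_list (vals val x) e + count_list (vals val y) e = k + off"
    using count_invariant[OF \<alpha>(2) e] w(2) xy(1) by simp
  ultimately show "\<exists>x y \<beta>. (x @ y, \<beta>) \<in> R \<and> length \<beta> \<le> length x \<and> count_list (vals val x) e = 0 \<and> count_list (vals val y) e = k + off"
    using w(4)[OF \<alpha>(1) \<beta>(1) \<alpha>(2) \<beta>(2)] xy by (intro exI[of _ x] exI[of _ y] exI[of _ \<beta>]) simp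
qed (use R in simp_all)

lemma collapse_padL:
  assumes reg: "regular \<Sigma> {padL \<alpha> \<beta> | \<alpha> \<beta>. (\<alpha>, \<beta>) \<in> R}" and e: "count_list u e = count_list v e"
    and R: "\<And>\<alpha> \<beta>. (\<alpha>, \<beta>) \<in> R \<Longrightarrow> c + count_list (vals val \<alpha>) e = count_list (vals val \<beta>) e"
    and ex: "\<And>k. \<exists>z\<in>lists A. \<forall>i. \<exists>w\<in>lists A. count_list w e = k + off \<and>
      (\<forall>w'. rel_cong u v w w' \<longrightarrow> i < length w' \<and> e \<notin> set (take i (rev w'))) \<and>
      (\<forall>\<alpha>\<in>L. \<forall>\<beta>\<in>L. rel_cong u v w (vals val \<alpha>) \<longrightarrow> rel_cong u v z (vals val \<beta>) \<longrightarrow> (\<alpha>, \<beta>) \<in> R)"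
  shows False
proof (rule exchange_padL[OF reg, where cnt="\<lambda>\<alpha>. count_list (vals val \<alpha>) e" and c=c and off=off])
  fix k
  obtain M where M: "\<forall>\<alpha>\<in>lists B. length (vals val \<alpha>) \<le> M * length \<alpha>" using length_bound by blast
  obtain z where z: "z \<in> lists A" and ex': "\<And>i. \<exists>w\<in>lists A. count_list w e = k + off \<and>
      (\<forall>w'. rel_cong u v w w' \<longrightarrow> i < length w' \<and> e \<notin> set (take i (rev w'))) \<and>
      (\<forall>\<alpha>\<in>L. \<forall>\<beta>\<in>L. rel_cong u v w (vals val \<alpha>) \<longrightarrow> rel_cong u v z (vals val \<beta>) \<longrightarrow> (\<alpha>, \<beta>) \<in> R)"
    using ex[of k] by blast
  obtain \<beta> where \<beta>: "\<beta> \<in> L" "rel_cong u v z (vals val \<beta>)" using represent[OF z] by blast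
  obtain w where w: "w \<in> lists A" "count_list w e = k + off"
    "\<And>w'. rel_cong u v w w' \<Longrightarrow> M * length \<beta> < length w' \<and> e \<notin> set (take (M * length \<beta>) (rev w'))"
    "\<And>\<alpha> \<beta>. \<alpha> \<in> L \<Longrightarrow> \<beta> \<in> L \<Longrightarrow> rel_cong u v w (vals val \<alpha>) \<Longrightarrow> rel_cong u v z (vals val \<beta>) \<Longrightarrow> (\<alpha>, \<beta>) \<in> R"
    using ex'[of "M * length \<beta>"] by blast
  obtain \<alpha> where \<alpha>: "\<alpha> \<in> L" "rel_cong u v w (vals val \<alpha>)" using represent[OF w(1)] by blast
  obtain x y where xy: "\<alpha> = y @ x" "length x = length \<beta>" "e \<notin> set (vals val x)"
    using long_suffix[OF M L_lists(1)[OF \<alpha>(1)], of "length \<beta>" e] w(3)[OF \<alpha>(2)] by blast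
  have "count_list (vals val x) e = 0" using xy(3) by (simp add: count_list_0_iff)
  moreover have "count_list (vals val y) e + count_list (vals val x) e = k + off"
    using count_invariant[OF \<alpha>(2) e] w(2) xy(1) by simp
  ultimately show "\<exists>x y \<beta>. (y @ x, \<beta>) \<in> R \<and> length \<beta> \<le> length x \<and> count_list (vals val x) e = 0 \<and> count_list (vals val y) e = k + off"
    using w(4)[OF \<alpha>(1) \<beta>(1) \<alpha>(2) \<beta>(2)] xy by (intro exI[of _ x] exI[of _ y] exI[of _ \<beta>]) simp
qed (use R in simp_all)

lemma right_mult_count:
  assumes "count_list u e = count_list v e" "rel_cong u v (vals val \<alpha> @ val g) (vals val \<beta>)"
  shows "count_list (val g) e + count_list (vals val \<alpha>) e = count_list (vals val \<beta>) e"
  using count_invariant[OF assms(2,1)] by simp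

lemma left_mult_count:
  assumes "count_list u e = count_list v e" "rel_cong u v (val g @ vals val \<alpha>) (vals val \<beta>)"
  shows "count_list (val g) e + count_list (vals val \<alpha>) e = count_list (vals val \<beta>) e"
  using count_invariant[OF assms(2,1)] by simp

end

lemma structure_presented:
  assumes "structure_base (pres_carrier A u v) (pres_mult A u v) B gen L" "u \<in> lists A" "v \<in> lists A"
  obtains val where "presented_structure A u v B gen L val"
proof -
  have sub: "gen ` B \<subseteq> pres_class A u v ` lists A" using assms(1) unfolding structure_base_def pres_carrier_def by (elim conjE)
  have "\<exists>w. w \<in> lists A \<and> gen b = pres_class A u v w" if "b \<in> B" for b
    using subsetD[OF sub imageI[OF that]] by (auto simp only: image_iff)
  then have "\<forall>b\<in>B. \<exists>w. w \<in> lists A \<and> gen b = pres_class A u v w" by (intro ballI)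
  from bchoice[OF this] obtain val where "\<forall>b\<in>B. val b \<in> lists A \<and> gen b = pres_class A u v (val b)" by (elim exE)
  then show thesis using that[of val] assms by (simp add: presented_structure_def)
qed

subsection \<open>Collapsing prefixes\<close>

text \<open>Multiplication by \<open>c\<close> removes the dependence on \<open>i\<close>, so the
  factor \<open>W i k\<close> can be made arbitrarily long against its product. As no side of the
  relation occurs in \<open>W i k\<close>, every representative spells out exactly this word and
  shows no \<open>e\<close> among its first \<open>i\<close> letters.\<close>

lemma not_automatic_collapse:
  fixes W :: "nat \<Rightarrow> nat \<Rightarrow> 'a list"
  assumes words: "u \<in> lists A" "v \<in> lists A" and e: "count_list u e = count_list v e"
    and c: "c \<in> A" "\<not> sublist u [c]" "\<not> sublist v [c]" and AW: "\<And>i k. W i k \<in> lists A" "\<And>k. z k \<in> lists A"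
    and W: "\<And>i k. \<not> sublist u (W i k)" "\<And>i k. \<not> sublist v (W i k)" "\<And>i k. i < length (W i k)"
      "\<And>i k. e \<notin> set (take i (W i k))" "\<And>i k. count_list (W i k) e = k + off"
    and z: "\<And>i k. rel_cong u v (W i k @ [c]) (z k)"
  shows "\<not> automatic (pres_carrier A u v) (pres_mult A u v)"
proof
  assume "automatic (pres_carrier A u v) (pres_mult A u v)"
  then obtain B :: "nat set" and gen L where S: "automatic_structure (pres_carrier A u v) (pres_mult A u v) B gen L"
    unfolding automatic_def by blast
  then have "structure_base (pres_carrier A u v) (pres_mult A u v) B gen L" by (simp add: automatic_structure_def)
  then obtain val where "presented_structure A u v B gen L val" using structure_presented words by blast
  then interpret presented_structure A u v B gen L val .
  obtain g where g: "g \<in> B" "val g = [c]" using letter_generator[OF c] by blast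
  let ?R = "{(\<alpha>, \<beta>). \<alpha> \<in> L \<and> \<beta> \<in> L \<and> rel_cong u v (vals val \<alpha> @ val g) (vals val \<beta>)}"
  have reg: "regular (pad_alph B) {padR \<alpha> \<beta> | \<alpha> \<beta>. (\<alpha>, \<beta>) \<in> ?R}"
    using S g(1) unfolding right_eq(1)[OF g(1), symmetric] automatic_structure_def by blast
  show False
  proof (rule collapse_padR[OF reg e, where c="count_list (val g) e" and off=off])
    show "count_list (val g) e + count_list (vals val \<alpha>) e = count_list (vals val \<beta>) e" if "(\<alpha>, \<beta>) \<in> ?R" for \<alpha> \<beta>
      using right_mult_count[OF e] that by blast
    fix k
    show "\<exists>z\<in>lists A. \<forall>i. \<exists>w\<in>lists A. count_list w e = k + off \<and>
      (\<forall>w'. rel_cong u v w w' \<longrightarrow> i < length w' \<and> e \<notin> set (take i w')) \<and>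
      (\<forall>\<alpha>\<in>L. \<forall>\<beta>\<in>L. rel_cong u v w (vals val \<alpha>) \<longrightarrow> rel_cong u v z (vals val \<beta>) \<longrightarrow> (\<alpha>, \<beta>) \<in> ?R)"
    proof (rule bexI[of _ "z k", OF _ AW(2)], rule allI)
      fix i
      have "rel_cong u v (vals val \<alpha> @ val g) (vals val \<beta>)"
        if "rel_cong u v (W i k) (vals val \<alpha>)" "rel_cong u v (z k) (vals val \<beta>)" for \<alpha> \<beta>
        using rel_cong_append_right[OF that(1)[THEN rel_cong_sym], of "[c]"] z[of i k] that(2) rel_cong_trans
        unfolding g(2) by blast
      moreover have "i < length w' \<and> e \<notin> set (take i w')" if "rel_cong u v (W i k) w'" for w'
        using rel_cong_irreducible[OF that W(1,2)] W(3,4)[of i k] by simp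
      ultimately show "\<exists>w\<in>lists A. count_list w e = k + off \<and>
        (\<forall>w'. rel_cong u v w w' \<longrightarrow> i < length w' \<and> e \<notin> set (take i w')) \<and>
        (\<forall>\<alpha>\<in>L. \<forall>\<beta>\<in>L. rel_cong u v w (vals val \<alpha>) \<longrightarrow> rel_cong u v (z k) (vals val \<beta>) \<longrightarrow> (\<alpha>, \<beta>) \<in> ?R)"
        using W(5)[of i k] AW(1)[of i k] by (intro bexI[of _ "W i k"]) auto
    qed
  qed
qed

lemma replicate_no_descent: "a \<noteq> b \<Longrightarrow> \<not> sublist [b, a] (replicate i a @ replicate n b)"
proof (induction i)
  case 0
  then show ?case using set_mono_sublist[of "[b, a]" "replicate n b"] by (auto split: if_splits)
next
  case (Suc i)
  then show ?case by (auto simp: sublist_Cons_right)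
qed

theorem not_automatic_aba_ba:
  assumes "a \<in> A" "b \<in> A" "a \<noteq> b"
  shows "\<not> automatic (pres_carrier A [a, b, a] [b, a]) (pres_mult A [a, b, a] [b, a])"
proof -
  let ?u = "[a, b, a]" and ?v = "[b, a]"
  let ?W = "\<lambda>i k. replicate i a @ replicate (Suc k) b" and ?z = "\<lambda>k. replicate (Suc k) b @ [a]"
  have one: "rel_cong ?u ?v (a # ?z k) (?z k)" for k
  proof (induction k)
    case 0
    then show ?case using rel_cong_base[of ?u ?v] by simp
  next
    case (Suc k)
    have "rel_cong ?u ?v (a # b # ?z k) (a # b # a # ?z k)"
      using rel_cong_append_left[OF Suc.IH[THEN rel_cong_sym], of "[a, b]"] by simp
    also have "rel_cong ?u ?v (a # b # a # ?z k) (b # a # ?z k)" using rel_cong_rule[of ?u ?v "[]" "?z k"] by simp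
    also have "rel_cong ?u ?v (b # a # ?z k) (b # ?z k)" using rel_cong_append_left[OF Suc.IH, of "[b]"] by simp
    finally show ?case by simp
  qed
  have z: "rel_cong ?u ?v (replicate i a @ ?z k) (?z k)" for i k
  proof (induction i)
    case (Suc i)
    from rel_cong_trans[OF rel_cong_append_left[OF Suc, of "[a]"]] one show ?case by simp
  qed simp
  have W: "\<not> sublist ?v (?W i k)" for i k using replicate_no_descent[OF assms(3)] .
  moreover have "sublist ?v ?u" by (simp add: sublist_Cons_right)
  ultimately have W': "\<not> sublist ?u (?W i k)" for i k using sublist_order.order_trans by blast
  show ?thesis
  proof (rule not_automatic_collapse[where W="?W" and z="?z" and c=a and e=b and off=1])
    show "rel_cong ?u ?v (?W i k @ [a]) (?z k)" for i k using z by simp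
    show "count_list (?W i k) b = k + 1" for i k
      using assms(3) by (induction i; induction k) auto
  qed (use assms W W' in \<open>auto simp: sublist_Cons_right\<close>)
qed

theorem not_automatic_abb_bb:
  assumes "a \<in> A" "b \<in> A" "a \<noteq> b"
  shows "\<not> automatic (pres_carrier A [a, b, b] [b, b]) (pres_mult A [a, b, b] [b, b])"
proof -
  let ?u = "[a, b, b]" and ?v = "[b, b]"
  \<comment> \<open>The letters \<open>b\<close> are kept apart by single letters \<open>a\<close>,
    because \<open>W i k\<close> must not contain \<open>bb\<close>. One more \<open>b\<close> at
    the right end starts a chain of absorptions that removes every \<open>a\<close>.\<close>
  let ?t = "\<lambda>k. concat (replicate k [b, a]) @ [b]"
  let ?W = "\<lambda>i k. replicate i a @ ?t k" and ?z = "\<lambda>k. replicate (Suc (Suc k)) b"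
  have t: "rel_cong ?u ?v (?t k @ [b]) (?z k)" for k
  proof (induction k)
    case (Suc k)
    have "rel_cong ?u ?v ([b, a] @ ?t k @ [b]) ([b, a] @ ?z k)" by (rule rel_cong_append_left[OF Suc.IH])
    also have "rel_cong ?u ?v ([b, a] @ ?z k) ([b] @ ?z k)" using rel_cong_rule[of ?u ?v "[b]" "replicate k b"] by simp
    finally show ?case by simp
  qed simp
  have z: "rel_cong ?u ?v (replicate i a @ ?z k) (?z k)" for i k
  proof (induction i)
    case (Suc i)
    have "rel_cong ?u ?v (a # ?z k) (?z k)" using rel_cong_rule[of ?u ?v "[]" "replicate k b"] by simp
    with rel_cong_append_left[OF Suc, of "[a]"] show ?case using rel_cong_trans by fastforce
  qed simp
  have tv: "\<not> sublist ?v (?t k)" for k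
    using assms(3) by (induction k) (auto simp: sublist_Cons_right)
  have W: "\<not> sublist ?v (?W i k)" for i k
    using assms(3) tv[of k] by (induction i) (auto simp: sublist_Cons_right)
  moreover have "sublist ?v ?u" by (simp add: sublist_Cons_right)
  ultimately have W': "\<not> sublist ?u (?W i k)" for i k using sublist_order.order_trans by blast
  show ?thesis
  proof (rule not_automatic_collapse[where W="?W" and z="?z" and c=b and e=b and off=1])
    show "rel_cong ?u ?v (?W i k @ [b]) (?z k)" for i k
      using rel_cong_trans[OF rel_cong_append_left[OF t[of k], of "replicate i a"] z] by simp
    have "count_list (?t k) b = k + 1" for k using assms(3) by (induction k) auto
    then show "count_list (?W i k) b = k + 1" for i k
      using assms(3) by (induction i) auto
    show "?W i k \<in> lists A" for i k
      using assms(1,2) by (induction k) auto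
  qed (use assms W W' in \<open>auto simp: sublist_Cons_right\<close>)
qed

subsection \<open>Exponential distortion\<close>

text \<open>Multiplication by a fixed generator can be carried out and undone with bounded growth of
  suitable representatives. The second statement yields some factor with the given product, not
  necessarily the class of \<open>\<alpha>\<close>; identifying it takes an argument about the
  particular monoid.\<close>

lemma (in presented_structure) mult_lengths:
  assumes "automatic_structure (pres_carrier A u v) (pres_mult A u v) B gen L" "g \<in> B"
  obtains N where
    "\<And>\<alpha>. \<alpha> \<in> L \<Longrightarrow> \<exists>\<beta>\<in>L. rel_cong u v (vals val \<alpha> @ val g) (vals val \<beta>) \<and> length \<beta> \<le> length \<alpha> + N"
    "\<And>\<alpha> \<beta>. \<alpha> \<in> L \<Longrightarrow> \<beta> \<in> L \<Longrightarrow> rel_cong u v (vals val \<alpha> @ val g) (vals val \<beta>) \<Longrightarrow>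
      \<exists>\<alpha>'\<in>L. rel_cong u v (vals val \<alpha>' @ val g) (vals val \<beta>) \<and> length \<alpha>' \<le> length \<beta> + N"
proof -
  let ?R = "{(\<alpha>, \<beta>). \<alpha> \<in> L \<and> \<beta> \<in> L \<and> rel_cong u v (vals val \<alpha> @ val g) (vals val \<beta>)}"
  have reg: "regular (pad_alph B) {padR \<alpha> \<beta> | \<alpha> \<beta>. (\<alpha>, \<beta>) \<in> ?R}"
    using assms unfolding right_eq(1)[OF assms(2), symmetric] automatic_structure_def by blast
  obtain M1 where M1: "\<forall>(\<alpha>, \<beta>)\<in>?R. \<exists>\<alpha>'. (\<alpha>', \<beta>) \<in> ?R \<and> length \<alpha>' \<le> length \<beta> + M1"
    using shorten_first[OF reg] by (elim exE)
  obtain M2 where M2: "\<forall>(\<alpha>, \<beta>)\<in>?R. \<exists>\<beta>'. (\<alpha>, \<beta>') \<in> ?R \<and> length \<beta>' \<le> length \<alpha> + M2"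
    using shorten_second[OF reg] by (elim exE)
  show thesis
  proof (rule that[of "M1 + M2"])
    fix \<alpha> assume \<alpha>: "\<alpha> \<in> L"
    have "vals val \<alpha> @ val g \<in> lists A" using vals_A[OF L_lists(1)[OF \<alpha>]] val(1)[OF assms(2)] by simp
    then obtain \<beta> where "\<beta> \<in> L" "rel_cong u v (vals val \<alpha> @ val g) (vals val \<beta>)" by (rule represent)
    then have "(\<alpha>, \<beta>) \<in> ?R" using \<alpha> by simp
    from bspec[OF M2 this] show "\<exists>\<beta>\<in>L. rel_cong u v (vals val \<alpha> @ val g) (vals val \<beta>) \<and> length \<beta> \<le> length \<alpha> + (M1 + M2)"
      by (auto intro: bexI[rotated])
  next
    fix \<alpha> \<beta> assume "\<alpha> \<in> L" "\<beta> \<in> L" "rel_cong u v (vals val \<alpha> @ val g) (vals val \<beta>)"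
    then have "(\<alpha>, \<beta>) \<in> ?R" by simp
    from bspec[OF M1 this] show "\<exists>\<alpha>'\<in>L. rel_cong u v (vals val \<alpha>' @ val g) (vals val \<beta>) \<and> length \<alpha>' \<le> length \<beta> + (M1 + M2)"
      by (auto intro: bexI[rotated])
  qed
qed

text \<open>In the monoid with \<open>aab = ba\<close> a word over \<open>{a, b}\<close> is determined by the number of its letters \<open>b\<close>
  and by the exponent of \<open>a\<close> that results from moving all letters \<open>b\<close> to the right.\<close>

fun doubling_exponent :: "'a \<Rightarrow> 'a list \<Rightarrow> nat" where
  "doubling_exponent a [] = 0"
| "doubling_exponent a (c # w) = (if c = a then Suc (doubling_exponent a w) else 2 * doubling_exponent a w)"

lemma doubling_exponent_invariant:
  assumes "rel_cong [a, a, b] [b, a] x y" "a \<noteq> b"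
  shows "doubling_exponent a x = doubling_exponent a y"
proof -
  have "doubling_exponent a (p @ [a, a, b] @ q) = doubling_exponent a (p @ [b, a] @ q)" for p q
    using assms(2) by (induction p) auto
  from rel_cong_invariant[OF assms(1), of "doubling_exponent a", OF this] show ?thesis .
qed

lemma doubling_exponent_normal:
  "a \<noteq> b \<Longrightarrow> doubling_exponent a (replicate m a @ replicate k b) = m"
proof (induction m)
  case 0
  then show ?case by (induction k) auto
qed auto

lemma doubling_exponent_snoc: "a \<noteq> b \<Longrightarrow> doubling_exponent a (w @ [b]) = doubling_exponent a w"
  by (induction w) auto

lemma rel_cong_doubling: "rel_cong [a, a, b] [b, a] (b # replicate m a @ w) (replicate (2 * m) a @ b # w)"
proof (induction m arbitrary: w)
  case (Suc m)
  have "rel_cong [a, a, b] [b, a] (b # a # replicate m a @ w) (a # a # b # replicate m a @ w)"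
    using rel_cong_rule'[of "[a, a, b]" "[b, a]" "[]" "replicate m a @ w"] by simp
  also have "rel_cong [a, a, b] [b, a] (a # a # b # replicate m a @ w) (a # a # replicate (2 * m) a @ b # w)"
    using rel_cong_append_left[OF Suc.IH[of w], of "[a, a]"] by simp
  finally show ?case by simp
qed simp

lemma doubling_normal_form:
  assumes "w \<in> lists {a, b}" "a \<noteq> b"
  shows "rel_cong [a, a, b] [b, a] w (replicate (doubling_exponent a w) a @ replicate (count_list w b) b)"
  using assms(1)
proof (induction w)
  case (Cons c w)
  have "rel_cong [a, a, b] [b, a] (c # w) (c # replicate (doubling_exponent a w) a @ replicate (count_list w b) b)"
    using rel_cong_append_left[OF Cons.IH, of "[c]"] by simp
  also have "rel_cong [a, a, b] [b, a] (c # replicate (doubling_exponent a w) a @ replicate (count_list w b) b)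
     (replicate (doubling_exponent a (c # w)) a @ replicate (count_list (c # w) b) b)"
    using Cons.hyps assms(2) rel_cong_doubling[of a b] by auto
  finally show ?case .
qed simp

theorem not_automatic_aab_ba:
  assumes "a \<in> A" "b \<in> A" "a \<noteq> b"
  shows "\<not> automatic (pres_carrier A [a, a, b] [b, a]) (pres_mult A [a, a, b] [b, a])"
proof
  let ?u = "[a, a, b]" and ?v = "[b, a]"
  let ?n = "\<lambda>m j. replicate m a @ replicate j b"
  assume "automatic (pres_carrier A ?u ?v) (pres_mult A ?u ?v)"
  then obtain B :: "nat set" and gen L where S: "automatic_structure (pres_carrier A ?u ?v) (pres_mult A ?u ?v) B gen L"
    unfolding automatic_def by blast
  have "?u \<in> lists A" "?v \<in> lists A" using assms by auto
  moreover have "structure_base (pres_carrier A ?u ?v) (pres_mult A ?u ?v) B gen L" using S by (simp add: automatic_structure_def)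
  ultimately obtain val where "presented_structure A ?u ?v B gen L val" using structure_presented by blast
  then interpret presented_structure A ?u ?v B gen L val .
  obtain ga gb where g: "ga \<in> B" "val ga = [a]" "gb \<in> B" "val gb = [b]"
    using letter_generator[of a] letter_generator[of b] assms by (auto simp: sublist_Cons_right)
  obtain M where M: "\<forall>\<alpha>\<in>lists B. length (vals val \<alpha>) \<le> M * length \<alpha>" using length_bound by blast
  obtain Na where Na: "\<And>\<alpha>. \<alpha> \<in> L \<Longrightarrow> \<exists>\<beta>\<in>L. rel_cong ?u ?v (vals val \<alpha> @ [a]) (vals val \<beta>) \<and> length \<beta> \<le> length \<alpha> + Na"
    using mult_lengths[OF S g(1)] unfolding g(2) by metis
  obtain N where N: "\<And>\<alpha>. \<alpha> \<in> L \<Longrightarrow> \<exists>\<beta>\<in>L. rel_cong ?u ?v (vals val \<alpha> @ [b]) (vals val \<beta>) \<and> length \<beta> \<le> length \<alpha> + N"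
    "\<And>\<alpha> \<beta>. \<alpha> \<in> L \<Longrightarrow> \<beta> \<in> L \<Longrightarrow> rel_cong ?u ?v (vals val \<alpha> @ [b]) (vals val \<beta>) \<Longrightarrow>
      \<exists>\<alpha>'\<in>L. rel_cong ?u ?v (vals val \<alpha>' @ [b]) (vals val \<beta>) \<and> length \<alpha>' \<le> length \<beta> + N"
    using mult_lengths[OF S g(3)] unfolding g(4) by metis
  obtain \<alpha>0 where \<alpha>0: "\<alpha>0 \<in> L" "rel_cong ?u ?v [] (vals val \<alpha>0)" using represent[of "[]"] by auto
  have up: "\<exists>\<beta>\<in>L. rel_cong ?u ?v (replicate n b) (vals val \<beta>) \<and> length \<beta> \<le> length \<alpha>0 + n * N" for n
  proof (induction n)
    case 0
    then show ?case using \<alpha>0 by auto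
  next
    case (Suc n)
    then obtain \<beta> where \<beta>: "\<beta> \<in> L" "rel_cong ?u ?v (replicate n b) (vals val \<beta>)" "length \<beta> \<le> length \<alpha>0 + n * N" by blast
    obtain \<gamma> where \<gamma>: "\<gamma> \<in> L" "rel_cong ?u ?v (vals val \<beta> @ [b]) (vals val \<gamma>)" "length \<gamma> \<le> length \<beta> + N"
      using N(1)[OF \<beta>(1)] by blast
    have "rel_cong ?u ?v (replicate n b @ [b]) (vals val \<gamma>)"
      using rel_cong_trans[OF rel_cong_append_right[OF \<beta>(2), of "[b]"] \<gamma>(2)] .
    then show ?case using \<gamma>(1,3) \<beta>(3) by (intro bexI[of _ \<gamma>]) (auto simp: replicate_append_same)
  qed
  \<comment> \<open>The letters \<open>b\<close> are cancelled one by one at the right end. The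
    short factor found in each step is the expected one because its number of letters
    \<open>b\<close> and its doubling exponent are the expected ones, and these two numbers
    determine the element.\<close>
  have down: "\<exists>\<alpha>\<in>L. rel_cong ?u ?v (replicate m a) (vals val \<alpha>) \<and> length \<alpha> \<le> length \<beta> + j * N"
    if "\<beta> \<in> L" "rel_cong ?u ?v (?n m j) (vals val \<beta>)" for m j \<beta>
    using that
  proof (induction j arbitrary: \<beta>)
    case 0
    then show ?case by auto
  next
    case (Suc j)
    obtain \<alpha> where \<alpha>: "\<alpha> \<in> L" "rel_cong ?u ?v (?n m j) (vals val \<alpha>)"
    proof (rule represent)
      show "?n m j \<in> lists A" using assms(1,2) by (auto simp: in_lists_conv_set)
    qed
    have "rel_cong ?u ?v (vals val \<alpha> @ [b]) (?n m j @ [b])" using rel_cong_append_right[OF \<alpha>(2)[THEN rel_cong_sym]] .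
    also have "?n m j @ [b] = ?n m (Suc j)" by (simp add: replicate_append_same)
    also note Suc.prems(2)
    finally obtain \<alpha>' where \<alpha>': "\<alpha>' \<in> L" "rel_cong ?u ?v (vals val \<alpha>' @ [b]) (vals val \<beta>)" "length \<alpha>' \<le> length \<beta> + N"
      using N(2)[OF \<alpha>(1) Suc.prems(1)] by blast
    have c: "rel_cong ?u ?v (?n m (Suc j)) (vals val \<alpha>' @ [b])"
      using rel_cong_trans[OF Suc.prems(2) \<alpha>'(2)[THEN rel_cong_sym]] .
    then have "vals val \<alpha>' @ [b] \<in> lists {a, b}" using rel_cong_lists[OF c, of "{a, b}"] by auto
    then have "vals val \<alpha>' \<in> lists {a, b}" by simp
    moreover have "doubling_exponent a (vals val \<alpha>') = m"
      using doubling_exponent_invariant[OF c assms(3)] doubling_exponent_normal[OF assms(3), of m "Suc j"] doubling_exponent_snoc[OF assms(3)] by (simp del: replicate_Suc)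
    moreover have "count_list (?n m (Suc j)) b = Suc j"
    proof -
      have "count_list (replicate m a) b = 0" "count_list (replicate (Suc j) b) b = Suc j"
        using assms(3) by (induction m; auto) (induction j; auto)
      then show ?thesis by simp
    qed
    with count_invariant[OF c, of b] assms(3) have "count_list (vals val \<alpha>') b = j" by simp
    ultimately have "rel_cong ?u ?v (?n m j) (vals val \<alpha>')"
      using doubling_normal_form[of "vals val \<alpha>'" a b] assms(3) rel_cong_sym by metis
    from Suc.IH[OF \<alpha>'(1) this] \<alpha>'(3) show ?case by fastforce
  qed
  \<comment> \<open>The term \<open>2 * n * N\<close> accounts for \<open>n\<close> multiplications
    by \<open>b\<close> and \<open>n\<close> cancellations of \<open>b\<close>, and
    \<open>Na\<close> for the multiplication by \<open>a\<close> in between. No side of the relation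
    occurs in a power of \<open>a\<close>, so every representative has a value of length exactly
    \<open>2 ^ n\<close>.\<close>
  have bound: "2 ^ n \<le> M * (length \<alpha>0 + 2 * n * N + Na)" for n
  proof -
    obtain \<beta> where \<beta>: "\<beta> \<in> L" "rel_cong ?u ?v (replicate n b) (vals val \<beta>)" "length \<beta> \<le> length \<alpha>0 + n * N"
      using up by blast
    obtain \<gamma> where \<gamma>: "\<gamma> \<in> L" "rel_cong ?u ?v (vals val \<beta> @ [a]) (vals val \<gamma>)" "length \<gamma> \<le> length \<beta> + Na"
      using Na[OF \<beta>(1)] by blast
    have E: "doubling_exponent a (replicate n b @ [a]) = 2 ^ n" "count_list (replicate n b @ [a]) b = n"
      using assms(3) by (induction n) auto
    have "replicate n b @ [a] \<in> lists {a, b}" by auto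
    from rel_cong_sym[OF doubling_normal_form[OF this assms(3)]]
    have "rel_cong ?u ?v (?n (2 ^ n) n) (replicate n b @ [a])" unfolding E .
    also have "rel_cong ?u ?v (replicate n b @ [a]) (vals val \<beta> @ [a])" by (rule rel_cong_append_right[OF \<beta>(2)])
    also note \<gamma>(2)
    finally obtain \<alpha> where \<alpha>: "\<alpha> \<in> L" "rel_cong ?u ?v (replicate (2 ^ n) a) (vals val \<alpha>)" "length \<alpha> \<le> length \<gamma> + n * N"
      using down[OF \<gamma>(1)] by blast
    have "\<not> sublist ?u (replicate (2 ^ n) a)" "\<not> sublist ?v (replicate (2 ^ n) a)"
      using set_mono_sublist[of ?u "replicate (2 ^ n) a"] set_mono_sublist[of ?v "replicate (2 ^ n) a"] assms(3) by auto
    from rel_cong_irreducible[OF \<alpha>(2) this] have "length (vals val \<alpha>) = 2 ^ n" by simp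
    moreover have "length (vals val \<alpha>) \<le> M * length \<alpha>" using M L_lists(1)[OF \<alpha>(1)] by blast
    moreover have "M * length \<alpha> \<le> M * (length \<alpha>0 + 2 * n * N + Na)"
      using \<alpha>(3) \<gamma>(3) \<beta>(3) by (intro mult_left_mono) auto
    ultimately show ?thesis by linarith
  qed
  \<comment> \<open>The bound is evaluated at \<open>n = 4 * D\<close>: the left-hand side is at
    least \<open>(2 * D + 1) * (2 * D + 1)\<close>, whereas the right-hand side is at most
    \<open>D * (4 * D + 1)\<close>, which is smaller.\<close>
  define D where "D = M * (length \<alpha>0 + 2 * N + Na)"
  have "(2 * D + 1) * (2 * D + 1) \<le> 2 ^ (2 * D) * (2 ^ (2 * D) :: nat)"
    by (intro mult_mono) (auto simp: Suc_leI less_exp)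
  also have "\<dots> = 2 ^ (4 * D)" by (simp flip: power_add)
  also have "\<dots> \<le> M * (length \<alpha>0 + 2 * (4 * D) * N + Na)" by (rule bound)
  also have "\<dots> \<le> M * ((length \<alpha>0 + 2 * N + Na) * (4 * D + 1))" by (intro mult_left_mono) (auto simp: algebra_simps)
  also have "\<dots> = D * (4 * D + 1)" unfolding D_def by (simp only: mult.assoc)
  finally show False by (simp add: algebra_simps)
qed

subsection \<open>Absorbing letters\<close>

lemma vals_eq_Cons: "vals val \<alpha> = c # w \<Longrightarrow> \<exists>g\<in>set \<alpha>. \<exists>w1 w2. val g = c # w1 \<and> w = w1 @ w2"
  by (induction \<alpha>) (auto simp: append_eq_Cons_conv)

lemma vals_eq_snoc: "vals val \<alpha> = w @ [c] \<Longrightarrow> \<exists>g\<in>set \<alpha>. \<exists>w1 w2. val g = w2 @ [c] \<and> w = w1 @ w2"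
proof (induction \<alpha> rule: rev_induct)
  case (snoc g \<alpha>)
  show ?case
  proof (cases "val g" rule: rev_cases)
    case Nil
    then show ?thesis using snoc by auto
  next
    case (snoc w2 d)
    then have "w = vals val \<alpha> @ w2" "d = c" using snoc.prems by auto
    then show ?thesis using snoc by auto
  qed
qed simp

text \<open>The form \<open>a b^n\<close> is respected by the relation in both directions: as the
  tail contains no \<open>a\<close>, a factor \<open>ab\<close> or \<open>a\<close> can occur only
  at the beginning.\<close>

lemma class_letter_absorbing:
  assumes "rel_cong [a, b] [a] [a] w" "a \<noteq> b"
  shows "\<exists>n. w = a # replicate n b"
proof -
  let ?Q = "\<lambda>w. \<exists>n. w = a # replicate n b"
  have "?Q (p @ [a, b] @ q) = ?Q (p @ [a] @ q)" for p q
  proof (cases p)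
    case Nil
    have "(\<exists>n. b # q = replicate n b) \<longleftrightarrow> (\<exists>n. q = replicate n b)"
      by (metis replicate_Suc list.inject replicate_0 list.distinct(1) not0_implies_Suc)
    then show ?thesis using Nil by auto
  next
    case (Cons c p')
    have "\<not> (\<exists>n. p' @ a # r = replicate n b)" for r
    proof
      assume "\<exists>n. p' @ a # r = replicate n b"
      then have "a \<in> set (replicate n b)" for n using assms(2)
        by (metis in_set_conv_decomp in_set_replicate)
      then show False using assms(2) by (metis in_set_replicate)
    qed
    then show ?thesis using Cons by auto
  qed
  from rel_cong_invariant[OF assms(1), of ?Q, OF this] show ?thesis by (auto intro: exI[of _ 0])
qed

lemma rel_cong_absorb: "rel_cong [a, b] [a] (a # replicate n b @ w) (a # w)"
proof (induction n)
  case (Suc n)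
  have "rel_cong [a, b] [a] (a # replicate (Suc n) b @ w) (a # replicate n b @ w)"
    using rel_cong_rule[of "[a, b]" "[a]" "[]" "replicate n b @ w"] by simp
  then show ?case using Suc rel_cong_trans by blast
qed simp

text \<open>A word containing \<open>a\<close> always has other representatives, since
  \<open>a\<close> can be expanded to \<open>ab\<close>. Every such change takes place behind the
  first \<open>a\<close> or at it, however, so the maximal prefix without \<open>a\<close> is an
  invariant.\<close>

lemma absorbing_prefix:
  assumes "rel_cong [a, b] [a] (replicate i b @ replicate (Suc k) a) w" "a \<noteq> b"
  shows "i < length w \<and> a \<notin> set (take i w)"
proof -
  let ?F = "takeWhile (\<lambda>c. c \<noteq> a)"
  have "?F (p @ [a, b] @ q) = ?F (p @ [a] @ q)" for p q by (induction p) auto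
  from rel_cong_invariant[OF assms(1), of ?F, OF this]
  have F: "?F w = replicate i b" using assms(2) by (simp add: takeWhile_append)
  have "count_list w a = Suc k"
  proof -
    have "count_list (replicate i b) a = 0" "count_list (replicate (Suc k) a) a = Suc k"
      using assms(2) by (induction i; auto) (induction k; auto)
    then show ?thesis using count_invariant[OF assms(1), of a] assms(2) by simp
  qed
  then have "a \<in> set w" by (metis count_notin nat.distinct(1))
  then have "length (?F w) < length w" by (metis (full_types) length_takeWhile_le nat_less_le takeWhile_eq_all_conv takeWhile_eq_take take_all)
  moreover have "take i w = ?F w" using F takeWhile_eq_take[of "\<lambda>c. c \<noteq> a" w] by simp
  ultimately show ?thesis using F assms(2) by (auto dest: in_set_takeD)
qed

theorem not_biautomatic_ab_a:
  assumes "a \<in> A" "b \<in> A" "a \<noteq> b"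
  shows "\<not> biautomatic (pres_carrier A [a, b] [a]) (pres_mult A [a, b] [a])"
proof
  let ?u = "[a, b]" and ?v = "[a]"
  assume "biautomatic (pres_carrier A ?u ?v) (pres_mult A ?u ?v)"
  then obtain B :: "nat set" and gen L where S: "biautomatic_structure (pres_carrier A ?u ?v) (pres_mult A ?u ?v) B gen L"
    unfolding biautomatic_def by blast
  have "?u \<in> lists A" "?v \<in> lists A" using assms by auto
  moreover have "structure_base (pres_carrier A ?u ?v) (pres_mult A ?u ?v) B gen L" using S by (simp add: biautomatic_structure_def)
  ultimately obtain val where "presented_structure A ?u ?v B gen L val" using structure_presented by blast
  then interpret presented_structure A ?u ?v B gen L val .
  have e: "count_list ?u a = count_list ?v a" using assms(3) by simp
  \<comment> \<open>The letter \<open>a\<close> need not be the value of a generator. All words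
    congruent to it have the form \<open>a b^n\<close>, so a representative of \<open>a\<close>
    contains a generator with a value \<open>a b^m\<close>, and this generator acts on the left as
    \<open>a\<close> does.\<close>
  obtain \<alpha>0 where \<alpha>0: "\<alpha>0 \<in> L" "rel_cong ?u ?v [a] (vals val \<alpha>0)" using represent[of "[a]"] assms(1) by auto
  then obtain n where "vals val \<alpha>0 = a # replicate n b" using class_letter_absorbing assms(3) by metis
  from vals_eq_Cons[OF this] obtain g w1 w2 where g: "g \<in> set \<alpha>0" "val g = a # w1" "replicate n b = w1 @ w2" by blast
  then have gB: "g \<in> B" using L_lists(1)[OF \<alpha>0(1)] by auto
  have "w1 = replicate (length w1) b" using g(3) by (metis append_eq_conv_conj take_replicate length_replicate)
  then have ga: "rel_cong ?u ?v (val g) [a]" using rel_cong_absorb[of a b "length w1" "[]"] g(2) by simp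
  let ?R = "{(\<alpha>, \<beta>). \<alpha> \<in> L \<and> \<beta> \<in> L \<and> rel_cong ?u ?v (val g @ vals val \<alpha>) (vals val \<beta>)}"
  have reg: "regular (pad_alph B) {padR \<alpha> \<beta> | \<alpha> \<beta>. (\<alpha>, \<beta>) \<in> ?R}"
    using S gB unfolding right_eq(3)[OF gB, symmetric] biautomatic_structure_def by blast
  show False
  proof (rule collapse_padR[OF reg e, where c="count_list (val g) a" and off=1])
    show "count_list (val g) a + count_list (vals val \<alpha>) a = count_list (vals val \<beta>) a" if "(\<alpha>, \<beta>) \<in> ?R" for \<alpha> \<beta>
      using left_mult_count[OF e] that by blast
    fix k
    show "\<exists>z\<in>lists A. \<forall>i. \<exists>w\<in>lists A. count_list w a = k + 1 \<and>
      (\<forall>w'. rel_cong ?u ?v w w' \<longrightarrow> i < length w' \<and> a \<notin> set (take i w')) \<and>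
      (\<forall>\<alpha>\<in>L. \<forall>\<beta>\<in>L. rel_cong ?u ?v w (vals val \<alpha>) \<longrightarrow> rel_cong ?u ?v z (vals val \<beta>) \<longrightarrow> (\<alpha>, \<beta>) \<in> ?R)"
    proof (rule bexI[of _ "a # replicate (Suc k) a"], rule allI)
      fix i
      let ?w = "replicate i b @ replicate (Suc k) a"
      have "rel_cong ?u ?v (val g @ vals val \<alpha>) (vals val \<beta>)"
        if "rel_cong ?u ?v ?w (vals val \<alpha>)" "rel_cong ?u ?v (a # replicate (Suc k) a) (vals val \<beta>)" for \<alpha> \<beta>
      proof -
        have "rel_cong ?u ?v (val g @ vals val \<alpha>) ([a] @ ?w)"
          using rel_cong_append2[OF ga that(1)[THEN rel_cong_sym]] .
        also have "rel_cong ?u ?v ([a] @ ?w) (a # replicate (Suc k) a)" using rel_cong_absorb[of a b i] by simp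
        also note that(2)
        finally show ?thesis .
      qed
      moreover have "count_list ?w a = k + 1"
        using assms(3) by (induction i; induction k) auto
      ultimately show "\<exists>w\<in>lists A. count_list w a = k + 1 \<and>
        (\<forall>w'. rel_cong ?u ?v w w' \<longrightarrow> i < length w' \<and> a \<notin> set (take i w')) \<and>
        (\<forall>\<alpha>\<in>L. \<forall>\<beta>\<in>L. rel_cong ?u ?v w (vals val \<alpha>) \<longrightarrow> rel_cong ?u ?v (a # replicate (Suc k) a) (vals val \<beta>) \<longrightarrow> (\<alpha>, \<beta>) \<in> ?R)"
        using absorbing_prefix[OF _ assms(3), of i k] assms(1,2) by (intro bexI[of _ ?w]) auto
    qed (use assms in auto)
  qed
qed

text \<open>Here \<open>b\<close> absorbs the letters \<open>a\<close> on its left, so the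
  obstruction lies in right multiplication with left padding. The facts about the class of the
  absorbing letter and about invariant prefixes are transferred by reversal from the relation
  between \<open>[b, a]\<close> and \<open>[b]\<close>.\<close>

theorem not_biautomatic_ab_b:
  assumes "a \<in> A" "b \<in> A" "a \<noteq> b"
  shows "\<not> biautomatic (pres_carrier A [a, b] [b]) (pres_mult A [a, b] [b])"
proof
  let ?u = "[a, b]" and ?v = "[b]"
  have rv: "rel_cong ?u ?v x y \<longleftrightarrow> rel_cong [b, a] [b] (rev x) (rev y)" for x y
    using rel_cong_rev_iff[of ?u ?v x y] by simp
  assume "biautomatic (pres_carrier A ?u ?v) (pres_mult A ?u ?v)"
  then obtain B :: "nat set" and gen L where S: "biautomatic_structure (pres_carrier A ?u ?v) (pres_mult A ?u ?v) B gen L"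
    unfolding biautomatic_def by blast
  have "?u \<in> lists A" "?v \<in> lists A" using assms by auto
  moreover have "structure_base (pres_carrier A ?u ?v) (pres_mult A ?u ?v) B gen L" using S by (simp add: biautomatic_structure_def)
  ultimately obtain val where "presented_structure A ?u ?v B gen L val" using structure_presented by blast
  then interpret presented_structure A ?u ?v B gen L val .
  have e: "count_list ?u b = count_list ?v b" using assms(3) by simp
  obtain \<alpha>0 where \<alpha>0: "\<alpha>0 \<in> L" "rel_cong ?u ?v [b] (vals val \<alpha>0)" using represent[of "[b]"] assms(2) by auto
  then have "rel_cong [b, a] [b] [b] (rev (vals val \<alpha>0))" using rv[of "[b]"] by simp
  then obtain n where "rev (vals val \<alpha>0) = b # replicate n a" using class_letter_absorbing assms(3) by metis
  then have "vals val \<alpha>0 = replicate n a @ [b]" by (metis rev.simps(2) rev_replicate rev_rev_ident)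
  from vals_eq_snoc[OF this] obtain g w1 w2 where g: "g \<in> set \<alpha>0" "val g = w2 @ [b]" "replicate n a = w1 @ w2" by blast
  then have gB: "g \<in> B" using L_lists(1)[OF \<alpha>0(1)] by auto
  have "w2 = replicate (length w2) a" using g(3) by (metis append_eq_conv_conj drop_replicate length_replicate)
  then have "rev (val g) = b # replicate (length w2) a" using g(2) by (metis rev.simps(2) rev_replicate rev_append rev_singleton_conv append_Cons append_Nil rev_rev_ident)
  then have ga: "rel_cong ?u ?v (val g) [b]" using rel_cong_absorb[of b a "length w2" "[]"] rv[of "val g" "[b]"] by simp
  let ?R = "{(\<alpha>, \<beta>). \<alpha> \<in> L \<and> \<beta> \<in> L \<and> rel_cong ?u ?v (vals val \<alpha> @ val g) (vals val \<beta>)}"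
  have reg: "regular (pad_alph B) {padL \<alpha> \<beta> | \<alpha> \<beta>. (\<alpha>, \<beta>) \<in> ?R}"
    using S gB unfolding right_eq(2)[OF gB, symmetric] biautomatic_structure_def by blast
  show False
  proof (rule collapse_padL[OF reg e, where c="count_list (val g) b" and off=1])
    show "count_list (val g) b + count_list (vals val \<alpha>) b = count_list (vals val \<beta>) b" if "(\<alpha>, \<beta>) \<in> ?R" for \<alpha> \<beta>
      using right_mult_count[OF e] that by blast
    fix k
    show "\<exists>z\<in>lists A. \<forall>i. \<exists>w\<in>lists A. count_list w b = k + 1 \<and>
      (\<forall>w'. rel_cong ?u ?v w w' \<longrightarrow> i < length w' \<and> b \<notin> set (take i (rev w'))) \<and>
      (\<forall>\<alpha>\<in>L. \<forall>\<beta>\<in>L. rel_cong ?u ?v w (vals val \<alpha>) \<longrightarrow> rel_cong ?u ?v z (vals val \<beta>) \<longrightarrow> (\<alpha>, \<beta>) \<in> ?R)"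
    proof (rule bexI[of _ "replicate (Suc k) b @ [b]"], rule allI)
      fix i
      let ?w = "replicate (Suc k) b @ replicate i a"
      have rw: "rev ?w = replicate i a @ replicate (Suc k) b" by (simp only: rev_append rev_replicate)
      have "rel_cong ?u ?v (vals val \<alpha> @ val g) (vals val \<beta>)"
        if "rel_cong ?u ?v ?w (vals val \<alpha>)" "rel_cong ?u ?v (replicate (Suc k) b @ [b]) (vals val \<beta>)" for \<alpha> \<beta>
      proof -
        have "rel_cong ?u ?v (vals val \<alpha> @ val g) (?w @ [b])"
          using rel_cong_append2[OF that(1)[THEN rel_cong_sym] ga] .
        also have "rel_cong ?u ?v (?w @ [b]) (replicate (Suc k) b @ [b])"
        proof -
          have "rel_cong ?u ?v (replicate i a @ [b]) [b]"
            using rel_cong_absorb[of b a i "[]"] rv[of "replicate i a @ [b]" "[b]"] by simp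
          from rel_cong_append_left[OF this, of "replicate (Suc k) b"] show ?thesis by simp
        qed
        also note that(2)
        finally show ?thesis .
      qed
      moreover have "count_list ?w b = k + 1"
        using assms(3) by (induction i; induction k) auto
      moreover have "i < length w' \<and> b \<notin> set (take i (rev w'))" if "rel_cong ?u ?v ?w w'" for w'
      proof -
        have "rel_cong [b, a] [b] (replicate i a @ replicate (Suc k) b) (rev w')"
          using that unfolding rv[of ?w w'] rw .
        from absorbing_prefix[OF this] assms(3) show ?thesis by simp
      qed
      ultimately show "\<exists>w\<in>lists A. count_list w b = k + 1 \<and>
        (\<forall>w'. rel_cong ?u ?v w w' \<longrightarrow> i < length w' \<and> b \<notin> set (take i (rev w'))) \<and>
        (\<forall>\<alpha>\<in>L. \<forall>\<beta>\<in>L. rel_cong ?u ?v w (vals val \<alpha>) \<longrightarrow> rel_cong ?u ?v (replicate (Suc k) b @ [b]) (vals val \<beta>) \<longrightarrow> (\<alpha>, \<beta>) \<in> ?R)"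
        using assms(1,2) by (intro bexI[of _ ?w]) auto
    qed (use assms in auto)
  qed
qed

section \<open>The classification\<close>

lemma pres_swap: "pres_carrier A u v = pres_carrier A v u" "pres_mult A u v = pres_mult A v u"
  unfolding pres_carrier_def pres_mult_def pres_class_def using rel_cong_swap[of u v] by simp_all

text \<open>The two properties are carried together because one pair of head structures yields both,
  and the same relations recur in both classifications.\<close>

definition both_automatic :: "'a set \<Rightarrow> 'a list \<Rightarrow> 'a list \<Rightarrow> bool" where
  "both_automatic A u v \<longleftrightarrow> biautomatic (pres_carrier A u v) (pres_mult A u v) \<and>
     prefix_automatic (pres_carrier A u v) (pres_mult A u v)"

lemma both_automatic_swap: "both_automatic A u v = both_automatic A v u"
  by (simp add: both_automatic_def pres_swap[of A u v])

lemma both_automaticI: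
  assumes "head_tame A u v B val K" "head_tame A (rev u) (rev v) B (\<lambda>b. rev (val b)) (rev ` K)"
  shows "both_automatic A u v"
  unfolding both_automatic_def
  using head_tame_biautomatic[OF assms] head_regular_prefix_automatic[OF head_tame_regular[OF assms(2)]] by simp

lemma both_automatic_single:
  assumes "head_tame A u v A single (avoid A F)" "head_tame A (rev u) (rev v) A single (avoid A (rev ` F))"
  shows "both_automatic A u v"
  using both_automaticI[OF assms(1)] assms(2) by (simp add: avoid_rev)

lemma both_automatic_palindromic:
  assumes "rev u = u" "rev v = v" "rev d = d"
    "\<exists>K. head_tame A u v (ext A) (extval d) K \<and> head_tame A u v (ext A) (extval d) (rev ` K)"
  shows "both_automatic A u v"
proof -
  have "(\<lambda>b. rev (extval d b)) = extval d" using assms(3) by (auto simp: extval_def split: option.split)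
  then show ?thesis using assms both_automaticI by metis
qed

lemma both_automatic_free:
  assumes "finite A" "u \<in> lists A"
  shows "both_automatic A u u"
  using head_tame_free[OF assms] head_tame_free[of A "rev u"] assms both_automatic_single[of A u u "{}"]
  by (simp add: in_lists_conv_set)

lemma both_automatic_eliminate:
  assumes "finite A" "p \<in> A" "w \<in> lists A" "p \<notin> set w"
  shows "both_automatic A [p] w"
  using head_tame_eliminate[OF assms] head_tame_eliminate[of A p "rev w"] assms
  by (intro both_automatic_single[of A _ _ "{[p]}"]) (auto simp: in_lists_conv_set)

text \<open>A word with at most two letters overlaps a prefix of \<open>xyz\<close> only by ending
  in \<open>x\<close> or by being \<open>xy\<close> itself, and both possibilities are
  excluded.\<close>

lemma head_tame_three_short:
  assumes "finite A" "{x, y, z} \<subseteq> A" "v \<in> lists A" "x \<noteq> z" "length v < 3" "v = [] \<or> last v \<noteq> x" "v \<noteq> [x, y]"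
  shows "head_tame A [x, y, z] v A single (avoid A {[x, y, z]})"
proof (rule head_tame_no_overlap)
  show "\<not> sublist [x, y, z] v" using assms(5) sublist_length_le[of "[x, y, z]" v] by auto
  show "\<not> prefix s [x, y, z]" if "s \<noteq> []" "suffix s v" for s
  proof
    assume "prefix s [x, y, z]"
    then have "s = [x] \<or> s = [x, y] \<or> s = [x, y, z]" using that(1) by (auto simp: prefix_Cons)
    moreover have "length s < 3" using suffix_length_le[OF that(2)] assms(5) by simp
    ultimately have "s = [x] \<or> s = [x, y]" by auto
    moreover have "last v = last s" using that by (auto simp: suffix_def)
    moreover have "v = s" if "s = [x, y]"
      using that \<open>suffix s v\<close> assms(5) by (auto simp: suffix_def)
    ultimately show False using assms(6,7) that by (auto simp: suffix_def)
  qed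
qed (use assms unbordered_three in auto)

lemma head_tame_two_short:
  assumes "finite A" "{x, y} \<subseteq> A" "v \<in> lists A" "x \<noteq> y" "length v < 2" "v \<noteq> [x]"
  shows "head_tame A [x, y] v A single (avoid A {[x, y]})"
proof (rule head_tame_no_overlap)
  show "\<not> sublist [x, y] v" using assms(5) sublist_length_le[of "[x, y]" v] by auto
  show "\<not> prefix s [x, y]" if "s \<noteq> []" "suffix s v" for s
    using that assms(4-6) by (cases v) (auto simp: prefix_Cons suffix_Cons)
qed (use assms unbordered_two in auto)

text \<open>The relation is oriented from its shorter to its longer side: \<open>pq\<close> is
  unbordered and the rule is applied at most once in a head multiplication, so the growth in length
  stays bounded.\<close>

lemma head_tame_two_three:
  assumes "finite A" "{x, y, z, p, q} \<subseteq> A" "p \<noteq> q" "z \<noteq> p" "[p, q] \<noteq> [x, y]" "[p, q] \<noteq> [y, z]"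
  shows "head_tame A [p, q] [x, y, z] A single (avoid A {[p, q]})"
proof (rule head_tame_no_overlap)
  show "\<not> sublist [p, q] [x, y, z]" using assms(5,6) by (auto simp: sublist_Cons_right prefix_Cons)
  show "\<not> prefix s [p, q]" if "s \<noteq> []" "suffix s [x, y, z]" for s
    using that assms(4-6) by (auto simp: prefix_Cons suffix_Cons)
qed (use assms unbordered_two in auto)

subsection \<open>Rules of length two\<close>

text \<open>Either side can serve as the left-hand side of the rule, and a side with two distinct
  letters is unbordered. Apart from the trivial relation, only an equation between two squares needs
  an additional generator.\<close>

lemma both_automatic_two_two:
  assumes A: "finite A" "{x, y, p, q} \<subseteq> A"
  shows "both_automatic A [x, y] [p, q]"
proof -
  have gen: "both_automatic A [x, y] [p, q]" if "{x, y, p, q} \<subseteq> A" "x \<noteq> y" "[x, y] \<noteq> [p, q]" for x y p q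
    using that A(1) head_tame_two_two[of A x y p q] head_tame_two_two[of A y x q p]
    by (intro both_automatic_single[of A _ _ "{[x, y]}"]) auto
  consider "[x, y] = [p, q]" | "[x, y] \<noteq> [p, q]" "x \<noteq> y" | "[x, y] \<noteq> [p, q]" "p \<noteq> q" | "x = y" "p = q" "x \<noteq> p" by auto
  then show ?thesis
  proof cases
    case 1
    then show ?thesis using both_automatic_free[of A "[x, y]"] A by simp
  next
    case 2
    then show ?thesis using gen A by blast
  next
    case 3
    then show ?thesis using gen[of p q x y] A both_automatic_swap by fastforce
  next
    case 4
    then show ?thesis using A both_automatic_palindromic[OF _ _ _ head_tame_powers[of A x p "[x]" "[p]"]] by simp
  qed
qed

lemma both_automatic_two_one:
  assumes A: "finite A" "{x, y, p} \<subseteq> A" and p: "x \<noteq> y \<Longrightarrow> p \<noteq> x \<and> p \<noteq> y"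
  shows "both_automatic A [x, y] [p]"
proof -
  consider "x \<noteq> y" | "x = y" "p = x" | "x = y" "p \<noteq> x" by auto
  then show ?thesis
  proof cases
    case 1
    then show ?thesis using p A head_tame_two_short[of A x y "[p]"] head_tame_two_short[of A y x "[p]"]
      by (intro both_automatic_single[of A _ _ "{[x, y]}"]) auto
  next
    case 2
    then show ?thesis using A head_tame_power(2)[of A x] by (intro both_automatic_single[of A _ _ "{[x, y]}"]) auto
  next
    case 3
    then show ?thesis using A both_automatic_eliminate[of A p "[x, y]"] both_automatic_swap by fastforce
  qed
qed

lemma both_automatic_two_zero:
  assumes A: "finite A" "{x, y} \<subseteq> A"
  shows "both_automatic A [x, y] []"
proof (cases "x = y")
  case True
  then show ?thesis using A head_tame_power(1)[of A x] by (intro both_automatic_single[of A _ _ "{[x, y]}"]) auto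
next
  case False
  then show ?thesis using A head_tame_two_short[of A x y "[]"] head_tame_two_short[of A y x "[]"]
    by (intro both_automatic_single[of A _ _ "{[x, y]}"]) auto
qed

subsection \<open>Rules of length three\<close>

lemma both_automatic_three_zero:
  assumes A: "finite A" "{x, y, z} \<subseteq> A"
  shows "both_automatic A [x, y, z] []"
proof -
  consider "x \<noteq> z" | "x = z" "x = y" | "x = z" "x \<noteq> y" by auto
  then show ?thesis
  proof cases
    case 1
    then show ?thesis using A head_tame_three_short[of A x y z "[]"] head_tame_three_short[of A z y x "[]"]
      by (intro both_automatic_single[of A _ _ "{[x, y, z]}"]) auto
  next
    case 2
    then show ?thesis using A head_tame_power(3)[of A x] by (intro both_automatic_single[of A _ _ "{[x, y, z]}"]) auto
  next
    case 3
    let ?F = "{[Some y], [Some x, None], [None, Some x]}"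
    have "(\<lambda>b. rev (extval [x, y] b)) = extval [y, x]" by (auto simp: extval_def split: option.split)
    moreover have "rev ` avoid (ext A) ?F = avoid (ext A) ?F" unfolding avoid_rev by (simp add: insert_commute)
    moreover have "head_tame A [x, y, x] [] (ext A) (extval w) (avoid (ext A) ?F)" if "w = [x, y] \<or> w = [y, x]" for w
      using head_tame_sandwich_one[OF A(1) _ _ 3(2) that] A(2) by simp
    ultimately show ?thesis using 3(1) both_automaticI[of A "[x, y, x]" "[]" "ext A" "extval [x, y]" "avoid (ext A) ?F"]
      by simp
  qed
qed

text \<open>The sides are interchangeable. If one of them is a cube, the middle letter of the other
  decides which system applies. If none is, the condition \<open>x \<noteq> q\<close> of
  \<open>head_tame_two_sandwiches\<close> can be reached by exchanging the sides, except when
  \<open>q = x\<close> and \<open>y = p\<close>, which is the braid relation.\<close>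

lemma both_automatic_palindromes:
  assumes A: "finite A" "{x, y, p, q} \<subseteq> A" and xp: "x \<noteq> p"
  shows "both_automatic A [x, y, x] [p, q, p]"
proof -
  have cube: "both_automatic A [x, y, x] [p, p, p]" if "{x, y, p} \<subseteq> A" "x \<noteq> p" for x y p
  proof -
    consider "y = x" | "y = p" | "y \<noteq> x" "y \<noteq> p" by auto
    then show ?thesis
    proof cases
      case 1
      then show ?thesis using A(1) that both_automatic_palindromic[OF _ _ _ head_tame_powers[of A x p "[x, x]" "[p, p]"]] by simp
    next
      case 2
      then show ?thesis using A(1) that both_automatic_palindromic[OF _ _ _ head_tame_sandwich_power[of A x p "[p, p, p]"]] by simp
    next
      case 3
      then show ?thesis using A(1) that both_automatic_palindromic[OF _ _ _ head_tame_sandwich_other_power[of A x y p "[p, p]"]] by simp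
    qed
  qed
  have two: "both_automatic A [x, y, x] [p, q, p]" if "{x, y, p, q} \<subseteq> A" "x \<noteq> y" "p \<noteq> q" "x \<noteq> p" "x \<noteq> q" for x y p q
    using A(1) that by (intro both_automatic_palindromic[OF _ _ _ head_tame_two_sandwiches[of A x y p q]]) auto
  consider "p = q" | "x = y" | "x \<noteq> y" "p \<noteq> q" "x = q" "y = p" | "x \<noteq> y" "p \<noteq> q" "x \<noteq> q" | "x \<noteq> y" "p \<noteq> q" "y \<noteq> p" by auto
  then show ?thesis
  proof cases
    case 1
    then show ?thesis using cube[of x y p] A xp by simp
  next
    case 2
    then show ?thesis using cube[of p q x] A xp both_automatic_swap by fastforce
  next
    case 3
    then show ?thesis using A xp both_automatic_palindromic[OF _ _ _ head_tame_braid[of A x y]] by simp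
  next
    case 4
    then show ?thesis using two A xp by simp
  next
    case 5
    then show ?thesis using two[of p q x y] A xp both_automatic_swap by fastforce
  qed
qed

text \<open>A side whose outer letters differ is unbordered and becomes the left-hand side of the
  rule. Otherwise both sides are palindromes, and it remains to separate different outer letters
  from equal ones.\<close>

lemma both_automatic_three_three:
  assumes A: "finite A" "{x, y, z, p, q, r} \<subseteq> A"
  shows "both_automatic A [x, y, z] [p, q, r]"
proof -
  have gen: "both_automatic A [x, y, z] [p, q, r]" if "{x, y, z, p, q, r} \<subseteq> A" "x \<noteq> z" "[x, y, z] \<noteq> [p, q, r]" for x y z p q r
    using that A(1) head_tame_three_three[of A x y z p q r] head_tame_three_three[of A z y x r q p]
    by (intro both_automatic_single[of A _ _ "{[x, y, z]}"]) auto
  have sandwich: "both_automatic A [x, y, x] [x, q, x]" if "{x, y, q} \<subseteq> A" "x \<noteq> y" "q \<noteq> y" for x y q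
    using that A(1) head_tame_sandwich(3)[of A x y q] by (intro both_automatic_single[of A _ _ "{[x, y, x]}"]) auto
  consider "[x, y, z] = [p, q, r]" | "[x, y, z] \<noteq> [p, q, r]" "x \<noteq> z" | "[x, y, z] \<noteq> [p, q, r]" "p \<noteq> r"
    | "x = z" "p = r" "x \<noteq> p" | "x = z" "p = r" "x = p" "q \<noteq> y" by auto
  then show ?thesis
  proof cases
    case 1
    then show ?thesis using both_automatic_free[of A "[x, y, z]"] A by simp
  next
    case 2
    then show ?thesis using gen A by blast
  next
    case 3
    then show ?thesis using gen[of p q r x y z] A both_automatic_swap by fastforce
  next
    case 4
    then show ?thesis using both_automatic_palindromes[of A x y p q] A by simp
  next
    case 5
    show ?thesis
    proof (cases "x = y")
      case True
      then show ?thesis using sandwich[of x q y] A 5 both_automatic_swap by fastforce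
    next
      case False
      then show ?thesis using sandwich[of x y q] A 5 by simp
    qed
  qed
qed

text \<open>The remaining rules are stated in mirrored form, because right multiplication is left multiplication in the
  mirror image.\<close>

definition mirror_prefix_automatic :: "'a set \<Rightarrow> 'a list \<Rightarrow> 'a list \<Rightarrow> bool" where
  "mirror_prefix_automatic A u v \<longleftrightarrow> prefix_automatic (pres_carrier A (rev u) (rev v)) (pres_mult A (rev u) (rev v))"

lemma mirror_prefix_automaticI:
  "head_regular A u v B val K \<Longrightarrow> mirror_prefix_automatic A u v"
  "head_tame A u v B val K \<Longrightarrow> mirror_prefix_automatic A u v"
  "\<exists>K. head_tame A u v B val K \<Longrightarrow> mirror_prefix_automatic A u v"
  "\<exists>K. head_tame A u v B val K \<and> head_tame A u v B val (rev ` K) \<Longrightarrow> mirror_prefix_automatic A u v"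
  using head_regular_prefix_automatic[of A "rev u" "rev v" B val] head_tame_regular[of A u v B val]
  unfolding mirror_prefix_automatic_def by auto

lemma mirror_prefix_automatic_swap: "mirror_prefix_automatic A u v = mirror_prefix_automatic A v u"
  by (simp add: mirror_prefix_automatic_def pres_swap[of A "rev u" "rev v"])

lemma mirror_prefix_automatic_two_one:
  assumes A: "finite A" "{x, y, p} \<subseteq> A" and "x \<noteq> y"
  shows "mirror_prefix_automatic A [x, y] [p]"
proof (cases "p = x")
  case True
  then show ?thesis using mirror_prefix_automaticI(1)[OF head_regular_collapse_two[of A x y]] assms by simp
next
  case False
  then show ?thesis using mirror_prefix_automaticI(2)[OF head_tame_two_short[of A x y "[p]"]] assms by simp
qed

lemma mirror_prefix_automatic_three_one:
  assumes A: "finite A" "{x, y, z, p} \<subseteq> A"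
  shows "mirror_prefix_automatic A [x, y, z] [p]"
proof -
  consider "x \<noteq> z" "p = x" | "x \<noteq> z" "p \<noteq> x" | "p \<noteq> x" "p \<noteq> y" "p \<noteq> z" | "x = z" "x = y" "p = x" | "x = z" "x \<noteq> y" "p = x"
    | "x = z" "x \<noteq> y" "p = y" by auto
  then show ?thesis
  proof cases
    case 1
    then show ?thesis using mirror_prefix_automaticI(1)[OF head_regular_collapse_three_one[of A x y z]] A by simp
  next
    case 2
    then show ?thesis using mirror_prefix_automaticI(2)[OF head_tame_three_short[of A x y z "[p]"]] A by simp
  next
    case 3
    then show ?thesis using mirror_prefix_automaticI(2)[OF head_tame_eliminate[of A p "[x, y, z]"]] A mirror_prefix_automatic_swap
      by fastforce
  next
    case 4
    then show ?thesis using mirror_prefix_automaticI(2)[OF head_tame_power(4)[of A x]] A by simp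
  next
    case 5
    then show ?thesis using mirror_prefix_automaticI(2)[OF head_tame_sandwich(1)[of A x y]] A by simp
  next
    case 6
    then show ?thesis using mirror_prefix_automaticI(4)[OF head_tame_sandwich_power[of A x y "[y]"]] A by simp
  qed
qed

section \<open>Relations between three letters and two letters\<close>

text \<open>The excluded patterns are the mirror images of \<open>aab = ba\<close> and
  \<open>abb = bb\<close>. The main question is whether \<open>q = x\<close>, that is, whether the
  last letter of the short side can begin a new \<open>xyz\<close>; if so, either the relation is
  oriented towards the long side or a letter is added.\<close>

lemma mirror_prefix_automatic_three_two_unbordered:
  assumes A: "finite A" "{x, y, z, p, q} \<subseteq> A" and xz: "x \<noteq> z"
    and ex: "\<not> (y = z \<and> p = z \<and> q = x)" "\<not> (x = y \<and> p = x \<and> q = x)"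
  shows "mirror_prefix_automatic A [x, y, z] [p, q]"
proof -
  consider "q \<noteq> x" "[p, q] \<noteq> [x, y]" | "q \<noteq> x" "p = x" "q = y" | "q = x" "p \<noteq> x" "p \<noteq> z"
    | "q = x" "p = x" "y = z" | "q = x" "p = x" "y \<noteq> x" "y \<noteq> z" | "q = x" "p = z" "x = y" | "q = x" "p = z" "y \<noteq> x" "y \<noteq> z"
    using ex by auto
  then show ?thesis
  proof cases
    case 1
    then show ?thesis using mirror_prefix_automaticI(2)[OF head_tame_three_short[of A x y z "[p, q]"]] A xz by simp
  next
    case 2
    then show ?thesis using mirror_prefix_automaticI(1)[OF head_regular_collapse_three_two[of A x y z]] A xz by simp
  next
    case 3
    then show ?thesis using mirror_prefix_automaticI(2)[OF head_tame_two_three[of A x y z p q]] A xz mirror_prefix_automatic_swap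
      by fastforce
  next
    case 4
    then show ?thesis using mirror_prefix_automaticI(3)[OF head_tame_baa_bb[of A z x]] A xz by simp
  next
    case 5
    then show ?thesis using mirror_prefix_automaticI(3)[OF head_tame_cba_cc[of A z y x]] A xz by simp
  next
    case 6
    then show ?thesis using mirror_prefix_automaticI(3)[OF head_tame_bba_ab[of A z x]] A xz by simp
  next
    case 7
    then show ?thesis using mirror_prefix_automaticI(3)[OF head_tame_cba_ac[of A z y x]] A xz by simp
  qed
qed

lemma mirror_prefix_automatic_cube_two:
  assumes A: "finite A" "{x, p, q} \<subseteq> A"
  shows "mirror_prefix_automatic A [x, x, x] [p, q]"
proof -
  consider "p = x" "q = x" | "p = x" "q \<noteq> x" | "p \<noteq> x" "p = q" | "p \<noteq> x" "p \<noteq> q" by auto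
  then show ?thesis
  proof cases
    case 1
    then show ?thesis using mirror_prefix_automaticI(2)[OF head_tame_power(5)[of A x]] A by simp
  next
    case 2
    then show ?thesis using mirror_prefix_automaticI(3)[OF head_tame_aaa_ab[of A x q]] A by simp
  next
    case 3
    then show ?thesis using mirror_prefix_automaticI(4)[OF head_tame_powers[of A x p "[x, x]" "[p]"]] A by simp
  next
    case 4
    then show ?thesis using mirror_prefix_automaticI(2)[OF head_tame_two_three[of A x x x p q]] A mirror_prefix_automatic_swap
      by fastforce
  qed
qed

lemma mirror_prefix_automatic_sandwich_two:
  assumes A: "finite A" "{x, y, p, q} \<subseteq> A" and xy: "x \<noteq> y" and ex: "\<not> (p = x \<and> q = y)"
  shows "mirror_prefix_automatic A [x, y, x] [p, q]"
proof -
  consider "p = x" "q = x" | "p = x" "q \<noteq> x" "q \<noteq> y" | "p = y" "q = y" | "p \<noteq> x" "p \<noteq> y" "p = q" | "p = y" "q = x"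
    | "p \<noteq> x" "p \<noteq> q" "[p, q] \<noteq> [y, x]" using ex by auto
  then show ?thesis
  proof cases
    case 1
    then show ?thesis using mirror_prefix_automaticI(2)[OF head_tame_sandwich(2)[of A x y]] A xy by simp
  next
    case 2
    then show ?thesis using mirror_prefix_automaticI(3)[OF head_tame_aba_ac[of A x y q]] A xy by simp
  next
    case 3
    then show ?thesis using mirror_prefix_automaticI(4)[OF head_tame_sandwich_power[of A x y "[y, y]"]] A xy by simp
  next
    case 4
    then show ?thesis using mirror_prefix_automaticI(4)[OF head_tame_sandwich_other_power[of A x y p "[p]"]] A xy by simp
  next
    case 5
    then show ?thesis using mirror_prefix_automaticI(3)[OF head_tame_aba_ba[of A x y]] A xy by simp
  next
    case 6
    then show ?thesis using mirror_prefix_automaticI(2)[OF head_tame_two_three[of A x y x p q]] A mirror_prefix_automatic_swap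
      by fastforce
  qed
qed

lemma prefix_automatic_three_two:
  assumes A: "finite A" "{x, y, z, p, q} \<subseteq> A"
    and ex: "\<not> (\<exists>a\<in>A. \<exists>b\<in>A. a \<noteq> b \<and> ([x, y, z], [p, q]) \<in> {([a,b,a],[b,a]), ([a,a,b],[b,a]), ([a,b,b],[b,b])})"
  shows "prefix_automatic (pres_carrier A [x, y, z] [p, q]) (pres_mult A [x, y, z] [p, q])"
proof -
  have "\<not> (a \<noteq> b \<and> ([x, y, z], [p, q]) \<in> {([a,b,a],[b,a]), ([a,a,b],[b,a]), ([a,b,b],[b,b])})"
    if "a \<in> A" "b \<in> A" for a b using ex that by blast
  \<comment> \<open>The pair of \<open>x\<close> and \<open>z\<close> is needed for
    \<open>aab = ba\<close>, where the second distinct letter is the last one of the long side; in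
    the other two relations it is the middle one.\<close>
  from this[of x y] this[of x z] A(2)
  have ex: "\<not> (x \<noteq> y \<and> x = z \<and> p = y \<and> q = x)" "\<not> (x \<noteq> z \<and> y = x \<and> p = z \<and> q = x)" "\<not> (x \<noteq> y \<and> y = z \<and> p = y \<and> q = y)"
    by auto
  have "mirror_prefix_automatic A [z, y, x] [q, p]"
  proof (cases "x = z")
    case False
    then show ?thesis using mirror_prefix_automatic_three_two_unbordered[of A z y x q p] A ex by auto
  next
    case True
    then show ?thesis using mirror_prefix_automatic_cube_two[of A z q p] mirror_prefix_automatic_sandwich_two[of A z y q p] A ex
      by (cases "x = y") auto
  qed
  then show ?thesis by (simp add: mirror_prefix_automatic_def)
qed

section \<open>Assembly of the cases by the lengths of the two sides\<close>

lemma prefix_automatic_classification: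
  fixes A :: "'a set"
  assumes A: "finite A" "u \<in> lists A" "v \<in> lists A" and len: "length v \<le> length u" "length u \<le> 3"
    and ex: "\<not> (\<exists>a\<in>A. \<exists>b\<in>A. a \<noteq> b \<and> (u, v) \<in> {([a,b,a],[b,a]), ([a,a,b],[b,a]), ([a,b,b],[b,b])})"
  shows "prefix_automatic (pres_carrier A u v) (pres_mult A u v)"
proof -
  have both: "prefix_automatic (pres_carrier A u v) (pres_mult A u v)" if "both_automatic A u v"
    using that by (simp add: both_automatic_def)
  consider "u = []" "v = []" | p where "u = [p]" "length v \<le> 1" | x y where "u = [x, y]" "v = []"
    | x y p where "u = [x, y]" "v = [p]" | x y p q where "u = [x, y]" "v = [p, q]" | x y z where "u = [x, y, z]" "v = []"
    | x y z p where "u = [x, y, z]" "v = [p]" | x y z p q where "u = [x, y, z]" "v = [p, q]"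
    | x y z p q r where "u = [x, y, z]" "v = [p, q, r]"
  proof -
    consider "v = []" | p where "v = [p]" | p q where "v = [p, q]" | p q r where "v = [p, q, r]"
      using len by (cases v; cases "tl v"; cases "tl (tl v)"; cases "tl (tl (tl v))") auto
    note v = this
    consider "u = []" | p where "u = [p]" | x y where "u = [x, y]" | x y z where "u = [x, y, z]"
      using len by (cases u; cases "tl u"; cases "tl (tl u)"; cases "tl (tl (tl u))") auto
    then show thesis
    proof cases
      case (3 x y)
      show thesis using v by cases (use 3 len that in auto)
    next
      case (4 x y z)
      show thesis using v by cases (use 4 that in auto)
    qed (use len that in auto)
  qed
  then show ?thesis
  proof cases
    case 1
    then show ?thesis using both both_automatic_free[of A u] A by simp
  next
    case (2 p)
    show ?thesis
    proof (cases "v = [p]")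
      case True
      then show ?thesis using 2 both both_automatic_free[of A u] A by simp
    next
      case False
      then have "p \<notin> set v" using 2(2) by (cases v) auto
      then show ?thesis using 2 both both_automatic_eliminate[of A p v] A by simp
    qed
  next
    case (3 x y)
    then show ?thesis using both both_automatic_two_zero[of A x y] A by simp
  next
    case (4 x y p)
    show ?thesis
    proof (cases "x = y")
      case True
      then show ?thesis using 4 both both_automatic_two_one[of A x y p] A by simp
    next
      case False
      then show ?thesis using 4 mirror_prefix_automatic_two_one[of A y x p] A by (simp add: mirror_prefix_automatic_def)
    qed
  next
    case (5 x y p q)
    then show ?thesis using both both_automatic_two_two[of A x y p q] A by simp
  next
    case (6 x y z)
    then show ?thesis using both both_automatic_three_zero[of A x y z] A by simp
  next
    case (7 x y z p)
    then show ?thesis using mirror_prefix_automatic_three_one[of A z y x p] A by (simp add: mirror_prefix_automatic_def)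
  next
    case (8 x y z p q)
    then show ?thesis using prefix_automatic_three_two[of A x y z p q] A ex by simp
  next
    case (9 x y z p q r)
    then show ?thesis using both both_automatic_three_three[of A x y z p q r] A by simp
  qed
qed

lemma biautomatic_classification:
  fixes A :: "'a set"
  assumes A: "finite A" "u \<in> lists A" "v \<in> lists A" and len: "length v \<le> length u"
    and cases: "(length u = 3 \<and> length v = 0) \<or> (length u = 3 \<and> length v = 3) \<or>
      (length u = 2 \<and> \<not> (\<exists>a\<in>A. \<exists>b\<in>A. a \<noteq> b \<and> (u, v) \<in> {([a,b],[a]), ([a,b],[b])}))"
  shows "biautomatic (pres_carrier A u v) (pres_mult A u v)"
proof -
  have "both_automatic A u v"
    using cases
  proof (elim disjE conjE)
    assume "length u = 3" "length v = 0"
    then obtain x y z where "u = [x, y, z]" "v = []" by (auto simp: length_Suc_conv numeral_3_eq_3)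
    then show ?thesis using both_automatic_three_zero[of A x y z] A by simp
  next
    assume "length u = 3" "length v = 3"
    then obtain x y z p q r where "u = [x, y, z]" "v = [p, q, r]" by (auto simp: length_Suc_conv numeral_3_eq_3)
    then show ?thesis using both_automatic_three_three[of A x y z p q r] A by simp
  next
    assume u: "length u = 2" and ex: "\<not> (\<exists>a\<in>A. \<exists>b\<in>A. a \<noteq> b \<and> (u, v) \<in> {([a,b],[a]), ([a,b],[b])})"
    obtain x y where xy: "u = [x, y]" using u by (auto simp: length_Suc_conv numeral_2_eq_2)
    consider "v = []" | p where "v = [p]" | p q where "v = [p, q]"
      using len u by (cases v; cases "tl v"; cases "tl (tl v)") auto
    then show ?thesis
    proof cases
      case 1
      then show ?thesis using both_automatic_two_zero[of A x y] A xy by simp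
    next
      case (2 p)
      then have "x \<noteq> y \<Longrightarrow> p \<noteq> x \<and> p \<noteq> y" using ex A(2) xy by auto
      then show ?thesis using both_automatic_two_one[of A x y p] A xy 2 by auto
    next
      case (3 p q)
      then show ?thesis using both_automatic_two_two[of A x y p q] A xy by simp
    qed
  qed
  then show ?thesis by (simp add: both_automatic_def)
qed

theorem theorem3p2p6:
  fixes A :: "'a set" and u v :: "'a list"
  assumes "finite A" and "card A \<ge> 2"
    and "u \<in> lists A" and "v \<in> lists A"
    and "length v \<le> length u" and "length u \<le> 3"
  shows
   "(\<not> (\<exists>a\<in>A. \<exists>b\<in>A. a \<noteq> b \<and> (u, v) \<in> {([a,b,a],[b,a]), ([a,a,b],[b,a]), ([a,b,b],[b,b])})
        \<longrightarrow> prefix_automatic (pres_carrier A u v) (pres_mult A u v))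
  \<and> ((\<exists>a\<in>A. \<exists>b\<in>A. a \<noteq> b \<and> (u, v) \<in> {([a,b,a],[b,a]), ([a,a,b],[b,a]), ([a,b,b],[b,b])})
        \<longrightarrow> \<not> automatic (pres_carrier A u v) (pres_mult A u v))
  \<and> (((length u = 3 \<and> length v = 0) \<or> (length u = 3 \<and> length v = 3) \<or>
       (length u = 2 \<and> \<not> (\<exists>a\<in>A. \<exists>b\<in>A. a \<noteq> b \<and> (u, v) \<in> {([a,b],[a]), ([a,b],[b])})))
        \<longrightarrow> biautomatic (pres_carrier A u v) (pres_mult A u v))
  \<and> ((length u = 2 \<and> (\<exists>a\<in>A. \<exists>b\<in>A. a \<noteq> b \<and> (u, v) \<in> {([a,b],[a]), ([a,b],[b])}))
        \<longrightarrow> \<not> biautomatic (pres_carrier A u v) (pres_mult A u v))"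
  (is "(\<not> ?E \<longrightarrow> ?P) \<and> (?E \<longrightarrow> ?N) \<and> (?C \<longrightarrow> ?Q) \<and> (?D \<longrightarrow> ?M)")
proof (intro conjI impI)
  show ?P if "\<not> ?E" by (rule prefix_automatic_classification[OF assms(1,3-6) that])
  show ?Q if ?C by (rule biautomatic_classification[OF assms(1,3-5) that])
  show ?N if ?E
  proof -
    from that obtain a b where "a \<in> A" "b \<in> A" "a \<noteq> b"
      "(u, v) = ([a,b,a],[b,a]) \<or> (u, v) = ([a,a,b],[b,a]) \<or> (u, v) = ([a,b,b],[b,b])" by blast
    then show ?thesis using not_automatic_aba_ba[of a A b] not_automatic_aab_ba[of a A b] not_automatic_abb_bb[of a A b] by auto
  qed
  show ?M if ?D
  proof -
    from that obtain a b where "a \<in> A" "b \<in> A" "a \<noteq> b" "(u, v) = ([a,b],[a]) \<or> (u, v) = ([a,b],[b])" by blast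
    then show ?thesis using not_biautomatic_ab_a[of a A b] not_biautomatic_ab_b[of a A b] by auto
  qed
qed

end
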